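(* Let $d\ge 1$, $k\ge 1$ and $n\ge \max(k,2)$ be integers, let $(p_j)_{1\le j\le n}$ be a Hölder tuple of exponents, and let $B\ge 1$. Then there is a constant $C$, depending only on $n$, $d$, $B$ and $(p_j)_{1\le j\le n}$, such that the following holds. Let $\Lambda$ be a perfect $n$-linear Calderón--Zygmund form in $\mathbb{R}^d$ and let $\Sigma$ be an admissible collection of paths in $I_n$. Assume that for each path $\sigma\in\Sigma$ of length $k$, each $\sigma$-nested $n$-tuple $\mathbf{Q}=(Q_1,\dots,Q_n)$ of dyadic cubes in $\mathbb{R}^d$, and each $j\in\sigma(I_{k-1})$ (with $I_0=\emptyset$) we are given a real-valued measurable function $b_{\sigma,\mathbf{Q},j}$ on $\mathbb{R}^d$ such that the following properties hold for all such $\sigma,\mathbf{Q},j$: 1. (Support condition) $\operatorname{supp}(b_{\sigma,\mathbf{Q},j})\subseteq Q_j$. 2. (Mean condition) $\int b_{\sigma,\mathbf{Q},j}=|Q_j|$. 3. (Norm bound condition) $\int |b_{\sigma,\mathbf{Q},j}|^{p_j}\le B\,|Q_j|$. 4. (Interdependence condition) If $\sigma,\sigma'\in\Sigma$ are paths of length $k$, $\mathbf{Q}$ is $\sigma$-nested, $\mathbf{Q}'$ is $\sigma'$-nested, and $1\le j<k$ is such that $\sigma(l)=\sigma'(l)$ and $Q_{\sigma(l)}=Q'_{\sigma'(l)}$ for all $1\le l\le j$, then $b_{\sigma,\mathbf{Q},\sigma(j)}=b_{\sigma',\mathbf{Q}',\sigma'(j)}$. 5. (Testing condition) For every path $\sigma\in\Sigma$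 of length $k$, every $\sigma$-nested tuple $\mathbf{Q}$ and every dyadic test function $g$ supported on $Q_{\sigma(k)}$, $$|\Lambda(f_1,\dots,f_n)|\le B\prod_{j=1}^n\|f_j\|_{p_j},$$ where $f_{\sigma(k)}=g$, $f_{\sigma(l)}=\mathbf{1}_{Q_{\sigma(k)}}\,b_{\sigma,\mathbf{Q},\sigma(l)}$ for $1\le l<k$, and $f_s=\mathbf{1}_{Q_{\sigma(k)}}$ for every $s\in I_n$ not in the range of $\sigma$. Then $$|\Lambda(f_1,\dots,f_n)|\le C\prod_{j=1}^n\|f_j\|_{p_j}$$ for every $n$-tuple $(f_j)_{1\le j\le n}$ of dyadic test functions.
   Context: A dyadic interval is an interval $[2^m l,2^m(l+1))$ with $m,l\in\mathbb{Z}$; a dyadic cube in $\mathbb{R}^d$ is a cube whose sides are dyadic intervals. A dyadic child of a dyadic cube $P$ is a dyadic subcube of $P$ of half the sidelength. A dyadic test function is a finite (real) linear combination of characteristic functions of dyadic cubes. $|Q|$ denotes Lebesgue measure, $\mathbf{1}_Q$ the characteristic function of $Q$, and $\|\cdot\|_p$ the $L^p(\mathbb{R}^d)$ norm. A Hölder tuple of exponents is a tuple $(p_j)_{1\le j\le n}$ with $1<p_j<\infty$ for all $j$ and $\sum_{j=1}^n 1/p_j=1$. A perfect $n$-linear Calderón--Zygmund form in $\mathbb{R}^d$ is an $n$-linear form $\Lambda$ mapping $n$-tuples of dyadic test functions on $\mathbb{R}^d$ to $\mathbb{R}$ such that: (i) (Dyadic decay) If the dyadic test functions $f_1,\dots,f_n$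 are all supported on the same dyadic cube $P$, and two of these functions are supported on different dyadic children of $P$, then $|\Lambda(f_1,\dots,f_n)|\le\prod_{j=1}^n\|f_j\|_{p_j}$ for any Hölder tuple $(p_j)_{1\le j\le n}$. (ii) (Perfect smoothness) If one of the functions $f_j$ is supported on some dyadic cube $P$ and has mean zero, and another one of the functions vanishes on $P$, then $\Lambda(f_1,\dots,f_n)=0$. (iii) (Qualitative truncation) The integral kernel of $\Lambda$ is a dyadic test function on $\mathbb{R}^{dn}$, i.e. $\Lambda(f_1,\dots,f_n)=\int_{\mathbb{R}^{dn}}K(x_1,\dots,x_n)\prod_{j=1}^n f_j(x_j)\,dx_1\cdots dx_n$ with $K$ a dyadic test function on $\mathbb{R}^{dn}$. Through the formula in (iii), $\Lambda$ is also evaluated on tuples of locally integrable functions. $I_m$ denotes the set of integers $i$ with $1\le i\le m$. A path in $I_n$ of length $k$, $1\le k\le n$, is an injective map $\sigma:I_k\to I_n$. A collection $\Sigma$ of paths in $I_n$ (of various lengths) is admissible if: (1) for each $j\in I_n$ there is a path $\sigma\in\Sigma$ of length one with $\sigma(1)=j$; (2) for each path $\tilde\sigma\in\Sigma$ of any length $k<n$ there is a path $\sigma\in\Sigma$ of length $k+1$ whose restriction to $I_k$ coincides with $\tilde\sigma$; (3) for each path $\sigma\in\Sigma$ of any length $k\ge 2$ there is a path $\tau\in\Sigma$ of the same length $k$ which coincides with $\sigma$ on $I_{k-2}$ and satisfies $\sigma(k-1)=\tau(k)$ and $\tau(k-1)=\sigma(k)$. For a path $\sigma$ of length $k\le n$,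 an $n$-tuple $\mathbf{Q}=(Q_1,\dots,Q_n)$ of dyadic cubes is $\sigma$-nested if $Q_{\sigma(i)}\supseteq Q_{\sigma(j)}$ for all $1\le i<j\le k$, and $Q_s=Q_{\sigma(k)}$ whenever $s\in I_n$ is not in the range of $\sigma$; in the case $k=n$ it is additionally required that $Q_{\sigma(n-1)}=Q_{\sigma(n)}$. *)

theory Defs
  imports "HOL-Analysis.Analysis"
begin

section \<open>Dyadic cubes and dyadic test functions\<close>

text \<open>
  These notions are defined over an arbitrary Euclidean space because they are used both on
  \<open>real^'d\<close> and on \<open>real^'d^'n\<close>, the space of \<open>n\<close>-tuples of points, which carries the
  integral kernels.
\<close>

definition dyadic_cubes_of_scale :: "int \<Rightarrow> 'a::euclidean_space set set" where
  "dyadic_cubes_of_scale m =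
     {Q. \<exists>l :: 'a \<Rightarrow> int. Q = {x. \<forall>b\<in>Basis.
        x \<bullet> b \<in> {2 powi m * real_of_int (l b) ..< 2 powi m * (real_of_int (l b) + 1)}}}"

definition dyadic_cube :: "'a::euclidean_space set \<Rightarrow> bool" where
  "dyadic_cube Q \<longleftrightarrow> (\<exists>m. Q \<in> dyadic_cubes_of_scale m)"

definition dyadic_child :: "'a::euclidean_space set \<Rightarrow> 'a set \<Rightarrow> bool" where
  "dyadic_child R P \<longleftrightarrow>
     R \<subseteq> P \<and> (\<exists>m. P \<in> dyadic_cubes_of_scale m \<and> R \<in> dyadic_cubes_of_scale (m - 1))"

definition dyadic_test_function :: "('a::euclidean_space \<Rightarrow> real) \<Rightarrow> bool" where
  "dyadic_test_function f \<longleftrightarrow>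
     (\<exists>\<Q> c. finite \<Q> \<and> (\<forall>Q\<in>\<Q>. dyadic_cube Q) \<and> f = (\<lambda>x. \<Sum>Q\<in>\<Q>. c Q * indicat_real Q x))"

text \<open>
  Dyadic cubes are half-open, so being supported on a set means vanishing outside of it; no
  closure is taken.
\<close>

definition supported_on :: "('a \<Rightarrow> real) \<Rightarrow> 'a set \<Rightarrow> bool" where
  "supported_on f Q \<longleftrightarrow> (\<forall>x. x \<notin> Q \<longrightarrow> f x = 0)"

definition locally_integrable :: "('a::euclidean_space \<Rightarrow> real) \<Rightarrow> bool" where
  "locally_integrable f \<longleftrightarrow> (\<forall>S. compact S \<longrightarrow> set_integrable lebesgue S f)"

text \<open>
  The value is a junk value \<open>0\<close> if \<open>\<bar>f\<bar> powr p\<close> is not integrable.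
\<close>

definition Lp_norm :: "real \<Rightarrow> ('a::euclidean_space \<Rightarrow> real) \<Rightarrow> real" where
  "Lp_norm p f = (LINT x|lebesgue. \<bar>f x\<bar> powr p) powr (1 / p)"

definition hoelder_tuple :: "('n::finite \<Rightarrow> real) \<Rightarrow> bool" where
  "hoelder_tuple p \<longleftrightarrow> (\<forall>j. 1 < p j) \<and> (\<Sum>j\<in>UNIV. 1 / p j) = 1"


section \<open>Perfect Calderon--Zygmund forms\<close>

text \<open>
  The index set \<open>{1,\<dots>,n}\<close> is rendered by the finite type \<open>'n\<close>. A form is a total function on
  tuples of functions.
\<close>

definition multilinear_on_test_functions ::
    "(('n::finite \<Rightarrow> real^'d::finite \<Rightarrow> real) \<Rightarrow> real) \<Rightarrow> bool" where
  "multilinear_on_test_functions \<Lambda> \<longleftrightarrow>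
     (\<forall>f i u v \<alpha> \<beta>. (\<forall>j. dyadic_test_function (f j)) \<longrightarrow>
        dyadic_test_function u \<longrightarrow> dyadic_test_function v \<longrightarrow>
        \<Lambda> (f(i := (\<lambda>x. \<alpha> * u x + \<beta> * v x))) = \<alpha> * \<Lambda> (f(i := u)) + \<beta> * \<Lambda> (f(i := v)))"

definition dyadic_decay :: "(('n::finite \<Rightarrow> real^'d::finite \<Rightarrow> real) \<Rightarrow> real) \<Rightarrow> bool" where
  "dyadic_decay \<Lambda> \<longleftrightarrow>
     (\<forall>f P. (\<forall>j. dyadic_test_function (f j)) \<longrightarrow> dyadic_cube P \<longrightarrow>
        (\<forall>j. supported_on (f j) P) \<longrightarrow>
        (\<exists>i j R S. i \<noteq> j \<and> R \<noteq> S \<and> dyadic_child R P \<and> dyadic_child S P \<and>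
           supported_on (f i) R \<and> supported_on (f j) S) \<longrightarrow>
        (\<forall>q. hoelder_tuple q \<longrightarrow> \<bar>\<Lambda> f\<bar> \<le> (\<Prod>j\<in>UNIV. Lp_norm (q j) (f j))))"

definition perfect_smoothness :: "(('n::finite \<Rightarrow> real^'d::finite \<Rightarrow> real) \<Rightarrow> real) \<Rightarrow> bool" where
  "perfect_smoothness \<Lambda> \<longleftrightarrow>
     (\<forall>f P i j. (\<forall>j. dyadic_test_function (f j)) \<longrightarrow> dyadic_cube P \<longrightarrow> i \<noteq> j \<longrightarrow>
        supported_on (f j) P \<longrightarrow> (LINT x|lebesgue. f j x) = 0 \<longrightarrow>
        (\<forall>x\<in>P. f i x = 0) \<longrightarrow> \<Lambda> f = 0)"

text \<open>
  Stating the kernel representation for locally integrable tuples covers test functions and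
  at the same time fixes how the form is evaluated beyond them.
\<close>

definition has_integral_kernel ::
    "(('n::finite \<Rightarrow> real^'d::finite \<Rightarrow> real) \<Rightarrow> real) \<Rightarrow> (real^'d^'n \<Rightarrow> real) \<Rightarrow> bool" where
  "has_integral_kernel \<Lambda> K \<longleftrightarrow>
     (\<forall>f. (\<forall>j. locally_integrable (f j)) \<longrightarrow>
        \<Lambda> f = (LINT x|lebesgue. K x * (\<Prod>j\<in>UNIV. f j (x $ j))))"

definition perfect_CZ_form :: "(('n::finite \<Rightarrow> real^'d::finite \<Rightarrow> real) \<Rightarrow> real) \<Rightarrow> bool" where
  "perfect_CZ_form \<Lambda> \<longleftrightarrow>
     multilinear_on_test_functions \<Lambda> \<and> dyadic_decay \<Lambda> \<and> perfect_smoothness \<Lambda> \<and>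
     (\<exists>K. dyadic_test_function K \<and> has_integral_kernel \<Lambda> K)"


section \<open>Paths\<close>

text \<open>
  A path of length \<open>k\<close> is the list of its values at \<open>1,\<dots>,k\<close>; injectivity is distinctness, and
  \<open>set \<sigma>\<close> is the range. Values are accessed with indices starting from \<open>1\<close>.
\<close>

definition is_path :: "'n::finite list \<Rightarrow> bool" where
  "is_path \<sigma> \<longleftrightarrow> 1 \<le> length \<sigma> \<and> distinct \<sigma>"

definition path_at :: "'n list \<Rightarrow> nat \<Rightarrow> 'n" where
  "path_at \<sigma> i = \<sigma> ! (i - 1)"

definition admissible :: "'n::finite list set \<Rightarrow> bool" where
  "admissible \<Sigma> \<longleftrightarrow>
     (\<forall>\<sigma>\<in>\<Sigma>. is_path \<sigma>) \<and>
     (\<forall>j. \<exists>\<sigma>\<in>\<Sigma>. length \<sigma> = 1 \<and> path_at \<sigma> 1 = j) \<and>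
     (\<forall>\<tau>\<in>\<Sigma>. length \<tau> < CARD('n) \<longrightarrow>
        (\<exists>\<sigma>\<in>\<Sigma>. length \<sigma> = length \<tau> + 1 \<and> (\<forall>i\<in>{1..length \<tau>}. path_at \<sigma> i = path_at \<tau> i))) \<and>
     (\<forall>\<sigma>\<in>\<Sigma>. 2 \<le> length \<sigma> \<longrightarrow>
        (\<exists>\<tau>\<in>\<Sigma>. length \<tau> = length \<sigma> \<and>
           (\<forall>i\<in>{1..length \<sigma> - 2}. path_at \<tau> i = path_at \<sigma> i) \<and>
           path_at \<sigma> (length \<sigma> - 1) = path_at \<tau> (length \<sigma>) \<and>
           path_at \<tau> (length \<sigma> - 1) = path_at \<sigma> (length \<sigma>)))"

definition nested :: "'n::finite list \<Rightarrow> ('n \<Rightarrow> (real^'d::finite) set) \<Rightarrow> bool" where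
  "nested \<sigma> Q \<longleftrightarrow>
     (\<forall>j. dyadic_cube (Q j)) \<and>
     (\<forall>i j. 1 \<le> i \<and> i < j \<and> j \<le> length \<sigma> \<longrightarrow> Q (path_at \<sigma> j) \<subseteq> Q (path_at \<sigma> i)) \<and>
     (\<forall>s. s \<notin> set \<sigma> \<longrightarrow> Q s = Q (path_at \<sigma> (length \<sigma>))) \<and>
     (length \<sigma> = CARD('n) \<longrightarrow> Q (path_at \<sigma> (CARD('n) - 1)) = Q (path_at \<sigma> (CARD('n))))"


section \<open>Testing functions\<close>

text \<open>
  A family of testing functions is indexed by a path, a tuple of cubes and a position.
\<close>

type_synonym ('n, 'd) testing_family =
  "'n list \<Rightarrow> ('n \<Rightarrow> (real^'d) set) \<Rightarrow> 'n \<Rightarrow> real^'d \<Rightarrow> real"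

definition testing_tuple ::
    "('n::finite, 'd::finite) testing_family \<Rightarrow> 'n list \<Rightarrow> ('n \<Rightarrow> (real^'d) set) \<Rightarrow>
     (real^'d \<Rightarrow> real) \<Rightarrow> 'n \<Rightarrow> real^'d \<Rightarrow> real" where
  "testing_tuple b \<sigma> Q g s =
     (let R = Q (path_at \<sigma> (length \<sigma>)) in
      if s = path_at \<sigma> (length \<sigma>) then g
      else if s \<in> set \<sigma> then (\<lambda>x. indicat_real R x * b \<sigma> Q s x)
      else indicat_real R)"

end

theory Submission
  imports Defs
begin

text \<open>
  Restricted to a large dyadic cube and averaged at the scale of the kernel, the form becomes a
  multilinear form on a finite tree, on which no constant may depend on the depth.

  Freeze all but two functions, at positions \<open>u\<close> and \<open>v\<close> that the admissible paths allow to be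
  swapped, and let \<open>V\<close> be the resulting bilinear form. Perfect smoothness says that
  \<open>V Q g h - (\<Sum>c. V c g h)\<close>, the sum over the children \<open>c\<close> of \<open>Q\<close>, depends only on the averages of \<open>g\<close> and
  \<open>h\<close> on the children, and that the testing functions act on functions of mean zero as multiplication
  by a function. Subtracting from \<open>g\<close> and \<open>h\<close> the multiples of the testing functions with the same
  averages, one finds that the terms of first order in the differences of averages between \<open>Q\<close> and
  its children cancel, as long as the testing functions are not changed. The terms of second order are
  square-summable over the tree. Whenever a testing function has to be replaced, because its average has
  become small or its size large, the loss is paid by a potential that is additive over the tree.

  This turns testing functions on paths of length \<open>k + 1\<close> into a bound on paths of length \<open>k\<close>, with \<open>1\<close>
  in place of the last testing function. After all testing functions have been removed, the same step
  with testing function \<open>1\<close> gives \<open>\<bar>\<Lambda> f\<bar> \<le> A * \<bar>P\<bar>\<close> for functions on \<open>P\<close> bounded by \<open>1\<close>. The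
  Lebesgue bounds follow by decomposing at the cubes on which some average becomes large, which is a
  sparse selection.
\<close>

section \<open>Weighted trees and bilinear forms\<close>

text \<open>The estimate passed from a length of paths to the next shorter one keeps one function in
  its Lebesgue space, because the testing condition quantifies over an arbitrary function there, and
  has the other one bounded by 1. This asymmetry closes the argument. The bounded function
  contributes only a power of the volume, which is small compared with the mass, so the constant
  comes back multiplied by a negative power of \<open>M\<close> and is absorbed.

  That is the content of the interdependence condition.

  Reducing to one large cube meets an obstacle: dyadic cubes never join two quadrants. Functions are
  therefore split by quadrants, and tuples that live in different quadrants contribute
  nothing.\<close>

definition wint :: "('x \<Rightarrow> real) \<Rightarrow> 'x set \<Rightarrow> ('x \<Rightarrow> real) \<Rightarrow> real" where
  "wint m Q f = (\<Sum>x\<in>Q. m x * f x)"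

definition restr :: "'x set \<Rightarrow> ('x \<Rightarrow> real) \<Rightarrow> 'x \<Rightarrow> real" where
  "restr Q f x = (if x \<in> Q then f x else 0)"

lemma wint_add: "wint m Q (\<lambda>x. f x + g x) = wint m Q f + wint m Q g"
  by (simp add: wint_def distrib_left sum.distrib)

lemma wint_diff: "wint m Q (\<lambda>x. f x - g x) = wint m Q f - wint m Q g"
  by (simp add: wint_def right_diff_distrib sum_subtractf)

lemma wint_cmult: "wint m Q (\<lambda>x. a * f x) = a * wint m Q f"
  by (simp add: wint_def sum_distrib_left mult_ac)

lemma wint_divide: "wint m Q (\<lambda>x. f x / a) = wint m Q f / a"
  by (simp add: wint_def sum_divide_distrib)

lemma wint_const: "wint m Q (\<lambda>x. a) = a * sum m Q"
  by (simp add: wint_def sum_distrib_left mult_ac)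

lemma wint_sum: "wint m Q (\<lambda>x. \<Sum>i\<in>S. f i x) = (\<Sum>i\<in>S. wint m Q (f i))"
  unfolding wint_def by (simp add: sum_distrib_left) (rule sum.swap)

lemma wint_cong: "(\<And>x. x \<in> Q \<Longrightarrow> f x = g x) \<Longrightarrow> wint m Q f = wint m Q g"
  by (simp add: wint_def)

lemma wint_restr: "finite P \<Longrightarrow> Q \<subseteq> P \<Longrightarrow> wint m P (restr Q f) = wint m Q f"
  unfolding wint_def restr_def by (simp add: if_distrib sum.If_cases Int_absorb1 cong: if_cong)

text \<open>A cube is represented by the set of its atoms. A single atom has no children: the value of \<open>ch\<close>
  on it is irrelevant.\<close>

locale weighted_tree =
  fixes m :: "'x \<Rightarrow> real" and D :: "'x set set" and ch :: "'x set \<Rightarrow> 'x set set" and \<kappa> :: real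
  assumes cube_finite: "Q \<in> D \<Longrightarrow> finite Q"
    and cube_ne: "Q \<in> D \<Longrightarrow> Q \<noteq> {}"
    and weight_pos: "Q \<in> D \<Longrightarrow> x \<in> Q \<Longrightarrow> 0 < m x"
    and ch_cube: "Q \<in> D \<Longrightarrow> card Q \<noteq> 1 \<Longrightarrow> c \<in> ch Q \<Longrightarrow> c \<in> D"
    and ch_psubset: "Q \<in> D \<Longrightarrow> card Q \<noteq> 1 \<Longrightarrow> c \<in> ch Q \<Longrightarrow> c \<subset> Q"
    and ch_vol: "Q \<in> D \<Longrightarrow> card Q \<noteq> 1 \<Longrightarrow> c \<in> ch Q \<Longrightarrow> sum m Q \<le> \<kappa> * sum m c"
    and ch_Union: "Q \<in> D \<Longrightarrow> card Q \<noteq> 1 \<Longrightarrow> \<Union>(ch Q) = Q"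
    and ch_disjoint: "Q \<in> D \<Longrightarrow> card Q \<noteq> 1 \<Longrightarrow> c \<in> ch Q \<Longrightarrow> c' \<in> ch Q \<Longrightarrow> c \<noteq> c' \<Longrightarrow> c \<inter> c' = {}"
    and kappa_ge_1: "1 \<le> \<kappa>"
begin

abbreviation I where "I \<equiv> wint m"
abbreviation vol where "vol \<equiv> sum m"
abbreviation av where "av Q f \<equiv> wint m Q f / sum m Q"

lemma vol_pos: "Q \<in> D \<Longrightarrow> 0 < vol Q"
  using cube_finite cube_ne weight_pos by (intro sum_pos) auto

lemma ch_subset: "Q \<in> D \<Longrightarrow> card Q \<noteq> 1 \<Longrightarrow> c \<in> ch Q \<Longrightarrow> c \<subseteq> Q"
  using ch_psubset by blast

lemma finite_ch: "Q \<in> D \<Longrightarrow> card Q \<noteq> 1 \<Longrightarrow> finite (ch Q)"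
  by (metis cube_finite ch_Union finite_UnionD)

lemma I_mono: "Q \<in> D \<Longrightarrow> (\<And>x. x \<in> Q \<Longrightarrow> f x \<le> g x) \<Longrightarrow> I Q f \<le> I Q g"
  unfolding wint_def by (intro sum_mono mult_left_mono) (auto dest: weight_pos less_imp_le)

lemma I_nonneg: "Q \<in> D \<Longrightarrow> (\<And>x. x \<in> Q \<Longrightarrow> 0 \<le> f x) \<Longrightarrow> 0 \<le> I Q f"
  unfolding wint_def by (intro sum_nonneg mult_nonneg_nonneg) (auto dest: weight_pos less_imp_le)

lemma I_abs: "Q \<in> D \<Longrightarrow> \<bar>I Q f\<bar> \<le> I Q (\<lambda>x. \<bar>f x\<bar>)"
  unfolding wint_def
  by (rule order_trans[OF sum_abs]) (auto simp: abs_mult intro!: sum_mono dest: weight_pos)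

lemma I_abs_le: "Q \<in> D \<Longrightarrow> (\<And>x. x \<in> Q \<Longrightarrow> \<bar>f x\<bar> \<le> g x) \<Longrightarrow> \<bar>I Q f\<bar> \<le> I Q g"
  by (rule order_trans[OF I_abs]) (auto intro: I_mono)

lemma I_mono_set: "P \<in> D \<Longrightarrow> Q \<subseteq> P \<Longrightarrow> (\<And>x. x \<in> P \<Longrightarrow> 0 \<le> f x) \<Longrightarrow> I Q f \<le> I P f"
  unfolding wint_def
  by (intro sum_mono2) (auto simp: cube_finite intro!: mult_nonneg_nonneg dest: weight_pos[THEN less_imp_le])

lemma I_ch: "Q \<in> D \<Longrightarrow> card Q \<noteq> 1 \<Longrightarrow> (\<Sum>c\<in>ch Q. I c f) = I Q f"
  unfolding wint_def
  using sum.Union_disjoint[of "ch Q" "\<lambda>x. m x * f x"] ch_Union ch_disjoint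
  by (metis (no_types, lifting) Sup_upper cube_finite finite_subset comp_apply sum.cong)

lemma vol_ch: "Q \<in> D \<Longrightarrow> card Q \<noteq> 1 \<Longrightarrow> (\<Sum>c\<in>ch Q. vol c) = vol Q"
  using I_ch[of Q "\<lambda>_. 1"] by (simp add: wint_def)

text \<open>The children are disjoint and each takes at least the fraction
  \<open>1 / \<kappa>\<close> of the volume.\<close>

lemma card_ch: assumes "Q \<in> D" "card Q \<noteq> 1" shows "real (card (ch Q)) \<le> \<kappa>"
proof -
  have "real (card (ch Q)) * vol Q = (\<Sum>c\<in>ch Q. vol Q)" by simp
  also have "\<dots> \<le> (\<Sum>c\<in>ch Q. \<kappa> * vol c)" by (intro sum_mono ch_vol assms)
  also have "\<dots> = \<kappa> * vol Q" by (subst sum_distrib_left[symmetric]) (simp only: vol_ch[OF assms])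
  finally show ?thesis using vol_pos[OF assms(1)] by simp
qed

text \<open>The reason why averages stay bounded on stopping cubes: the parent has not stopped, and
  passing to a child costs the factor \<kappa>.\<close>

lemma I_child_le:
  assumes "Q \<in> D" "card Q \<noteq> 1" "c \<in> ch Q" "\<And>x. x \<in> Q \<Longrightarrow> 0 \<le> f x" "I Q f \<le> L * vol Q" "0 \<le> L"
  shows "I c f \<le> \<kappa> * L * vol c"
proof -
  have "I c f \<le> I Q f" using assms ch_subset by (intro I_mono_set) auto
  also have "\<dots> \<le> L * vol Q" by fact
  also have "\<dots> \<le> L * (\<kappa> * vol c)" using ch_vol assms by (intro mult_left_mono) auto
  finally show ?thesis by (simp add: mult_ac)
qed

text \<open>Orthogonality of martingale differences, the source of all square-summability below.\<close>

lemma sum_square_diff_ch: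
  assumes "Q \<in> D" "card Q \<noteq> 1"
  shows "(\<Sum>c\<in>ch Q. vol c * (av c f - av Q f)\<^sup>2) = (\<Sum>c\<in>ch Q. vol c * (av c f)\<^sup>2) - vol Q * (av Q f)\<^sup>2"
proof -
  have pos: "vol c > 0" if "c \<in> ch Q" for c using that ch_cube assms vol_pos by blast
  have "(\<Sum>c\<in>ch Q. vol c * (av c f - av Q f)\<^sup>2)
      = (\<Sum>c\<in>ch Q. vol c * (av c f)\<^sup>2 - 2 * av Q f * I c f + (av Q f)\<^sup>2 * vol c)"
  proof (rule sum.cong[OF refl])
    fix c assume "c \<in> ch Q"
    define A where "A = av c f"
    define q where "q = av Q f"
    have A: "I c f = vol c * A" using pos[OF \<open>c \<in> ch Q\<close>] by (simp add: A_def)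
    show "vol c * (av c f - av Q f)\<^sup>2 = vol c * (av c f)\<^sup>2 - 2 * av Q f * I c f + (av Q f)\<^sup>2 * vol c"
      unfolding A_def[symmetric] q_def[symmetric] A by (simp add: algebra_simps power2_eq_square)
  qed
  also have "\<dots> = (\<Sum>c\<in>ch Q. vol c * (av c f)\<^sup>2) - 2 * av Q f * I Q f + (av Q f)\<^sup>2 * vol Q"
    by (simp only: sum.distrib sum_subtractf sum_distrib_left[symmetric] I_ch[OF assms] vol_ch[OF assms])
  also have "2 * av Q f * I Q f = 2 * (av Q f)\<^sup>2 * vol Q"
    using vol_pos[OF assms(1)] by (simp add: power2_eq_square)
  finally show ?thesis by simp
qed

lemma sum_restr_ch:
  assumes "Q \<in> D" "card Q \<noteq> 1" "c \<in> ch Q" "x \<in> c"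
  shows "(\<Sum>c\<in>ch Q. restr c (F c) x) = F c x"
proof -
  have "(\<Sum>c\<in>ch Q. restr c (F c) x) = (\<Sum>c'\<in>ch Q. if c' = c then F c x else 0)"
    using assms ch_disjoint[OF assms(1,2)] by (intro sum.cong) (auto simp: restr_def)
  then show ?thesis using finite_ch assms by simp
qed

end

section \<open>Bilinear forms with perfect smoothness and their defect over the children\<close>

locale perfect_bilinear = weighted_tree m D ch \<kappa>
  for m :: "'x \<Rightarrow> real" and D ch \<kappa> +
  fixes V :: "'x set \<Rightarrow> ('x \<Rightarrow> real) \<Rightarrow> ('x \<Rightarrow> real) \<Rightarrow> real"
  assumes V_cong: "(\<And>x. x \<in> Q \<Longrightarrow> f x = f' x) \<Longrightarrow> (\<And>x. x \<in> Q \<Longrightarrow> h x = h' x) \<Longrightarrow> V Q f h = V Q f' h'"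
    and V_lin1: "V Q (\<lambda>x. \<alpha> * f x + \<beta> * f' x) h = \<alpha> * V Q f h + \<beta> * V Q f' h"
    and V_lin2: "V Q f (\<lambda>x. \<alpha> * h x + \<beta> * h' x) = \<alpha> * V Q f h + \<beta> * V Q f h'"
    and V_smooth1: "Q \<in> D \<Longrightarrow> c \<in> D \<Longrightarrow> c \<subseteq> Q \<Longrightarrow> wint m c f = 0 \<Longrightarrow> V Q (restr c f) h = V c f h"
    and V_smooth2: "Q \<in> D \<Longrightarrow> c \<in> D \<Longrightarrow> c \<subseteq> Q \<Longrightarrow> wint m c h = 0 \<Longrightarrow> V Q f (restr c h) = V c f h"
begin

text \<open>Several pairs of lemmas below are proved for one argument and transferred to the other
  through this interpretation.\<close>

lemma swap: "perfect_bilinear m D ch \<kappa> (\<lambda>Q f h. V Q h f)"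
  by unfold_locales (blast intro: V_cong V_lin1 V_lin2 V_smooth1 V_smooth2)+

lemma V_zero1: "V Q (\<lambda>x. 0) h = 0"
  using V_lin1[of Q 0 "\<lambda>_. 0" 0 "\<lambda>_. 0" h] by simp

lemma V_cmult1: "V Q (\<lambda>x. a * f x) h = a * V Q f h"
  using V_lin1[of Q a f 0 f h] by simp

lemma V_sum1: "finite S \<Longrightarrow> V Q (\<lambda>x. \<Sum>i\<in>S. a i * F i x) h = (\<Sum>i\<in>S. a i * V Q (F i) h)"
proof (induction S rule: finite_induct)
  case empty
  then show ?case by (simp add: V_zero1)
next
  case (insert i S)
  then show ?case using V_lin1[of Q "a i" "F i" 1 "\<lambda>x. \<Sum>i\<in>S. a i * F i x" h] by simp
qed

lemma V_zero2: "V Q f (\<lambda>x. 0) = 0"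
  using V_lin2[of Q f 0 "\<lambda>_. 0" 0 "\<lambda>_. 0"] by simp

lemma V_cmult2: "V Q f (\<lambda>x. a * h x) = a * V Q f h"
  using V_lin2[of Q f a h 0 h] by simp

lemma V_diff2: "V Q f (\<lambda>x. h x - h' x) = V Q f h - V Q f h'"
  using V_lin2[of Q f 1 h "-1" h'] by simp

text \<open>Isolates one generation of the tree. As a function of the averages on the children it is
  a bilinear form on a space of dimension at most \<kappa>, whatever the depth of the tree
  below.\<close>

definition child_defect :: "'x set \<Rightarrow> ('x \<Rightarrow> real) \<Rightarrow> ('x \<Rightarrow> real) \<Rightarrow> real" where
  "child_defect Q f h = V Q f h - (\<Sum>c\<in>ch Q. V c f h)"

lemma child_defect_lin1: "child_defect Q (\<lambda>x. \<alpha> * f x + \<beta> * f' x) h = \<alpha> * child_defect Q f h + \<beta> * child_defect Q f' h"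
  unfolding child_defect_def V_lin1 by (simp add: sum.distrib sum_distrib_left algebra_simps)

lemma child_defect_lin2: "child_defect Q f (\<lambda>x. \<alpha> * h x + \<beta> * h' x) = \<alpha> * child_defect Q f h + \<beta> * child_defect Q f h'"
  unfolding child_defect_def V_lin2 by (simp add: sum.distrib sum_distrib_left algebra_simps)

lemma child_defect_sum1: "finite S \<Longrightarrow> child_defect Q (\<lambda>x. \<Sum>i\<in>S. a i * F i x) h = (\<Sum>i\<in>S. a i * child_defect Q (F i) h)"
proof (induction S rule: finite_induct)
  case empty
  then show ?case using child_defect_lin1[of Q 0 "\<lambda>_. 0" 0 "\<lambda>_. 0" h] by simp
next
  case (insert i S)
  then show ?case using child_defect_lin1[of Q "a i" "F i" 1 "\<lambda>x. \<Sum>i\<in>S. a i * F i x" h] by simp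
qed

lemma child_defect_sum2: "finite S \<Longrightarrow> child_defect Q f (\<lambda>x. \<Sum>i\<in>S. a i * F i x) = (\<Sum>i\<in>S. a i * child_defect Q f (F i))"
proof (induction S rule: finite_induct)
  case empty
  then show ?case using child_defect_lin2[of Q f 0 "\<lambda>_. 0" 0 "\<lambda>_. 0"] by simp
next
  case (insert i S)
  then show ?case using child_defect_lin2[of Q f "a i" "F i" 1 "\<lambda>x. \<Sum>i\<in>S. a i * F i x"] by simp
qed

text \<open>The difference \<open>e\<close> has mean zero on every child, so smoothness turns
  \<open>V Q (restr c e) h\<close> into \<open>V c e h\<close>, and after summation nothing is left
  of the defect of \<open>e\<close>.\<close>

lemma child_defect_avg1:
  assumes Q: "Q \<in> D" "card Q \<noteq> 1" and eq: "\<And>c. c \<in> ch Q \<Longrightarrow> I c f = I c f'"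
  shows "child_defect Q f h = child_defect Q f' h"
proof -
  define e where "e = (\<lambda>x. f x - f' x)"
  have e0: "I c e = 0" if "c \<in> ch Q" for c using eq[OF that] by (simp add: e_def wint_diff)
  have "V Q e h = V Q (\<lambda>x. \<Sum>c\<in>ch Q. 1 * restr c e x) h"
  proof (rule V_cong)
    fix x assume "x \<in> Q"
    then obtain c where "c \<in> ch Q" "x \<in> c" using ch_Union[OF Q] by blast
    then show "e x = (\<Sum>c\<in>ch Q. 1 * restr c e x)" using sum_restr_ch[OF Q, of c x "\<lambda>_. e"] by simp
  qed simp
  also have "\<dots> = (\<Sum>c\<in>ch Q. 1 * V Q (restr c e) h)" by (rule V_sum1[OF finite_ch[OF Q]])
  also have "\<dots> = (\<Sum>c\<in>ch Q. V c e h)"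
    using Q by (intro sum.cong) (auto simp: V_smooth1 ch_cube ch_subset e0)
  finally have "child_defect Q e h = 0" by (simp add: child_defect_def)
  then show ?thesis using child_defect_lin1[of Q 1 f "-1" f' h] by (simp add: e_def)
qed

lemma child_defect_avg2:
  assumes Q: "Q \<in> D" "card Q \<noteq> 1" and eq: "\<And>c. c \<in> ch Q \<Longrightarrow> I c h = I c h'"
  shows "child_defect Q f h = child_defect Q f h'"
proof -
  interpret sw: perfect_bilinear m D ch \<kappa> "\<lambda>Q f h. V Q h f" by (rule swap)
  show ?thesis using sw.child_defect_avg1[OF assms] by (simp add: child_defect_def sw.child_defect_def)
qed

lemma I_sum_restr:
  assumes Q: "Q \<in> D" "card Q \<noteq> 1" and c: "c \<in> ch Q"
  shows "I c (\<lambda>x. \<Sum>c'\<in>ch Q. a c' * restr c' (F c') x) = a c * I c (F c)"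
proof -
  have "I c (\<lambda>x. \<Sum>c'\<in>ch Q. a c' * restr c' (F c') x) = I c (\<lambda>x. a c * F c x)"
  proof (rule wint_cong)
    fix x assume "x \<in> c"
    have "(\<Sum>c'\<in>ch Q. a c' * restr c' (F c') x) = (\<Sum>c'\<in>ch Q. restr c' (\<lambda>x. a c' * F c' x) x)"
      by (intro sum.cong) (auto simp: restr_def)
    then show "(\<Sum>c'\<in>ch Q. a c' * restr c' (F c') x) = a c * F c x"
      using sum_restr_ch[OF Q c \<open>x \<in> c\<close>, of "\<lambda>c' x. a c' * F c' x"] by simp
  qed
  then show ?thesis by (simp add: wint_cmult)
qed

text \<open>Only the averages of \<open>h\<close> matter, so \<open>h\<close> may be replaced by a
  combination of arbitrary functions of mean one on the children. The freedom in
  \<open>\<beta>\<close> later allows the current testing function on some children and a fresh one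
  on the others.\<close>

lemma child_defect_expand2:
  assumes Q: "Q \<in> D" "card Q \<noteq> 1" and \<beta>: "\<And>c. c \<in> ch Q \<Longrightarrow> I c (\<beta> c) = vol c"
  shows "child_defect Q f h = (\<Sum>c\<in>ch Q. av c h * (V Q f (restr c (\<beta> c)) - V c f (\<beta> c)))"
proof -
  have pos: "vol c > 0" if "c \<in> ch Q" for c using that ch_cube Q vol_pos by blast
  have "child_defect Q f h = child_defect Q f (\<lambda>x. \<Sum>c\<in>ch Q. av c h * restr c (\<beta> c) x)"
  proof (rule child_defect_avg2[OF Q])
    fix c assume "c \<in> ch Q"
    then show "I c h = I c (\<lambda>x. \<Sum>c\<in>ch Q. av c h * restr c (\<beta> c) x)"
      using I_sum_restr[OF Q, of c "\<lambda>c. av c h" \<beta>] \<beta>[of c] pos[of c] by simp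
  qed
  also have "\<dots> = (\<Sum>c\<in>ch Q. av c h * child_defect Q f (restr c (\<beta> c)))" by (rule child_defect_sum2[OF finite_ch[OF Q]])
  also have "\<dots> = (\<Sum>c\<in>ch Q. av c h * (V Q f (restr c (\<beta> c)) - V c f (\<beta> c)))"
  proof (intro sum.cong refl arg_cong2[where f="(*)"])
    fix c assume c: "c \<in> ch Q"
    have "V c' f (restr c (\<beta> c)) = (if c' = c then V c f (\<beta> c) else 0)" if c': "c' \<in> ch Q" for c'
    proof (cases "c' = c")
      case True then show ?thesis by (auto intro: V_cong simp: restr_def)
    next
      case False
      have "V c' f (restr c (\<beta> c)) = V c' f (\<lambda>x. 0)"
        using ch_disjoint[OF Q c' c False] by (intro V_cong) (auto simp: restr_def)
      then show ?thesis using False by (simp add: V_zero2)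
    qed
    then have "(\<Sum>c'\<in>ch Q. V c' f (restr c (\<beta> c))) = V c f (\<beta> c)"
      using c finite_ch[OF Q] by (simp cong: sum.cong)
    then show "child_defect Q f (restr c (\<beta> c)) = V Q f (restr c (\<beta> c)) - V c f (\<beta> c)" by (simp add: child_defect_def)
  qed
  finally show ?thesis .
qed

text \<open>Since the averages of \<open>h\<close> add up to zero, the term with \<open>\<rho>\<close> is free; it is later used to
  turn the bracket into a difference between \<open>Q\<close> and its child.\<close>

lemma child_defect_mean_zero2:
  assumes Q: "Q \<in> D" "card Q \<noteq> 1" and \<beta>: "\<And>c. c \<in> ch Q \<Longrightarrow> I c (\<beta> c) = vol c"
    and rep: "\<And>\<phi>. I Q \<phi> = 0 \<Longrightarrow> V Q f \<phi> = I Q (\<lambda>x. a x * \<phi> x)" and h0: "I Q h = 0"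
  shows "child_defect Q f h = (\<Sum>c\<in>ch Q. av c h * (I c (\<lambda>x. a x * \<beta> c x) - V c f (\<beta> c) - \<rho> * vol c))"
proof -
  have pos: "vol c > 0" if "c \<in> ch Q" for c using that ch_cube Q vol_pos by blast
  define \<psi> where "\<psi> = (\<lambda>x. \<Sum>c\<in>ch Q. av c h * restr c (\<beta> c) x)"
  interpret sw: perfect_bilinear m D ch \<kappa> "\<lambda>Q f h. V Q h f" by (rule swap)
  have Vs: "V Q f (\<lambda>x. \<Sum>c\<in>ch Q. w c * G c x) = (\<Sum>c\<in>ch Q. w c * V Q f (G c))" for w G
    by (rule sw.V_sum1[OF finite_ch[OF Q]])
  have Ic: "I c \<psi> = I c h" if "c \<in> ch Q" for c
    using I_sum_restr[OF Q that, of "\<lambda>c. av c h" \<beta>] \<beta>[OF that] pos[OF that] by (simp add: \<psi>_def)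
  then have "I Q \<psi> = 0" using h0 I_ch[OF Q, of \<psi>] I_ch[OF Q, of h] by simp
  then have "V Q f \<psi> = I Q (\<lambda>x. a x * \<psi> x)" by (rule rep)
  also have "\<dots> = (\<Sum>c\<in>ch Q. I c (\<lambda>x. a x * \<psi> x))" by (simp add: I_ch[OF Q])
  also have "\<dots> = (\<Sum>c\<in>ch Q. av c h * I c (\<lambda>x. a x * \<beta> c x))"
  proof (rule sum.cong[OF refl])
    fix c assume c: "c \<in> ch Q"
    have "I c (\<lambda>x. a x * \<psi> x) = I c (\<lambda>x. \<Sum>c\<in>ch Q. av c h * restr c (\<lambda>x. a x * \<beta> c x) x)"
      by (intro wint_cong) (auto simp: \<psi>_def restr_def sum_distrib_left intro!: sum.cong)
    then show "I c (\<lambda>x. a x * \<psi> x) = av c h * I c (\<lambda>x. a x * \<beta> c x)"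
      using I_sum_restr[OF Q c, of "\<lambda>c. av c h" "\<lambda>c x. a x * \<beta> c x"] by simp
  qed
  finally have 1: "(\<Sum>c\<in>ch Q. av c h * V Q f (restr c (\<beta> c))) = (\<Sum>c\<in>ch Q. av c h * I c (\<lambda>x. a x * \<beta> c x))"
    unfolding \<psi>_def Vs .
  have 2: "(\<Sum>c\<in>ch Q. av c h * (\<rho> * vol c)) = 0"
  proof -
    have "(\<Sum>c\<in>ch Q. av c h * (\<rho> * vol c)) = (\<Sum>c\<in>ch Q. \<rho> * I c h)"
      by (rule sum.cong) (auto dest: pos)
    then show ?thesis using h0 I_ch[OF Q, of h] by (simp add: sum_distrib_left[symmetric])
  qed
  show ?thesis
    using child_defect_expand2[of Q \<beta> f h, OF Q \<beta>] 1 2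
    by (simp only: right_diff_distrib sum_subtractf diff_0_right)
qed

lemma child_defect_mean_zero1:
  assumes Q: "Q \<in> D" "card Q \<noteq> 1" and \<alpha>: "\<And>c. c \<in> ch Q \<Longrightarrow> I c (\<alpha> c) = vol c"
    and rep: "\<And>\<phi>. I Q \<phi> = 0 \<Longrightarrow> V Q \<phi> h = I Q (\<lambda>x. a x * \<phi> x)" and f0: "I Q f = 0"
  shows "child_defect Q f h = (\<Sum>c\<in>ch Q. av c f * (I c (\<lambda>x. a x * \<alpha> c x) - V c (\<alpha> c) h - \<rho> * vol c))"
proof -
  interpret sw: perfect_bilinear m D ch \<kappa> "\<lambda>Q f h. V Q h f" by (rule swap)
  show ?thesis using sw.child_defect_mean_zero2[OF assms] by (simp add: child_defect_def sw.child_defect_def)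
qed

text \<open>Both arguments may be replaced by functions constant on the children. This reduces the
  bound to pairs of indicator functions, which is where dyadic decay enters.\<close>

lemma child_defect_bound:
  assumes Q: "Q \<in> D" "card Q \<noteq> 1"
    and E: "\<And>c c'. c \<in> ch Q \<Longrightarrow> c' \<in> ch Q \<Longrightarrow> \<bar>child_defect Q (indicat_real c) (indicat_real c')\<bar> \<le> E"
  shows "\<bar>child_defect Q f h\<bar> \<le> E * (\<Sum>c\<in>ch Q. \<bar>av c f\<bar>) * (\<Sum>c\<in>ch Q. \<bar>av c h\<bar>)"
proof -
  have pos: "vol c > 0" if "c \<in> ch Q" for c using that ch_cube Q vol_pos by blast
  have rest: "restr c (\<lambda>_. 1) = indicat_real c" for c :: "'x set" by (auto simp: restr_def indicator_def)
  have red: "I c f = I c (\<lambda>x. \<Sum>c\<in>ch Q. av c f * indicat_real c x)" if "c \<in> ch Q" for c f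
    using I_sum_restr[OF Q that, of "\<lambda>c. av c f" "\<lambda>_ _. 1"] pos[OF that] by (simp add: rest wint_const)
  have "child_defect Q f h = child_defect Q (\<lambda>x. \<Sum>c\<in>ch Q. av c f * indicat_real c x) h"
    using red by (intro child_defect_avg1 Q)
  also have "\<dots> = child_defect Q (\<lambda>x. \<Sum>c\<in>ch Q. av c f * indicat_real c x) (\<lambda>x. \<Sum>c\<in>ch Q. av c h * indicat_real c x)"
    using red by (intro child_defect_avg2 Q)
  also have "\<dots> = (\<Sum>c\<in>ch Q. av c f * (\<Sum>c'\<in>ch Q. av c' h * child_defect Q (indicat_real c) (indicat_real c')))"
    by (simp only: child_defect_sum1 child_defect_sum2 finite_ch[OF Q])
  finally have "\<bar>child_defect Q f h\<bar> \<le> (\<Sum>c\<in>ch Q. \<bar>av c f\<bar> * (\<Sum>c'\<in>ch Q. \<bar>av c' h\<bar> * \<bar>child_defect Q (indicat_real c) (indicat_real c')\<bar>))"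
    by (simp only:) (rule order_trans[OF sum_abs], rule sum_mono, subst abs_mult,
        rule mult_left_mono, rule order_trans[OF sum_abs], simp_all add: abs_mult)
  also have "\<dots> \<le> (\<Sum>c\<in>ch Q. \<bar>av c f\<bar> * (\<Sum>c'\<in>ch Q. \<bar>av c' h\<bar> * E))"
    using E by (intro sum_mono mult_left_mono) (auto)
  also have "\<dots> = E * (\<Sum>c\<in>ch Q. \<bar>av c f\<bar>) * (\<Sum>c\<in>ch Q. \<bar>av c h\<bar>)"
    by (simp only: sum_distrib_right[symmetric]) (simp only: mult_ac)
  finally show ?thesis .
qed

end

section \<open>The estimate for one generation\<close>

lemma quotient_diff_bound:
  fixes a a' b b' d K :: real
  assumes "\<bar>a - a'\<bar> \<le> d" "\<bar>b - b'\<bar> \<le> d" "1/2 \<le> b" "1/2 \<le> b'" "\<bar>a'\<bar> \<le> K" "1 \<le> K"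
  shows "\<bar>a / b - a' / b'\<bar> \<le> 6 * K * d"
proof -
  have d0: "0 \<le> d" using assms(1) by linarith
  have eq: "a / b - a' / b' = (a - a') / b + (a' / b') * ((b' - b) / b)"
    using assms by (simp add: field_simps)
  have 0: "\<bar>x / b\<bar> \<le> 2 * d" if "\<bar>x\<bar> \<le> d" for x
  proof -
    have "\<bar>x / b\<bar> = \<bar>x\<bar> / b" using assms by simp
    also have "\<dots> \<le> d / (1/2)" using assms that d0 by (intro frac_le) auto
    finally show ?thesis by simp
  qed
  have "\<bar>a' / b'\<bar> = \<bar>a'\<bar> / b'" using assms by simp
  also have "\<dots> \<le> K / (1/2)" using assms by (intro frac_le) auto
  finally have 1: "\<bar>a' / b'\<bar> \<le> 2 * K" by simp
  have "\<bar>(a' / b') * ((b' - b) / b)\<bar> \<le> (2 * K) * (2 * d)"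
    unfolding abs_mult using 1 0[of "b' - b"] assms by (intro mult_mono) auto
  moreover have "\<bar>(a - a') / b\<bar> \<le> 2 * d" by (rule 0) fact
  moreover have "d \<le> K * d" using assms(6) d0 by (simp add: mult_le_cancel_right1)
  moreover have "(2 * K) * (2 * d) = 4 * (K * d)" "6 * K * d = 6 * (K * d)" by simp_all
  moreover have "\<bar>s + t\<bar> \<le> 6 * K * d"
    if "\<bar>t\<bar> \<le> 4 * (K * d)" "\<bar>s\<bar> \<le> 2 * d" "d \<le> K * d" "6 * K * d = 6 * (K * d)" for s t
    using that by linarith
  ultimately show ?thesis unfolding eq by (metis (no_types, lifting))
qed

lemma abs_add4_le:
  fixes a b c d x y z w :: real
  shows "\<bar>b\<bar> \<le> x \<Longrightarrow> \<bar>c\<bar> \<le> y \<Longrightarrow> \<bar>d\<bar> \<le> z \<Longrightarrow> x + y + z \<le> w \<Longrightarrow> \<bar>a + (b + c + d)\<bar> \<le> \<bar>a\<bar> + w"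
  by linarith

context perfect_bilinear
begin

text \<open>The list will hold the two functions, the two current testing functions and the products
  of each testing function with the density of the other. One number then bounds all first-order
  differences between \<open>Q\<close> and a child.\<close>

definition osc :: "('x \<Rightarrow> real) list \<Rightarrow> 'x set \<Rightarrow> 'x set \<Rightarrow> real" where
  "osc ys Q c = (\<Sum>y\<leftarrow>ys. \<bar>av c y - av Q y\<bar>)"

definition energy :: "('x \<Rightarrow> real) list \<Rightarrow> 'x set \<Rightarrow> real" where
  "energy ys Q = (\<Sum>y\<leftarrow>ys. (av Q y)\<^sup>2)"

lemma osc_square: "(osc ys Q c)\<^sup>2 \<le> real (length ys) * (\<Sum>y\<leftarrow>ys. (av c y - av Q y)\<^sup>2)"
proof -
  have "(\<Sum>y\<leftarrow>ys. \<bar>av c y - av Q y\<bar>)\<^sup>2 = (\<Sum>i<length ys. 1 * \<bar>av c (ys!i) - av Q (ys!i)\<bar>)\<^sup>2"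
    by (simp add: sum_list_sum_nth atLeast0LessThan)
  also have "\<dots> \<le> (\<Sum>i<length ys. 1\<^sup>2) * (\<Sum>i<length ys. \<bar>av c (ys!i) - av Q (ys!i)\<bar>\<^sup>2)"
    by (rule Cauchy_Schwarz_ineq_sum)
  also have "\<dots> = real (length ys) * (\<Sum>y\<leftarrow>ys. (av c y - av Q y)\<^sup>2)"
    by (simp add: sum_list_sum_nth atLeast0LessThan)
  finally show ?thesis by (simp add: osc_def)
qed

lemma osc_nonneg: "0 \<le> osc ys Q c"
  unfolding osc_def by (induction ys) auto

lemma energy_nonneg: "0 \<le> energy ys Q"
  unfolding energy_def by (induction ys) auto

lemma energy_le: "(\<And>y. y \<in> set ys \<Longrightarrow> \<bar>av Q y\<bar> \<le> K) \<Longrightarrow> energy ys Q \<le> real (length ys) * K\<^sup>2"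
proof (induction ys)
  case (Cons y ys)
  have "(av Q y)\<^sup>2 \<le> K\<^sup>2" using Cons.prems[of y] by (intro abs_le_square_iff[THEN iffD1]) auto
  moreover have "energy ys Q \<le> real (length ys) * K\<^sup>2" using Cons by simp
  ultimately show ?case by (simp add: energy_def algebra_simps)
qed (simp add: energy_def)

text \<open>Cauchy-Schwarz over the list, then orthogonality for each entry. The right side is a
  difference of energies of consecutive generations and telescopes over the tree.\<close>

lemma sum_osc_square:
  assumes Q: "Q \<in> D" "card Q \<noteq> 1"
  shows "(\<Sum>c\<in>ch Q. vol c * (osc ys Q c)\<^sup>2) \<le> real (length ys) * ((\<Sum>c\<in>ch Q. vol c * energy ys c) - vol Q * energy ys Q)"
proof -
  have pos: "vol c > 0" if "c \<in> ch Q" for c using that ch_cube Q vol_pos by blast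
  have "(\<Sum>c\<in>ch Q. vol c * (osc ys Q c)\<^sup>2)
      \<le> (\<Sum>c\<in>ch Q. vol c * (real (length ys) * (\<Sum>y\<leftarrow>ys. (av c y - av Q y)\<^sup>2)))"
    using pos by (intro sum_mono mult_left_mono osc_square) (auto dest: less_imp_le)
  also have "\<dots> = real (length ys) * (\<Sum>y\<leftarrow>ys. \<Sum>c\<in>ch Q. vol c * (av c y - av Q y)\<^sup>2)"
    by (simp add: sum_list_sum_nth sum_distrib_left sum.swap[of _ "ch Q"] mult_ac)
  also have "\<dots> = real (length ys) * (\<Sum>y\<leftarrow>ys. (\<Sum>c\<in>ch Q. vol c * (av c y)\<^sup>2) - vol Q * (av Q y)\<^sup>2)"
    by (simp only: sum_square_diff_ch[OF Q])
  also have "\<dots> = real (length ys) * ((\<Sum>c\<in>ch Q. vol c * energy ys c) - vol Q * energy ys Q)"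
    unfolding energy_def
    by (rule arg_cong2[where f="(*)"], rule refl, induction ys) (simp_all add: sum.distrib algebra_simps)
  finally show ?thesis .
qed

text \<open>Insert \<open>g = lam * bu + f'\<close> and \<open>h = \<mu> * bv + h'\<close> into the
  defect, where \<open>f'\<close> and \<open>h'\<close> have mean zero on \<open>Q\<close>. The part
  from \<open>bu\<close> and \<open>bv\<close> goes to the left side, the mixed parts are given by
  the mean-zero formulas, and the defect of \<open>f'\<close> and \<open>h'\<close> is of second
  order.\<close>

lemma one_step_identity:
  fixes g h bu bv au av' :: "'x \<Rightarrow> real" and \<rho> \<rho>' :: real
  assumes Q: "Q \<in> D" "card Q \<noteq> 1"
    and \<alpha>: "\<And>c. c \<in> ch Q \<Longrightarrow> I c (\<alpha> c) = vol c"
    and \<beta>: "\<And>c. c \<in> ch Q \<Longrightarrow> I c (\<beta> c) = vol c"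
    and rep1: "\<And>\<phi>. I Q \<phi> = 0 \<Longrightarrow> V Q bu \<phi> = I Q (\<lambda>x. au x * \<phi> x)"
    and rep2: "\<And>\<phi>. I Q \<phi> = 0 \<Longrightarrow> V Q \<phi> bv = I Q (\<lambda>x. av' x * \<phi> x)"
    and nz: "I Q bu \<noteq> 0" "I Q bv \<noteq> 0"
  defines "lam \<equiv> av Q g / av Q bu" and "\<mu> \<equiv> av Q h / av Q bv"
  defines "f' \<equiv> (\<lambda>x. g x - lam * bu x)" and "h' \<equiv> (\<lambda>x. h x - \<mu> * bv x)"
  shows "V Q g h - lam * \<mu> * V Q bu bv =
    (\<Sum>c\<in>ch Q. V c g h - lam * \<mu> * V c bu bv
       + lam * (av c h' * (I c (\<lambda>x. au x * \<beta> c x) - V c bu (\<beta> c) - \<rho> * vol c))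
       + \<mu> * (av c f' * (I c (\<lambda>x. av' x * \<alpha> c x) - V c (\<alpha> c) bv - \<rho>' * vol c)))
    + child_defect Q f' h'"
proof -
  have f'0: "I Q f' = 0" and h'0: "I Q h' = 0"
    using nz vol_pos[OF Q(1)] by (simp_all add: f'_def h'_def wint_diff wint_cmult wint_divide lam_def \<mu>_def)
  have g: "g = (\<lambda>x. lam * bu x + 1 * f' x)" and h: "h = (\<lambda>x. \<mu> * bv x + 1 * h' x)"
    by (auto simp: f'_def h'_def)
  have "child_defect Q g h = lam * child_defect Q bu h + child_defect Q f' h"
    by (subst g, subst child_defect_lin1) simp
  also have "child_defect Q bu h = \<mu> * child_defect Q bu bv + child_defect Q bu h'"
    by (subst h, subst child_defect_lin2) simp
  also have "child_defect Q f' h = \<mu> * child_defect Q f' bv + child_defect Q f' h'"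
    by (subst h, subst child_defect_lin2) simp
  finally have "child_defect Q g h = lam * \<mu> * child_defect Q bu bv + lam * child_defect Q bu h' + \<mu> * child_defect Q f' bv + child_defect Q f' h'"
    by (simp add: algebra_simps)
  moreover have "child_defect Q bu h' = (\<Sum>c\<in>ch Q. av c h' * (I c (\<lambda>x. au x * \<beta> c x) - V c bu (\<beta> c) - \<rho> * vol c))"
    by (rule child_defect_mean_zero2[OF Q \<beta> rep1 h'0])
  moreover have "child_defect Q f' bv = (\<Sum>c\<in>ch Q. av c f' * (I c (\<lambda>x. av' x * \<alpha> c x) - V c (\<alpha> c) bv - \<rho>' * vol c))"
    by (rule child_defect_mean_zero1[OF Q \<alpha> rep2 f'0])
  ultimately show ?thesis
    unfolding child_defect_def[of Q g h] child_defect_def[of Q bu bv]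
    by (simp only: sum.distrib sum_subtractf sum_distrib_left[symmetric]) (simp add: algebra_simps)
qed

text \<open>A child is \<open>good\<close> if the current pair of testing functions is kept on it. There the first-order
  terms cancel; on the other children only the size of everything matters.\<close>

lemma one_step_bound:
  fixes g h bu bv au av' :: "'x \<Rightarrow> real" and K E :: real
  assumes Q: "Q \<in> D" "card Q \<noteq> 1" and K: "1 \<le> K"
    and \<alpha>0: "\<And>c. c \<in> ch Q \<Longrightarrow> I c (\<alpha>0 c) = vol c"
    and \<beta>0: "\<And>c. c \<in> ch Q \<Longrightarrow> I c (\<beta>0 c) = vol c"
    and rep1: "\<And>\<phi>. I Q \<phi> = 0 \<Longrightarrow> V Q bu \<phi> = I Q (\<lambda>x. au x * \<phi> x)"
    and rep2: "\<And>\<phi>. I Q \<phi> = 0 \<Longrightarrow> V Q \<phi> bv = I Q (\<lambda>x. av' x * \<phi> x)"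
    and ys: "ys = [g, h, bu, bv, \<lambda>x. au x * bv x, \<lambda>x. av' x * bu x]"
    and KQ: "\<And>y. y \<in> set ys \<Longrightarrow> \<bar>av Q y\<bar> \<le> K"
    and Kc: "\<And>c y. c \<in> ch Q \<Longrightarrow> y \<in> set ys \<Longrightarrow> \<bar>av c y\<bar> \<le> K"
    and lowQ: "1/2 \<le> av Q bu" "1/2 \<le> av Q bv"
    and good: "\<And>c. c \<in> ch Q \<Longrightarrow> good c \<Longrightarrow> 1/2 \<le> av c bu \<and> 1/2 \<le> av c bv"
    and W: "\<And>c. c \<in> ch Q \<Longrightarrow> \<bar>V c bu bv\<bar> \<le> K * vol c"
    and bad: "\<And>c. c \<in> ch Q \<Longrightarrow> \<not> good c \<Longrightarrow> \<bar>I c (\<lambda>x. au x * \<beta>0 c x)\<bar> \<le> K * vol c \<and> \<bar>V c bu (\<beta>0 c)\<bar> \<le> K * vol c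
       \<and> \<bar>I c (\<lambda>x. av' x * \<alpha>0 c x)\<bar> \<le> K * vol c \<and> \<bar>V c (\<alpha>0 c) bv\<bar> \<le> K * vol c"
    and E: "\<And>c c'. c \<in> ch Q \<Longrightarrow> c' \<in> ch Q \<Longrightarrow> \<bar>child_defect Q (indicat_real c) (indicat_real c')\<bar> \<le> E * vol Q" "0 \<le> E"
  shows "\<bar>V Q g h - av Q g / av Q bu * (av Q h / av Q bv) * V Q bu bv\<bar>
     \<le> (\<Sum>c\<in>ch Q. if good c then \<bar>V c g h - av c g / av c bu * (av c h / av c bv) * V c bu bv\<bar>
                     else \<bar>V c g h\<bar> + 52 * K^4 * vol c)
       + (108 * K^3 + 9 * K\<^sup>2 * E * \<kappa>\<^sup>2) * 6 * ((\<Sum>c\<in>ch Q. vol c * energy ys c) - vol Q * energy ys Q)"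
proof -
  have pos: "vol c > 0" if "c \<in> ch Q" for c using that ch_cube Q vol_pos by blast
  define lam where "lam = av Q g / av Q bu"
  define \<mu> where "\<mu> = av Q h / av Q bv"
  define f' where "f' = (\<lambda>x. g x - lam * bu x)"
  define h' where "h' = (\<lambda>x. h x - \<mu> * bv x)"
  \<comment> \<open>The free constants are fixed so that
    \<open>av c (\<lambda>x. au x * bv x) - \<rho> * av c bv\<close> vanishes for \<open>Q\<close>
    in place of \<open>c\<close>; on a child it is then of first order.\<close>
  define \<rho> where "\<rho> = av Q (\<lambda>x. au x * bv x) / av Q bv"
  define \<rho>' where "\<rho>' = av Q (\<lambda>x. av' x * bu x) / av Q bu"
  \<comment> \<open>On a good child the current testing function is normalized to mean one, which is
    harmless since its average there is at least 1/2.\<close>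
  define \<alpha> where "\<alpha> = (\<lambda>c. if good c then \<lambda>x. (1 / av c bu) * bu x else \<alpha>0 c)"
  define \<beta> where "\<beta> = (\<lambda>c. if good c then \<lambda>x. (1 / av c bv) * bv x else \<beta>0 c)"
  define d where "d = osc ys Q"
  have \<alpha>: "I c (\<alpha> c) = vol c" and \<beta>: "I c (\<beta> c) = vol c" if "c \<in> ch Q" for c
    using good[OF that] \<alpha>0[OF that] \<beta>0[OF that] pos[OF that] by (auto simp: \<alpha>_def \<beta>_def wint_cmult wint_divide)
  have d: "\<bar>av c y - av Q y\<bar> \<le> d c" if "y \<in> set ys" for c y
    unfolding d_def osc_def by (rule member_le_sum_list) (use that in auto)
  have d0: "0 \<le> d c" for c by (simp add: d_def osc_nonneg)
  have mem: "g \<in> set ys" "h \<in> set ys" "bu \<in> set ys" "bv \<in> set ys"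
    "(\<lambda>x. au x * bv x) \<in> set ys" "(\<lambda>x. av' x * bu x) \<in> set ys" by (auto simp: ys)
  have K0: "0 \<le> K" using K by simp
  have quot: "\<bar>a / b\<bar> \<le> 2 * K" if "\<bar>a\<bar> \<le> K" "1/2 \<le> b" for a b :: real
  proof -
    have "\<bar>a / b\<bar> = \<bar>a\<bar> / b" using that by simp
    also have "\<dots> \<le> K / (1/2)" using that K by (intro frac_le) auto
    finally show ?thesis by simp
  qed
  have lm: "\<bar>lam\<bar> \<le> 2 * K" "\<bar>\<mu>\<bar> \<le> 2 * K" "\<bar>\<rho>\<bar> \<le> 2 * K" "\<bar>\<rho>'\<bar> \<le> 2 * K"
    unfolding lam_def \<mu>_def \<rho>_def \<rho>'_def by (rule quot; use KQ mem lowQ in blast)+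
  have nz: "I Q bu \<noteq> 0" "I Q bv \<noteq> 0" using lowQ by auto
  define T where "T c = V c g h - lam * \<mu> * V c bu bv
       + lam * (av c h' * (I c (\<lambda>x. au x * \<beta> c x) - V c bu (\<beta> c) - \<rho> * vol c))
       + \<mu> * (av c f' * (I c (\<lambda>x. av' x * \<alpha> c x) - V c (\<alpha> c) bv - \<rho>' * vol c))" for c
  have id: "V Q g h - lam * \<mu> * V Q bu bv = (\<Sum>c\<in>ch Q. T c) + child_defect Q f' h'"
    unfolding T_def lam_def \<mu>_def f'_def h'_def
    by (rule one_step_identity[OF Q \<alpha> \<beta> rep1 rep2 nz])
  have avf: "av c f' = av c g - lam * av c bu" and avh: "av c h' = av c h - \<mu> * av c bv" for c
    by (simp_all add: f'_def h'_def wint_diff wint_cmult diff_divide_distrib)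
  have diff3: "\<bar>y - l * b\<bar> \<le> 3 * K * d c" 
    if "\<bar>y - y0\<bar> \<le> d c" "\<bar>b - b0\<bar> \<le> d c" "y0 = l * b0" "\<bar>l\<bar> \<le> 2 * K" for y y0 b b0 l c
  proof -
    have "\<bar>y - l * b\<bar> = \<bar>(y - y0) - l * (b - b0)\<bar>" using that by (simp add: algebra_simps)
    also have "\<dots> \<le> \<bar>y - y0\<bar> + \<bar>l\<bar> * \<bar>b - b0\<bar>" by (simp add: abs_mult[symmetric] abs_triangle_ineq4)
    also have "\<dots> \<le> d c + (2 * K) * d c" using that K by (intro add_mono mult_mono) auto
    also have "\<dots> \<le> K * d c + (2 * K) * d c" using K d0[of c] by (simp add: mult_le_cancel_right1)
    finally show ?thesis by simp
  qed
  have avQ: "av Q g = lam * av Q bu" "av Q h = \<mu> * av Q bv" 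
     "av Q (\<lambda>x. au x * bv x) = \<rho> * av Q bv" "av Q (\<lambda>x. av' x * bu x) = \<rho>' * av Q bu"
    using nz vol_pos[OF Q(1)] by (simp_all add: lam_def \<mu>_def \<rho>_def \<rho>'_def)
  have small: "\<bar>av c f'\<bar> \<le> 3 * K * d c" "\<bar>av c h'\<bar> \<le> 3 * K * d c" 
     "\<bar>av c (\<lambda>x. au x * bv x) - \<rho> * av c bv\<bar> \<le> 3 * K * d c"
     "\<bar>av c (\<lambda>x. av' x * bu x) - \<rho>' * av c bu\<bar> \<le> 3 * K * d c" if "c \<in> ch Q" for c
    unfolding avf avh using d mem avQ lm by (blast intro: diff3)+
  have Tgood: "\<bar>T c\<bar> \<le> \<bar>V c g h - av c g / av c bu * (av c h / av c bv) * V c bu bv\<bar> + 108 * K^3 * (vol c * (d c)\<^sup>2)"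
    if c: "c \<in> ch Q" and gc: "good c" for c
  proof -
    define l where "l = av c g / av c bu"
    define n where "n = av c h / av c bv"
    have low: "1/2 \<le> av c bu" "1/2 \<le> av c bv" using good[OF c gc] by auto
    have dl: "\<bar>l - lam\<bar> \<le> 6 * K * d c" "\<bar>n - \<mu>\<bar> \<le> 6 * K * d c"
      unfolding l_def n_def lam_def \<mu>_def
      by (rule quotient_diff_bound; use d mem low lowQ KQ K in blast)+
    have vn: "vol c > 0" by (rule pos[OF c])
    then have vn0: "0 \<le> vol c" by linarith
    have e1: "V c bu (\<beta> c) = V c bu bv / av c bv" "V c (\<alpha> c) bv = V c bu bv / av c bu"
      using gc by (simp_all only: \<alpha>_def \<beta>_def if_True V_cmult1 V_cmult2) simp_all
    have e2: "I c (\<lambda>x. au x * \<beta> c x) = I c (\<lambda>x. (1 / av c bv) * (au x * bv x))"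
       "I c (\<lambda>x. av' x * \<alpha> c x) = I c (\<lambda>x. (1 / av c bu) * (av' x * bu x))"
      using gc by (auto simp: \<alpha>_def \<beta>_def mult_ac intro!: wint_cong)
    define X where "X = av c (\<lambda>x. au x * bv x)"
    define Y where "Y = av c (\<lambda>x. av' x * bu x)"
    have e3: "I c (\<lambda>x. au x * bv x) = X * vol c" "I c (\<lambda>x. av' x * bu x) = Y * vol c"
      using vn by (simp_all add: X_def Y_def)
    define b1 where "b1 = av c bu"
    define b2 where "b2 = av c bv"
    have e4: "av c h' = (n - \<mu>) * b2" "av c f' = (l - lam) * b1"
      using low vn unfolding avf avh l_def n_def b1_def b2_def by (simp_all add: left_diff_distrib diff_divide_distrib)
    have b0: "b1 > 0" "b2 > 0" using low b1_def b2_def by linarith+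
    have Teq: "T c = V c g h - lam * \<mu> * V c bu bv
       + lam * (((n - \<mu>) * b2) * ((1 / b2) * (X * vol c) - V c bu bv / b2 - \<rho> * vol c))
       + \<mu> * (((l - lam) * b1) * ((1 / b1) * (Y * vol c) - V c bu bv / b1 - \<rho>' * vol c))"
      unfolding T_def e4 unfolding e1 e2 wint_cmult e3 unfolding b1_def b2_def ..
    have 1: "((n - \<mu>) * b2) * ((1 / b2) * (X * vol c) - V c bu bv / b2 - \<rho> * vol c) = (n - \<mu>) * (X * vol c - V c bu bv - \<rho> * vol c * b2)"
      "((l - lam) * b1) * ((1 / b1) * (Y * vol c) - V c bu bv / b1 - \<rho>' * vol c) = (l - lam) * (Y * vol c - V c bu bv - \<rho>' * vol c * b1)"
      using b0 by (simp_all add: field_simps)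
    \<comment> \<open>The key cancellation: the terms with \<open>V c bu bv\<close> linear in
      \<open>l - lam\<close> and \<open>n - \<mu>\<close> turn the coefficient
      \<open>lam * \<mu>\<close> of \<open>Q\<close> into the coefficient \<open>l * n\<close> of
      the child, up to the product of both differences. In the other two terms the choice of \<rho>
      and \<rho>' supplies the second small factor.\<close>
    have Teq2: "T c = (V c g h - l * n * V c bu bv) + (V c bu bv * ((l - lam) * (n - \<mu>))
       + (lam * (n - \<mu>)) * ((X - \<rho> * b2) * vol c) + (\<mu> * (l - lam)) * ((Y - \<rho>' * b1) * vol c))"
      unfolding Teq 1 by (simp add: algebra_simps)
    have sX: "\<bar>X - \<rho> * b2\<bar> \<le> 3 * K * d c" "\<bar>Y - \<rho>' * b1\<bar> \<le> 3 * K * d c"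
      using small(3,4)[OF c] by (simp_all add: X_def Y_def b1_def b2_def)
    have b1: "\<bar>V c bu bv * ((l - lam) * (n - \<mu>))\<bar> \<le> (K * vol c) * ((6 * K * d c) * (6 * K * d c))"
      unfolding abs_mult by (intro mult_mono mult_nonneg_nonneg abs_ge_zero W[OF c] dl d0 K0 vn0; simp)
    have b2: "\<bar>(lam * (n - \<mu>)) * ((X - \<rho> * b2) * vol c)\<bar> \<le> (2 * K * (6 * K * d c)) * ((3 * K * d c) * vol c)"
      unfolding abs_mult using vn0 by (intro mult_mono mult_nonneg_nonneg abs_ge_zero lm dl sX d0 K0 vn0; simp)
    have b3: "\<bar>(\<mu> * (l - lam)) * ((Y - \<rho>' * b1) * vol c)\<bar> \<le> (2 * K * (6 * K * d c)) * ((3 * K * d c) * vol c)"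
      unfolding abs_mult using vn0 by (intro mult_mono mult_nonneg_nonneg abs_ge_zero lm dl sX d0 K0 vn0; simp)
    \<comment> \<open>Each of the three second-order terms contributes 36.\<close>
    have "(K * vol c) * ((6 * K * d c) * (6 * K * d c)) + (2 * K * (6 * K * d c)) * ((3 * K * d c) * vol c)
       + (2 * K * (6 * K * d c)) * ((3 * K * d c) * vol c) \<le> 108 * K^3 * (vol c * (d c)\<^sup>2)"
      by (simp add: power2_eq_square power3_eq_cube)
    from abs_add4_le[OF b1 b2 b3 this]
    show ?thesis unfolding Teq2 l_def[symmetric] n_def[symmetric] .
  qed
  \<comment> \<open>Nothing is small here, so every factor is estimated by its size: 4 from the
    product with \<open>V c bu bv\<close>, and 24 from each of the two mixed terms.\<close>
  have Tbad: "\<bar>T c\<bar> \<le> \<bar>V c g h\<bar> + 52 * K^4 * vol c" if c: "c \<in> ch Q" and gc: "\<not> good c" for c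
  proof -
    have vn: "vol c > 0" by (rule pos[OF c])
    then have vn0: "0 \<le> vol c" by linarith
    have K2: "K^1 \<le> K\<^sup>2" "K^3 \<le> K^4" using K by (rule power_increasing[rotated]; simp)+
    have b3: "\<bar>y - l * b\<bar> \<le> 3 * K\<^sup>2" if "\<bar>y\<bar> \<le> K" "\<bar>l\<bar> \<le> 2 * K" "\<bar>b\<bar> \<le> K" for y l b :: real
    proof -
      have "\<bar>y - l * b\<bar> \<le> \<bar>y\<bar> + \<bar>l\<bar> * \<bar>b\<bar>" by (simp add: abs_mult[symmetric] abs_triangle_ineq4)
      also have "\<dots> \<le> K + (2 * K) * K" using that K by (intro add_mono mult_mono) auto
      finally show ?thesis using K2 by (simp add: power2_eq_square)
    qed
    have f3: "\<bar>av c f'\<bar> \<le> 3 * K\<^sup>2" "\<bar>av c h'\<bar> \<le> 3 * K\<^sup>2"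
      unfolding avf avh by (rule b3; use Kc[OF c] mem lm in blast)+
    have br: "\<bar>x - y - r * vol c\<bar> \<le> 4 * K * vol c" if "\<bar>x\<bar> \<le> K * vol c" "\<bar>y\<bar> \<le> K * vol c" "\<bar>r\<bar> \<le> 2 * K" for x y r
    proof -
      have "\<bar>r * vol c\<bar> \<le> 2 * K * vol c" unfolding abs_mult using that vn by (intro mult_mono) auto
      then show ?thesis using that by linarith
    qed
    have B: "\<bar>I c (\<lambda>x. au x * \<beta> c x) - V c bu (\<beta> c) - \<rho> * vol c\<bar> \<le> 4 * K * vol c"
      "\<bar>I c (\<lambda>x. av' x * \<alpha> c x) - V c (\<alpha> c) bv - \<rho>' * vol c\<bar> \<le> 4 * K * vol c"
      using bad[OF c gc] gc lm by (auto simp: \<alpha>_def \<beta>_def intro!: br)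
    have b1: "\<bar>- (lam * \<mu> * V c bu bv)\<bar> \<le> (2 * K * (2 * K)) * (K * vol c)"
      unfolding abs_minus_cancel abs_mult by (intro mult_mono mult_nonneg_nonneg abs_ge_zero lm W[OF c] K0 vn0; simp)
    have b2: "\<bar>lam * (av c h' * (I c (\<lambda>x. au x * \<beta> c x) - V c bu (\<beta> c) - \<rho> * vol c))\<bar> \<le> (2 * K) * ((3 * K\<^sup>2) * (4 * K * vol c))"
      unfolding abs_mult by (intro mult_mono mult_nonneg_nonneg abs_ge_zero lm f3 B K0 vn0; simp)
    have b3: "\<bar>\<mu> * (av c f' * (I c (\<lambda>x. av' x * \<alpha> c x) - V c (\<alpha> c) bv - \<rho>' * vol c))\<bar> \<le> (2 * K) * ((3 * K\<^sup>2) * (4 * K * vol c))"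
      unfolding abs_mult by (intro mult_mono mult_nonneg_nonneg abs_ge_zero lm f3 B K0 vn0; simp)
    have "(2 * K * (2 * K)) * (K * vol c) + (2 * K) * ((3 * K\<^sup>2) * (4 * K * vol c)) + (2 * K) * ((3 * K\<^sup>2) * (4 * K * vol c))
       = 4 * (K^3 * vol c) + 48 * (K^4 * vol c)" by (simp add: power2_eq_square power3_eq_cube power4_eq_xxxx)
    moreover have "K^3 * vol c \<le> K^4 * vol c" using K2 vn by simp
    ultimately have "(2 * K * (2 * K)) * (K * vol c) + (2 * K) * ((3 * K\<^sup>2) * (4 * K * vol c)) + (2 * K) * ((3 * K\<^sup>2) * (4 * K * vol c))
       \<le> 52 * K^4 * vol c" by (simp add: mult.commute)
    from abs_add4_le[OF b1 b2 b3 this] show ?thesis unfolding T_def by (simp only: diff_conv_add_uminus add.assoc)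
  qed
  \<comment> \<open>One factor \<kappa> counts the children, the other compares \<open>vol Q\<close>
    with \<open>vol c\<close>.\<close>
  have DE: "\<bar>child_defect Q f' h'\<bar> \<le> 9 * K\<^sup>2 * E * \<kappa>\<^sup>2 * (\<Sum>c\<in>ch Q. vol c * (d c)\<^sup>2)"
  proof -
    define S where "S = (\<Sum>c\<in>ch Q. d c)"
    have S0: "0 \<le> S" unfolding S_def by (intro sum_nonneg d0)
    have Sf: "(\<Sum>c\<in>ch Q. \<bar>av c f'\<bar>) \<le> 3 * K * S" and Sh: "(\<Sum>c\<in>ch Q. \<bar>av c h'\<bar>) \<le> 3 * K * S"
      unfolding S_def sum_distrib_left by (intro sum_mono small; assumption)+
    have "\<bar>child_defect Q f' h'\<bar> \<le> (E * vol Q) * (\<Sum>c\<in>ch Q. \<bar>av c f'\<bar>) * (\<Sum>c\<in>ch Q. \<bar>av c h'\<bar>)"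
      by (rule child_defect_bound[OF Q E(1)])
    also have "\<dots> \<le> (E * vol Q) * (3 * K * S) * (3 * K * S)"
      by (intro mult_mono Sf Sh mult_nonneg_nonneg sum_nonneg abs_ge_zero S0 K0 E(2) order_refl
          vol_pos[OF Q(1), THEN less_imp_le]; simp)
    also have "\<dots> = 9 * K\<^sup>2 * E * vol Q * S\<^sup>2" by (simp add: power2_eq_square)
    also have "S\<^sup>2 \<le> (\<Sum>c\<in>ch Q. 1\<^sup>2) * (\<Sum>c\<in>ch Q. (d c)\<^sup>2)"
      unfolding S_def using Cauchy_Schwarz_ineq_sum[of "\<lambda>_. 1" d "ch Q"] by simp
    also have "(\<Sum>c\<in>ch Q. 1\<^sup>2) \<le> \<kappa>" using card_ch[OF Q] by simp
    finally have "\<bar>child_defect Q f' h'\<bar> \<le> 9 * K\<^sup>2 * E * vol Q * (\<kappa> * (\<Sum>c\<in>ch Q. (d c)\<^sup>2))"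
      using E(2) vol_pos[OF Q(1)] by (simp add: mult_left_mono mult_right_mono sum_nonneg)
    also have "\<dots> = 9 * K\<^sup>2 * E * \<kappa> * (\<Sum>c\<in>ch Q. vol Q * (d c)\<^sup>2)"
      by (simp add: sum_distrib_left mult_ac)
    also have "\<dots> \<le> 9 * K\<^sup>2 * E * \<kappa> * (\<Sum>c\<in>ch Q. (\<kappa> * vol c) * (d c)\<^sup>2)"
      using E(2) kappa_ge_1 ch_vol[OF Q] by (intro mult_left_mono sum_mono mult_right_mono) auto
    also have "\<dots> = 9 * K\<^sup>2 * E * \<kappa>\<^sup>2 * (\<Sum>c\<in>ch Q. vol c * (d c)\<^sup>2)"
      by (simp add: sum_distrib_left power2_eq_square mult_ac)
    finally show ?thesis .
  qed
  define G where "G = (\<lambda>c. if good c then \<bar>V c g h - av c g / av c bu * (av c h / av c bv) * V c bu bv\<bar>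
                     else \<bar>V c g h\<bar> + 52 * K^4 * vol c)"
  have "\<bar>\<Sum>c\<in>ch Q. T c\<bar> \<le> (\<Sum>c\<in>ch Q. G c + 108 * K^3 * (vol c * (d c)\<^sup>2))"
  proof (rule order_trans[OF sum_abs], rule sum_mono)
    fix c assume c: "c \<in> ch Q"
    have z: "0 \<le> 108 * K^3 * (vol c * (d c)\<^sup>2)" using K pos[OF c] by simp
    show "\<bar>T c\<bar> \<le> G c + 108 * K^3 * (vol c * (d c)\<^sup>2)"
      using Tgood[OF c] add_increasing2[OF z Tbad[OF c]] unfolding G_def by (cases "good c") simp_all
  qed
  also have "\<dots> = (\<Sum>c\<in>ch Q. G c) + 108 * K^3 * (\<Sum>c\<in>ch Q. vol c * (d c)\<^sup>2)"
    by (simp add: sum.distrib sum_distrib_left)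
  finally have "\<bar>V Q g h - lam * \<mu> * V Q bu bv\<bar> \<le> (\<Sum>c\<in>ch Q. G c) + (108 * K^3 + 9 * K\<^sup>2 * E * \<kappa>\<^sup>2) * (\<Sum>c\<in>ch Q. vol c * (d c)\<^sup>2)"
    unfolding id using DE by (simp add: algebra_simps)
  also have "\<dots> \<le> (\<Sum>c\<in>ch Q. G c) + (108 * K^3 + 9 * K\<^sup>2 * E * \<kappa>\<^sup>2) * (6 * ((\<Sum>c\<in>ch Q. vol c * energy ys c) - vol Q * energy ys Q))"
    using sum_osc_square[OF Q, of ys] K E(2) by (intro add_left_mono mult_left_mono) (auto simp: d_def ys)
  finally show ?thesis unfolding G_def lam_def \<mu>_def by (simp only: mult.assoc)
qed

end

section \<open>The stopping-time argument\<close>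

lemma le_one_plus_powr:
  fixes x q :: real assumes "1 \<le> q" shows "x \<le> 1 + x powr q"
proof (cases "x \<le> 1")
  case True
  then show ?thesis by (smt (verit) powr_ge_zero)
next
  case False
  then have "x powr 1 \<le> x powr q" using assms by (intro powr_mono) auto
  then show ?thesis using False by simp
qed

lemma powr_le_mult_powr:
  fixes x v L e :: real
  assumes "0 \<le> x" "x \<le> L * v" "0 < v" "1 \<le> L" "0 \<le> e" "e \<le> 1"
  shows "x powr e \<le> L * v powr e"
proof -
  have "x powr e \<le> (L * v) powr e" using assms by (intro powr_mono2) auto
  also have "\<dots> = L powr e * v powr e" using assms by (simp add: powr_mult)
  also have "L powr e \<le> L powr 1" using assms by (intro powr_mono) auto
  finally show ?thesis using assms by simp
qed

lemma abs_mult_le_powr_add: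
  fixes a b r :: real
  assumes "1 < r" shows "\<bar>a * b\<bar> \<le> \<bar>a\<bar> powr (r / (r - 1)) + \<bar>b\<bar> powr r"
proof -
  have r': "1 < r / (r - 1)" "1 / (r / (r - 1)) + 1 / r = 1" using assms by (auto simp: field_simps)
  have "\<bar>a\<bar> * \<bar>b\<bar> \<le> \<bar>a\<bar> powr (r / (r - 1)) / (r / (r - 1)) + \<bar>b\<bar> powr r / r"
    using r' assms by (intro Youngs_inequality) auto
  also have "\<dots> \<le> \<bar>a\<bar> powr (r / (r - 1)) / 1 + \<bar>b\<bar> powr r / 1"
    using r' assms by (intro add_mono divide_left_mono) auto
  finally show ?thesis by (simp add: abs_mult)
qed

text \<open>Constants of a potential with density \<open>pot_base q B - pot_slope B * b + G\<close>.
  The slope is twice \<open>B + 1\<close>: an average of \<open>b\<close> that falls from 1 to 1/2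
  raises the potential by \<open>B + 1\<close> per volume, which exceeds by one the bound
  \<open>B\<close> for a fresh \<open>G\<close>. \<open>pot_base\<close> keeps the density above
  \<open>G / 2\<close>.\<close>

definition pot_slope :: "real \<Rightarrow> real" where "pot_slope B = 2 * (B + 1)"
definition pot_base :: "real \<Rightarrow> real \<Rightarrow> real" where
  "pot_base q B = pot_slope B * (2 * pot_slope B) powr (1 / (q - 1))"
definition pot_bound :: "real \<Rightarrow> real \<Rightarrow> real" where "pot_bound q B = 2 * (pot_base q B + B + 1)"

lemma pot_constants:
  assumes "1 < q" "1 \<le> B"
  shows "0 \<le> pot_base q B" "1 \<le> pot_bound q B" "B \<le> pot_bound q B"
proof -
  show 1: "0 \<le> pot_base q B" using assms by (simp add: pot_base_def pot_slope_def)
  show "1 \<le> pot_bound q B" "B \<le> pot_bound q B" using 1 assms by (simp_all add: pot_bound_def)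
qed

text \<open>The power \<open>w powr q\<close> beats \<open>w\<close> beyond the threshold
  \<open>t\<close>, chosen with \<open>t powr (1 - q) = 1 / (2 * s)\<close>. Hence
  \<open>s * b\<close> is covered by the constant \<open>s * t\<close> and half of
  \<open>G\<close>.\<close>

lemma pot_lower:
  fixes b w G q B :: real
  assumes "1 < q" "1 \<le> B" "\<bar>b\<bar> \<le> w" "w powr q \<le> G"
  shows "G / 2 \<le> pot_base q B - pot_slope B * b + G"
proof -
  define s where "s = pot_slope B"
  define t where "t = (2 * s) powr (1 / (q - 1))"
  have s: "4 \<le> s" using assms by (simp add: s_def pot_slope_def)
  have t: "0 < t" using s by (simp add: t_def)
  have t1: "t powr (1 - q) = 1 / (2 * s)"
  proof -
    have "t powr (1 - q) = (2 * s) powr ((1 / (q - 1)) * (1 - q))" by (simp add: t_def powr_powr)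
    also have "(1 / (q - 1)) * (1 - q) = -1" using assms by (simp add: field_simps)
    finally show ?thesis using s by (simp add: powr_minus_divide)
  qed
  have w0: "0 \<le> w" using assms(3) by linarith
  have "w \<le> t + t powr (1 - q) * w powr q"
  proof (cases "w \<le> t")
    case True then show ?thesis by (simp add: add_increasing2)
  next
    case False
    have "w = w powr (1 - q) * w powr q" using False t by (simp add: powr_add[symmetric])
    also have "\<dots> \<le> t powr (1 - q) * w powr q"
      using False t assms by (intro mult_right_mono powr_mono2') auto
    finally show ?thesis using t by simp
  qed
  also have "\<dots> \<le> t + 1 / (2 * s) * G" unfolding t1 using assms s by (intro add_left_mono mult_left_mono) auto
  finally have "s * b \<le> s * (t + 1 / (2 * s) * G)" using assms s by (intro mult_left_mono) auto
  also have "\<dots> = s * t + G / 2" using s by (simp add: field_simps)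
  finally show ?thesis by (simp add: pot_base_def s_def t_def)
qed

section \<open>Duality on a finite set\<close>

context weighted_tree
begin

text \<open>Riesz representation: the density is read off from the indicators of points, and its
  dual norm is found by testing \<open>L\<close> on the extremizer, the signed power of the density
  with exponent \<open>r' - 1\<close>.\<close>

lemma exists_dual_density:
  assumes Q: "Q \<in> D" and r: "1 < r" and N: "0 \<le> N"
    and cong: "\<And>\<phi> \<phi>'. (\<And>x. x \<in> Q \<Longrightarrow> \<phi> x = \<phi>' x) \<Longrightarrow> L \<phi> = L \<phi>'"
    and lin: "\<And>\<alpha> \<beta> \<phi> \<phi>'. L (\<lambda>x. \<alpha> * \<phi> x + \<beta> * \<phi>' x) = \<alpha> * L \<phi> + \<beta> * L \<phi>'"
    and bound: "\<And>\<phi>. \<bar>L \<phi>\<bar> \<le> N * (I Q (\<lambda>x. \<bar>\<phi> x\<bar> powr r)) powr (1 / r)"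
  shows "\<exists>a. (\<forall>\<phi>. L \<phi> = I Q (\<lambda>x. a x * \<phi> x)) \<and> I Q (\<lambda>x. \<bar>a x\<bar> powr (r / (r - 1))) \<le> N powr (r / (r - 1))"
proof -
  define a where "a x = L (indicat_real {x}) / m x" for x
  have rep: "L \<phi> = I Q (\<lambda>x. a x * \<phi> x)" for \<phi>
  proof -
    have fin: "finite Q" using Q cube_finite by blast
    have sum: "L (\<lambda>y. \<Sum>x\<in>S. \<phi> x * indicat_real {x} y) = (\<Sum>x\<in>S. \<phi> x * L (indicat_real {x}))" if "finite S" for S
      using that
    proof (induction S rule: finite_induct)
      case empty then show ?case using lin[of 0 "\<lambda>_. 0" 0 "\<lambda>_. 0"] by simp
    next
      case (insert x S)
      show ?case
        using lin[of "\<phi> x" "indicat_real {x}" 1 "\<lambda>y. \<Sum>x\<in>S. \<phi> x * indicat_real {x} y"]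
        by (simp only: sum.insert[OF insert.hyps] insert.IH mult_1)
    qed
    have "L \<phi> = L (\<lambda>y. \<Sum>x\<in>Q. \<phi> x * indicat_real {x} y)"
      by (rule cong) (simp add: fin indicator_def)
    also have "\<dots> = (\<Sum>x\<in>Q. \<phi> x * L (indicat_real {x}))" by (rule sum[OF fin])
    also have "\<dots> = I Q (\<lambda>x. a x * \<phi> x)"
      unfolding wint_def
    proof (rule sum.cong[OF refl])
      fix x assume "x \<in> Q"
      then have "m x \<noteq> 0" using weight_pos[OF Q] by force
      then show "\<phi> x * L (indicat_real {x}) = m x * (a x * \<phi> x)" by (simp add: a_def)
    qed
    finally show ?thesis .
  qed
  define r' where "r' = r / (r - 1)"
  have r': "1 < r'" "(r' - 1) * r = r'" "1 - 1 / r = 1 / r'" using r by (auto simp: r'_def field_simps)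
  define S where "S = I Q (\<lambda>x. \<bar>a x\<bar> powr r')"
  define \<phi> where "\<phi> x = sgn (a x) * \<bar>a x\<bar> powr (r' - 1)" for x
  have "a x * \<phi> x = \<bar>a x\<bar> powr r'" for x
  proof (cases "a x = 0")
    case False
    have "a x * \<phi> x = \<bar>a x\<bar> powr 1 * \<bar>a x\<bar> powr (r' - 1)"
      by (simp add: \<phi>_def mult.assoc[symmetric] abs_sgn[symmetric])
    also have "\<dots> = \<bar>a x\<bar> powr r'" by (simp only: powr_add[symmetric]) simp
    finally show ?thesis .
  qed (use r' in simp)
  moreover have "\<bar>\<phi> x\<bar> powr r = \<bar>a x\<bar> powr r'" for x
  proof (cases "a x = 0")
    case False
    then have "\<bar>\<phi> x\<bar> = \<bar>a x\<bar> powr (r' - 1)" by (simp add: \<phi>_def abs_mult abs_sgn_eq)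
    then show ?thesis using r' by (simp add: powr_powr)
  qed (use r' in \<open>simp add: \<phi>_def\<close>)
  ultimately have "\<bar>S\<bar> \<le> N * S powr (1 / r)" using bound[of \<phi>] by (simp add: rep S_def)
  have S0: "0 \<le> S" unfolding S_def using Q by (intro I_nonneg) auto
  have "S \<le> N powr r'"
  proof (cases "S = 0")
    case False
    have "S powr (1 / r') * S powr (1 / r) = S powr (1 / r' + 1 / r)" by (simp add: powr_add)
    also have "\<dots> = S" using r'(3) S0 by (simp add: field_simps)
    also have "\<dots> \<le> N * S powr (1 / r)" using \<open>\<bar>S\<bar> \<le> N * S powr (1 / r)\<close> by simp
    finally have "S powr (1 / r') \<le> N" using False S0 by simp
    then have "(S powr (1 / r')) powr r' \<le> N powr r'" using r' by (intro powr_mono2) auto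
    then show ?thesis using S0 r' by (simp add: powr_powr)
  qed simp
  then show ?thesis using rep by (auto simp: S_def r'_def)
qed

end

text \<open>\<open>\<Phi> P\<close> stands for the product of the norms on \<open>P\<close> of the functions at the frozen positions.\<close>

locale bilinear_testing = perfect_bilinear m D ch \<kappa> V
  for m :: "'x \<Rightarrow> real" and D ch \<kappa> V +
  fixes q r B E :: real and \<Phi> :: "'x set \<Rightarrow> real" and R0 :: "'x set"
    and bu bv wu wv :: "'x set \<Rightarrow> 'x \<Rightarrow> real"
  assumes q: "1 < q" and r: "1 < r" and qr: "1 / q + 1 / r \<le> 1" and B: "1 \<le> B" and E: "0 \<le> E"
    and \<Phi>: "\<And>P. P \<in> D \<Longrightarrow> 0 \<le> \<Phi> P"
    and bu_le: "\<And>P x. P \<in> D \<Longrightarrow> P \<subseteq> R0 \<Longrightarrow> x \<in> P \<Longrightarrow> \<bar>bu P x\<bar> \<le> wu P x"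
    and bv_le: "\<And>P x. P \<in> D \<Longrightarrow> P \<subseteq> R0 \<Longrightarrow> x \<in> P \<Longrightarrow> \<bar>bv P x\<bar> \<le> wv P x"
    and bu_mean: "\<And>P. P \<in> D \<Longrightarrow> P \<subseteq> R0 \<Longrightarrow> wint m P (bu P) = sum m P"
    and bv_mean: "\<And>P. P \<in> D \<Longrightarrow> P \<subseteq> R0 \<Longrightarrow> wint m P (bv P) = sum m P"
    and wu_int: "\<And>P. P \<in> D \<Longrightarrow> P \<subseteq> R0 \<Longrightarrow> wint m P (\<lambda>x. wu P x powr q) \<le> B * sum m P"
    and wv_int: "\<And>P. P \<in> D \<Longrightarrow> P \<subseteq> R0 \<Longrightarrow> wint m P (\<lambda>x. wv P x powr r) \<le> B * sum m P"
    and test_u: "\<And>P \<phi>. P \<in> D \<Longrightarrow> P \<subseteq> R0 \<Longrightarrow> \<bar>V P (bu P) \<phi>\<bar> \<le>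
        B * (wint m P (\<lambda>x. wu P x powr q)) powr (1 / q) * (wint m P (\<lambda>x. \<bar>\<phi> x\<bar> powr r)) powr (1 / r) * \<Phi> P"
    and test_v: "\<And>P \<phi>. P \<in> D \<Longrightarrow> P \<subseteq> R0 \<Longrightarrow> \<bar>V P \<phi> (bv P)\<bar> \<le>
        B * (wint m P (\<lambda>x. wv P x powr r)) powr (1 / r) * (wint m P (\<lambda>x. \<bar>\<phi> x\<bar> powr q)) powr (1 / q) * \<Phi> P"
    and decay: "\<And>Q c c'. Q \<in> D \<Longrightarrow> Q \<subseteq> R0 \<Longrightarrow> card Q \<noteq> 1 \<Longrightarrow> c \<in> ch Q \<Longrightarrow> c' \<in> ch Q \<Longrightarrow>
        \<bar>child_defect Q (indicat_real c) (indicat_real c')\<bar> \<le> E * (sum m Q) powr (1 / q + 1 / r) * \<Phi> Q"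
begin

lemma swap_testing: "bilinear_testing m D ch \<kappa> (\<lambda>Q f h. V Q h f) r q B E \<Phi> R0 bv bu wv wu"
proof -
  interpret sw: perfect_bilinear m D ch \<kappa> "\<lambda>Q f h. V Q h f" by (rule swap)
  have dd: "sw.child_defect Q f h = child_defect Q h f" for Q f h by (simp add: sw.child_defect_def child_defect_def)
  show ?thesis
  proof (intro bilinear_testing.intro swap bilinear_testing_axioms.intro)
    show "1 / r + 1 / q \<le> 1" using qr by simp
    show "\<bar>sw.child_defect Q (indicat_real c) (indicat_real c')\<bar> \<le> E * vol Q powr (1 / r + 1 / q) * \<Phi> Q"
      if "Q \<in> D" "Q \<subseteq> R0" "card Q \<noteq> 1" "c \<in> ch Q" "c' \<in> ch Q" for Q c c'
      unfolding dd using decay[OF that(1,2,3,5,4)] by (simp add: add.commute)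
    show "\<bar>V P \<phi> (bv P)\<bar> \<le> B * I P (\<lambda>x. wv P x powr r) powr (1 / r) * I P (\<lambda>x. \<bar>\<phi> x\<bar> powr q) powr (1 / q) * \<Phi> P"
      if "P \<in> D" "P \<subseteq> R0" for P \<phi> by (rule test_v[OF that])
    show "\<bar>V P (bu P) \<phi>\<bar> \<le> B * I P (\<lambda>x. wu P x powr q) powr (1 / q) * I P (\<lambda>x. \<bar>\<phi> x\<bar> powr r) powr (1 / r) * \<Phi> P"
      if "P \<in> D" "P \<subseteq> R0" for P \<phi> by (rule test_u[OF that])
    show "1 < q" "1 < r" "1 \<le> B" "0 \<le> E" by (rule q r B E)+
    show "0 \<le> \<Phi> P" if "P \<in> D" for P using that by (rule \<Phi>)
    fix P assume P: "P \<in> D" "P \<subseteq> R0"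
    show "I P (bu P) = vol P" "I P (bv P) = vol P" by (rule bu_mean bv_mean, rule P, rule P)+
    show "I P (\<lambda>x. wu P x powr q) \<le> B * vol P" by (rule wu_int[OF P])
    show "I P (\<lambda>x. wv P x powr r) \<le> B * vol P" by (rule wv_int[OF P])
    show "\<bar>bu P x\<bar> \<le> wu P x" "\<bar>bv P x\<bar> \<le> wv P x" if "x \<in> P" for x
      by (rule bu_le[OF P that], rule bv_le[OF P that])
  qed
qed

lemma exists_density_u:
  "\<exists>au. \<forall>P\<in>D. P \<subseteq> R0 \<longrightarrow> (\<forall>\<phi>. V P (bu P) \<phi> = I P (\<lambda>x. au P x * \<phi> x)) \<and>
     I P (\<lambda>x. \<bar>au P x\<bar> powr (r / (r - 1))) \<le> (B * (I P (\<lambda>x. wu P x powr q)) powr (1 / q) * \<Phi> P) powr (r / (r - 1))"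
proof -
  have "\<exists>a. P \<in> D \<longrightarrow> P \<subseteq> R0 \<longrightarrow> (\<forall>\<phi>. V P (bu P) \<phi> = I P (\<lambda>x. a x * \<phi> x)) \<and>
     I P (\<lambda>x. \<bar>a x\<bar> powr (r / (r - 1))) \<le> (B * (I P (\<lambda>x. wu P x powr q)) powr (1 / q) * \<Phi> P) powr (r / (r - 1))" for P
  proof (cases "P \<in> D \<and> P \<subseteq> R0")
    case True
    have "\<exists>a. (\<forall>\<phi>. V P (bu P) \<phi> = I P (\<lambda>x. a x * \<phi> x)) \<and>
       I P (\<lambda>x. \<bar>a x\<bar> powr (r / (r - 1))) \<le> (B * (I P (\<lambda>x. wu P x powr q)) powr (1 / q) * \<Phi> P) powr (r / (r - 1))"
    proof (rule exists_dual_density[OF _ r])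
      fix \<phi>
      show "\<bar>V P (bu P) \<phi>\<bar> \<le> B * (I P (\<lambda>x. wu P x powr q)) powr (1 / q) * \<Phi> P * (I P (\<lambda>x. \<bar>\<phi> x\<bar> powr r)) powr (1 / r)"
        using test_u[of P \<phi>] True by (simp add: mult_ac)
    qed (use True B \<Phi> in \<open>auto intro: V_cong V_lin2\<close>)
    then show ?thesis by blast
  qed auto
  then have "\<forall>P. \<exists>a. P \<in> D \<longrightarrow> P \<subseteq> R0 \<longrightarrow> (\<forall>\<phi>. V P (bu P) \<phi> = I P (\<lambda>x. a x * \<phi> x)) \<and>
     I P (\<lambda>x. \<bar>a x\<bar> powr (r / (r - 1))) \<le> (B * (I P (\<lambda>x. wu P x powr q)) powr (1 / q) * \<Phi> P) powr (r / (r - 1))"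
    by (rule allI)
  from choice[OF this] show ?thesis by blast
qed

text \<open>Smoothness lifts a function of mean zero from \<open>Q\<close> to \<open>P\<close>
  without changing the value of the form. So the density found on \<open>P\<close> serves on all
  smaller cubes, and a testing function can be kept while the cubes shrink.\<close>

lemma rep_u:
  assumes "P \<in> D" "Q \<in> D" "Q \<subseteq> P" "\<And>\<phi>. V P f \<phi> = I P (\<lambda>x. a x * \<phi> x)" "I Q \<phi> = 0"
  shows "V Q f \<phi> = I Q (\<lambda>x. a x * \<phi> x)"
proof -
  have "V Q f \<phi> = V P f (restr Q \<phi>)" by (rule V_smooth2[OF assms(1,2,3,5), symmetric])
  also have "\<dots> = I P (restr Q (\<lambda>x. a x * \<phi> x))"
    unfolding assms(4) by (rule wint_cong) (simp add: restr_def)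
  finally show ?thesis using assms by (simp add: wint_restr cube_finite)
qed

lemma exponent_le: "0 \<le> 1 - 1 / q - 1 / r" "1 - 1 / q - 1 / r \<le> 1" "inverse q \<le> 1" "1 / q \<le> 1" "1 / r \<le> 1" "0 \<le> 1 / q" "0 \<le> 1 / r"
  using q r qr by (auto simp: field_simps)

lemma vol_powr_split: "0 < v \<Longrightarrow> v powr (1 / q) * v powr (1 / r) * v powr (1 - 1 / q - 1 / r) = v"
  by (simp add: powr_add[symmetric])

lemma density_bound:
  assumes P: "P \<in> D" "P \<subseteq> R0" and \<Phi>P: "\<Phi> P \<le> (I P \<omega>) powr (1 - 1 / q - 1 / r)"
    and \<omega>: "I P \<omega> \<le> M * vol P" "0 \<le> I P \<omega>" "1 \<le> M"
  shows "(B * (I P (\<lambda>x. wu P x powr q)) powr (1 / q) * \<Phi> P) powr (r / (r - 1)) \<le> (B\<^sup>2 * M) powr (r / (r - 1)) * vol P"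
proof -
  define v where "v = vol P"
  have v: "0 < v" using P vol_pos by (simp add: v_def)
  have 1: "(I P (\<lambda>x. wu P x powr q)) powr (1 / q) \<le> B * v powr (1 / q)"
    by (intro powr_le_mult_powr wu_int[OF P, folded v_def] v B exponent_le I_nonneg P(1) powr_ge_zero)
  have 2: "\<Phi> P \<le> M * v powr (1 - 1 / q - 1 / r)"
    by (rule order_trans[OF \<Phi>P], intro powr_le_mult_powr \<omega>[folded v_def] v exponent_le)
  have "B * (I P (\<lambda>x. wu P x powr q)) powr (1 / q) * \<Phi> P \<le> B * (B * v powr (1 / q)) * (M * v powr (1 - 1 / q - 1 / r))"
    using 1 2 B \<Phi>[OF P(1)] by (intro mult_mono) auto
  also have "\<dots> = (B\<^sup>2 * M) * (v powr (1 / q) * v powr (1 - 1 / q - 1 / r))" by (simp add: power2_eq_square)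
  also have "v powr (1 / q) * v powr (1 - 1 / q - 1 / r) = v powr (1 - 1 / r)" by (simp add: powr_add[symmetric])
  finally have "(B * (I P (\<lambda>x. wu P x powr q)) powr (1 / q) * \<Phi> P) powr (r / (r - 1)) \<le> ((B\<^sup>2 * M) * v powr (1 - 1 / r)) powr (r / (r - 1))"
    using B \<Phi>[OF P(1)] r by (intro powr_mono2) auto
  also have "\<dots> = (B\<^sup>2 * M) powr (r / (r - 1)) * v powr ((1 - 1 / r) * (r / (r - 1)))"
    using B \<omega> v by (simp add: powr_mult powr_powr)
  also have "(1 - 1 / r) * (r / (r - 1)) = 1" using r by (simp add: field_simps)
  finally show ?thesis using v by (simp add: v_def)
qed

text \<open>The testing function of \<open>P1\<close> seen on a subcube. Against the fresh function
  \<open>bv c\<close> the testing condition on \<open>c\<close> itself applies, with the old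
  function in the free place. Any other \<open>b\<close> differs from a multiple of
  \<open>bv c\<close> by a function of mean zero, on which the form acts through the
  density.\<close>

lemma restricted_testing_bounds:
  assumes c: "c \<in> D" "P1 \<in> D" "c \<subseteq> P1" "P1 \<subseteq> R0"
    and au: "\<And>\<phi>. V P1 (bu P1) \<phi> = I P1 (\<lambda>x. au x * \<phi> x)"
    and Z: "1 \<le> Z" and Gu: "I c (\<lambda>x. wu P1 x powr q + \<bar>au x\<bar> powr (r / (r - 1))) \<le> Z * vol c"
    and \<omega>: "I c \<omega> \<le> Z * vol c" "0 \<le> I c \<omega>" and \<Phi>c: "\<Phi> c \<le> (I c \<omega>) powr (1 - 1 / q - 1 / r)"
  shows "\<bar>V c (bu P1) (bv c)\<bar> \<le> B\<^sup>2 * Z\<^sup>2 * vol c"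
    and "\<bar>I c (\<lambda>x. au x * bv c x)\<bar> \<le> (Z + B) * vol c"
    and "\<lbrakk>\<And>x. x \<in> c \<Longrightarrow> \<bar>b x\<bar> \<le> w x; I c (\<lambda>x. w x powr r) \<le> Z * vol c\<rbrakk> \<Longrightarrow>
          \<bar>V c (bu P1) b\<bar> \<le> 8 * B\<^sup>2 * Z^3 * vol c"
proof -
  define v where "v = vol c"
  have v: "0 < v" using c vol_pos by (simp add: v_def)
  have cR: "c \<subseteq> R0" using c by simp
  have part: "I c (\<lambda>x. wu P1 x powr q) \<le> Z * v" "I c (\<lambda>x. \<bar>au x\<bar> powr (r / (r - 1))) \<le> Z * v"
    by (rule order_trans[OF I_mono[OF c(1)] Gu[folded v_def]], simp)+
  have bux: "\<bar>bu P1 x\<bar> \<le> wu P1 x" if "x \<in> c" for x using bu_le[of P1 x] c that by auto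
  have pow: "I c (\<lambda>x. \<bar>bu P1 x\<bar> powr q) \<le> Z * v"
    using q bux by (intro order_trans[OF _ part(1)] I_mono c(1) powr_mono2) auto
  show 1: "\<bar>V c (bu P1) (bv c)\<bar> \<le> B\<^sup>2 * Z\<^sup>2 * vol c"
  proof -
    have "\<bar>V c (bu P1) (bv c)\<bar> \<le> B * (I c (\<lambda>x. wv c x powr r)) powr (1 / r) * (I c (\<lambda>x. \<bar>bu P1 x\<bar> powr q)) powr (1 / q) * \<Phi> c"
      by (rule test_v[OF c(1) cR])
    also have "\<dots> \<le> B * (B * v powr (1 / r)) * (Z * v powr (1 / q)) * (Z * v powr (1 - 1 / q - 1 / r))"
    proof (intro mult_mono)
      show "(I c (\<lambda>x. wv c x powr r)) powr (1 / r) \<le> B * v powr (1 / r)"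
        by (intro powr_le_mult_powr wv_int[OF c(1) cR, folded v_def] v B exponent_le I_nonneg c(1) powr_ge_zero)
      show "(I c (\<lambda>x. \<bar>bu P1 x\<bar> powr q)) powr (1 / q) \<le> Z * v powr (1 / q)"
        by (intro powr_le_mult_powr pow v Z exponent_le I_nonneg c(1) powr_ge_zero)
      show "\<Phi> c \<le> Z * v powr (1 - 1 / q - 1 / r)"
        by (rule order_trans[OF \<Phi>c], intro powr_le_mult_powr \<omega>[folded v_def] v exponent_le Z)
    qed (use B Z \<Phi>[OF c(1)] in auto)
    also have "\<dots> = B\<^sup>2 * Z\<^sup>2 * (v powr (1 / q) * v powr (1 / r) * v powr (1 - 1 / q - 1 / r))"
      by (simp add: power2_eq_square)
    finally show ?thesis using vol_powr_split[OF v] by (simp add: v_def)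
  qed
  have aub: "\<bar>I c (\<lambda>x. au x * b x)\<bar> \<le> (Z + Y) * v"
    if "\<And>x. x \<in> c \<Longrightarrow> \<bar>b x\<bar> \<le> w x" "I c (\<lambda>x. w x powr r) \<le> Y * vol c" for b w Y
  proof -
    have "\<bar>I c (\<lambda>x. au x * b x)\<bar> \<le> I c (\<lambda>x. \<bar>au x\<bar> powr (r / (r - 1)) + w x powr r)"
    proof (rule I_abs_le[OF c(1)])
      fix x assume "x \<in> c"
      then have "\<bar>b x\<bar> powr r \<le> w x powr r" using that r by (intro powr_mono2) auto
      then show "\<bar>au x * b x\<bar> \<le> \<bar>au x\<bar> powr (r / (r - 1)) + w x powr r"
        using abs_mult_le_powr_add[OF r, of "au x" "b x"] by linarith
    qed
    also have "\<dots> \<le> Z * v + Y * v" unfolding wint_add using part that by (intro add_mono) (auto simp: v_def)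
    finally show ?thesis by (simp add: distrib_right)
  qed
  show 2: "\<bar>I c (\<lambda>x. au x * bv c x)\<bar> \<le> (Z + B) * vol c"
    using aub[of "bv c" "wv c" B] bv_le[OF c(1) cR] wv_int[OF c(1) cR] by (simp add: v_def)
  assume b: "\<And>x. x \<in> c \<Longrightarrow> \<bar>b x\<bar> \<le> w x" and w: "I c (\<lambda>x. w x powr r) \<le> Z * vol c"
  have 3: "\<bar>I c (\<lambda>x. au x * b x)\<bar> \<le> (Z + Z) * v" by (rule aub[OF b w])
  define y where "y = av c b"
  have y: "\<bar>y\<bar> \<le> 2 * Z"
  proof -
    have "\<bar>I c b\<bar> \<le> I c (\<lambda>x. 1 + w x powr r)"
      using b r le_one_plus_powr[of r] by (intro I_abs_le[OF c(1)]) (meson less_imp_le order_trans)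
    also have "\<dots> \<le> v + Z * v" using w by (simp add: wint_add wint_const v_def)
    also have "\<dots> \<le> (2 * Z) * v" using Z v by (simp add: algebra_simps)
    finally show ?thesis using v by (simp add: y_def v_def field_simps)
  qed
  have "I c (\<lambda>x. b x - y * bv c x) = 0"
    using bv_mean[OF c(1) cR] v by (simp add: wint_diff wint_cmult wint_divide y_def v_def)
  then have "V c (bu P1) (\<lambda>x. b x - y * bv c x) = I c (\<lambda>x. au x * (b x - y * bv c x))"
    using rep_u[OF c(2,1,3) au] by blast
  then have eq: "V c (bu P1) b = y * V c (bu P1) (bv c) + (I c (\<lambda>x. au x * b x) - y * I c (\<lambda>x. au x * bv c x))"
    by (simp add: V_diff2 V_cmult2 right_diff_distrib wint_diff wint_cmult mult.left_commute[of _ y])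
  have 4: "\<bar>y * V c (bu P1) (bv c)\<bar> \<le> (2 * Z) * (B\<^sup>2 * Z\<^sup>2 * v)"
    unfolding abs_mult using y 1 Z by (intro mult_mono) (auto simp: v_def)
  have 5: "\<bar>y * I c (\<lambda>x. au x * bv c x)\<bar> \<le> (2 * Z) * ((Z + B) * v)"
    unfolding abs_mult using y 2 Z by (intro mult_mono) (auto simp: v_def)
  have "\<bar>V c (bu P1) b\<bar> \<le> (2 * Z) * (B\<^sup>2 * Z\<^sup>2 * v) + ((Z + Z) * v + (2 * Z) * ((Z + B) * v))"
    unfolding eq using 3 4 5 by linarith
  also have "\<dots> = 2 * (B\<^sup>2 * Z^3) * v + (2 * Z + 2 * Z\<^sup>2 + 2 * (B * Z)) * v"
    by (simp add: algebra_simps power2_eq_square power3_eq_cube)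
  also have "\<dots> \<le> 2 * (B\<^sup>2 * Z^3) * v + (2 * (B\<^sup>2 * Z^3) + 2 * (B\<^sup>2 * Z^3) + 2 * (B\<^sup>2 * Z^3)) * v"
  proof -
    have B2: "1 \<le> B\<^sup>2" "B \<le> B\<^sup>2" using B by (simp_all add: self_le_power)
    have Z3: "Z \<le> Z^3" "Z\<^sup>2 \<le> Z^3" using Z power_increasing[of 1 3 Z] power_increasing[of 2 3 Z] by auto
    have "1 * Z \<le> B\<^sup>2 * Z^3" "1 * Z\<^sup>2 \<le> B\<^sup>2 * Z^3" "B * Z \<le> B\<^sup>2 * Z^3"
      using B2 Z3 Z B by (intro mult_mono; simp)+
    then show ?thesis using v by (intro add_left_mono mult_right_mono) auto
  qed
  finally show "\<bar>V c (bu P1) b\<bar> \<le> 8 * B\<^sup>2 * Z^3 * vol c" by (simp add: v_def mult_ac)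
qed

end

text \<open>The exponents \<open>q\<close>, \<open>r\<close> and the number \<open>M\<close> determine all constants of the stopping-time argument:
  \<open>stop_G\<close> bounds the averages of the stopping functions, \<open>stop_Z\<close> their averages on the children.\<close>

definition stop_B :: "real \<Rightarrow> real \<Rightarrow> real \<Rightarrow> real \<Rightarrow> real" where
  "stop_B q r B M = B + (B\<^sup>2 * M) powr (r / (r - 1)) + (B\<^sup>2 * M) powr (q / (q - 1))"

definition stop_G :: "real \<Rightarrow> real \<Rightarrow> real \<Rightarrow> real \<Rightarrow> real" where
  "stop_G q r B M = max M (max (pot_bound q (stop_B q r B M)) (pot_bound r (stop_B q r B M)))"

definition stop_Z :: "real \<Rightarrow> real \<Rightarrow> real \<Rightarrow> real \<Rightarrow> real \<Rightarrow> real" where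
  "stop_Z q r B M \<kappa> = \<kappa> * stop_G q r B M"

definition stop_K :: "real \<Rightarrow> real \<Rightarrow> real \<Rightarrow> real \<Rightarrow> real \<Rightarrow> real" where
  "stop_K q r B M \<kappa> = 8 * B\<^sup>2 * stop_Z q r B M \<kappa> ^ 3"

definition energy_const :: "real \<Rightarrow> real \<Rightarrow> real \<Rightarrow> real \<Rightarrow> real \<Rightarrow> real \<Rightarrow> real" where
  "energy_const q r B M \<kappa> E = (108 * stop_K q r B M \<kappa> ^ 3 + 9 * (stop_K q r B M \<kappa>)\<^sup>2 * (E * M) * \<kappa>\<^sup>2) * 6"

text \<open>Here \<open>56 = 52 + 4\<close>: the crude error on a child that is not good, and the
  size of the main term after renewal of a testing function. The last summand pays for the energy
  given up on such a child.\<close>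

definition size_const :: "real \<Rightarrow> real \<Rightarrow> real \<Rightarrow> real \<Rightarrow> real \<Rightarrow> real \<Rightarrow> real" where
  "size_const q r B M \<kappa> E = 56 * stop_K q r B M \<kappa> ^ 4 + 6 * (stop_K q r B M \<kappa>)\<^sup>2 * energy_const q r B M \<kappa> E"

text \<open>The value of the inductive bound at the top cube, without the contribution of \<omega>,
  plus the size of the main term there. The negative contribution of the slope has been
  dropped.\<close>

definition total_const :: "real \<Rightarrow> real \<Rightarrow> real \<Rightarrow> real \<Rightarrow> real \<Rightarrow> real \<Rightarrow> real" where
  "total_const q r B M \<kappa> E = 4 * stop_K q r B M \<kappa> ^ 3 + size_const q r B M \<kappa> E * (1
     + pot_base q (stop_B q r B M) + pot_base r (stop_B q r B M) + 2 * stop_B q r B M)"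

section \<open>The potential that pays for a new testing function\<close>

context weighted_tree
begin

definition pot :: "real \<Rightarrow> real \<Rightarrow> ('x \<Rightarrow> real) \<Rightarrow> ('x \<Rightarrow> real) \<Rightarrow> 'x set \<Rightarrow> real" where
  "pot q B b G Q = I Q (\<lambda>x. pot_base q B - pot_slope B * b x + G x)"

lemma pot_eq: "pot q B b G Q = pot_base q B * vol Q - pot_slope B * I Q b + I Q G"
  by (simp add: pot_def wint_add wint_diff wint_cmult wint_const)

lemma pot_ge:
  assumes "1 < q" "1 \<le> B" "Q \<in> D" "\<And>x. x \<in> Q \<Longrightarrow> \<bar>b x\<bar> \<le> w x" "\<And>x. x \<in> Q \<Longrightarrow> w x powr q \<le> G x"
  shows "I Q G / 2 \<le> pot q B b G Q" "0 \<le> pot q B b G Q"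
proof -
  have "I Q (\<lambda>x. G x / 2) \<le> pot q B b G Q"
    unfolding pot_def using assms(4,5) by (intro I_mono[OF assms(3)] pot_lower[OF assms(1,2)])
  then show 1: "I Q G / 2 \<le> pot q B b G Q" by (simp add: wint_divide)
  have "0 \<le> I Q G" using assms by (intro I_nonneg) (auto intro: order_trans[OF powr_ge_zero])
  then show "0 \<le> pot q B b G Q" using 1 by linarith
qed

lemma pot_top:
  assumes "I P b = vol P" "I P G \<le> B * vol P"
  shows "pot q B b G P \<le> (pot_base q B - pot_slope B + B) * vol P"
  using assms by (simp add: pot_eq algebra_simps)

text \<open>To be compared with \<open>pot_top\<close>: whichever of the two reasons stops the old
  function, replacing it by a fresh one lowers the potential by at least the volume of the
  cube.\<close>

lemma pot_stop:
  assumes "1 < q" "1 \<le> B" "Q \<in> D" "\<And>x. x \<in> Q \<Longrightarrow> \<bar>b x\<bar> \<le> w x" "\<And>x. x \<in> Q \<Longrightarrow> w x powr q \<le> G x"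
    and stop: "av Q b < 1/2 \<or> pot_bound q B * vol Q < I Q G"
  shows "(pot_base q B - pot_slope B + B + 1) * vol Q \<le> pot q B b G Q"
  using stop
proof
  assume low: "av Q b < 1/2"
  have v: "0 < vol Q" using assms vol_pos by simp
  have G0: "0 \<le> I Q G" using assms by (intro I_nonneg) (auto intro: order_trans[OF powr_ge_zero])
  have "I Q b \<le> vol Q / 2" using low v by (simp add: field_simps)
  then have "pot_slope B * I Q b \<le> pot_slope B * (vol Q / 2)" using assms by (intro mult_left_mono) (auto simp: pot_slope_def)
  then show ?thesis using G0 by (simp add: pot_eq pot_slope_def algebra_simps)
next
  assume "pot_bound q B * vol Q < I Q G"
  then have "(pot_base q B + B + 1) * vol Q < I Q G / 2" by (simp add: pot_bound_def algebra_simps)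
  moreover have "0 \<le> pot_slope B * vol Q" using assms vol_pos[of Q] by (simp add: pot_slope_def)
  ultimately show ?thesis using pot_ge(1)[of q B Q b w G] assms by (simp add: algebra_simps)
qed

lemma pot_ch:
  assumes "Q \<in> D" "card Q \<noteq> 1"
  shows "(\<Sum>c\<in>ch Q. pot q B b G c) = pot q B b G Q"
  unfolding pot_def by (rule I_ch[OF assms])

end

section \<open>The stopping-time estimate on one cube\<close>

context bilinear_testing
begin

lemma dyadic_stopping_estimate:
  assumes P: "P \<in> D" "P \<subseteq> R0" and M: "1 \<le> M"
    and \<omega>1: "\<And>x. x \<in> P \<Longrightarrow> 1 \<le> \<omega> x"
    and \<Phi>\<omega>: "\<And>Q. Q \<in> D \<Longrightarrow> Q \<subseteq> P \<Longrightarrow> \<Phi> Q \<le> (I Q \<omega>) powr (1 - 1 / q - 1 / r)"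
    and g: "\<And>x. x \<in> P \<Longrightarrow> \<bar>g x\<bar> powr q \<le> \<omega> x"
    and h: "\<And>x. x \<in> P \<Longrightarrow> \<bar>h x\<bar> \<le> 1"
    and \<omega>P: "I P \<omega> \<le> M * vol P"
    and rec: "\<And>R. R \<in> D \<Longrightarrow> R \<subset> P \<Longrightarrow> \<bar>V R g h\<bar> \<le> C * (I R (\<lambda>x. \<bar>g x\<bar> powr q)) powr (1 / q) * vol R powr (1 / r) * \<Phi> R"
    and C: "0 \<le> C"
  shows "\<bar>V P g h\<bar> \<le> total_const q r B M \<kappa> E * vol P + C * M powr (- 1 / r) * I P \<omega>"
proof -
  interpret sw: bilinear_testing m D ch \<kappa> "\<lambda>Q f h. V Q h f" r q B E \<Phi> R0 bv bu wv wu by (rule swap_testing)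
  obtain au where au: "\<And>P \<phi>. P \<in> D \<Longrightarrow> P \<subseteq> R0 \<Longrightarrow> V P (bu P) \<phi> = I P (\<lambda>x. au P x * \<phi> x)"
    and aub: "\<And>P. P \<in> D \<Longrightarrow> P \<subseteq> R0 \<Longrightarrow> I P (\<lambda>x. \<bar>au P x\<bar> powr (r / (r - 1))) \<le> (B * (I P (\<lambda>x. wu P x powr q)) powr (1 / q) * \<Phi> P) powr (r / (r - 1))"
    using exists_density_u by blast
  obtain aw where aw: "\<And>P \<phi>. P \<in> D \<Longrightarrow> P \<subseteq> R0 \<Longrightarrow> V P \<phi> (bv P) = I P (\<lambda>x. aw P x * \<phi> x)"
    and awb: "\<And>P. P \<in> D \<Longrightarrow> P \<subseteq> R0 \<Longrightarrow> I P (\<lambda>x. \<bar>aw P x\<bar> powr (q / (q - 1))) \<le> (B * (I P (\<lambda>x. wv P x powr r)) powr (1 / r) * \<Phi> P) powr (q / (q - 1))"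
    using sw.exists_density_u by blast
  define B1 where "B1 = stop_B q r B M"
  define L where "L = stop_G q r B M"
  define Z where "Z = stop_Z q r B M \<kappa>"
  define K where "K = stop_K q r B M \<kappa>"
  define C2 where "C2 = energy_const q r B M \<kappa> E"
  define C3 where "C3 = size_const q r B M \<kappa> E"
  have B1: "1 \<le> B1" "B + (B\<^sup>2 * M) powr (r / (r - 1)) \<le> B1" "B + (B\<^sup>2 * M) powr (q / (q - 1)) \<le> B1"
    using B by (auto simp: B1_def stop_B_def add_increasing2)
  have L: "M \<le> L" "pot_bound q B1 \<le> L" "pot_bound r B1 \<le> L" by (simp_all add: L_def stop_G_def B1_def)
  then have L1: "1 \<le> L" using M by simp
  have Z: "L \<le> Z" "Z = \<kappa> * L" using kappa_ge_1 L1 by (simp_all add: Z_def stop_Z_def L_def mult_le_cancel_right1)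
  then have Z1: "1 \<le> Z" "1 \<le> \<kappa>" using order_trans[OF L1 Z(1)] kappa_ge_1 by auto
  have Z3: "Z \<le> Z^3" "1 \<le> Z^3" using Z1 power_increasing[of 1 3 Z] by auto
  have B2: "1 \<le> B\<^sup>2" "B \<le> B\<^sup>2" using B by (simp_all add: self_le_power)
  have BZ: "Z \<le> B\<^sup>2 * Z^3" "B \<le> B\<^sup>2 * Z^3" "B\<^sup>2 * Z\<^sup>2 \<le> B\<^sup>2 * Z^3" "1 \<le> B\<^sup>2 * Z^3"
  proof -
    show "Z \<le> B\<^sup>2 * Z^3" using mult_mono[of 1 "B\<^sup>2" Z "Z^3"] B2 Z3 Z1 by simp
    show "B \<le> B\<^sup>2 * Z^3" using mult_mono[of B "B\<^sup>2" 1 "Z^3"] B2 Z3 B by simp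
    show "1 \<le> B\<^sup>2 * Z^3" using mult_mono[of 1 "B\<^sup>2" 1 "Z^3"] B2 Z3 by simp
    show "B\<^sup>2 * Z\<^sup>2 \<le> B\<^sup>2 * Z^3" using Z1 power_increasing[of 2 3 Z] B2 by (intro mult_left_mono) auto
  qed
  have Kdef: "K = 8 * (B\<^sup>2 * Z^3)" by (simp add: K_def stop_K_def Z_def)
  have K: "2 * Z \<le> K" "Z + B \<le> K" "B\<^sup>2 * Z\<^sup>2 \<le> K" "1 \<le> K" "8 * B\<^sup>2 * Z^3 = K" unfolding Kdef using BZ by auto
  define E' where "E' = E * M"
  have E': "0 \<le> E'" using E M by (simp add: E'_def)
  have C2: "C2 = (108 * K^3 + 9 * K\<^sup>2 * E' * \<kappa>\<^sup>2) * 6" "0 \<le> C2"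
  proof -
    show "C2 = (108 * K^3 + 9 * K\<^sup>2 * E' * \<kappa>\<^sup>2) * 6" by (simp add: C2_def energy_const_def K_def E'_def)
    then show "0 \<le> C2" using K(4) E' by (auto intro!: add_nonneg_nonneg mult_nonneg_nonneg)
  qed
  have C3: "C3 = 56 * K^4 + 6 * K\<^sup>2 * C2" "0 \<le> C3"
  proof -
    show "C3 = 56 * K^4 + 6 * K\<^sup>2 * C2" by (simp add: C3_def size_const_def K_def C2_def)
    then show "0 \<le> C3" using C2(2) by (auto intro!: add_nonneg_nonneg mult_nonneg_nonneg)
  qed
  have K4: "0 \<le> K^4" "K^3 \<le> K^4" using K power_increasing[of 3 4 K] by auto
  \<comment> \<open>A testing function is stopped by its own size or by that of its density; one
    function records both.\<close>
  define Gu where "Gu P x = wu P x powr q + \<bar>au P x\<bar> powr (r / (r - 1))" for P x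
  define Gv where "Gv P x = wv P x powr r + \<bar>aw P x\<bar> powr (q / (q - 1))" for P x
  have Gw: "wu P x powr q \<le> Gu P x" "0 \<le> Gu P x" "wv P x powr r \<le> Gv P x" "0 \<le> Gv P x" for P x
    by (simp_all add: Gu_def Gv_def)
  define Pu where "Pu P = pot q B1 (bu P) (Gu P)" for P
  define Pv where "Pv P = pot r B1 (bv P) (Gv P)" for P
  define ys where "ys P1 P2 = [g, h, bu P1, bv P2, \<lambda>x. au P1 x * bv P2 x, \<lambda>x. aw P2 x * bu P1 x]" for P1 P2
  define top where "top P1 \<longleftrightarrow> P1 \<in> D \<and> P1 \<subseteq> P \<and> I P1 \<omega> \<le> M * vol P1" for P1
  define ustop where "ustop P1 c \<longleftrightarrow> av c (bu P1) < 1/2 \<or> pot_bound q B1 * vol c < I c (Gu P1)" for P1 c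
  define vstop where "vstop P2 c \<longleftrightarrow> av c (bv P2) < 1/2 \<or> pot_bound r B1 * vol c < I c (Gv P2)" for P2 c
  \<comment> \<open>The state of the induction: \<open>Q\<close> is the current cube, and
    \<open>P1\<close> and \<open>P2\<close> are the cubes whose testing functions are in
    use.\<close>
  define st where "st Q P1 P2 \<longleftrightarrow> top Q \<and> top P1 \<and> top P2 \<and> Q \<subseteq> P1 \<and> Q \<subseteq> P2 \<and> \<not> ustop P1 Q \<and> \<not> vstop P2 Q" for Q P1 P2
  have \<omega>0: "0 \<le> I Q \<omega>" if "Q \<in> D" "Q \<subseteq> P" for Q
  proof (intro I_nonneg that)
    fix x assume "x \<in> Q"
    then show "0 \<le> \<omega> x" using \<omega>1[of x] that by auto
  qed
  have topD: "I P1 (Gu P1) \<le> B1 * vol P1" "I P1 (Gv P1) \<le> B1 * vol P1" if "top P1" for P1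
  proof -
    have P1: "P1 \<in> D" "P1 \<subseteq> P" "I P1 \<omega> \<le> M * vol P1" "P1 \<subseteq> R0" using that P by (auto simp: top_def)
    have v: "0 < vol P1" by (rule vol_pos[OF P1(1)])
    have \<Phi>v: "\<Phi> P1 \<le> (I P1 \<omega>) powr (1 - 1 / r - 1 / q)" using \<Phi>\<omega>[OF P1(1,2)] by (simp add: algebra_simps)
    have "I P1 (Gu P1) \<le> B * vol P1 + (B\<^sup>2 * M) powr (r / (r - 1)) * vol P1"
      unfolding Gu_def wint_add
      by (intro add_mono wu_int P1 order_trans[OF aub[OF P1(1,4)]] density_bound[OF P1(1,4) \<Phi>\<omega>[OF P1(1,2)]] \<omega>0 M)
    also have "\<dots> \<le> B1 * vol P1" using mult_right_mono[OF B1(2), of "vol P1"] v by (simp add: algebra_simps)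
    finally show "I P1 (Gu P1) \<le> B1 * vol P1" .
    have "I P1 (Gv P1) \<le> B * vol P1 + (B\<^sup>2 * M) powr (q / (q - 1)) * vol P1"
      unfolding Gv_def wint_add
      by (intro add_mono wv_int P1 order_trans[OF awb[OF P1(1,4)]] sw.density_bound[OF P1(1,4) \<Phi>v] \<omega>0 M)
    also have "\<dots> \<le> B1 * vol P1" using mult_right_mono[OF B1(3), of "vol P1"] v by (simp add: algebra_simps)
    finally show "I P1 (Gv P1) \<le> B1 * vol P1" .
  qed
  \<comment> \<open>A fresh function has average exactly 1, and its stopping function averages at
    most \<open>B1\<close>, which lies below the stopping level.\<close>
  have top_fresh: "\<not> ustop P1 P1" "\<not> vstop P1 P1" if "top P1" for P1
  proof -
    have P1: "P1 \<in> D" "P1 \<subseteq> R0" using that P by (auto simp: top_def)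
    have v: "0 < vol P1" by (rule vol_pos[OF P1(1)])
    have "B1 * vol P1 \<le> pot_bound q B1 * vol P1" "B1 * vol P1 \<le> pot_bound r B1 * vol P1"
      using pot_constants(3)[OF q B1(1)] pot_constants(3)[OF r B1(1)] v by (auto intro: mult_right_mono)
    then have "\<not> pot_bound q B1 * vol P1 < I P1 (Gu P1)" "\<not> pot_bound r B1 * vol P1 < I P1 (Gv P1)"
      using topD[OF that] by linarith+
    then show "\<not> ustop P1 P1" "\<not> vstop P1 P1"
      unfolding ustop_def vstop_def bu_mean[OF P1] bv_mean[OF P1] using v by simp_all
  qed
  have pots: "0 \<le> Pu P1 c" "ustop P1 c \<Longrightarrow> (pot_base q B1 - pot_slope B1 + B1 + 1) * vol c \<le> Pu P1 c"
     "0 \<le> Pv P1 c" "vstop P1 c \<Longrightarrow> (pot_base r B1 - pot_slope B1 + B1 + 1) * vol c \<le> Pv P1 c"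
    if "top P1" "c \<in> D" "c \<subseteq> P1" for P1 c
  proof -
    have P1: "P1 \<in> D" "P1 \<subseteq> R0" using that P by (auto simp: top_def)
    have bb: "\<bar>bu P1 x\<bar> \<le> wu P1 x" "\<bar>bv P1 x\<bar> \<le> wv P1 x" if "x \<in> c" for x
      using bu_le[OF P1] bv_le[OF P1] that \<open>c \<subseteq> P1\<close> by auto
    show "0 \<le> Pu P1 c" unfolding Pu_def by (rule pot_ge(2)[OF q B1(1) \<open>c \<in> D\<close> bb(1) Gw(1)])
    show "0 \<le> Pv P1 c" unfolding Pv_def by (rule pot_ge(2)[OF r B1(1) \<open>c \<in> D\<close> bb(2) Gw(3)])
    show "ustop P1 c \<Longrightarrow> (pot_base q B1 - pot_slope B1 + B1 + 1) * vol c \<le> Pu P1 c"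
      unfolding Pu_def ustop_def by (rule pot_stop[OF q B1(1) \<open>c \<in> D\<close> bb(1) Gw(1)])
    show "vstop P1 c \<Longrightarrow> (pot_base r B1 - pot_slope B1 + B1 + 1) * vol c \<le> Pv P1 c"
      unfolding Pv_def vstop_def by (rule pot_stop[OF r B1(1) \<open>c \<in> D\<close> bb(2) Gw(3)])
  qed
  have pot_top': "Pu P1 P1 \<le> (pot_base q B1 - pot_slope B1 + B1) * vol P1"
     "Pv P1 P1 \<le> (pot_base r B1 - pot_slope B1 + B1) * vol P1" if "top P1" for P1
  proof -
    have P1: "P1 \<in> D" "P1 \<subseteq> R0" using that P by (auto simp: top_def)
    show "Pu P1 P1 \<le> (pot_base q B1 - pot_slope B1 + B1) * vol P1"
      unfolding Pu_def by (rule pot_top[OF bu_mean[OF P1] topD(1)[OF that]])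
    show "Pv P1 P1 \<le> (pot_base r B1 - pot_slope B1 + B1) * vol P1"
      unfolding Pv_def by (rule pot_top[OF bv_mean[OF P1] topD(2)[OF that]])
  qed
  text \<open>All bounds on a cube \<open>c\<close> where the stopping functions have averages at most \<open>Z\<close>.\<close>
  have cube_bounds: "\<bar>av c y\<bar> \<le> K"
    if "c \<in> D" "c \<subseteq> P" "c \<subseteq> P1" "c \<subseteq> P2" "top P1" "top P2" "I c \<omega> \<le> Z * vol c"
      "I c (Gu P1) \<le> Z * vol c" "I c (Gv P2) \<le> Z * vol c" "y \<in> set (ys P1 P2)" for c P1 P2 y
  proof -
    have v: "0 < vol c" by (rule vol_pos) fact
    have P1: "P1 \<in> D" "P1 \<subseteq> R0" "P2 \<in> D" "P2 \<subseteq> R0" using that P by (auto simp: top_def)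
    have bb: "\<bar>bu P1 x\<bar> \<le> wu P1 x" "\<bar>bv P2 x\<bar> \<le> wv P2 x" if "x \<in> c" for x
      using bu_le[OF P1(1,2)] bv_le[OF P1(3,4)] that \<open>c \<subseteq> P1\<close> \<open>c \<subseteq> P2\<close> by auto
    have fin: "\<bar>av c y\<bar> \<le> K" if "\<And>x. x \<in> c \<Longrightarrow> \<bar>y x\<bar> \<le> s x + t x" "I c s \<le> Z * vol c" "I c t \<le> Z * vol c" for y s t
    proof -
      have "\<bar>I c y\<bar> \<le> I c s + I c t" using I_abs_le[OF \<open>c \<in> D\<close> that(1)] by (simp add: wint_add)
      also have "\<dots> \<le> (2 * Z) * vol c" using that by simp
      also have "\<dots> \<le> K * vol c" using K v by (intro mult_right_mono) auto
      finally show ?thesis using v by (simp add: field_simps)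
    qed
    have one: "I c (\<lambda>_. 1) \<le> Z * vol c" using Z1 v by (simp add: wint_const)
    have "\<bar>g x\<bar> \<le> \<omega> x + 1" "\<bar>h x\<bar> \<le> 1 + \<omega> x" "\<bar>bu P1 x\<bar> \<le> Gu P1 x + 1" "\<bar>bv P2 x\<bar> \<le> Gv P2 x + 1"
       "\<bar>au P1 x * bv P2 x\<bar> \<le> Gu P1 x + Gv P2 x" "\<bar>aw P2 x * bu P1 x\<bar> \<le> Gu P1 x + Gv P2 x" if "x \<in> c" for x
    proof -
      have x: "x \<in> P" using that \<open>c \<subseteq> P\<close> by auto
      show "\<bar>g x\<bar> \<le> \<omega> x + 1" using le_one_plus_powr[of q "\<bar>g x\<bar>"] g[OF x] q by linarith
      show "\<bar>h x\<bar> \<le> 1 + \<omega> x" using h[OF x] \<omega>1[OF x] by linarith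
      show "\<bar>bu P1 x\<bar> \<le> Gu P1 x + 1" using le_one_plus_powr[of q "wu P1 x"] bb[OF that] Gw(1)[of P1 x] q by linarith
      show "\<bar>bv P2 x\<bar> \<le> Gv P2 x + 1" using le_one_plus_powr[of r "wv P2 x"] bb[OF that] Gw(3)[of P2 x] r by linarith
      have p: "\<bar>bu P1 x\<bar> powr q \<le> wu P1 x powr q" "\<bar>bv P2 x\<bar> powr r \<le> wv P2 x powr r"
        using bb[OF that] q r by (auto intro: powr_mono2)
      show "\<bar>au P1 x * bv P2 x\<bar> \<le> Gu P1 x + Gv P2 x"
        using abs_mult_le_powr_add[OF r, of "au P1 x" "bv P2 x"] p(2) unfolding Gu_def Gv_def
        by (smt (verit) powr_ge_zero)
      show "\<bar>aw P2 x * bu P1 x\<bar> \<le> Gu P1 x + Gv P2 x"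
        using abs_mult_le_powr_add[OF q, of "aw P2 x" "bu P1 x"] p(1) unfolding Gu_def Gv_def
        by (smt (verit) powr_ge_zero)
    qed note B6 = this
    show ?thesis
      using \<open>y \<in> set (ys P1 P2)\<close> fin[OF B6(1) that(7) one] fin[OF B6(2) one that(7)] fin[OF B6(3) that(8) one]
        fin[OF B6(4) that(9) one] fin[OF B6(5) that(8,9)] fin[OF B6(6) that(8,9)]
      unfolding ys_def by auto
  qed
  have W_bounds: "\<bar>V c (bu P1) (bv P2)\<bar> \<le> K * vol c" "\<bar>I c (\<lambda>x. au P1 x * bv c x)\<bar> \<le> K * vol c" "\<bar>V c (bu P1) (bv c)\<bar> \<le> K * vol c"
     "\<bar>I c (\<lambda>x. aw P2 x * bu c x)\<bar> \<le> K * vol c" "\<bar>V c (bu c) (bv P2)\<bar> \<le> K * vol c"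
    if "c \<in> D" "c \<subseteq> P" "c \<subseteq> P1" "c \<subseteq> P2" "top P1" "top P2" "I c \<omega> \<le> Z * vol c"
      "I c (Gu P1) \<le> Z * vol c" "I c (Gv P2) \<le> Z * vol c" for c P1 P2
  proof -
    have v: "0 < vol c" by (rule vol_pos) fact
    have P1: "P1 \<in> D" "P1 \<subseteq> R0" "P2 \<in> D" "P2 \<subseteq> R0" using that P by (auto simp: top_def)
    have Wv: "I c (\<lambda>x. wv P2 x powr r) \<le> Z * vol c" by (rule order_trans[OF I_mono[OF that(1) Gw(3)] that(9)])
    have bvx: "\<bar>bv P2 x\<bar> \<le> wv P2 x" if "x \<in> c" for x using bv_le[OF P1(3,4)] that \<open>c \<subseteq> P2\<close> by auto
    note U = restricted_testing_bounds[OF that(1) P1(1) that(3) P1(2) au[OF P1(1,2)] Z1(1) that(8)[unfolded Gu_def] that(7) \<omega>0[OF that(1,2)] \<Phi>\<omega>[OF that(1,2)]]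
    have \<Phi>v: "\<Phi> c \<le> (I c \<omega>) powr (1 - 1 / r - 1 / q)" using \<Phi>\<omega>[OF that(1,2)] by (simp add: algebra_simps)
    note U' = sw.restricted_testing_bounds[OF that(1) P1(3) that(4) P1(4) aw[OF P1(3,4)] Z1(1) that(9)[unfolded Gv_def] that(7) \<omega>0[OF that(1,2)] \<Phi>v]
    have le: "x * vol c \<le> K * vol c" if "x \<le> K" for x using that v by (intro mult_right_mono) auto
    show "\<bar>V c (bu P1) (bv P2)\<bar> \<le> K * vol c" using U(3)[OF bvx Wv] K(5) by simp
    show "\<bar>V c (bu P1) (bv c)\<bar> \<le> K * vol c" using U(1) le[OF K(3)] by linarith
    show "\<bar>I c (\<lambda>x. au P1 x * bv c x)\<bar> \<le> K * vol c" using U(2) le[OF K(2)] by linarith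
    show "\<bar>V c (bu c) (bv P2)\<bar> \<le> K * vol c" using U'(1) le[OF K(3)] by linarith
    show "\<bar>I c (\<lambda>x. aw P2 x * bu c x)\<bar> \<le> K * vol c" using U'(2) le[OF K(2)] by linarith
  qed
  have st_Z: "c \<in> D" "c \<subseteq> P" "c \<subseteq> P1" "c \<subseteq> P2" "top P1" "top P2" "I c \<omega> \<le> Z * vol c"
      "I c (Gu P1) \<le> Z * vol c" "I c (Gv P2) \<le> Z * vol c" "1/2 \<le> av c (bu P1)" "1/2 \<le> av c (bv P2)"
      "I c \<omega> \<le> L * vol c" "I c (Gu P1) \<le> L * vol c" "I c (Gv P2) \<le> L * vol c"
    if "st c P1 P2" for c P1 P2
  proof -
    show c: "c \<in> D" "c \<subseteq> P" "c \<subseteq> P1" "c \<subseteq> P2" "top P1" "top P2" "1/2 \<le> av c (bu P1)" "1/2 \<le> av c (bv P2)"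
      using that by (auto simp: st_def top_def ustop_def vstop_def)
    have v: "0 < vol c" by (rule vol_pos) fact
    have le: "x * vol c \<le> L * vol c" if "x \<le> L" for x using that v by (intro mult_right_mono) auto
    have LZ: "L * vol c \<le> Z * vol c" using Z(1) v by (intro mult_right_mono) auto
    show *: "I c \<omega> \<le> L * vol c" using le[OF L(1)] that by (auto simp: st_def top_def)
    show **: "I c (Gu P1) \<le> L * vol c" using le[OF L(2)] that by (auto simp: st_def ustop_def)
    show ***: "I c (Gv P2) \<le> L * vol c" using le[OF L(3)] that by (auto simp: st_def vstop_def)
    show "I c \<omega> \<le> Z * vol c" "I c (Gu P1) \<le> Z * vol c" "I c (Gv P2) \<le> Z * vol c" using * ** *** LZ by linarith+
  qed
  define lm where "lm Q P1 P2 = av Q g / av Q (bu P1) * (av Q h / av Q (bv P2))" for Q P1 P2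
  have lm: "\<bar>lm Q P1 P2 * V Q (bu P1) (bv P2)\<bar> \<le> 4 * K^3 * vol Q" if "st Q P1 P2" for Q P1 P2
  proof -
    note s = st_Z[OF that]
    have quot: "\<bar>a / b\<bar> \<le> 2 * K" if "\<bar>a\<bar> \<le> K" "1/2 \<le> b" for a b :: real
    proof -
      have "\<bar>a / b\<bar> = \<bar>a\<bar> / b" using that by simp
      also have "\<dots> \<le> K / (1/2)" using that K by (intro frac_le) auto
      finally show ?thesis by simp
    qed
    have 1: "\<bar>av Q g / av Q (bu P1)\<bar> \<le> 2 * K" "\<bar>av Q h / av Q (bv P2)\<bar> \<le> 2 * K"
      by (rule quot[OF cube_bounds[OF s(1-9)] s(10)], simp add: ys_def, rule quot[OF cube_bounds[OF s(1-9)] s(11)], simp add: ys_def)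
    have "\<bar>lm Q P1 P2 * V Q (bu P1) (bv P2)\<bar> \<le> (2 * K) * (2 * K) * (K * vol Q)"
      unfolding lm_def abs_mult using K(4)
      by (intro mult_mono 1 W_bounds(1)[OF s(1-9)] mult_nonneg_nonneg abs_ge_zero; simp)
    then show ?thesis by (simp add: power3_eq_cube)
  qed
  define C' where "C' = C * M powr (- 1 / r)"
  have C': "0 \<le> C'" using C by (simp add: C'_def)
  have en: "C2 * (vol c * energy (ys P1 P2) c) \<le> 6 * K\<^sup>2 * C2 * vol c"
    if "\<And>y. y \<in> set (ys P1 P2) \<Longrightarrow> \<bar>av c y\<bar> \<le> K" "c \<in> D" for c P1 P2
  proof -
    have "energy (ys P1 P2) c \<le> real (length (ys P1 P2)) * K\<^sup>2" by (rule energy_le) (rule that)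
    then have "C2 * (vol c * energy (ys P1 P2) c) \<le> C2 * (vol c * (6 * K\<^sup>2))"
      using C2(2) vol_pos[OF that(2)] by (intro mult_left_mono) (auto simp: ys_def)
    then show ?thesis by (simp add: mult_ac)
  qed
  \<comment> \<open>The energy enters with a negative sign, so that the second-order errors
    telescope. The volume, the potentials and the integral of \<omega> are additive over the
    children.\<close>
  have claim: "\<bar>V Q g h - lm Q P1 P2 * V Q (bu P1) (bv P2)\<bar>
      \<le> C3 * vol Q - C2 * (vol Q * energy (ys P1 P2) Q) + C3 * (Pu P1 Q + Pv P2 Q) + C' * I Q \<omega>"
    if "st Q P1 P2" for Q P1 P2
    using that
  proof (induction "card Q" arbitrary: Q P1 P2 rule: less_induct)
    case less
    note s = st_Z[OF less.prems]
    have v: "0 < vol Q" by (rule vol_pos[OF s(1)])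
    have P12: "P1 \<in> D" "P1 \<subseteq> R0" "P2 \<in> D" "P2 \<subseteq> R0" using s P by (auto simp: top_def)
    show ?case
    proof (cases "card Q = 1")
      case True
      then obtain x where x: "Q = {x}" by (auto simp: card_1_singleton_iff)
      have m: "m x > 0" using weight_pos[OF s(1)] x by auto
      have avx: "av Q f = f x" for f using m by (simp add: x wint_def)
      define l where "l = g x / bu P1 x"
      define n where "n = h x / bv P2 x"
      have nz: "bu P1 x \<noteq> 0" "bv P2 x \<noteq> 0" using s(10,11) unfolding avx by auto
      \<comment> \<open>On an atom all functions are constants, hence \<open>g\<close> and
        \<open>h\<close> are multiples of the testing functions and nothing remains to be
        estimated.\<close>
      have "V Q g h = V Q (\<lambda>y. l * bu P1 y) (\<lambda>y. n * bv P2 y)"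
        using nz by (intro V_cong) (auto simp: x l_def n_def)
      also have "\<dots> = lm Q P1 P2 * V Q (bu P1) (bv P2)" 
        by (simp only: V_cmult1 V_cmult2 lm_def avx l_def[symmetric] n_def[symmetric] mult.assoc)
      finally have "\<bar>V Q g h - lm Q P1 P2 * V Q (bu P1) (bv P2)\<bar> = 0" by simp
      moreover have "C2 * (vol Q * energy (ys P1 P2) Q) \<le> C3 * vol Q"
      proof -
        have "C2 * (vol Q * energy (ys P1 P2) Q) \<le> 6 * K\<^sup>2 * C2 * vol Q"
          by (rule en) (rule cube_bounds[OF s(1-9)], assumption, rule s(1))
        also have "\<dots> \<le> C3 * vol Q" using v K4 by (intro mult_right_mono) (auto simp: C3)
        finally show ?thesis .
      qed
      moreover have "0 \<le> C3 * (Pu P1 Q + Pv P2 Q)" using C3(2) pots(1)[OF s(5,1,3)] pots(3)[OF s(6,1,4)] by simp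
      moreover have "0 \<le> C' * I Q \<omega>" using C' \<omega>0[OF s(1,2)] by simp
      ultimately show ?thesis by linarith
    next
      case nQ: False
      note Q = s(1) nQ
      define good where "good c \<longleftrightarrow> st c P1 P2" for c
      have cD: "c \<in> D" "c \<subseteq> Q" "card c < card Q" "c \<subseteq> P" "c \<subseteq> P1" "c \<subseteq> P2" "c \<subset> P" if "c \<in> ch Q" for c
        using ch_cube[OF Q that] ch_psubset[OF Q that] s(2,3,4) cube_finite[OF s(1)] by (auto intro: psubset_card_mono)
      have cZ: "I c \<omega> \<le> Z * vol c" "I c (Gu P1) \<le> Z * vol c" "I c (Gv P2) \<le> Z * vol c" if "c \<in> ch Q" for c
      proof -
        have *: "0 \<le> \<omega> x" if "x \<in> Q" for x using \<omega>1[of x] s(2) that by force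
        show "I c \<omega> \<le> Z * vol c" "I c (Gu P1) \<le> Z * vol c" "I c (Gv P2) \<le> Z * vol c"
          unfolding Z(2) using L1
          by (intro I_child_le[OF Q that _ s(12)] I_child_le[OF Q that _ s(13)] I_child_le[OF Q that _ s(14)] * Gw; simp)+
      qed
      note cb = cube_bounds[OF cD(1,4,5,6) s(5,6) cZ]
      note Wb = W_bounds[OF cD(1,4,5,6) s(5,6) cZ]
      define T where "T c = (if good c then \<bar>V c g h - lm c P1 P2 * V c (bu P1) (bv P2)\<bar> else \<bar>V c g h\<bar> + 52 * K^4 * vol c)" for c
      have p1: "I c (bu c) = vol c" "I c (bv c) = vol c" if "c \<in> ch Q" for c
        using bu_mean[of c] bv_mean[of c] cD[OF that] P by auto
      have p2: "V Q (bu P1) \<phi> = I Q (\<lambda>x. au P1 x * \<phi> x)" if "I Q \<phi> = 0" for \<phi>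
        by (rule rep_u[OF P12(1) s(1,3) au[OF P12(1,2)] that])
      have p3: "V Q \<phi> (bv P2) = I Q (\<lambda>x. aw P2 x * \<phi> x)" if "I Q \<phi> = 0" for \<phi>
        by (rule sw.rep_u[OF P12(3) s(1,4) aw[OF P12(3,4)] that])
      have p4: "\<bar>av Q y\<bar> \<le> K" if "y \<in> set (ys P1 P2)" for y by (rule cube_bounds[OF s(1-9) that])
      have p5: "\<bar>av c y\<bar> \<le> K" if "c \<in> ch Q" "y \<in> set (ys P1 P2)" for c y using cb that by blast
      have p6: "1/2 \<le> av c (bu P1) \<and> 1/2 \<le> av c (bv P2)" if "good c" for c
        using st_Z(10,11)[of c P1 P2] that by (simp add: good_def)
      have p7: "\<bar>V c (bu P1) (bv P2)\<bar> \<le> K * vol c" if "c \<in> ch Q" for c using Wb that by blast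
      have p8: "\<bar>I c (\<lambda>x. au P1 x * bv c x)\<bar> \<le> K * vol c \<and> \<bar>V c (bu P1) (bv c)\<bar> \<le> K * vol c
         \<and> \<bar>I c (\<lambda>x. aw P2 x * bu c x)\<bar> \<le> K * vol c \<and> \<bar>V c (bu c) (bv P2)\<bar> \<le> K * vol c" if "c \<in> ch Q" for c
        using Wb that by blast
      have p9: "\<bar>child_defect Q (indicat_real c) (indicat_real c')\<bar> \<le> E' * vol Q" if "c \<in> ch Q" "c' \<in> ch Q" for c c'
      proof -
        have \<Phi>Q: "\<Phi> Q \<le> M * vol Q powr (1 - 1 / q - 1 / r)"
          using less.prems by (intro order_trans[OF \<Phi>\<omega>[OF s(1,2)]] powr_le_mult_powr v exponent_le \<omega>0 s M) (simp add: st_def top_def)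
        have "\<bar>child_defect Q (indicat_real c) (indicat_real c')\<bar> \<le> E * vol Q powr (1 / q + 1 / r) * \<Phi> Q"
          using s(2) P by (intro decay that Q) simp
        also have "\<dots> \<le> E * vol Q powr (1 / q + 1 / r) * (M * vol Q powr (1 - 1 / q - 1 / r))"
          using \<Phi>Q E by (intro mult_left_mono) auto
        also have "\<dots> = E' * (vol Q powr (1 / q) * vol Q powr (1 / r) * vol Q powr (1 - 1 / q - 1 / r))"
          by (simp add: E'_def powr_add)
        finally show ?thesis unfolding vol_powr_split[OF v] .
      qed
      have step: "\<bar>V Q g h - lm Q P1 P2 * V Q (bu P1) (bv P2)\<bar>
         \<le> (\<Sum>c\<in>ch Q. T c) + C2 * ((\<Sum>c\<in>ch Q. vol c * energy (ys P1 P2) c) - vol Q * energy (ys P1 P2) Q)"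
        unfolding T_def lm_def C2(1)
        by (rule one_step_bound[where good=good and ys="ys P1 P2" and E=E' and K=K, OF Q K(4) p1 p2 p3 ys_def p4 p5 s(10,11) p6 p7 p8 p9 E'])
      define R where "R c = C3 * vol c - C2 * (vol c * energy (ys P1 P2) c) + C3 * (Pu P1 c + Pv P2 c) + C' * I c \<omega>" for c
      have TR: "T c \<le> R c" if c: "c \<in> ch Q" for c
      proof (cases "good c")
        case True
        then show ?thesis unfolding T_def R_def good_def using less.hyps[OF cD(3)[OF c]] by simp
      next
        case ng: False
        have vc: "0 < vol c" by (rule vol_pos[OF cD(1)[OF c]])
        have en': "C2 * (vol c * energy (ys P1 P2) c) \<le> 6 * K\<^sup>2 * C2 * vol c" by (rule en[OF cb[OF c c c c c c c] cD(1)[OF c]])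
        have K4v: "0 \<le> K^4 * vol c" "K^3 * vol c \<le> K^4 * vol c" using K4 vc by (auto intro: mult_right_mono)
        have C3v: "C3 * vol c = 56 * (K^4 * vol c) + 6 * K\<^sup>2 * C2 * vol c" by (simp add: C3 algebra_simps)
        note pc = pots[OF s(5) cD(1,5)[OF c]] pots[OF s(6) cD(1,6)[OF c]]
        show ?thesis
        proof (cases "I c \<omega> \<le> M * vol c")
          case False
          have "\<bar>V c g h\<bar> \<le> C * (I c (\<lambda>x. \<bar>g x\<bar> powr q)) powr (1 / q) * vol c powr (1 / r) * \<Phi> c" by (rule rec[OF cD(1,7)[OF c]])
          \<comment> \<open>The volume is below \<open>I c \<omega> / M\<close>, and it carries the
            exponent \<open>1 / r\<close> because \<open>h\<close> is bounded. This is the source of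
            the gain.\<close>
          also have "\<dots> \<le> C * (I c \<omega>) powr (1 / q) * (I c \<omega> / M) powr (1 / r) * (I c \<omega>) powr (1 - 1 / q - 1 / r)"
          proof (intro mult_mono)
            show "(I c (\<lambda>x. \<bar>g x\<bar> powr q)) powr (1 / q) \<le> (I c \<omega>) powr (1 / q)"
              using cD[OF c] g q by (intro powr_mono2 I_mono I_nonneg) auto
            show "vol c powr (1 / r) \<le> (I c \<omega> / M) powr (1 / r)"
              using vc M False r by (intro powr_mono2) (auto simp: field_simps)
          qed (use C \<Phi> \<Phi>\<omega> cD[OF c] in auto)
          also have "\<dots> = C' * ((I c \<omega>) powr (1 / q) * (I c \<omega>) powr (1 / r) * (I c \<omega>) powr (1 - 1 / q - 1 / r))"
            using M \<omega>0[OF cD(1,4)[OF c]] by (simp add: C'_def powr_divide powr_minus_divide)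
          also have "\<dots> = C' * I c \<omega>"
          proof -
            have "0 < M * vol c" using M vc by simp
            then have "0 < I c \<omega>" using False by linarith
            then show ?thesis by (simp only: vol_powr_split)
          qed
          finally have "\<bar>V c g h\<bar> \<le> C' * I c \<omega>" .
          moreover have "0 \<le> C3 * (Pu P1 c + Pv P2 c)" using C3(2) pc by simp
          moreover have "T c = \<bar>V c g h\<bar> + 52 * (K^4 * vol c)" using ng by (simp add: T_def)
          ultimately show ?thesis unfolding R_def using en' K4v C3v by linarith
        next
          case True
          have tc: "top c" using cD[OF c] True by (simp add: top_def)
          \<comment> \<open>Only stopped testing functions are renewed. The child is not good
            although the average of \<omega> is small, so at least one of the two has
            stopped.\<close>
          define P1' where "P1' = (if ustop P1 c then c else P1)"
          define P2' where "P2' = (if vstop P2 c then c else P2)"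
          have st': "st c P1' P2'"
            using tc s(5,6) cD[OF c] top_fresh[OF tc] by (auto simp: st_def P1'_def P2'_def)
          have drop: "ustop P1 c \<or> vstop P2 c" using ng tc s(5,6) cD[OF c] by (auto simp: good_def st_def)
          have 1: "Pu P1' c + (if ustop P1 c then vol c else 0) \<le> Pu P1 c"
            using pot_top'(1)[OF tc] pc(2) by (auto simp: P1'_def algebra_simps)
          have 2: "Pv P2' c + (if vstop P2 c then vol c else 0) \<le> Pv P2 c"
            using pot_top'(2)[OF tc] pc(8) by (auto simp: P2'_def algebra_simps)
          have "Pu P1' c + Pv P2' c + vol c \<le> Pu P1 c + Pv P2 c" using 1 2 drop vc by (auto split: if_splits)
          \<comment> \<open>The drop of the potential pays for the volume term of the induction
            hypothesis. The volume term of \<open>R c\<close> is thereby free for the crude errors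
            and the lost energy.\<close>
          then have "C3 * (Pu P1' c + Pv P2' c + vol c) \<le> C3 * (Pu P1 c + Pv P2 c)" using C3(2) by (rule mult_left_mono)
          then have 3: "C3 * (Pu P1' c + Pv P2' c) + C3 * vol c \<le> C3 * (Pu P1 c + Pv P2 c)" by (simp add: algebra_simps)
          have 4: "\<bar>V c g h - lm c P1' P2' * V c (bu P1') (bv P2')\<bar>
             \<le> C3 * vol c - C2 * (vol c * energy (ys P1' P2') c) + C3 * (Pu P1' c + Pv P2' c) + C' * I c \<omega>"
            by (rule less.hyps[OF cD(3)[OF c] st'])
          have 5: "\<bar>lm c P1' P2' * V c (bu P1') (bv P2')\<bar> \<le> 4 * (K^3 * vol c)" using lm[OF st'] by simp
          have 6: "0 \<le> C2 * (vol c * energy (ys P1' P2') c)" using C2(2) vc energy_nonneg by simp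
          have 7: "T c = \<bar>V c g h\<bar> + 52 * (K^4 * vol c)" using ng by (simp add: T_def)
          show ?thesis unfolding R_def using 3 4 5 6 7 en' K4v C3v by linarith
        qed
      qed
      have "(\<Sum>c\<in>ch Q. T c) \<le> (\<Sum>c\<in>ch Q. R c)" by (rule sum_mono) (rule TR)
      also have "\<dots> = C3 * (\<Sum>c\<in>ch Q. vol c) - C2 * (\<Sum>c\<in>ch Q. vol c * energy (ys P1 P2) c)
          + C3 * ((\<Sum>c\<in>ch Q. Pu P1 c) + (\<Sum>c\<in>ch Q. Pv P2 c)) + C' * (\<Sum>c\<in>ch Q. I c \<omega>)"
        unfolding R_def by (simp only: sum.distrib sum_subtractf sum_distrib_left[symmetric])
      also have "\<dots> = C3 * vol Q - C2 * (\<Sum>c\<in>ch Q. vol c * energy (ys P1 P2) c) + C3 * (Pu P1 Q + Pv P2 Q) + C' * I Q \<omega>"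
        unfolding Pu_def Pv_def by (simp only: vol_ch[OF Q] pot_ch[OF Q] I_ch[OF Q])
      finally show ?thesis using step by (simp add: right_diff_distrib)
    qed
  qed
  have tP: "top P" using P \<omega>P by (simp add: top_def)
  have stP: "st P P P" using tP top_fresh[OF tP] by (simp add: st_def)
  have v: "0 < vol P" by (rule vol_pos[OF P(1)])
  have slope: "0 \<le> pot_slope B1 * vol P" using B1(1) v by (simp add: pot_slope_def)
  have "Pu P P + Pv P P \<le> (pot_base q B1 + pot_base r B1 + 2 * B1) * vol P"
    using pot_top'[OF tP] slope by (simp add: algebra_simps)
  then have "C3 * (Pu P P + Pv P P) \<le> C3 * ((pot_base q B1 + pot_base r B1 + 2 * B1) * vol P)"
    using C3(2) by (rule mult_left_mono)
  moreover have "0 \<le> C2 * (vol P * energy (ys P P) P)" using C2(2) v energy_nonneg by simp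
  ultimately have "\<bar>V P g h\<bar> \<le> 4 * K^3 * vol P + C3 * vol P + C3 * ((pot_base q B1 + pot_base r B1 + 2 * B1) * vol P) + C' * I P \<omega>"
    using claim[OF stP] lm[OF stP] by linarith
  also have "4 * K^3 * vol P + C3 * vol P + C3 * ((pot_base q B1 + pot_base r B1 + 2 * B1) * vol P) = total_const q r B M \<kappa> E * vol P"
    by (simp add: total_const_def K_def C3_def B1_def algebra_simps)
  finally show ?thesis by (simp add: C'_def)
qed

end

section \<open>From bilinear to multilinear forms\<close>

lemma restr_restr: "c \<subseteq> Q \<Longrightarrow> restr Q (restr c f) = restr c f"
  by (auto simp: restr_def fun_eq_iff)

lemma (in weighted_tree) I_eq_0D:
  assumes "Q \<in> D" "\<And>x. x \<in> Q \<Longrightarrow> 0 \<le> f x" "I Q f = 0" "x \<in> Q"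
  shows "f x = 0"
proof -
  have "\<forall>x\<in>Q. m x * f x = 0"
    using assms(3) unfolding wint_def
    by (subst (asm) sum_nonneg_eq_0_iff)
      (use assms(1,2) cube_finite in \<open>auto intro!: mult_nonneg_nonneg weight_pos[THEN less_imp_le]\<close>)
  then show ?thesis using weight_pos[OF assms(1,4)] assms(4) by auto
qed

section \<open>Normalization and absorption of the recursive term\<close>

context bilinear_testing
begin

lemma scale_testing:
  assumes T: "0 < T"
  shows "bilinear_testing m D ch \<kappa> (\<lambda>Q f h. V Q f h / T) q r B E (\<lambda>Q. \<Phi> Q / T) R0 bu bv wu wv"
proof -
  interpret s: perfect_bilinear m D ch \<kappa> "\<lambda>Q f h. V Q f h / T"
    by unfold_locales
      (auto intro: V_cong simp: V_lin1 V_lin2 V_smooth1 V_smooth2 add_divide_distrib cong: V_cong)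
  have child_defect: "s.child_defect Q f h = child_defect Q f h / T" for Q f h
    by (simp add: s.child_defect_def child_defect_def diff_divide_distrib sum_divide_distrib)
  have div: "\<bar>x / T\<bar> \<le> y * (z / T)" if "\<bar>x\<bar> \<le> y * z" for x y z
    using that T by (simp add: divide_right_mono)
  show ?thesis
  proof (intro bilinear_testing.intro s.perfect_bilinear_axioms bilinear_testing_axioms.intro)
    show "1 < q" "1 < r" "1 / q + 1 / r \<le> 1" "1 \<le> B" "0 \<le> E" by (rule q r qr B E)+
    show "0 \<le> \<Phi> P / T" if "P \<in> D" for P using \<Phi>[OF that] T by simp
    show "\<bar>s.child_defect Q (indicat_real c) (indicat_real c')\<bar> \<le> E * vol Q powr (1 / q + 1 / r) * (\<Phi> Q / T)"
      if "Q \<in> D" "Q \<subseteq> R0" "card Q \<noteq> 1" "c \<in> ch Q" "c' \<in> ch Q" for Q c c'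
      unfolding child_defect by (intro div decay that)
    fix P assume P: "P \<in> D" "P \<subseteq> R0"
    show "I P (bu P) = vol P" "I P (bv P) = vol P" by (rule bu_mean bv_mean, rule P, rule P)+
    show "I P (\<lambda>x. wu P x powr q) \<le> B * vol P" by (rule wu_int[OF P])
    show "I P (\<lambda>x. wv P x powr r) \<le> B * vol P" by (rule wv_int[OF P])
    show "\<bar>bu P x\<bar> \<le> wu P x" "\<bar>bv P x\<bar> \<le> wv P x" if "x \<in> P" for x
      by (rule bu_le[OF P that], rule bv_le[OF P that])
    show "\<bar>V P \<phi> (bv P) / T\<bar> \<le> B * I P (\<lambda>x. wv P x powr r) powr (1 / r) * I P (\<lambda>x. \<bar>\<phi> x\<bar> powr q) powr (1 / q) * (\<Phi> P / T)" for \<phi>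
      by (intro div test_v P)
    show "\<bar>V P (bu P) \<phi> / T\<bar> \<le> B * I P (\<lambda>x. wu P x powr q) powr (1 / q) * I P (\<lambda>x. \<bar>\<phi> x\<bar> powr r) powr (1 / r) * (\<Phi> P / T)" for \<phi>
      by (intro div test_u P)
  qed
qed

lemma bilinear_bound:
  fixes S :: "'i set" and p :: "'i \<Rightarrow> real" and w :: "'i \<Rightarrow> 'x \<Rightarrow> real"
  assumes S: "finite S" and p: "\<And>i. i \<in> S \<Longrightarrow> 1 < p i" and ps: "(\<Sum>i\<in>S. 1 / p i) = 1 - 1 / q - 1 / r"
    and \<Phi>_eq: "\<And>Q. \<Phi> Q = (\<Prod>i\<in>S. (I Q (\<lambda>x. w i x powr p i)) powr (1 / p i))"
    and V0: "\<And>Q f h. Q \<in> D \<Longrightarrow> Q \<subseteq> R0 \<Longrightarrow> \<Phi> Q = 0 \<Longrightarrow> V Q f h = 0"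
    and M: "real (card S) + 2 \<le> M" "(real (card S) + 2) * M powr (- 1 / r) \<le> 1 / 2"
    and P: "P \<in> D" "P \<subseteq> R0" and h: "\<And>x. x \<in> P \<Longrightarrow> \<bar>h x\<bar> \<le> 1"
  defines "C \<equiv> 2 * \<bar>total_const q r B M \<kappa> E\<bar>"
  shows "\<bar>V P g h\<bar> \<le> C * (I P (\<lambda>x. \<bar>g x\<bar> powr q)) powr (1 / q) * vol P powr (1 / r) * \<Phi> P"
  using P h
proof (induction "card P" arbitrary: P rule: less_induct)
  case less
  note P = less.prems(1,2)
  have v: "0 < vol P" by (rule vol_pos[OF P(1)])
  have C: "0 \<le> C" by (simp add: C_def)
  define G0 where "G0 = av P (\<lambda>x. \<bar>g x\<bar> powr q)"
  define a where "a i = av P (\<lambda>x. w i x powr p i)" for i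
  have IG: "I P (\<lambda>x. \<bar>g x\<bar> powr q) = G0 * vol P" and Iw: "I P (\<lambda>x. w i x powr p i) = a i * vol P" for i
    using v by (simp_all add: G0_def a_def)
  have G0: "0 \<le> G0" and a: "0 \<le> a i" for i
    using v P by (auto simp: G0_def a_def intro!: divide_nonneg_pos I_nonneg)
  show ?case
  \<comment> \<open>Normalization divides by these averages; if one of them is zero, some function
    vanishes on \<open>P\<close> and so does the form.\<close>
  proof (cases "G0 = 0 \<or> \<Phi> P = 0")
    case True
    have "V P g h = 0"
    proof (cases "\<Phi> P = 0")
      case False
      then have 0: "I P (\<lambda>x. \<bar>g x\<bar> powr q) = 0" using True IG by simp
      have "g x = 0" if "x \<in> P" for x
        using I_eq_0D[OF P(1) _ 0 that] by simp
      then have "V P g h = V P (\<lambda>_. 0) h" by (intro V_cong) auto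
      then show ?thesis by (simp add: V_zero1)
    qed (rule V0[OF P])
    then show ?thesis using C \<Phi>[OF P(1)] by simp
  next
    case False
    then have G0: "0 < G0" and \<Phi>P: "\<Phi> P \<noteq> 0" using G0 by (auto simp: less_le)
    have a: "0 < a i" if "i \<in> S" for i
    proof -
      have "I P (\<lambda>x. w i x powr p i) \<noteq> 0"
      proof
        assume "I P (\<lambda>x. w i x powr p i) = 0"
        then have "\<Phi> P = 0" unfolding \<Phi>_eq using S that by (intro prod_zero) auto
        then show False using \<Phi>P by simp
      qed
      then show ?thesis using Iw[of i] a[of i] by (cases "a i = 0") auto
    qed
    define T where "T = (\<Prod>i\<in>S. a i powr (1 / p i))"
    have T: "0 < T" unfolding T_def by (intro prod_pos) (simp add: a[THEN less_imp_neq, symmetric])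
    define tg where "tg = G0 powr (1 / q)"
    have tg: "0 < tg" using G0 by (simp add: tg_def)
    define g' where "g' x = g x / tg" for x
    have Vg': "V Q g' h = V Q g h / tg" for Q
      using V_cmult1[of Q "1 / tg" g h] by (simp add: g'_def[abs_def])
    define \<omega> where "\<omega> x = 1 + \<bar>g x\<bar> powr q / G0 + (\<Sum>i\<in>S. w i x powr p i / a i)" for x
    interpret s: bilinear_testing m D ch \<kappa> "\<lambda>Q f h. V Q f h / T" q r B E "\<lambda>Q. \<Phi> Q / T" R0 bu bv wu wv
      by (rule scale_testing[OF T])
    have g'q: "\<bar>g' x\<bar> powr q = \<bar>g x\<bar> powr q / G0" for x
      using tg q G0 by (simp add: g'_def tg_def powr_divide powr_powr)
    have wa: "0 \<le> w i x powr p i / a i" if "i \<in> S" for i x using a[OF that] by simp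
    have \<omega>1: "1 \<le> \<omega> x" for x
      unfolding \<omega>_def using G0 sum_nonneg[of S "\<lambda>i. w i x powr p i / a i"] wa by simp
    have \<omega>g: "\<bar>g' x\<bar> powr q \<le> \<omega> x" for x
      unfolding \<omega>_def g'q using G0 sum_nonneg[of S "\<lambda>i. w i x powr p i / a i"] wa by simp
    have \<omega>w: "w i x powr p i / a i \<le> \<omega> x" if "i \<in> S" for i x
      unfolding \<omega>_def using G0 member_le_sum[OF that, of "\<lambda>i. w i x powr p i / a i"] wa S
      by (smt (verit) DiffD1 divide_nonneg_pos powr_ge_zero)
    have I\<omega>: "I P \<omega> = (real (card S) + 2) * vol P"
    proof -
      have "I P \<omega> = vol P + I P (\<lambda>x. \<bar>g x\<bar> powr q) / G0 + (\<Sum>i\<in>S. I P (\<lambda>x. w i x powr p i) / a i)"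
        unfolding \<omega>_def wint_add wint_sum wint_divide by (simp add: wint_const)
      also have "(\<Sum>i\<in>S. I P (\<lambda>x. w i x powr p i) / a i) = (\<Sum>i\<in>S. vol P)"
      proof (rule sum.cong[OF refl])
        fix i assume i: "i \<in> S"
        show "I P (\<lambda>x. w i x powr p i) / a i = vol P" using a[OF i] by (simp add: Iw)
      qed
      finally show ?thesis using G0 by (simp add: IG algebra_simps)
    qed
    have "\<bar>V P g' h / T\<bar> \<le> total_const q r B M \<kappa> E * vol P + C * M powr (- 1 / r) * I P \<omega>"
    proof (rule s.dyadic_stopping_estimate[OF P _ \<omega>1])
      show "1 \<le> M" using M(1) by simp
      show "\<Phi> Q / T \<le> (I Q \<omega>) powr (1 - 1 / q - 1 / r)" if "Q \<in> D" "Q \<subseteq> P" for Q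
      proof -
        have "vol Q * 1 \<le> I Q \<omega>" using I_mono[OF that(1), of "\<lambda>_. 1" \<omega>] \<omega>1 by (simp add: wint_const)
        then have pos: "0 < I Q \<omega>" using vol_pos[OF that(1)] by linarith
        have "\<Phi> Q / T = (\<Prod>i\<in>S. (I Q (\<lambda>x. w i x powr p i / a i)) powr (1 / p i))"
          unfolding \<Phi>_eq T_def prod_dividef[symmetric] wint_divide
          using a that by (intro prod.cong refl) (auto simp: powr_divide I_nonneg less_imp_le)
        also have "\<dots> \<le> (\<Prod>i\<in>S. (I Q \<omega>) powr (1 / p i))"
          using p wa \<omega>w that by (intro prod_mono conjI powr_mono2 I_mono I_nonneg) (auto intro: less_imp_le order_trans[OF zero_le_one less_imp_le])
        also have "\<dots> = (I Q \<omega>) powr (1 - 1 / q - 1 / r)"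
          using pos by (simp add: powr_sum[symmetric] S ps)
        finally show ?thesis .
      qed
      show "\<bar>g' x\<bar> powr q \<le> \<omega> x" for x by (rule \<omega>g)
      show "I P \<omega> \<le> M * vol P" unfolding I\<omega> using M(1) v by (intro mult_right_mono) auto
      show "\<bar>V R g' h / T\<bar> \<le> C * (I R (\<lambda>x. \<bar>g' x\<bar> powr q)) powr (1 / q) * vol R powr (1 / r) * (\<Phi> R / T)"
        if R: "R \<in> D" "R \<subset> P" for R
      proof -
        have "card R < card P" using R cube_finite[OF P(1)] by (intro psubset_card_mono)
        then have "\<bar>V R g h\<bar> \<le> C * (I R (\<lambda>x. \<bar>g x\<bar> powr q)) powr (1 / q) * vol R powr (1 / r) * \<Phi> R"
          using R P less.prems(3) by (intro less.hyps) auto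
        then have "\<bar>V R g h\<bar> / (tg * T) \<le> (C * (I R (\<lambda>x. \<bar>g x\<bar> powr q)) powr (1 / q) * vol R powr (1 / r) * \<Phi> R) / (tg * T)"
          using tg T by (intro divide_right_mono) auto
        moreover have "V R g' h / T = V R g h / (tg * T)"
          by (simp add: Vg')
        moreover have "(I R (\<lambda>x. \<bar>g' x\<bar> powr q)) powr (1 / q) = (I R (\<lambda>x. \<bar>g x\<bar> powr q)) powr (1 / q) / tg"
          unfolding g'q wint_divide tg_def by (rule powr_divide)
        ultimately show ?thesis using tg T by (simp add: abs_mult mult_ac)
      qed
    qed (use less.prems(3) C in auto)
    also have "\<dots> \<le> (C / 2) * vol P + C * (1 / 2) * vol P"
    proof (rule add_mono)
      show "total_const q r B M \<kappa> E * vol P \<le> C / 2 * vol P" using v by (intro mult_right_mono) (auto simp: C_def)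
      have "C * M powr (- 1 / r) * I P \<omega> = C * ((real (card S) + 2) * M powr (- 1 / r)) * vol P" by (simp add: I\<omega>)
      also have "\<dots> \<le> C * (1 / 2) * vol P" using C v M(2) by (intro mult_right_mono mult_left_mono) auto
      finally show "C * M powr (- 1 / r) * I P \<omega> \<le> C * (1 / 2) * vol P" .
    qed
    finally have "\<bar>V P g' h / T\<bar> \<le> C * vol P" by simp
    then have "\<bar>V P g' h\<bar> \<le> C * vol P * T" using T by (simp add: field_simps)
    moreover have "V P g h = tg * V P g' h" using tg by (simp add: Vg')
    ultimately have "\<bar>V P g h\<bar> \<le> tg * (C * vol P * T)" using tg by (simp add: abs_mult)
    also have "\<dots> = C * (tg * vol P powr (1 / q)) * vol P powr (1 / r) * (T * vol P powr (1 - 1 / q - 1 / r))"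
      using vol_powr_split[OF v] by (simp add: mult_ac)
    also have "tg * vol P powr (1 / q) = (I P (\<lambda>x. \<bar>g x\<bar> powr q)) powr (1 / q)"
      unfolding IG tg_def using G0 v by (simp add: powr_mult)
    also have "T * vol P powr (1 - 1 / q - 1 / r) = \<Phi> P"
    proof -
      have "vol P powr (1 - 1 / q - 1 / r) = (\<Prod>i\<in>S. vol P powr (1 / p i))"
        using v by (simp add: powr_sum[symmetric] S ps)
      then show ?thesis
        unfolding T_def \<Phi>_eq prod.distrib[symmetric] Iw using a v
        by (simp add: prod.distrib[symmetric]) (intro prod.cong refl; simp add: powr_mult less_imp_le)
    qed
    finally show ?thesis .
  qed
qed

end

section \<open>Multilinear forms on a finite tree, with all but two functions frozen\<close>

locale perfect_form = weighted_tree m D ch \<kappa>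
  for m :: "'x \<Rightarrow> real" and D ch \<kappa> +
  fixes \<Lambda> :: "('n::finite \<Rightarrow> 'x \<Rightarrow> real) \<Rightarrow> real" and p :: "'n \<Rightarrow> real"
  assumes p_gt_1: "1 < p j" and p_sum: "(\<Sum>j\<in>UNIV. 1 / p j) = 1"
    and multilinear: "\<Lambda> (f(i := (\<lambda>x. \<alpha> * g x + \<beta> * h x))) = \<alpha> * \<Lambda> (f(i := g)) + \<beta> * \<Lambda> (f(i := h))"
    and smoothness: "P \<in> D \<Longrightarrow> i \<noteq> j \<Longrightarrow> (\<And>x. x \<notin> P \<Longrightarrow> f j x = 0) \<Longrightarrow> wint m P (f j) = 0 \<Longrightarrow>
      (\<And>x. x \<in> P \<Longrightarrow> f i x = 0) \<Longrightarrow> \<Lambda> f = 0"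
    and form_decay: "P \<in> D \<Longrightarrow> card P \<noteq> 1 \<Longrightarrow> (\<And>j x. x \<notin> P \<Longrightarrow> f j x = 0) \<Longrightarrow> i \<noteq> j \<Longrightarrow> c \<in> ch P \<Longrightarrow> c' \<in> ch P \<Longrightarrow>
      c \<noteq> c' \<Longrightarrow> (\<And>x. x \<notin> c \<Longrightarrow> f i x = 0) \<Longrightarrow> (\<And>x. x \<notin> c' \<Longrightarrow> f j x = 0) \<Longrightarrow>
      \<bar>\<Lambda> f\<bar> \<le> (\<Prod>j\<in>UNIV. (wint m P (\<lambda>x. \<bar>f j x\<bar> powr p j)) powr (1 / p j))"
begin

definition nrm :: "'n \<Rightarrow> 'x set \<Rightarrow> ('x \<Rightarrow> real) \<Rightarrow> real" where
  "nrm i Q f = (I Q (\<lambda>x. \<bar>f x\<bar> powr p i)) powr (1 / p i)"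

lemma nrm_nonneg: "0 \<le> nrm i Q f"
  by (simp add: nrm_def)

lemma nrm_mono: "Q \<in> D \<Longrightarrow> (\<And>x. x \<in> Q \<Longrightarrow> \<bar>f x\<bar> \<le> \<bar>g x\<bar>) \<Longrightarrow> nrm i Q f \<le> nrm i Q g"
  unfolding nrm_def using p_gt_1[of i]
  by (intro powr_mono2 I_mono I_nonneg) (auto intro: less_imp_le order_trans[OF zero_le_one less_imp_le])

lemma nrm_le_vol: "Q \<in> D \<Longrightarrow> (\<And>x. x \<in> Q \<Longrightarrow> \<bar>f x\<bar> \<le> 1) \<Longrightarrow> nrm i Q f \<le> vol Q powr (1 / p i)"
  using nrm_mono[of Q f "\<lambda>_. 1" i] by (simp add: nrm_def wint_const)

lemma nrm_one: "nrm i Q (\<lambda>_. 1) = vol Q powr (1 / p i)"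
  by (simp add: nrm_def wint_const)

lemma form_sum: "finite A \<Longrightarrow> \<Lambda> (f(i := (\<lambda>x. \<Sum>c\<in>A. F c x))) = (\<Sum>c\<in>A. \<Lambda> (f(i := F c)))"
proof (induction A rule: finite_induct)
  case empty
  show ?case using multilinear[of f i 0 "\<lambda>_. 0" 0 "\<lambda>_. 0"] by (simp del: fun_upd_apply)
next
  case (insert c A)
  then show ?case using multilinear[of f i 1 "F c" 1 "\<lambda>x. \<Sum>c\<in>A. F c x"]
    by (simp del: fun_upd_apply)
qed

lemma form_zero: "(\<And>x. f i x = 0) \<Longrightarrow> \<Lambda> f = 0"
proof -
  assume "\<And>x. f i x = 0"
  then have "f = f(i := (\<lambda>x. 0 * f i x + 0 * f i x))" by (auto simp: fun_eq_iff)
  then have "\<Lambda> f = \<Lambda> (f(i := (\<lambda>x. 0 * f i x + 0 * f i x)))" by (rule arg_cong)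
  also have "\<dots> = 0" unfolding multilinear by simp
  finally show ?thesis .
qed

text \<open>The functions are cut off one at a time: the discarded part vanishes on
  \<open>c\<close>, where a function of mean zero lives, so smoothness removes it.\<close>

lemma form_restrict:
  assumes c: "c \<in> D" and f: "\<And>x. x \<notin> c \<Longrightarrow> f j x = 0" "I c (f j) = 0" and S: "finite S" "j \<notin> S"
  shows "\<Lambda> f = \<Lambda> (\<lambda>s. if s \<in> S then restr c (f s) else f s)"
  using S
proof (induction S rule: finite_induct)
  case (insert i S)
  define f1 where "f1 = (\<lambda>s. if s \<in> S then restr c (f s) else f s)"
  have i: "i \<noteq> j" using insert by auto
  have j: "f1 j = f j" using insert by (auto simp: f1_def)
  have "f1 = f1(i := (\<lambda>x. 1 * restr c (f i) x + 1 * restr (- c) (f i) x))"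
    using insert by (auto simp: f1_def restr_def fun_eq_iff)
  then have "\<Lambda> f1 = 1 * \<Lambda> (f1(i := restr c (f i))) + 1 * \<Lambda> (f1(i := restr (- c) (f i)))"
    by (metis multilinear)
  also have "\<Lambda> (f1(i := restr (- c) (f i))) = 0"
    using i j f by (intro smoothness[OF c i]) (auto simp: restr_def)
  also have "f1(i := restr c (f i)) = (\<lambda>s. if s \<in> insert i S then restr c (f s) else f s)"
    by (auto simp: f1_def)
  finally show ?case using insert by (simp add: f1_def)
qed simp

definition pform :: "('n \<Rightarrow> 'x \<Rightarrow> real) \<Rightarrow> 'n \<Rightarrow> 'n \<Rightarrow> 'x set \<Rightarrow> ('x \<Rightarrow> real) \<Rightarrow> ('x \<Rightarrow> real) \<Rightarrow> real" where
  "pform F u v Q f h = \<Lambda> (\<lambda>s. restr Q ((F(u := f, v := h)) s))"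

lemma pform_swap: "u \<noteq> v \<Longrightarrow> pform F u v Q f h = pform F v u Q h f"
  by (simp add: pform_def fun_upd_twist)

lemma pform_lin2: "pform F u v Q f (\<lambda>x. \<alpha> * h x + \<beta> * h' x) = \<alpha> * pform F u v Q f h + \<beta> * pform F u v Q f h'"
proof -
  have *: "(\<lambda>s. restr Q ((F(u := f, v := k)) s)) = (\<lambda>s. restr Q ((F(u := f)) s))(v := restr Q k)" for k
    by auto
  have "restr Q (\<lambda>x. \<alpha> * h x + \<beta> * h' x) = (\<lambda>x. \<alpha> * restr Q h x + \<beta> * restr Q h' x)"
    by (auto simp: restr_def)
  then show ?thesis unfolding pform_def * by (simp add: multilinear)
qed

lemma pform_smooth2:
  assumes uv: "u \<noteq> v" and Q: "Q \<in> D" "c \<in> D" "c \<subseteq> Q" and h: "I c h = 0"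
  shows "pform F u v Q f (restr c h) = pform F u v c f h"
proof -
  define G where "G = (\<lambda>s. restr Q ((F(u := f, v := restr c h)) s))"
  have Gv: "G v = restr c h" using Q by (simp add: G_def restr_restr)
  have "I c (G v) = I c h" unfolding Gv by (rule wint_cong) (simp add: restr_def)
  then have "\<Lambda> G = \<Lambda> (\<lambda>s. if s \<in> UNIV - {v} then restr c (G s) else G s)"
    using h by (intro form_restrict[OF Q(2)]) (auto simp: Gv restr_def)
  also have "(\<lambda>s. if s \<in> UNIV - {v} then restr c (G s) else G s) = (\<lambda>s. restr c ((F(u := f, v := h)) s))"
  proof (rule ext, rule ext)
    fix s x
    show "(if s \<in> UNIV - {v} then restr c (G s) else G s) x = restr c ((F(u := f, v := h)) s) x"
      using Q Gv by (cases "s = v") (auto simp: G_def restr_def)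
  qed
  finally show ?thesis by (simp add: pform_def G_def)
qed

lemma pform_cong:
  assumes "\<And>x. x \<in> Q \<Longrightarrow> f x = f' x" "\<And>x. x \<in> Q \<Longrightarrow> h x = h' x"
  shows "pform F u v Q f h = pform F u v Q f' h'"
proof -
  have "restr Q f = restr Q f'" "restr Q h = restr Q h'" using assms by (auto simp: restr_def)
  then have "(\<lambda>s. restr Q ((F(u := f, v := h)) s)) = (\<lambda>s. restr Q ((F(u := f', v := h')) s))" by auto
  then show ?thesis by (simp add: pform_def)
qed

lemma perfect_bilinear_pform:
  assumes uv: "u \<noteq> v" shows "perfect_bilinear m D ch \<kappa> (pform F u v)"
proof
  fix Q c f f' h h' and \<alpha> \<beta> :: real
  show "pform F u v Q f (\<lambda>x. \<alpha> * h x + \<beta> * h' x) = \<alpha> * pform F u v Q f h + \<beta> * pform F u v Q f h'"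
    by (rule pform_lin2)
  show "pform F u v Q (\<lambda>x. \<alpha> * f x + \<beta> * f' x) h = \<alpha> * pform F u v Q f h + \<beta> * pform F u v Q f' h"
    unfolding pform_swap[OF uv] by (rule pform_lin2)
  show "pform F u v Q f h = pform F u v Q f' h'" if "\<And>x. x \<in> Q \<Longrightarrow> f x = f' x" "\<And>x. x \<in> Q \<Longrightarrow> h x = h' x"
    using that by (rule pform_cong)
  assume Q: "Q \<in> D" "c \<in> D" "c \<subseteq> Q"
  show "pform F u v Q f (restr c h) = pform F u v c f h" if "I c h = 0" by (rule pform_smooth2[OF uv Q that])
  show "pform F u v Q (restr c f) h = pform F u v c f h" if "I c f = 0"
    unfolding pform_swap[OF uv] by (rule pform_smooth2[OF uv[symmetric] Q that])
qed

lemma prod_split2: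
  fixes f :: "'n \<Rightarrow> real" assumes "u \<noteq> v"
  shows "(\<Prod>j\<in>UNIV. f j) = f u * f v * (\<Prod>j\<in>UNIV - {u, v}. f j)"
proof -
  have "(\<Prod>j\<in>UNIV. f j) = f u * (\<Prod>j\<in>UNIV - {u}. f j)" by (rule prod.remove) auto
  also have "(\<Prod>j\<in>UNIV - {u}. f j) = f v * (\<Prod>j\<in>UNIV - {u} - {v}. f j)" by (rule prod.remove) (use assms in auto)
  also have "UNIV - {u} - {v} = UNIV - {u, v}" by auto
  finally show ?thesis by (simp add: mult.assoc)
qed

lemma sum_split2:
  fixes f :: "'n \<Rightarrow> real" assumes "u \<noteq> v"
  shows "(\<Sum>j\<in>UNIV. f j) = f u + f v + (\<Sum>j\<in>UNIV - {u, v}. f j)"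
proof -
  have "(\<Sum>j\<in>UNIV. f j) = f u + (\<Sum>j\<in>UNIV - {u}. f j)" by (rule sum.remove) auto
  also have "(\<Sum>j\<in>UNIV - {u}. f j) = f v + (\<Sum>j\<in>UNIV - {u} - {v}. f j)" by (rule sum.remove) (use assms in auto)
  also have "UNIV - {u} - {v} = UNIV - {u, v}" by auto
  finally show ?thesis by (simp add: add.assoc)
qed

lemma decay_bound:
  assumes uv: "u \<noteq> v" and Q: "Q \<in> D" "card Q \<noteq> 1" and F: "\<And>i x. x \<in> Q \<Longrightarrow> i \<noteq> u \<Longrightarrow> i \<noteq> v \<Longrightarrow> \<bar>F i x\<bar> \<le> w i x"
    and f0: "\<And>j x. x \<notin> Q \<Longrightarrow> f j x = 0" and f: "\<And>j x. x \<in> Q \<Longrightarrow> j \<noteq> u \<Longrightarrow> j \<noteq> v \<Longrightarrow> \<bar>f j x\<bar> \<le> \<bar>F j x\<bar>"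
    and f1: "\<And>x. x \<in> Q \<Longrightarrow> \<bar>f u x\<bar> \<le> 1" "\<And>x. x \<in> Q \<Longrightarrow> \<bar>f v x\<bar> \<le> 1"
    and ij: "i \<noteq> j" "c \<in> ch Q" "c' \<in> ch Q" "c \<noteq> c'" "\<And>x. x \<notin> c \<Longrightarrow> f i x = 0" "\<And>x. x \<notin> c' \<Longrightarrow> f j x = 0"
  shows "\<bar>\<Lambda> f\<bar> \<le> vol Q powr (1 / p u + 1 / p v) * (\<Prod>i\<in>UNIV - {u, v}. nrm i Q (w i))"
proof -
  have "\<bar>\<Lambda> f\<bar> \<le> (\<Prod>j\<in>UNIV. nrm j Q (f j))"
    unfolding nrm_def by (rule form_decay[OF Q f0 ij])
  also have "\<dots> = nrm u Q (f u) * nrm v Q (f v) * (\<Prod>j\<in>UNIV - {u, v}. nrm j Q (f j))" by (rule prod_split2[OF uv])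
  also have "\<dots> \<le> vol Q powr (1 / p u) * vol Q powr (1 / p v) * (\<Prod>j\<in>UNIV - {u, v}. nrm j Q (w j))"
  proof (intro mult_mono nrm_le_vol[OF Q(1)] f1 prod_mono conjI nrm_nonneg mult_nonneg_nonneg prod_nonneg)
    fix j assume "j \<in> UNIV - {u, v}"
    then have j: "j \<noteq> u" "j \<noteq> v" by auto
    show "nrm j Q (f j) \<le> nrm j Q (w j)"
      by (rule nrm_mono[OF Q(1)], rule order_trans[OF f[OF _ j] order_trans[OF F[OF _ j] abs_ge_self]])
  qed auto
  finally show ?thesis by (simp add: powr_add)
qed

lemma pform_decay:
  fixes F w
  assumes uv: "u \<noteq> v" and Q: "Q \<in> D" "card Q \<noteq> 1" and F: "\<And>i x. x \<in> Q \<Longrightarrow> i \<noteq> u \<Longrightarrow> i \<noteq> v \<Longrightarrow> \<bar>F i x\<bar> \<le> w i x"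
    and c: "c \<in> ch Q" "c' \<in> ch Q"
  shows "\<bar>perfect_bilinear.child_defect ch (pform F u v) Q (indicat_real c) (indicat_real c')\<bar>
     \<le> (real CARD('n) * \<kappa>) * vol Q powr (1 / p u + 1 / p v) * (\<Prod>i\<in>UNIV - {u, v}. nrm i Q (w i))"
proof -
  interpret pb: perfect_bilinear m D ch \<kappa> "pform F u v" by (rule perfect_bilinear_pform[OF uv])
  define K0 where "K0 = vol Q powr (1 / p u + 1 / p v) * (\<Prod>i\<in>UNIV - {u, v}. nrm i Q (w i))"
  have K0: "0 \<le> K0" by (auto simp: K0_def intro!: mult_nonneg_nonneg prod_nonneg nrm_nonneg)
  have nk: "1 \<le> real CARD('n) * \<kappa>"
    using mult_mono[of 1 "real CARD('n)" 1 \<kappa>] kappa_ge_1 by (simp add: Suc_leI)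
  have fch: "finite (ch Q)" by (rule finite_ch[OF Q])
  have *: "\<bar>pb.child_defect Q (indicat_real c) (indicat_real c')\<bar> \<le> (real CARD('n) * \<kappa>) * K0"
  proof (cases "c = c'")
    case False
    have "pform F u v d (indicat_real c) (indicat_real c') = 0" if d: "d \<in> ch Q" for d
    proof -
      have "c \<inter> d = {} \<or> c' \<inter> d = {}" using ch_disjoint[OF Q] c d False by metis
      then show ?thesis
      proof
        assume "c \<inter> d = {}"
        then have "pform F u v d (indicat_real c) (indicat_real c') = pform F u v d (\<lambda>_. 0) (indicat_real c')"
          by (intro pform_cong) (auto simp: indicator_def)
        then show ?thesis by (simp add: pb.V_zero1)
      next
        assume "c' \<inter> d = {}"
        then have "pform F u v d (indicat_real c) (indicat_real c') = pform F u v d (indicat_real c) (\<lambda>_. 0)"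
          by (intro pform_cong) (auto simp: indicator_def)
        then show ?thesis by (simp add: pb.V_zero2)
      qed
    qed
    then have "pb.child_defect Q (indicat_real c) (indicat_real c') = pform F u v Q (indicat_real c) (indicat_real c')"
      by (simp add: pb.child_defect_def)
    also have "\<bar>\<dots>\<bar> \<le> K0"
      unfolding pform_def K0_def using uv False
      by (intro decay_bound[where F=F and i=u and j=v and c=c and c'=c', OF uv Q F]) (auto simp: restr_def indicator_def c)
    also have "\<dots> \<le> (real CARD('n) * \<kappa>) * K0" using mult_right_mono[OF nk K0] by simp
    finally show ?thesis .
  next
    case True
    define G where "G = F(u := indicat_real c, v := indicat_real c)"
    define fS where "fS S = (\<lambda>s. if s \<in> S then restr c (G s) else restr Q (G s))" for S
    have cQ: "c \<subseteq> Q" by (rule ch_subset[OF Q c(1)])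
    have Gc: "restr c (G u) = restr Q (G u)" "restr c (G v) = restr Q (G v)" "restr Q (G u) = indicat_real c" 
      using cQ by (auto simp: G_def restr_def indicator_def fun_eq_iff)
    have step: "\<bar>\<Lambda> (fS {}) - \<Lambda> (fS S)\<bar> \<le> real (card S) * (\<kappa> * K0)" if "finite S" for S
      using that
    proof (induction S rule: finite_induct)
      case (insert i S)
      have "\<bar>\<Lambda> (fS S) - \<Lambda> (fS (insert i S))\<bar> \<le> \<kappa> * K0"
      proof (cases "i = u \<or> i = v")
        case True
        then have "fS (insert i S) = fS S" using Gc by (auto simp: fS_def)
        then show ?thesis using K0 kappa_ge_1 by simp
      next
        case False
        \<comment> \<open>The children other than \<open>c\<close>: they carry the pieces of the
          function at \<open>i\<close> that are removed in this step.\<close>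
        define A where "A = ch Q - {c}"
        have "restr Q (G i) x = (\<Sum>d\<in>insert c A. restr d (G i) x)" for x
        proof (cases "x \<in> Q")
          case True
          then obtain d where d: "d \<in> ch Q" "x \<in> d" using ch_Union[OF Q] by blast
          have "insert c A = ch Q" using c by (auto simp: A_def)
          then show ?thesis using sum_restr_ch[OF Q d, of "\<lambda>_. G i"] True by (simp add: restr_def)
        next
          case False
          have "restr d (G i) x = 0" if "d \<in> insert c A" for d
            using that c ch_subset[OF Q] False by (auto simp: A_def restr_def)
          then show ?thesis using False by (simp add: restr_def)
        qed
        then have "fS S = (fS S)(i := (\<lambda>x. \<Sum>d\<in>insert c A. restr d (G i) x))"
          using insert by (auto simp: fS_def fun_eq_iff)
        then have "\<Lambda> (fS S) = (\<Sum>d\<in>insert c A. \<Lambda> ((fS S)(i := restr d (G i))))"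
          using form_sum[of "insert c A" "fS S" i "\<lambda>d. restr d (G i)"] fch by (simp add: A_def)
        also have "\<dots> = \<Lambda> ((fS S)(i := restr c (G i))) + (\<Sum>d\<in>A. \<Lambda> ((fS S)(i := restr d (G i))))"
          by (rule sum.insert) (use fch in \<open>auto simp: A_def\<close>)
        also have "(fS S)(i := restr c (G i)) = fS (insert i S)" by (auto simp: fS_def)
        finally have "\<bar>\<Lambda> (fS S) - \<Lambda> (fS (insert i S))\<bar> \<le> (\<Sum>d\<in>A. \<bar>\<Lambda> ((fS S)(i := restr d (G i)))\<bar>)"
          by (simp del: fun_upd_apply add: sum_abs)
        also have "\<dots> \<le> (\<Sum>d\<in>A. K0)"
        proof (rule sum_mono)
          fix d assume d: "d \<in> A"
          have dQ: "d \<subseteq> Q" "d \<in> ch Q" "c \<noteq> d" using d ch_subset[OF Q] by (auto simp: A_def)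
          show "\<bar>\<Lambda> ((fS S)(i := restr d (G i)))\<bar> \<le> K0"
            unfolding K0_def using uv False dQ cQ c(1) Gc
            by (intro decay_bound[where F=F and i=u and j=i and c=c and c'=d, OF uv Q F])
              (auto simp: fS_def restr_def G_def indicator_def)
        qed
        also have "\<dots> \<le> \<kappa> * K0"
        proof -
          have "card A \<le> card (ch Q)" using fch by (auto simp: A_def intro: card_mono)
          then have "real (card A) \<le> \<kappa>" using card_ch[OF Q] by linarith
          then show ?thesis using mult_right_mono[OF _ K0, of "real (card A)" \<kappa>] by simp
        qed
        finally show ?thesis .
      qed
      then show ?case using insert by (simp add: algebra_simps)
    qed simp
    have "pform F u v d (indicat_real c) (indicat_real c) = (if d = c then \<Lambda> (fS UNIV) else 0)" if d: "d \<in> ch Q" for d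
    proof (cases "d = c")
      case True
      then show ?thesis by (simp add: pform_def fS_def G_def)
    next
      case False
      then have "pform F u v d (indicat_real c) (indicat_real c) = pform F u v d (\<lambda>_. 0) (indicat_real c)"
        using ch_disjoint[OF Q d c(1) False] by (intro pform_cong) (auto simp: indicator_def)
      then show ?thesis using False by (simp add: pb.V_zero1)
    qed
    then have "(\<Sum>d\<in>ch Q. pform F u v d (indicat_real c) (indicat_real c)) = \<Lambda> (fS UNIV)"
      using c(1) fch by (simp cong: sum.cong)
    then have "pb.child_defect Q (indicat_real c) (indicat_real c') = \<Lambda> (fS {}) - \<Lambda> (fS UNIV)"
      unfolding pb.child_defect_def True[symmetric] by (simp add: pform_def fS_def G_def)
    then show ?thesis using step[of UNIV] by (simp add: mult.assoc)
  qed
  then show ?thesis by (simp add: K0_def mult.assoc)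
qed

text \<open>A sum over all pairs of positions, so that one constant serves every pair. With
  \<open>n = CARD('n)\<close>, the level \<open>M = (2 * n) powr p v\<close> satisfies
  \<open>M powr (- 1 / p v) = 1 / (2 * n)\<close>, and \<omega> has average \<open>n\<close>; this
  gives the factor 1/2 for absorption.\<close>

definition step_const :: "real \<Rightarrow> real" where
  "step_const B = 1 + (\<Sum>u\<in>UNIV. \<Sum>v\<in>UNIV. 2 * \<bar>total_const (p u) (p v) B ((2 * real CARD('n)) powr p v) \<kappa> (real CARD('n) * \<kappa>)\<bar>)"

text \<open>In the descent \<open>h\<close> is the constant 1 at the end of the longer path and
  \<open>g\<close> is the free function of the shorter one. Later \<open>h\<close> is a general
  function bounded by 1.\<close>

theorem bilinear_step:
  fixes F :: "'n \<Rightarrow> 'x \<Rightarrow> real"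
  assumes uv: "u \<noteq> v" and B: "1 \<le> B"
    and F: "\<And>i x. x \<in> U \<Longrightarrow> i \<noteq> u \<Longrightarrow> i \<noteq> v \<Longrightarrow> \<bar>F i x\<bar> \<le> w i x"
    and bu_le: "\<And>P x. P \<in> D \<Longrightarrow> P \<subseteq> U \<Longrightarrow> x \<in> P \<Longrightarrow> \<bar>bu P x\<bar> \<le> wu P x"
    and bv_le: "\<And>P x. P \<in> D \<Longrightarrow> P \<subseteq> U \<Longrightarrow> x \<in> P \<Longrightarrow> \<bar>bv P x\<bar> \<le> wv P x"
    and bu_mean: "\<And>P. P \<in> D \<Longrightarrow> P \<subseteq> U \<Longrightarrow> I P (bu P) = vol P"
    and bv_mean: "\<And>P. P \<in> D \<Longrightarrow> P \<subseteq> U \<Longrightarrow> I P (bv P) = vol P"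
    and wu_int: "\<And>P. P \<in> D \<Longrightarrow> P \<subseteq> U \<Longrightarrow> I P (\<lambda>x. wu P x powr p u) \<le> B * vol P"
    and wv_int: "\<And>P. P \<in> D \<Longrightarrow> P \<subseteq> U \<Longrightarrow> I P (\<lambda>x. wv P x powr p v) \<le> B * vol P"
    and test_u: "\<And>P \<phi>. P \<in> D \<Longrightarrow> P \<subseteq> U \<Longrightarrow> \<bar>pform F u v P (bu P) \<phi>\<bar> \<le>
        B * nrm u P (wu P) * nrm v P \<phi> * (\<Prod>i\<in>UNIV - {u, v}. nrm i P (w i))"
    and test_v: "\<And>P \<phi>. P \<in> D \<Longrightarrow> P \<subseteq> U \<Longrightarrow> \<bar>pform F u v P \<phi> (bv P)\<bar> \<le>
        B * nrm v P (wv P) * nrm u P \<phi> * (\<Prod>i\<in>UNIV - {u, v}. nrm i P (w i))"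
    and P: "P \<in> D" "P \<subseteq> U" and h: "\<And>x. x \<in> P \<Longrightarrow> \<bar>h x\<bar> \<le> 1"
  shows "\<bar>pform F u v P g h\<bar> \<le> step_const B * nrm u P g * vol P powr (1 / p v) * (\<Prod>i\<in>UNIV - {u, v}. nrm i P (w i))"
proof -
  define S where "S = UNIV - {u, v}"
  define \<Phi> where "\<Phi> Q = (\<Prod>i\<in>S. (I Q (\<lambda>x. \<bar>w i x\<bar> powr p i)) powr (1 / p i))" for Q
  have \<Phi>n: "\<Phi> Q = (\<Prod>i\<in>UNIV - {u, v}. nrm i Q (w i))" for Q by (simp add: \<Phi>_def S_def nrm_def)
  have ab: "I P (\<lambda>x. \<bar>k x\<bar> powr e) = I P (\<lambda>x. k x powr e)" if "\<And>x. x \<in> P \<Longrightarrow> \<bar>b x\<bar> \<le> k x" for P k b and e :: real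
    using that by (intro wint_cong) (metis abs_of_nonneg abs_ge_zero order_trans)
  have ps: "(\<Sum>i\<in>S. 1 / p i) = 1 - 1 / p u - 1 / p v" using p_sum sum_split2[OF uv, of "\<lambda>i. 1 / p i"] by (simp add: S_def)
  have pn: "0 \<le> 1 / p i" for i using p_gt_1[of i] by simp
  interpret pb: perfect_bilinear m D ch \<kappa> "pform F u v" by (rule perfect_bilinear_pform[OF uv])
  interpret bt: bilinear_testing m D ch \<kappa> "pform F u v" "p u" "p v" B "real CARD('n) * \<kappa>" \<Phi> U bu bv wu wv
  proof
    show "1 < p u" "1 < p v" by (rule p_gt_1)+
    show "1 / p u + 1 / p v \<le> 1" using ps sum_nonneg[of S "\<lambda>i. 1 / p i"] pn by simp
    show "0 \<le> real CARD('n) * \<kappa>" using kappa_ge_1 by simp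
    show "0 \<le> \<Phi> P" for P by (simp add: \<Phi>_def prod_nonneg)
    show "\<bar>pb.child_defect Q (indicat_real c) (indicat_real c')\<bar> \<le> real CARD('n) * \<kappa> * vol Q powr (1 / p u + 1 / p v) * \<Phi> Q"
      if "Q \<in> D" "Q \<subseteq> U" "card Q \<noteq> 1" "c \<in> ch Q" "c' \<in> ch Q" for Q c c'
      unfolding \<Phi>n using that by (intro pform_decay[OF uv] F) auto
    fix P assume P: "P \<in> D" "P \<subseteq> U"
    show "\<bar>pform F u v P (bu P) \<phi>\<bar> \<le> B * I P (\<lambda>x. wu P x powr p u) powr (1 / p u) * I P (\<lambda>x. \<bar>\<phi> x\<bar> powr p v) powr (1 / p v) * \<Phi> P" for \<phi>
      using test_u[OF P, of \<phi>] by (simp only: \<Phi>n nrm_def ab[of P "bu P" "wu P", OF bu_le[OF P]])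
    show "\<bar>pform F u v P \<phi> (bv P)\<bar> \<le> B * I P (\<lambda>x. wv P x powr p v) powr (1 / p v) * I P (\<lambda>x. \<bar>\<phi> x\<bar> powr p u) powr (1 / p u) * \<Phi> P" for \<phi>
      using test_v[OF P, of \<phi>] by (simp only: \<Phi>n nrm_def ab[of P "bv P" "wv P", OF bv_le[OF P]])
  qed (fact B bu_le bv_le bu_mean bv_mean wu_int wv_int)+
  define M where "M = (2 * real CARD('n)) powr p v"
  have n: "0 < real CARD('n)" by simp
  have cS: "real (card S) + 2 = real CARD('n)"
  proof -
    have "card S = CARD('n) - card {u, v}" unfolding S_def by (rule card_Diff_subset) auto
    moreover have "card {u, v} \<le> CARD('n)" by (rule card_mono) auto
    ultimately show ?thesis using uv by simp
  qed
  have M: "real (card S) + 2 \<le> M" "(real (card S) + 2) * M powr (- 1 / p v) \<le> 1 / 2"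
  proof -
    have "(2 * real CARD('n)) powr 1 \<le> M" unfolding M_def using p_gt_1[of v] n
      by (intro powr_mono) (auto intro: order_trans[of 1 "real CARD('n)"])
    then show "real (card S) + 2 \<le> M" unfolding cS using n by simp
    have "M powr (- 1 / p v) = (2 * real CARD('n)) powr (-1)"
      unfolding M_def powr_powr using p_gt_1[of v] by simp
    then show "(real (card S) + 2) * M powr (- 1 / p v) \<le> 1 / 2" unfolding cS using n by (simp add: powr_minus_divide)
  qed
  have "\<bar>pform F u v P g h\<bar> \<le> 2 * \<bar>total_const (p u) (p v) B M \<kappa> (real CARD('n) * \<kappa>)\<bar> *
      (I P (\<lambda>x. \<bar>g x\<bar> powr p u)) powr (1 / p u) * vol P powr (1 / p v) * \<Phi> P"
  proof (rule bt.bilinear_bound[where S=S and p=p and w="\<lambda>i x. \<bar>w i x\<bar>", OF _ p_gt_1 ps \<Phi>_def _ M P h])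
    show "pform F u v Q f h = 0" if Q: "Q \<in> D" "Q \<subseteq> U" "\<Phi> Q = 0" for Q f h
    proof -
      have "finite S" by simp
      then obtain i where i: "i \<in> S" "(I Q (\<lambda>x. \<bar>w i x\<bar> powr p i)) powr (1 / p i) = 0"
        using Q(3) unfolding \<Phi>_def by (auto simp: prod_zero_iff)
      then have 0: "I Q (\<lambda>x. \<bar>w i x\<bar> powr p i) = 0" by simp
      have "w i x = 0" if "x \<in> Q" for x using I_eq_0D[OF Q(1) _ 0 that] by simp
      then have "F i x = 0" if "x \<in> Q" for x
        using F[of x i] that i(1) Q(2) by (force simp: S_def)
      then show ?thesis
        unfolding pform_def using i(1) by (intro form_zero[of _ i]) (auto simp: restr_def S_def)
    qed
  qed auto
  also have "\<dots> \<le> step_const B * nrm u P g * vol P powr (1 / p v) * \<Phi> P"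
  proof -
    define t where "t a b = 2 * \<bar>total_const (p a) (p b) B ((2 * real CARD('n)) powr p b) \<kappa> (real CARD('n) * \<kappa>)\<bar>" for a b
    have "t u v \<le> (\<Sum>b\<in>UNIV. t u b)" by (rule member_le_sum) (auto simp: t_def)
    also have "\<dots> \<le> (\<Sum>a\<in>UNIV. \<Sum>b\<in>UNIV. t a b)" by (rule member_le_sum[of u UNIV "\<lambda>a. \<Sum>b\<in>UNIV. t a b"]) (auto simp: t_def sum_nonneg)
    finally have "t u v \<le> step_const B" by (simp add: step_const_def t_def)
    then show ?thesis unfolding nrm_def t_def M_def[symmetric]
      by (intro mult_right_mono) (auto simp: \<Phi>_def prod_nonneg)
  qed
  finally show ?thesis by (simp add: \<Phi>n)
qed

lemma step_const_ge_1: "1 \<le> step_const B"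
  by (simp add: step_const_def sum_nonneg)

end

section \<open>Shortening paths\<close>

lemma admissible_single:
  assumes "admissible \<Sigma>" shows "[j] \<in> \<Sigma>"
proof -
  obtain \<sigma> where "\<sigma> \<in> \<Sigma>" "length \<sigma> = 1" "path_at \<sigma> 1 = j" using assms unfolding admissible_def by blast
  then show ?thesis by (cases \<sigma>) (auto simp: path_at_def)
qed

lemma admissible_extend:
  fixes \<Sigma> :: "'n::finite list set"
  assumes "admissible \<Sigma>" "\<sigma> \<in> \<Sigma>" "length \<sigma> < CARD('n)" shows "\<exists>s. \<sigma> @ [s] \<in> \<Sigma>"
proof -
  obtain \<tau> where \<tau>: "\<tau> \<in> \<Sigma>" "length \<tau> = length \<sigma> + 1" "\<And>i. i \<in> {1..length \<sigma>} \<Longrightarrow> path_at \<tau> i = path_at \<sigma> i"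
    using assms unfolding admissible_def by metis
  have "\<tau> ! i = \<sigma> ! i" if "i < length \<sigma>" for i using \<tau>(3)[of "Suc i"] that by (simp add: path_at_def)
  then have "take (length \<sigma>) \<tau> = \<sigma>" using \<tau>(2) by (intro nth_equalityI) auto
  then have "\<tau> = \<sigma> @ [last \<tau>]" using \<tau>(2)
    by (metis append_butlast_last_id butlast_conv_take diff_add_inverse2 list.size(3) add_is_0 one_neq_zero)
  then show ?thesis using \<tau>(1) by metis
qed

lemma admissible_swap:
  assumes "admissible \<Sigma>" "\<rho> @ [u, v] \<in> \<Sigma>" shows "\<rho> @ [v, u] \<in> \<Sigma>"
proof -
  define k where "k = length \<rho>"
  define \<sigma> where "\<sigma> = \<rho> @ [u, v]"
  have len: "length \<sigma> = k + 2" by (simp add: \<sigma>_def k_def)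
  have "\<exists>\<tau>\<in>\<Sigma>. length \<tau> = length \<sigma> \<and>
           (\<forall>i\<in>{1..length \<sigma> - 2}. path_at \<tau> i = path_at \<sigma> i) \<and>
           path_at \<sigma> (length \<sigma> - 1) = path_at \<tau> (length \<sigma>) \<and>
           path_at \<tau> (length \<sigma> - 1) = path_at \<sigma> (length \<sigma>)"
  proof -
    note a = assms(1)[unfolded admissible_def, THEN conjunct2, THEN conjunct2, THEN conjunct2]
    have "\<sigma> \<in> \<Sigma>" "2 \<le> length \<sigma>" using assms(2) len by (simp_all add: \<sigma>_def)
    then show ?thesis by (rule mp[OF bspec[OF a]])
  qed
  then obtain \<tau> where \<tau>: "\<tau> \<in> \<Sigma>" "length \<tau> = k + 2" "\<And>i. i \<in> {1..k} \<Longrightarrow> path_at \<tau> i = path_at \<sigma> i"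
     "path_at \<sigma> (k + 1) = path_at \<tau> (k + 2)" "path_at \<tau> (k + 1) = path_at \<sigma> (k + 2)"
    using len by auto
  have "\<tau> = \<rho> @ [v, u]"
  proof (rule nth_equalityI)
    show "length \<tau> = length (\<rho> @ [v, u])" using \<tau>(2) by (simp add: k_def)
    fix i assume i: "i < length \<tau>"
    then consider "i < k" | "i = k" | "i = Suc k" using \<tau>(2) by linarith
    then show "\<tau> ! i = (\<rho> @ [v, u]) ! i"
    proof cases
      case 1
      then show ?thesis using \<tau>(3)[of "Suc i"] by (simp add: path_at_def \<sigma>_def k_def nth_append)
    next
      case 2
      then show ?thesis using \<tau>(5) by (simp add: path_at_def \<sigma>_def k_def nth_append)
    next
      case 3
      then show ?thesis using \<tau>(4) by (simp add: path_at_def \<sigma>_def k_def nth_append)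
    qed
  qed
  then show ?thesis using \<tau>(1) by simp
qed

section \<open>The case in which all testing functions are 1\<close>

context perfect_form
begin

text \<open>The assumption admits one free function, bounded functions on \<open>S\<close> and ones
  elsewhere. With the free function at \<open>v\<close> and at \<open>u\<close> it yields the two
  testing conditions with testing function 1, and the bilinear step adds \<open>v\<close> to the set
  of positions with bounded functions.\<close>

lemma T1_step:
  assumes C: "1 \<le> C" and v: "v \<notin> S" and u: "u \<notin> insert v S"
    and hyp: "\<And>u P f. u \<notin> S \<Longrightarrow> P \<in> D \<Longrightarrow> (\<And>i x. i \<in> S \<Longrightarrow> x \<in> P \<Longrightarrow> \<bar>f i x\<bar> \<le> 1) \<Longrightarrow>
       (\<And>i x. i \<notin> insert u S \<Longrightarrow> x \<in> P \<Longrightarrow> f i x = 1) \<Longrightarrow>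
       \<bar>\<Lambda> (\<lambda>s. restr P (f s))\<bar> \<le> C * nrm u P (f u) * (\<Prod>i\<in>UNIV - {u}. vol P powr (1 / p i))"
    and P: "P \<in> D" and f: "\<And>i x. i \<in> insert v S \<Longrightarrow> x \<in> P \<Longrightarrow> \<bar>f i x\<bar> \<le> 1"
      "\<And>i x. i \<notin> insert u (insert v S) \<Longrightarrow> x \<in> P \<Longrightarrow> f i x = 1"
  shows "\<bar>\<Lambda> (\<lambda>s. restr P (f s))\<bar> \<le> step_const C * nrm u P (f u) * (\<Prod>i\<in>UNIV - {u}. vol P powr (1 / p i))"
proof -
  have uv: "u \<noteq> v" using u by auto
  have rem: "(\<Prod>i\<in>UNIV - {a}. g i) = g b * (\<Prod>i\<in>UNIV - {a, b}. g i)" if "a \<noteq> b" for a b :: 'n and g :: "'n \<Rightarrow> real"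
  proof -
    have "UNIV - {a, b} = UNIV - {a} - {b}" by auto
    then show ?thesis using that by (simp add: prod.remove[of "UNIV - {a}" b])
  qed
  have ff: "\<bar>f i x\<bar> \<le> 1" if "x \<in> P" "i \<noteq> u" for i x using f(1)[of i x] f(2)[of i x] that by (cases "i \<in> insert v S") auto
  note D = \<open>P \<in> D\<close>
  have int: "I R (\<lambda>x. 1 powr e) \<le> C * vol R" if "R \<in> D" for R and e :: real
    using C vol_pos[OF that] by (simp add: wint_const mult_le_cancel_right1)
  have mean: "I R (\<lambda>_. 1) = vol R" for R by (simp add: wint_const)
  have F: "\<bar>f i x\<bar> \<le> 1" if "x \<in> P" "i \<noteq> u" "i \<noteq> v" for i x by (rule ff[OF that(1,2)])
  have fv: "\<bar>f v x\<bar> \<le> 1" if "x \<in> P" for x using ff[OF that, of v] uv by simp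
  have one: "\<bar>1::real\<bar> \<le> 1" by simp
  have t1: "\<bar>pform f u v R (\<lambda>_. 1) \<phi>\<bar> \<le> C * nrm u R (\<lambda>_. 1) * nrm v R \<phi> * (\<Prod>i\<in>UNIV - {u, v}. nrm i R (\<lambda>_. 1))"
    if R: "R \<in> D" "R \<subseteq> P" for R \<phi>
  proof -
    have "\<bar>pform f u v R (\<lambda>_. 1) \<phi>\<bar> \<le> C * nrm v R ((f(u := (\<lambda>_. 1), v := \<phi>)) v) * (\<Prod>i\<in>UNIV - {v}. vol R powr (1 / p i))"
      unfolding pform_def using v u f R by (intro hyp) auto
    then show ?thesis by (simp add: rem[OF uv[symmetric]] nrm_one insert_commute mult_ac)
  qed
  have t2: "\<bar>pform f u v R \<phi> (\<lambda>_. 1)\<bar> \<le> C * nrm v R (\<lambda>_. 1) * nrm u R \<phi> * (\<Prod>i\<in>UNIV - {u, v}. nrm i R (\<lambda>_. 1))"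
    if R: "R \<in> D" "R \<subseteq> P" for R \<phi>
  proof -
    have "\<bar>pform f u v R \<phi> (\<lambda>_. 1)\<bar> \<le> C * nrm u R ((f(u := \<phi>, v := (\<lambda>_. 1))) u) * (\<Prod>i\<in>UNIV - {u}. vol R powr (1 / p i))"
      unfolding pform_def using v u f R by (intro hyp) auto
    then show ?thesis using uv by (simp add: rem[OF uv] nrm_one mult_ac)
  qed
  have "\<bar>pform f u v P (f u) (f v)\<bar> \<le> step_const C * nrm u P (f u) * vol P powr (1 / p v) * (\<Prod>i\<in>UNIV - {u, v}. nrm i P (\<lambda>_. 1))"
    by (rule bilinear_step[where w="\<lambda>_ _. 1" and bu="\<lambda>_ _. 1" and bv="\<lambda>_ _. 1" and wu="\<lambda>_ _. 1" and wv="\<lambda>_ _. 1" and F=f and U=P,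
          OF uv C F one one mean mean int int t1 t2 P subset_refl fv])
  moreover have "pform f u v P (f u) (f v) = \<Lambda> (\<lambda>s. restr P (f s))" by (simp add: pform_def)
  ultimately show ?thesis by (simp add: rem[OF uv] nrm_one mult_ac)
qed

lemma step_const_iter_ge_1: "1 \<le> B \<Longrightarrow> 1 \<le> (step_const ^^ k) B"
  by (cases k) (simp_all add: step_const_ge_1)

lemma T1_iterate:
  assumes B: "1 \<le> B"
    and base: "\<And>u P \<phi>. P \<in> D \<Longrightarrow> \<bar>\<Lambda> (\<lambda>s. restr P (if s = u then \<phi> else (\<lambda>_. 1)))\<bar> \<le> B * nrm u P \<phi> * (\<Prod>i\<in>UNIV - {u}. vol P powr (1 / p i))"
    and "finite S" "u \<notin> S" "P \<in> D" "\<And>i x. i \<in> S \<Longrightarrow> x \<in> P \<Longrightarrow> \<bar>f i x\<bar> \<le> 1"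
    "\<And>i x. i \<notin> insert u S \<Longrightarrow> x \<in> P \<Longrightarrow> f i x = 1"
  shows "\<bar>\<Lambda> (\<lambda>s. restr P (f s))\<bar> \<le> (step_const ^^ card S) B * nrm u P (f u) * (\<Prod>i\<in>UNIV - {u}. vol P powr (1 / p i))"
  using assms(3-7)
proof (induction S arbitrary: u P f rule: finite_induct)
  case empty
  have "(\<lambda>s. restr P (f s)) = (\<lambda>s. restr P (if s = u then f u else (\<lambda>_. 1)))"
    using empty by (auto simp: restr_def fun_eq_iff)
  then show ?case using base[OF empty(2), of u "f u"] by simp
next
  case (insert v S)
  have "\<bar>\<Lambda> (\<lambda>s. restr P (f s))\<bar> \<le> step_const ((step_const ^^ card S) B) * nrm u P (f u) * (\<Prod>i\<in>UNIV - {u}. vol P powr (1 / p i))"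
    by (rule T1_step[OF step_const_iter_ge_1[OF B] insert(2,4) insert.IH insert.prems(2,3,4)])
  then show ?case using insert.hyps by simp
qed

text \<open>Once all positions but \<open>u\<close> carry bounded functions, the free function is
  taken bounded too. The exponents \<open>1 / p i\<close> add up to one, which leaves the
  volume.\<close>

lemma bounded_estimate:
  assumes B: "1 \<le> B"
    and base: "\<And>u P \<phi>. P \<in> D \<Longrightarrow> \<bar>\<Lambda> (\<lambda>s. restr P (if s = u then \<phi> else (\<lambda>_. 1)))\<bar> \<le> B * nrm u P \<phi> * (\<Prod>i\<in>UNIV - {u}. vol P powr (1 / p i))"
    and P: "P \<in> D" and f: "\<And>i x. x \<in> P \<Longrightarrow> \<bar>f i x\<bar> \<le> 1"
  shows "\<bar>\<Lambda> (\<lambda>s. restr P (f s))\<bar> \<le> (step_const ^^ (CARD('n) - 1)) B * vol P"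
proof -
  obtain u :: 'n where True by blast
  define C where "C = (step_const ^^ (CARD('n) - 1)) B"
  have C: "1 \<le> C" unfolding C_def by (rule step_const_iter_ge_1[OF B])
  have v: "0 < vol P" by (rule vol_pos[OF P])
  have "\<bar>\<Lambda> (\<lambda>s. restr P (f s))\<bar> \<le> (step_const ^^ card (UNIV - {u})) B * nrm u P (f u) * (\<Prod>i\<in>UNIV - {u}. vol P powr (1 / p i))"
    using P f by (intro T1_iterate[OF B base]) auto
  also have "(step_const ^^ card (UNIV - {u})) B = C" by (simp add: C_def card_Diff_singleton)
  also have "C * nrm u P (f u) * (\<Prod>i\<in>UNIV - {u}. vol P powr (1 / p i)) \<le> C * vol P powr (1 / p u) * (\<Prod>i\<in>UNIV - {u}. vol P powr (1 / p i))"
    using C f P by (intro mult_right_mono mult_left_mono nrm_le_vol prod_nonneg) auto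
  also have "\<dots> = C * (\<Prod>i\<in>UNIV. vol P powr (1 / p i))" by (simp add: prod.remove[of UNIV u])
  also have "(\<Prod>i\<in>UNIV. vol P powr (1 / p i)) = vol P" using v by (simp add: powr_sum[symmetric] p_sum)
  finally show ?thesis by (simp add: C_def)
qed

text \<open>List positions are counted from 0, so \<open>CARD('n) - 2\<close> is the next to last
  position of a path of full length.\<close>

definition tnested :: "'n list \<Rightarrow> ('n \<Rightarrow> 'x set) \<Rightarrow> bool" where
  "tnested \<sigma> Q \<longleftrightarrow> (\<forall>j. Q j \<in> D) \<and> (\<forall>i j. i < j \<and> j < length \<sigma> \<longrightarrow> Q (\<sigma> ! j) \<subseteq> Q (\<sigma> ! i)) \<and>
     (\<forall>s. s \<notin> set \<sigma> \<longrightarrow> Q s = Q (last \<sigma>)) \<and>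
     (length \<sigma> = CARD('n) \<longrightarrow> Q (\<sigma> ! (CARD('n) - 2)) = Q (last \<sigma>))"

text \<open>There is no cut-off to the last cube here, since the form is always evaluated on the
  restrictions to it.\<close>

definition ttuple :: "('n list \<Rightarrow> ('n \<Rightarrow> 'x set) \<Rightarrow> 'n \<Rightarrow> 'x \<Rightarrow> real) \<Rightarrow> 'n list \<Rightarrow> ('n \<Rightarrow> 'x set) \<Rightarrow> ('x \<Rightarrow> real) \<Rightarrow> 'n \<Rightarrow> 'x \<Rightarrow> real" where
  "ttuple b \<sigma> Q g s = (if s = last \<sigma> then g else if s \<in> set \<sigma> then b \<sigma> Q s else (\<lambda>_. 1))"

text \<open>The hypotheses of the theorem on paths of length \<open>k\<close>. The functions \<open>w\<close> dominate the testing
  functions: they carry the norms of the original ones when \<open>b\<close> consists of their averages.\<close>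

definition testing_data :: "'n list set \<Rightarrow> nat \<Rightarrow> real \<Rightarrow> ('n list \<Rightarrow> ('n \<Rightarrow> 'x set) \<Rightarrow> 'n \<Rightarrow> 'x \<Rightarrow> real) \<Rightarrow>
    ('n list \<Rightarrow> ('n \<Rightarrow> 'x set) \<Rightarrow> 'n \<Rightarrow> 'x \<Rightarrow> real) \<Rightarrow> bool" where
  "testing_data \<Sigma> k B b w \<longleftrightarrow>
    (\<forall>\<sigma>\<in>\<Sigma>. \<forall>Q. \<forall>j\<in>set (butlast \<sigma>). length \<sigma> = k \<longrightarrow> tnested \<sigma> Q \<longrightarrow>
       (\<forall>x. \<bar>b \<sigma> Q j x\<bar> \<le> w \<sigma> Q j x) \<and> I (Q j) (b \<sigma> Q j) = vol (Q j) \<and> I (Q j) (\<lambda>x. w \<sigma> Q j x powr p j) \<le> B * vol (Q j)) \<and>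
    (\<forall>\<sigma>\<in>\<Sigma>. \<forall>\<sigma>'\<in>\<Sigma>. \<forall>Q Q' j. length \<sigma> = k \<longrightarrow> length \<sigma>' = k \<longrightarrow> tnested \<sigma> Q \<longrightarrow> tnested \<sigma>' Q' \<longrightarrow> Suc j < k \<longrightarrow>
       (\<forall>l\<le>j. \<sigma> ! l = \<sigma>' ! l \<and> Q (\<sigma> ! l) = Q' (\<sigma>' ! l)) \<longrightarrow>
       b \<sigma> Q (\<sigma> ! j) = b \<sigma>' Q' (\<sigma>' ! j) \<and> w \<sigma> Q (\<sigma> ! j) = w \<sigma>' Q' (\<sigma>' ! j)) \<and>
    (\<forall>\<sigma>\<in>\<Sigma>. \<forall>Q g. length \<sigma> = k \<longrightarrow> tnested \<sigma> Q \<longrightarrow>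
       \<bar>\<Lambda> (\<lambda>s. restr (Q (last \<sigma>)) (ttuple b \<sigma> Q g s))\<bar> \<le> B * (\<Prod>j\<in>UNIV. nrm j (Q (last \<sigma>)) (ttuple w \<sigma> Q g j)))"

lemma testing_dataD:
  assumes "testing_data \<Sigma> k B b w"
  shows "\<And>\<sigma> Q j x. \<sigma> \<in> \<Sigma> \<Longrightarrow> length \<sigma> = k \<Longrightarrow> tnested \<sigma> Q \<Longrightarrow> j \<in> set (butlast \<sigma>) \<Longrightarrow> \<bar>b \<sigma> Q j x\<bar> \<le> w \<sigma> Q j x"
    "\<And>\<sigma> Q j. \<sigma> \<in> \<Sigma> \<Longrightarrow> length \<sigma> = k \<Longrightarrow> tnested \<sigma> Q \<Longrightarrow> j \<in> set (butlast \<sigma>) \<Longrightarrow> I (Q j) (b \<sigma> Q j) = vol (Q j)"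
    "\<And>\<sigma> Q j. \<sigma> \<in> \<Sigma> \<Longrightarrow> length \<sigma> = k \<Longrightarrow> tnested \<sigma> Q \<Longrightarrow> j \<in> set (butlast \<sigma>) \<Longrightarrow> I (Q j) (\<lambda>x. w \<sigma> Q j x powr p j) \<le> B * vol (Q j)"
    "\<And>\<sigma> \<sigma>' Q Q' j. \<sigma> \<in> \<Sigma> \<Longrightarrow> \<sigma>' \<in> \<Sigma> \<Longrightarrow> length \<sigma> = k \<Longrightarrow> length \<sigma>' = k \<Longrightarrow> tnested \<sigma> Q \<Longrightarrow> tnested \<sigma>' Q' \<Longrightarrow> Suc j < k \<Longrightarrow>
       (\<And>l. l \<le> j \<Longrightarrow> \<sigma> ! l = \<sigma>' ! l \<and> Q (\<sigma> ! l) = Q' (\<sigma>' ! l)) \<Longrightarrow>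
       b \<sigma> Q (\<sigma> ! j) = b \<sigma>' Q' (\<sigma>' ! j) \<and> w \<sigma> Q (\<sigma> ! j) = w \<sigma>' Q' (\<sigma>' ! j)"
    "\<And>\<sigma> Q g. \<sigma> \<in> \<Sigma> \<Longrightarrow> length \<sigma> = k \<Longrightarrow> tnested \<sigma> Q \<Longrightarrow>
       \<bar>\<Lambda> (\<lambda>s. restr (Q (last \<sigma>)) (ttuple b \<sigma> Q g s))\<bar> \<le> B * (\<Prod>j\<in>UNIV. nrm j (Q (last \<sigma>)) (ttuple w \<sigma> Q g j))"
proof -
  note A = assms[unfolded testing_data_def]
  note A1 = A[THEN conjunct1] and A2 = A[THEN conjunct2, THEN conjunct1] and A3 = A[THEN conjunct2, THEN conjunct2]
  show "\<bar>b \<sigma> Q j x\<bar> \<le> w \<sigma> Q j x" "I (Q j) (b \<sigma> Q j) = vol (Q j)" "I (Q j) (\<lambda>x. w \<sigma> Q j x powr p j) \<le> B * vol (Q j)"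
    if "\<sigma> \<in> \<Sigma>" "length \<sigma> = k" "tnested \<sigma> Q" "j \<in> set (butlast \<sigma>)" for \<sigma> Q j x
    using A1 that by blast+
  show "b \<sigma> Q (\<sigma> ! j) = b \<sigma>' Q' (\<sigma>' ! j) \<and> w \<sigma> Q (\<sigma> ! j) = w \<sigma>' Q' (\<sigma>' ! j)"
    if "\<sigma> \<in> \<Sigma>" "\<sigma>' \<in> \<Sigma>" "length \<sigma> = k" "length \<sigma>' = k" "tnested \<sigma> Q" "tnested \<sigma>' Q'" "Suc j < k"
      "\<And>l. l \<le> j \<Longrightarrow> \<sigma> ! l = \<sigma>' ! l \<and> Q (\<sigma> ! l) = Q' (\<sigma>' ! l)" for \<sigma> \<sigma>' Q Q' j
    by (rule A2[rule_format, OF that(1-7)]) (use that(8) in blast)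
  show "\<bar>\<Lambda> (\<lambda>s. restr (Q (last \<sigma>)) (ttuple b \<sigma> Q g s))\<bar> \<le> B * (\<Prod>j\<in>UNIV. nrm j (Q (last \<sigma>)) (ttuple w \<sigma> Q g j))"
    if "\<sigma> \<in> \<Sigma>" "length \<sigma> = k" "tnested \<sigma> Q" for \<sigma> Q g
    using A3 that by blast
qed

lemma tnestedD: "tnested \<sigma> Q \<Longrightarrow> i < j \<Longrightarrow> j < length \<sigma> \<Longrightarrow> Q (\<sigma> ! j) \<subseteq> Q (\<sigma> ! i)"
  unfolding tnested_def by blast

text \<open>A position outside the path carries the last cube already. Appending it repeats that
  cube, which is also the extra requirement for a path of full length.\<close>

lemma tnested_append:
  assumes "tnested \<sigma> Q" "\<sigma> \<noteq> []" "v \<notin> set \<sigma>"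
  shows "tnested (\<sigma> @ [v]) Q"
proof -
  have Qv: "Q v = Q (last \<sigma>)" using assms by (auto simp: tnested_def)
  have last: "last \<sigma> = \<sigma> ! (length \<sigma> - 1)" using assms(2) by (rule last_conv_nth)
  have "Q ((\<sigma> @ [v]) ! j) \<subseteq> Q ((\<sigma> @ [v]) ! i)" if "i < j" "j < length (\<sigma> @ [v])" for i j
  proof (cases "j < length \<sigma>")
    case True
    then show ?thesis using assms(1) that by (simp add: tnested_def nth_append)
  next
    case False
    then have j: "j = length \<sigma>" "i < length \<sigma>" using that by auto
    have "Q (\<sigma> ! (length \<sigma> - 1)) \<subseteq> Q (\<sigma> ! i)"
    proof (cases "i = length \<sigma> - 1")
      case False
      then show ?thesis using j by (intro tnestedD[OF assms(1)]) auto
    qed simp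
    then show ?thesis using j Qv last by (simp add: nth_append)
  qed
  moreover have "Q ((\<sigma> @ [v]) ! (CARD('n) - 2)) = Q v" if "length (\<sigma> @ [v]) = CARD('n)"
  proof -
    have "CARD('n) - 2 = length \<sigma> - 1" using that by simp
    then show ?thesis using assms(2) last Qv by (simp add: nth_append)
  qed
  ultimately show ?thesis using assms Qv by (auto simp: tnested_def)
qed

text \<open>The last two positions may be given any common cube inside the earlier ones. This
  provides testing functions on all cubes of a tree while the earlier cubes stay fixed.\<close>

lemma tnested_shrink:
  assumes \<rho>: "\<And>i j. i < j \<Longrightarrow> j < length \<rho> \<Longrightarrow> Q (\<rho> ! j) \<subseteq> Q (\<rho> ! i)" "\<And>j. Q j \<in> D"
    and P: "P \<in> D" "\<And>s. s \<in> set \<rho> \<Longrightarrow> P \<subseteq> Q s" and uv: "u \<notin> set \<rho>" "v \<notin> set \<rho>"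
  shows "tnested (\<rho> @ [u, v]) (\<lambda>s. if s \<in> set \<rho> then Q s else P)"
proof -
  define QP where "QP = (\<lambda>s. if s \<in> set \<rho> then Q s else P)"
  have 1: "QP ((\<rho> @ [u, v]) ! i) = (if i < length \<rho> then Q (\<rho> ! i) else P)" if "i < length \<rho> + 2" for i
    using that uv by (auto simp: QP_def nth_append nth_Cons split: nat.splits)
  have "QP ((\<rho> @ [u, v]) ! j) \<subseteq> QP ((\<rho> @ [u, v]) ! i)" if "i < j" "j < length \<rho> + 2" for i j
    using 1[of i] 1[of j] that \<rho>(1)[of i j] P(2)[of "\<rho> ! i"] by auto
  moreover have "QP ((\<rho> @ [u, v]) ! (CARD('n) - 2)) = P" if "length (\<rho> @ [u, v]) = CARD('n)"
    using 1[of "length \<rho>"] that[symmetric] by simp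
  moreover have "QP v = P" using uv by (simp add: QP_def)
  ultimately have "tnested (\<rho> @ [u, v]) QP"
    unfolding tnested_def using \<rho>(2) P(1) by (auto simp: QP_def)
  then show ?thesis by (simp add: QP_def)
qed

text \<open>A path ending in \<open>u\<close> is extended by \<open>v\<close>, and both orders of
  the last two positions are used: one has its testing function at \<open>u\<close> and the free
  function at \<open>v\<close>, the other conversely. The functions at earlier positions are common
  to both and are frozen. The bilinear step with 1 at \<open>v\<close> is the testing condition of
  the shorter path.\<close>

lemma testing_data_descend:
  assumes adm: "admissible \<Sigma>" and data: "testing_data \<Sigma> (Suc k) B b w" and B: "1 \<le> B"
    and k: "1 \<le> k" "Suc k \<le> CARD('n)"
  shows "\<exists>b' w'. testing_data \<Sigma> k (B + step_const B) b' w'"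
proof -
  \<comment> \<open>Any extension will do: the testing functions that are kept sit at positions
    before the last one of the shorter path, and by interdependence they do not depend on the
    choice.\<close>
  define ex where "ex \<sigma> = (SOME s. \<sigma> @ [s] \<in> \<Sigma>)" for \<sigma>
  have ex: "\<sigma> @ [ex \<sigma>] \<in> \<Sigma>" if "\<sigma> \<in> \<Sigma>" "length \<sigma> = k" for \<sigma>
    unfolding ex_def using admissible_extend[OF adm that(1)] that k by (intro someI_ex[of "\<lambda>s. \<sigma> @ [s] \<in> \<Sigma>"]) auto
  have dist: "distinct \<sigma>" if "\<sigma> \<in> \<Sigma>" for \<sigma> using adm that by (auto simp: admissible_def is_path_def)
  have nest: "tnested (\<sigma> @ [ex \<sigma>]) Q" if "\<sigma> \<in> \<Sigma>" "length \<sigma> = k" "tnested \<sigma> Q" for \<sigma> Q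
    using that k dist[OF ex[OF that(1,2)]] by (intro tnested_append) auto
  note D = testing_dataD[OF data]
  define b' where "b' \<sigma> = b (\<sigma> @ [ex \<sigma>])" for \<sigma>
  define w' where "w' \<sigma> = w (\<sigma> @ [ex \<sigma>])" for \<sigma>
  have st: "1 \<le> step_const B" by (rule step_const_ge_1)
  have "testing_data \<Sigma> k (B + step_const B) b' w'"
    unfolding testing_data_def
  proof (intro conjI ballI allI impI)
    fix \<sigma> Q j assume \<sigma>: "\<sigma> \<in> \<Sigma>" "length \<sigma> = k" "tnested \<sigma> Q" and j: "j \<in> set (butlast \<sigma>)"
    have j': "j \<in> set (butlast (\<sigma> @ [ex \<sigma>]))" using j by (simp add: in_set_butlastD)
    note E = ex[OF \<sigma>(1,2)] _ nest[OF \<sigma>] j'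
    show "\<bar>b' \<sigma> Q j x\<bar> \<le> w' \<sigma> Q j x" for x unfolding b'_def w'_def by (rule D(1)[OF E]) (simp add: \<sigma>)
    show "I (Q j) (b' \<sigma> Q j) = vol (Q j)" unfolding b'_def by (rule D(2)[OF E]) (simp add: \<sigma>)
    have "I (Q j) (\<lambda>x. w' \<sigma> Q j x powr p j) \<le> B * vol (Q j)" unfolding w'_def by (rule D(3)[OF E]) (simp add: \<sigma>)
    also have "\<dots> \<le> (B + step_const B) * vol (Q j)"
      using st vol_pos[of "Q j"] \<sigma>(3) by (intro mult_right_mono) (auto simp: tnested_def less_imp_le)
    finally show "I (Q j) (\<lambda>x. w' \<sigma> Q j x powr p j) \<le> (B + step_const B) * vol (Q j)" .
  next
    fix \<sigma> \<sigma>' Q Q' j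
    assume \<sigma>: "\<sigma> \<in> \<Sigma>" "\<sigma>' \<in> \<Sigma>" "length \<sigma> = k" "length \<sigma>' = k" "tnested \<sigma> Q" "tnested \<sigma>' Q'" "Suc j < k"
      and eq: "\<forall>l\<le>j. \<sigma> ! l = \<sigma>' ! l \<and> Q (\<sigma> ! l) = Q' (\<sigma>' ! l)"
    have "b (\<sigma> @ [ex \<sigma>]) Q ((\<sigma> @ [ex \<sigma>]) ! j) = b (\<sigma>' @ [ex \<sigma>']) Q' ((\<sigma>' @ [ex \<sigma>']) ! j) \<and>
      w (\<sigma> @ [ex \<sigma>]) Q ((\<sigma> @ [ex \<sigma>]) ! j) = w (\<sigma>' @ [ex \<sigma>']) Q' ((\<sigma>' @ [ex \<sigma>']) ! j)"
      using \<sigma> eq by (intro D(4) ex nest) (auto simp: nth_append)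
    then show "b' \<sigma> Q (\<sigma> ! j) = b' \<sigma>' Q' (\<sigma>' ! j)" "w' \<sigma> Q (\<sigma> ! j) = w' \<sigma>' Q' (\<sigma>' ! j)"
      using \<sigma> by (auto simp: b'_def w'_def nth_append)
  next
    fix \<sigma> Q g assume \<sigma>: "\<sigma> \<in> \<Sigma>" "length \<sigma> = k" "tnested \<sigma> Q"
    define u where "u = last \<sigma>"
    define \<rho> where "\<rho> = butlast \<sigma>"
    define v where "v = ex \<sigma>"
    have "\<sigma> \<noteq> []" using k \<sigma>(2) by auto
    then have \<sigma>e: "\<sigma> = \<rho> @ [u]" by (simp add: u_def \<rho>_def)
    have s1: "\<rho> @ [u, v] \<in> \<Sigma>" using ex[OF \<sigma>(1,2)] by (simp add: \<sigma>e v_def)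
    have s2: "\<rho> @ [v, u] \<in> \<Sigma>" by (rule admissible_swap[OF adm s1])
    have uv: "u \<noteq> v" "u \<notin> set \<rho>" "v \<notin> set \<rho>" using dist[OF s1] by auto
    have len: "length (\<rho> @ [u, v]) = Suc k" "length (\<rho> @ [v, u]) = Suc k" using \<sigma>(2) \<sigma>e by auto
    define R where "R = Q u"
    have R: "R \<in> D" using \<sigma>(3) by (auto simp: R_def tnested_def)
    have \<rho>n: "Q (\<rho> ! j) \<subseteq> Q (\<rho> ! i)" if "i < j" "j < length \<rho>" for i j
    proof -
      have "Q (\<sigma> ! j) \<subseteq> Q (\<sigma> ! i)" using that \<sigma>e by (intro tnestedD[OF \<sigma>(3)]) auto
      then show ?thesis using that by (simp add: \<sigma>e nth_append)
    qed
    have Ru: "R \<subseteq> Q s" if "s \<in> set \<rho>" for s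
    proof -
      obtain i where i: "i < length \<rho>" "s = \<rho> ! i" using \<open>s \<in> set \<rho>\<close> by (metis in_set_conv_nth)
      have "Q (\<sigma> ! length \<rho>) \<subseteq> Q (\<sigma> ! i)" using i \<sigma>e by (intro tnestedD[OF \<sigma>(3)]) auto
      then show ?thesis using i by (simp add: \<sigma>e nth_append R_def)
    qed
    define QP where "QP P = (\<lambda>s. if s \<in> set \<rho> then Q s else P)" for P
    have n1: "tnested (\<rho> @ [u, v]) (QP P)" and n2: "tnested (\<rho> @ [v, u]) (QP P)" if "P \<in> D" "P \<subseteq> R" for P
    proof -
      have QD: "Q j \<in> D" for j using \<sigma>(3) by (simp add: tnested_def)
      have Ps: "P \<subseteq> Q s" if "s \<in> set \<rho>" for s using Ru[OF that] \<open>P \<subseteq> R\<close> by blast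
      show "tnested (\<rho> @ [u, v]) (QP P)" "tnested (\<rho> @ [v, u]) (QP P)"
        unfolding QP_def
        by (rule tnested_shrink[of \<rho> Q P u v, OF \<rho>n QD that(1) Ps uv(2,3)], assumption+,
            rule tnested_shrink[of \<rho> Q P v u, OF \<rho>n QD that(1) Ps uv(3,2)], assumption+)
    qed
    have n0: "tnested (\<rho> @ [u, v]) Q" using nest[OF \<sigma>] by (simp add: \<sigma>e v_def)
    define F where "F i = (if i \<in> set \<rho> then b (\<rho> @ [u, v]) Q i else (\<lambda>_. 1))" for i
    define W where "W i = (if i \<in> set \<rho> then w (\<rho> @ [u, v]) Q i else (\<lambda>_. 1))" for i
    \<comment> \<open>A testing function depends only on the path and the cubes up to its own
      position, and for positions in \<open>\<rho>\<close> these are common to all the tuples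
      considered.\<close>
    have same: "b \<tau> (QP P) i = b (\<rho> @ [u, v]) Q i \<and> w \<tau> (QP P) i = w (\<rho> @ [u, v]) Q i"
      if "i \<in> set \<rho>" "P \<in> D" "P \<subseteq> R" "\<tau> = \<rho> @ [u, v] \<or> \<tau> = \<rho> @ [v, u]" for \<tau> i P
    proof -
      obtain j where j: "j < length \<rho>" "i = \<rho> ! j" using \<open>i \<in> set \<rho>\<close> by (metis in_set_conv_nth)
      have \<tau>: "\<tau> \<in> \<Sigma>" "length \<tau> = Suc k" "tnested \<tau> (QP P)" "\<tau> ! l = \<rho> ! l" if "l < length \<rho>" for l
        using \<open>\<tau> = _ \<or> _\<close> s1 s2 len n1[OF \<open>P \<in> D\<close> \<open>P \<subseteq> R\<close>] n2[OF \<open>P \<in> D\<close> \<open>P \<subseteq> R\<close>] that by (auto simp: nth_append)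
      have "b \<tau> (QP P) (\<tau> ! j) = b (\<rho> @ [u, v]) Q ((\<rho> @ [u, v]) ! j) \<and> w \<tau> (QP P) (\<tau> ! j) = w (\<rho> @ [u, v]) Q ((\<rho> @ [u, v]) ! j)"
      proof (rule D(4)[OF \<tau>(1)[OF j(1)] s1 \<tau>(2)[OF j(1)] len(1) \<tau>(3)[OF j(1)] n0])
        show "Suc j < Suc k" using j len by simp
        show "\<tau> ! l = (\<rho> @ [u, v]) ! l \<and> QP P (\<tau> ! l) = Q ((\<rho> @ [u, v]) ! l)" if "l \<le> j" for l
          using that j \<tau>(4)[of l] by (simp add: nth_append QP_def)
      qed
      then show ?thesis using j \<tau>(4)[OF j(1)] by (simp add: nth_append)
    qed
    define bu where "bu P = b (\<rho> @ [u, v]) (QP P) u" for P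
    define wu where "wu P = w (\<rho> @ [u, v]) (QP P) u" for P
    define bv where "bv P = b (\<rho> @ [v, u]) (QP P) v" for P
    define wv where "wv P = w (\<rho> @ [v, u]) (QP P) v" for P
    have QPuv: "QP P u = P" "QP P v = P" for P using uv by (auto simp: QP_def)
    have main: "\<bar>pform F u v R g (\<lambda>_. 1)\<bar> \<le> step_const B * nrm u R g * vol R powr (1 / p v) * (\<Prod>i\<in>UNIV - {u, v}. nrm i R (W i))"
    proof (rule bilinear_step[where F=F and w=W and bu=bu and bv=bv and wu=wu and wv=wv and U=R, OF uv(1) B])
      show "\<bar>F i x\<bar> \<le> W i x" for i x
        using D(1)[OF s1 len(1) n0, of i x] by (auto simp: F_def W_def butlast_append)
      fix P assume P: "P \<in> D" "P \<subseteq> R"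
      note N1 = n1[OF P] and N2 = n2[OF P]
      show "\<bar>bu P x\<bar> \<le> wu P x" for x
        unfolding bu_def wu_def by (rule D(1)[OF s1 len(1) N1]) (simp add: butlast_append)
      show "\<bar>bv P x\<bar> \<le> wv P x" for x
        unfolding bv_def wv_def by (rule D(1)[OF s2 len(2) N2]) (simp add: butlast_append)
      show "I P (bu P) = vol P"
        using D(2)[OF s1 len(1) N1, of u] unfolding bu_def QPuv by (simp add: butlast_append)
      show "I P (bv P) = vol P"
        using D(2)[OF s2 len(2) N2, of v] unfolding bv_def QPuv by (simp add: butlast_append)
      show "I P (\<lambda>x. wu P x powr p u) \<le> B * vol P"
        using D(3)[OF s1 len(1) N1, of u] unfolding wu_def QPuv by (simp add: butlast_append)
      show "I P (\<lambda>x. wv P x powr p v) \<le> B * vol P"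
        using D(3)[OF s2 len(2) N2, of v] unfolding wv_def QPuv by (simp add: butlast_append)
      fix \<phi>
      have t1: "ttuple b (\<rho> @ [u, v]) (QP P) \<phi> s = (F(u := bu P, v := \<phi>)) s"
        "ttuple w (\<rho> @ [u, v]) (QP P) \<phi> s = (W(u := wu P, v := \<phi>)) s" for s
        using same[OF _ P, of s "\<rho> @ [u, v]"] by (auto simp: ttuple_def F_def W_def bu_def wu_def)
      have t2: "ttuple b (\<rho> @ [v, u]) (QP P) \<phi> s = (F(u := \<phi>, v := bv P)) s"
        "ttuple w (\<rho> @ [v, u]) (QP P) \<phi> s = (W(u := \<phi>, v := wv P)) s" for s
        using same[OF _ P, of s "\<rho> @ [v, u]"] uv by (auto simp: ttuple_def F_def W_def bv_def wv_def)
      have W2: "(\<Prod>j\<in>UNIV - {u, v}. nrm j P ((W(u := x, v := y)) j)) = (\<Prod>j\<in>UNIV - {u, v}. nrm j P (W j))" for x y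
        by (rule prod.cong) auto
      have "\<bar>pform F u v P (bu P) \<phi>\<bar> \<le> B * (\<Prod>j\<in>UNIV. nrm j P ((W(u := wu P, v := \<phi>)) j))"
        using D(5)[OF s1 len(1) N1, of \<phi>] unfolding t1 pform_def by (simp add: QPuv)
      then show "\<bar>pform F u v P (bu P) \<phi>\<bar> \<le> B * nrm u P (wu P) * nrm v P \<phi> * (\<Prod>i\<in>UNIV - {u, v}. nrm i P (W i))"
        unfolding prod_split2[OF uv(1)] W2 using uv(1) by (simp add: mult.assoc)
      have "\<bar>pform F u v P \<phi> (bv P)\<bar> \<le> B * (\<Prod>j\<in>UNIV. nrm j P ((W(u := \<phi>, v := wv P)) j))"
        using D(5)[OF s2 len(2) N2, of \<phi>] unfolding t2 pform_def by (simp add: QPuv)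
      then show "\<bar>pform F u v P \<phi> (bv P)\<bar> \<le> B * nrm v P (wv P) * nrm u P \<phi> * (\<Prod>i\<in>UNIV - {u, v}. nrm i P (W i))"
        unfolding prod_split2[OF uv(1)] W2 using uv(1) by (simp add: mult_ac)
    qed (use R in auto)
    have t0: "ttuple b' \<sigma> Q g s = (F(u := g, v := (\<lambda>_. 1))) s" "ttuple w' \<sigma> Q g s = (W(u := g, v := (\<lambda>_. 1))) s" for s
      using uv by (auto simp: ttuple_def F_def W_def b'_def w'_def \<sigma>e v_def[symmetric] v_def[unfolded \<sigma>e, symmetric])
    have W2: "(\<Prod>j\<in>UNIV - {u, v}. nrm j R ((W(u := x, v := y)) j)) = (\<Prod>j\<in>UNIV - {u, v}. nrm j R (W j))" for x y
      by (rule prod.cong) auto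
    have pr: "(\<Prod>j\<in>UNIV. nrm j R ((W(u := g, v := (\<lambda>_. 1))) j)) = nrm u R g * vol R powr (1 / p v) * (\<Prod>i\<in>UNIV - {u, v}. nrm i R (W i))"
      unfolding prod_split2[OF uv(1)] W2 using uv(1) by (simp add: nrm_one)
    have "0 \<le> (\<Prod>j\<in>UNIV. nrm j R ((W(u := g, v := (\<lambda>_. 1))) j))" by (intro prod_nonneg) (simp add: nrm_nonneg)
    then have "step_const B * (\<Prod>j\<in>UNIV. nrm j R ((W(u := g, v := (\<lambda>_. 1))) j)) \<le> (B + step_const B) * (\<Prod>j\<in>UNIV. nrm j R ((W(u := g, v := (\<lambda>_. 1))) j))"
      using B by (intro mult_right_mono) auto
    then show "\<bar>\<Lambda> (\<lambda>s. restr (Q (last \<sigma>)) (ttuple b' \<sigma> Q g s))\<bar>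
        \<le> (B + step_const B) * (\<Prod>j\<in>UNIV. nrm j (Q (last \<sigma>)) (ttuple w' \<sigma> Q g j))"
      unfolding u_def[symmetric] R_def[symmetric] t0 using main unfolding pr pform_def by (simp only: mult.assoc)
  qed
  then show ?thesis by blast
qed

section \<open>Descent to paths of length one\<close>

definition level_const :: "nat \<Rightarrow> real \<Rightarrow> real" where
  "level_const k B = ((\<lambda>B. B + step_const B) ^^ k) B"

lemma level_const_ge_1: "1 \<le> B \<Longrightarrow> 1 \<le> level_const k B"
proof (induction k)
  case (Suc k)
  then show ?case using step_const_ge_1[of "level_const k B"] by (simp add: level_const_def)
qed (simp add: level_const_def)

lemma testing_data_level_1:
  assumes adm: "admissible \<Sigma>" and "testing_data \<Sigma> (Suc k) B b w" "1 \<le> B" "Suc k \<le> CARD('n)"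
  shows "\<exists>b w. testing_data \<Sigma> 1 (level_const k B) b w"
  using assms(2-)
proof (induction k arbitrary: B b w)
  case 0
  then show ?case by (auto simp: level_const_def)
next
  case (Suc k)
  obtain b' w' where *: "testing_data \<Sigma> (Suc k) (B + step_const B) b' w'"
    using testing_data_descend[OF adm Suc.prems(1,2)] Suc.prems(3) by auto
  have "1 \<le> B + step_const B" using Suc.prems(2) step_const_ge_1[of B] by linarith
  from Suc.IH[OF * this] Suc.prems(3) show ?case by (simp add: level_const_def funpow_Suc_right del: funpow.simps)
qed

definition bounded_const :: "nat \<Rightarrow> real \<Rightarrow> real" where
  "bounded_const k B = (step_const ^^ (CARD('n) - 1)) (level_const (k - 1) B)"

text \<open>On paths of length one no testing function is left. The testing condition then has one
  free function at an arbitrary position and ones elsewhere, which starts the iteration with testing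
  function 1.\<close>

theorem testing_data_bounded:
  assumes adm: "admissible \<Sigma>" and data: "testing_data \<Sigma> k B b w" and B: "1 \<le> B" and k: "1 \<le> k" "k \<le> CARD('n)"
    and n: "2 \<le> CARD('n)"
    and P: "P \<in> D" and f: "\<And>i x. x \<in> P \<Longrightarrow> \<bar>f i x\<bar> \<le> 1"
  shows "\<bar>\<Lambda> (\<lambda>s. restr P (f s))\<bar> \<le> bounded_const k B * vol P"
proof -
  obtain b w where data1: "testing_data \<Sigma> 1 (level_const (k - 1) B) b w"
    using testing_data_level_1[OF adm, of "k - 1" B b w] data B k by auto
  show ?thesis
    unfolding bounded_const_def
  proof (rule bounded_estimate[OF level_const_ge_1[OF B] _ P f])
    fix u P \<phi> assume P: "P \<in> D"
    have nest: "tnested [u] (\<lambda>_. P)" using P by (simp add: tnested_def)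
    have "\<bar>\<Lambda> (\<lambda>s. restr P (ttuple b [u] (\<lambda>_. P) \<phi> s))\<bar> \<le> level_const (k - 1) B * (\<Prod>j\<in>UNIV. nrm j P (ttuple w [u] (\<lambda>_. P) \<phi> j))"
      using testing_dataD(5)[OF data1 admissible_single[OF adm] _ nest, of \<phi>] by simp
    moreover have tt: "ttuple c [u] (\<lambda>_. P) \<phi> = (\<lambda>s. if s = u then \<phi> else (\<lambda>_. 1))" for c
      by (auto simp: ttuple_def)
    have "(\<Prod>j\<in>UNIV. nrm j P (if j = u then \<phi> else (\<lambda>_. 1))) = nrm u P \<phi> * (\<Prod>i\<in>UNIV - {u}. vol P powr (1 / p i))"
      by (simp add: prod.remove[of UNIV u] nrm_one)
    ultimately show "\<bar>\<Lambda> (\<lambda>s. restr P (if s = u then \<phi> else (\<lambda>_. 1)))\<bar> \<le> level_const (k - 1) B * nrm u P \<phi> * (\<Prod>i\<in>UNIV - {u}. vol P powr (1 / p i))"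
      by (simp add: tt mult.assoc)
  qed
qed

end

section \<open>From bounded functions to Lebesgue spaces\<close>

text \<open>The weighted inequality between arithmetic and geometric means, from convexity of the
  exponential function.\<close>

lemma prod_le_weighted_sum:
  fixes a p :: "'n::finite \<Rightarrow> real"
  assumes p: "\<And>j. 1 < p j" "(\<Sum>j\<in>UNIV. 1 / p j) = 1" and a: "\<And>j. 0 \<le> a j"
  shows "(\<Prod>j\<in>UNIV. a j) \<le> (\<Sum>j\<in>UNIV. a j powr p j / p j)"
proof (cases "\<exists>j. a j = 0")
  case True
  then have "(\<Prod>j\<in>UNIV. a j) = 0" by (auto intro!: prod_zero)
  moreover have "0 \<le> (\<Sum>j\<in>UNIV. a j powr p j / p j)"
    using p(1) by (intro sum_nonneg divide_nonneg_nonneg) (auto intro: order_trans[OF zero_le_one less_imp_le])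
  ultimately show ?thesis by linarith
next
  case False
  then have a: "0 < a j" for j using a[of j] by (metis less_eq_real_def)
  have pj: "0 < p j" for j using p(1)[of j] by simp
  have "(\<Prod>j\<in>UNIV. a j) = exp (\<Sum>j\<in>UNIV. (1 / p j) *\<^sub>R (p j * ln (a j)))"
    using a pj by (simp add: exp_sum less_imp_neq[THEN not_sym])
  also have "\<dots> \<le> (\<Sum>j\<in>UNIV. (1 / p j) * exp (p j * ln (a j)))"
    using p pj by (intro convex_on_sum[OF _ _ exp_convex]) (auto simp: less_imp_le)
  also have "\<dots> = (\<Sum>j\<in>UNIV. a j powr p j / p j)"
    using a by (intro sum.cong refl) (simp add: powr_def less_imp_neq[THEN not_sym])
  finally show ?thesis .
qed

text \<open>The tangent of \<open>x powr p\<close>, up to constants; it serves as a substitute for Hoelder's inequality.\<close>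

lemma le_add_scaled_powr:
  fixes x t p :: real
  assumes "0 \<le> x" "0 < t" "1 < p"
  shows "x \<le> t + t powr (1 - p) * x powr p"
proof (cases "x \<le> t")
  case True then show ?thesis by (simp add: add_increasing2)
next
  case False
  have "x = x powr (1 - p) * x powr p" using False assms by (simp add: powr_add[symmetric])
  also have "\<dots> \<le> t powr (1 - p) * x powr p"
    using False assms by (intro mult_right_mono powr_mono2') auto
  finally show ?thesis using assms by simp
qed

section \<open>Stopping cubes and their Carleson embedding\<close>

context weighted_tree
begin

text \<open>Descend until an average exceeds its level or an atom is reached. The upper bounds
  survive because the parent of a new cube had all averages below the levels.\<close>

lemma stopping_partition:
  assumes Q: "Q \<in> D" and L: "\<And>j::'i. 0 \<le> L j" and le: "\<And>j. I Q (\<lambda>x. \<bar>f j x\<bar>) \<le> \<kappa> * L j * vol Q"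
  shows "\<exists>\<R>. finite \<R> \<and> \<R> \<subseteq> D \<and> \<Union>\<R> = Q \<and> disjoint \<R> \<and>
    (\<forall>R\<in>\<R>. (card R = 1 \<or> (\<exists>j. L j * vol R < I R (\<lambda>x. \<bar>f j x\<bar>))) \<and> (\<forall>j. I R (\<lambda>x. \<bar>f j x\<bar>) \<le> \<kappa> * L j * vol R))"
  using Q le
proof (induction "card Q" arbitrary: Q rule: less_induct)
  case less
  show ?case
  proof (cases "card Q = 1 \<or> (\<exists>j. L j * vol Q < I Q (\<lambda>x. \<bar>f j x\<bar>))")
    case True
    then show ?thesis using less.prems by (intro exI[of _ "{Q}"]) (auto simp: disjoint_def)
  next
    case False
    note Q = \<open>Q \<in> D\<close> and nQ = False[THEN de_Morgan_disj[THEN iffD1], THEN conjunct1]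
    have "\<exists>\<R>. finite \<R> \<and> \<R> \<subseteq> D \<and> \<Union>\<R> = c \<and> disjoint \<R> \<and>
      (\<forall>R\<in>\<R>. (card R = 1 \<or> (\<exists>j. L j * vol R < I R (\<lambda>x. \<bar>f j x\<bar>))) \<and> (\<forall>j. I R (\<lambda>x. \<bar>f j x\<bar>) \<le> \<kappa> * L j * vol R))"
      if c: "c \<in> ch Q" for c
    proof (rule less.hyps)
      show "card c < card Q" using ch_psubset[OF Q nQ c] cube_finite[OF Q] by (intro psubset_card_mono)
      show "c \<in> D" by (rule ch_cube[OF Q nQ c])
      show "I c (\<lambda>x. \<bar>f j x\<bar>) \<le> \<kappa> * L j * vol c" for j
        using False by (intro I_child_le[OF Q nQ c _ _ L]) (auto simp: not_less)
    qed
    then obtain \<R> where \<R>: "\<And>c. c \<in> ch Q \<Longrightarrow> finite (\<R> c) \<and> \<R> c \<subseteq> D \<and> \<Union>(\<R> c) = c \<and> disjoint (\<R> c) \<and>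
      (\<forall>R\<in>\<R> c. (card R = 1 \<or> (\<exists>j. L j * vol R < I R (\<lambda>x. \<bar>f j x\<bar>))) \<and> (\<forall>j. I R (\<lambda>x. \<bar>f j x\<bar>) \<le> \<kappa> * L j * vol R))"
      by metis
    show ?thesis
    proof (intro exI[of _ "\<Union>c\<in>ch Q. \<R> c"] conjI)
      show "finite (\<Union>c\<in>ch Q. \<R> c)" using \<R> finite_ch[OF Q nQ] by auto
      show "(\<Union>c\<in>ch Q. \<R> c) \<subseteq> D" using \<R> by blast
      show "\<Union>(\<Union>c\<in>ch Q. \<R> c) = Q"
      proof -
        have "\<Union>(\<Union>c\<in>ch Q. \<R> c) = (\<Union>c\<in>ch Q. \<Union>(\<R> c))" by blast
        also have "\<dots> = \<Union>(ch Q)" using \<R> by simp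
        finally show ?thesis using ch_Union[OF Q nQ] by simp
      qed
      show "disjoint (\<Union>c\<in>ch Q. \<R> c)"
      proof (rule disjointI)
        fix a b assume ab: "a \<in> (\<Union>c\<in>ch Q. \<R> c)" "b \<in> (\<Union>c\<in>ch Q. \<R> c)" "a \<noteq> b"
        then obtain c c' where c: "c \<in> ch Q" "a \<in> \<R> c" "c' \<in> ch Q" "b \<in> \<R> c'" by blast
        show "a \<inter> b = {}"
        proof (cases "c = c'")
          case True
          have "disjoint (\<R> c)" using \<R>[OF c(1)] by blast
          then show ?thesis using c ab True by (auto simp: disjoint_def)
        next
          case False
          have "a \<subseteq> c" "b \<subseteq> c'" using \<R>[OF c(1)] \<R>[OF c(3)] c by auto
          then show ?thesis using ch_disjoint[OF Q nQ c(1,3) False] by blast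
        qed
      qed
      show "\<forall>R\<in>\<Union>c\<in>ch Q. \<R> c. (card R = 1 \<or> (\<exists>j. L j * vol R < I R (\<lambda>x. \<bar>f j x\<bar>))) \<and> (\<forall>j. I R (\<lambda>x. \<bar>f j x\<bar>) \<le> \<kappa> * L j * vol R)"
        using \<R> by blast
    qed
  qed
qed

lemma I_partition:
  assumes "finite \<R>" "\<R> \<subseteq> D" "disjoint \<R>"
  shows "(\<Sum>R\<in>\<R>. I R f) = I (\<Union>\<R>) f"
  using sum.Union_disjoint[of \<R> "\<lambda>x. m x * f x"] assms cube_finite
  unfolding wint_def disjoint_def by (metis (no_types, lifting) comp_apply subsetD sum.cong)

lemma vol_partition:
  assumes "finite \<R>" "\<R> \<subseteq> D" "disjoint \<R>"
  shows "(\<Sum>R\<in>\<R>. vol R) = vol (\<Union>\<R>)"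
  using I_partition[OF assms, of "\<lambda>_. 1"] by (simp add: wint_const)

text \<open>One generation of the Carleson embedding theorem.\<close>

lemma carleson_step:
  assumes P: "P \<in> D" and \<R>: "finite \<R>" "\<R> \<subseteq> D" "disjoint \<R>" "\<Union>\<R> \<subseteq> P"
    and p: "1 < p" and \<theta>: "0 < \<theta>" "(\<Sum>R\<in>\<R>. vol R) \<le> \<theta> * vol P" "4 * (4 * \<theta>) powr (p - 1) \<le> 1"
  shows "2 * vol P * (av P (\<lambda>x. \<bar>f x\<bar>)) powr p
     \<le> (\<Sum>R\<in>\<R>. vol R * (av R (\<lambda>x. \<bar>f x\<bar>)) powr p) + 4 powr p * I (P - \<Union>\<R>) (\<lambda>x. \<bar>f x\<bar> powr p)"
proof -
  define a where "a = av P (\<lambda>x. \<bar>f x\<bar>)"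
  define E where "E = P - \<Union>\<R>"
  have v: "0 < vol P" by (rule vol_pos[OF P])
  have posR: "0 < vol R" if "R \<in> \<R>" for R using that \<R> vol_pos by blast
  have finP: "finite P" by (rule cube_finite[OF P])
  have m0: "0 \<le> m x" if "x \<in> P" for x using weight_pos[OF P that] by simp
  have IE: "I E k \<le> I E l" if "\<And>x. k x \<le> l x" for k l
    unfolding wint_def using that m0 by (intro sum_mono mult_left_mono) (auto simp: E_def)
  have a0: "0 \<le> a" unfolding a_def using P v by (intro divide_nonneg_pos I_nonneg) auto
  have rhs: "0 \<le> (\<Sum>R\<in>\<R>. vol R * (av R (\<lambda>x. \<bar>f x\<bar>)) powr p)" "0 \<le> I E (\<lambda>x. \<bar>f x\<bar> powr p)"
    using posR IE[of "\<lambda>_. 0" "\<lambda>x. \<bar>f x\<bar> powr p"] by (auto intro!: sum_nonneg simp: wint_const less_imp_le)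
  show ?thesis
  proof (cases "a = 0")
    case True
    then have z: "2 * vol P * a powr p = 0" by simp
    show ?thesis unfolding a_def[symmetric] E_def[symmetric] z
      using rhs by (intro add_nonneg_nonneg mult_nonneg_nonneg) auto
  next
    case False
    then have a: "0 < a" using a0 by simp
    \<comment> \<open>The thresholds are chosen so that the constant terms of the tangent inequality
      use up a quarter of \<open>a * vol P\<close> each, inside and outside the stopped cubes. Half
      of it is left.\<close>
    define t where "t = a / (4 * \<theta>)"
    define s where "s = a / 4"
    have ts: "0 < t" "0 < s" using a \<theta> by (auto simp: t_def s_def)
    define SR where "SR = (\<Sum>R\<in>\<R>. vol R * (av R (\<lambda>x. \<bar>f x\<bar>)) powr p)"
    define SE where "SE = I E (\<lambda>x. \<bar>f x\<bar> powr p)"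
    have "a * vol P = I P (\<lambda>x. \<bar>f x\<bar>)" using v by (simp add: a_def)
    also have "\<dots> = I (\<Union>\<R>) (\<lambda>x. \<bar>f x\<bar>) + I E (\<lambda>x. \<bar>f x\<bar>)"
      unfolding wint_def E_def using sum.subset_diff[OF \<R>(4) finP] by (simp add: add.commute)
    also have "I (\<Union>\<R>) (\<lambda>x. \<bar>f x\<bar>) = (\<Sum>R\<in>\<R>. I R (\<lambda>x. \<bar>f x\<bar>))" by (rule I_partition[OF \<R>(1-3), symmetric])
    also have "\<dots> \<le> (\<Sum>R\<in>\<R>. t * vol R + t powr (1 - p) * (vol R * (av R (\<lambda>x. \<bar>f x\<bar>)) powr p))"
    proof (rule sum_mono)
      fix R assume R: "R \<in> \<R>"
      have "0 \<le> av R (\<lambda>x. \<bar>f x\<bar>)" using R \<R> posR[OF R] by (intro divide_nonneg_pos I_nonneg) auto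
      then have "av R (\<lambda>x. \<bar>f x\<bar>) * vol R \<le> (t + t powr (1 - p) * (av R (\<lambda>x. \<bar>f x\<bar>)) powr p) * vol R"
        using posR[OF R] ts p by (intro mult_right_mono le_add_scaled_powr) auto
      then show "I R (\<lambda>x. \<bar>f x\<bar>) \<le> t * vol R + t powr (1 - p) * (vol R * (av R (\<lambda>x. \<bar>f x\<bar>)) powr p)"
        using posR[OF R] by (simp add: algebra_simps)
    qed
    also have "\<dots> = t * (\<Sum>R\<in>\<R>. vol R) + t powr (1 - p) * SR" by (simp add: SR_def sum.distrib sum_distrib_left)
    also have "t * (\<Sum>R\<in>\<R>. vol R) \<le> t * (\<theta> * vol P)" using ts \<theta> by (intro mult_left_mono) auto
    also have "t * (\<theta> * vol P) = a * vol P / 4" using \<theta> by (simp add: t_def)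
    also have "I E (\<lambda>x. \<bar>f x\<bar>) \<le> I E (\<lambda>x. s + s powr (1 - p) * \<bar>f x\<bar> powr p)"
      using ts p by (intro IE le_add_scaled_powr) auto
    also have "\<dots> = s * vol E + s powr (1 - p) * SE" by (simp add: wint_add wint_cmult wint_const SE_def)
    also have "s * vol E \<le> s * vol P"
      using ts m0 finP by (intro mult_left_mono sum_mono2) (auto simp: E_def)
    also have "s * vol P = a * vol P / 4" by (simp add: s_def)
    finally have "a * vol P \<le> 2 * (t powr (1 - p) * SR + s powr (1 - p) * SE)" by simp
    then have "2 * a powr (p - 1) * (a * vol P) \<le> 2 * a powr (p - 1) * (2 * (t powr (1 - p) * SR + s powr (1 - p) * SE))"
      by (intro mult_left_mono) auto
    also have "2 * a powr (p - 1) * (a * vol P) = 2 * vol P * a powr p"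
    proof -
      have "a powr (p - 1) * a = a powr (p - 1) * a powr 1" using a by simp
      also have "\<dots> = a powr p" by (simp only: powr_add[symmetric]) simp
      finally show ?thesis by (simp add: mult_ac)
    qed
    also have "2 * a powr (p - 1) * (2 * (t powr (1 - p) * SR + s powr (1 - p) * SE))
       = (4 * (a powr (p - 1) * t powr (1 - p))) * SR + (4 * (a powr (p - 1) * s powr (1 - p))) * SE"
      by (simp add: algebra_simps)
    also have "a powr (p - 1) * t powr (1 - p) = (4 * \<theta>) powr (p - 1)"
      unfolding t_def using a \<theta> powr_minus_divide[of "a / (4 * \<theta>)" "p - 1"] by (simp add: powr_divide)
    also have "a powr (p - 1) * s powr (1 - p) = 4 powr (p - 1)"
      unfolding s_def using a powr_minus_divide[of "a / 4" "p - 1"] by (simp add: powr_divide)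
    also have "(4::real) * 4 powr (p - 1) = 4 powr 1 * 4 powr (p - 1)" by simp
    also have "\<dots> = 4 powr p" by (simp only: powr_add[symmetric]) simp
    also have "4 * (4 * \<theta>) powr (p - 1) * SR \<le> 1 * SR" using \<theta>(3) rhs by (intro mult_right_mono) (auto simp: SR_def)
    finally show ?thesis by (simp add: a_def SR_def SE_def E_def)
  qed
qed

end

section \<open>The sparse induction\<close>

context perfect_form
begin

lemma form_scale: "\<Lambda> (\<lambda>s x. t s * f s x) = (\<Prod>s\<in>UNIV. t s) * \<Lambda> f"
proof -
  have "\<Lambda> (\<lambda>s. if s \<in> S then (\<lambda>x. t s * f s x) else f s) = (\<Prod>s\<in>S. t s) * \<Lambda> f" if "finite S" for S
    using that
  proof (induction S rule: finite_induct)
    case (insert i S)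
    define f1 where "f1 = (\<lambda>s. if s \<in> S then (\<lambda>x. t s * f s x) else f s)"
    have "(\<lambda>s. if s \<in> insert i S then (\<lambda>x. t s * f s x) else f s) = f1(i := (\<lambda>x. t i * f i x + 0 * f i x))"
      by (auto simp: f1_def)
    then have "\<Lambda> (\<lambda>s. if s \<in> insert i S then (\<lambda>x. t s * f s x) else f s) = t i * \<Lambda> (f1(i := f i))"
      by (simp only: multilinear)
    also have "f1(i := f i) = f1" using insert by (auto simp: f1_def)
    finally show ?case using insert by (simp add: f1_def)
  qed simp
  from this[of UNIV] show ?thesis by simp
qed

abbreviation loc :: "'x set \<Rightarrow> ('n \<Rightarrow> 'x \<Rightarrow> real) \<Rightarrow> real" where
  "loc P f \<equiv> \<Lambda> (\<lambda>s. restr P (f s))"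

text \<open>By smoothness this defect depends only on the averages of the functions on the cubes of the
  partition.\<close>

lemma partition_defect:
  assumes P: "P \<in> D" and \<R>: "finite \<R>" "\<R> \<subseteq> D" "disjoint \<R>" "\<Union>\<R> = P"
    and eq: "\<And>R j. R \<in> \<R> \<Longrightarrow> I R (f j) = I R (g j)"
  shows "loc P f - (\<Sum>R\<in>\<R>. loc R f) = loc P g - (\<Sum>R\<in>\<R>. loc R g)"
proof -
  have one: "loc P f - (\<Sum>R\<in>\<R>. loc R f) = loc P (f(j := k)) - (\<Sum>R\<in>\<R>. loc R (f(j := k)))"
    if k: "\<And>R. R \<in> \<R> \<Longrightarrow> I R (f j) = I R k" for f j k
  proof -
    define e where "e x = f j x - k x" for x
    have upd: "(\<lambda>s. restr Q ((f(j := h)) s)) = (\<lambda>s. restr Q (f s))(j := restr Q h)" for Q h by auto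
    have lin: "loc Q (f(j := e)) = loc Q f - loc Q (f(j := k))" for Q
    proof -
      have "restr Q e = (\<lambda>x. 1 * restr Q (f j) x + (-1) * restr Q k x)" by (auto simp: restr_def e_def)
      then have "loc Q (f(j := e)) = 1 * loc Q (f(j := f j)) + (-1) * loc Q (f(j := k))"
        unfolding upd by (simp only: multilinear)
      then show ?thesis by simp
    qed
    have e0: "I R e = 0" if "R \<in> \<R>" for R using k[OF that] by (simp add: e_def[abs_def] wint_diff)
    have "restr P e = (\<lambda>x. \<Sum>R\<in>\<R>. restr R e x)"
    proof
      fix x
      show "restr P e x = (\<Sum>R\<in>\<R>. restr R e x)"
      proof (cases "x \<in> P")
        case True
        then obtain R where R: "R \<in> \<R>" "x \<in> R" using \<R>(4) by blast
        have "(\<Sum>R\<in>\<R>. restr R e x) = (\<Sum>R'\<in>\<R>. if R' = R then e x else 0)"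
          using R \<R>(3) by (intro sum.cong) (auto simp: restr_def disjoint_def)
        then show ?thesis using R \<R>(1) True by (simp add: restr_def)
      next
        case False
        then have "restr R e x = 0" if "R \<in> \<R>" for R using that \<R>(4) by (auto simp: restr_def)
        then show ?thesis using False by (simp add: restr_def)
      qed
    qed
    then have "loc P (f(j := e)) = (\<Sum>R\<in>\<R>. \<Lambda> ((\<lambda>s. restr P (f s))(j := restr R e)))"
      unfolding upd by (simp only: form_sum[OF \<R>(1)])
    also have "\<dots> = (\<Sum>R\<in>\<R>. loc R (f(j := e)))"
    proof (rule sum.cong[OF refl])
      fix R assume R: "R \<in> \<R>"
      define G where "G = (\<lambda>s. restr P (f s))(j := restr R e)"
      have RP: "R \<subseteq> P" "R \<in> D" using R \<R> by auto
      have "I R (G j) = I R e" unfolding G_def by (rule wint_cong) (simp add: restr_def)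
      then have "\<Lambda> G = \<Lambda> (\<lambda>s. if s \<in> UNIV - {j} then restr R (G s) else G s)"
        using e0[OF R] by (intro form_restrict[OF RP(2)]) (auto simp: G_def restr_def)
      also have "(\<lambda>s. if s \<in> UNIV - {j} then restr R (G s) else G s) = (\<lambda>s. restr R ((f(j := e)) s))"
        using RP by (auto simp: G_def restr_def fun_eq_iff)
      finally show "\<Lambda> ((\<lambda>s. restr P (f s))(j := restr R e)) = loc R (f(j := e))" unfolding G_def .
    qed
    finally show ?thesis unfolding lin sum_subtractf by simp
  qed
  have "loc P f - (\<Sum>R\<in>\<R>. loc R f) = loc P (\<lambda>s. if s \<in> S then g s else f s) - (\<Sum>R\<in>\<R>. loc R (\<lambda>s. if s \<in> S then g s else f s))"
    if "finite S" for S
    using that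
  proof (induction S rule: finite_induct)
    case (insert i S)
    define f1 where "f1 = (\<lambda>s. if s \<in> S then g s else f s)"
    have upd: "loc Q (\<lambda>s. if s \<in> insert i S then g s else f s) = loc Q (f1(i := g i))"
      "loc Q (\<lambda>s. if s \<in> S then g s else f s) = loc Q f1" for Q
      by (rule arg_cong[where f=\<Lambda>]; auto simp: f1_def fun_eq_iff)+
    have eqi: "I R (f1 i) = I R (g i)" if "R \<in> \<R>" for R using eq[OF that] insert by (simp add: f1_def)
    show ?case using insert.IH one[of f1 i "g i", OF eqi] by (simp only: upd)
  qed simp
  from this[of UNIV] show ?thesis by simp
qed

text \<open>The factor by which an average must grow for a cube to stop. Stopped cubes then fill at
  most the fraction \<open>CARD('n) / sparse_M\<close> of the volume, and the value makes this
  fraction small enough in \<open>carleson_step\<close> for every exponent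
  \<open>p j\<close>.\<close>

definition sparse_M :: real where
  "sparse_M = (\<Sum>j\<in>UNIV. 4 * real CARD('n) * 4 powr (1 / (p j - 1)))"

lemma sparse_M:
  "1 \<le> sparse_M" "4 * (4 * (real CARD('n) / sparse_M)) powr (p j - 1) \<le> 1"
proof -
  have n: "0 < real CARD('n)" by simp
  have pj: "0 < p j - 1" for j using p_gt_1[of j] by simp
  have le: "4 * real CARD('n) * 4 powr (1 / (p j - 1)) \<le> sparse_M" for j
    unfolding sparse_M_def by (rule member_le_sum) auto
  have "1 \<le> real CARD('n)" by (simp add: Suc_leI)
  then have n4: "1 \<le> 4 * real CARD('n)" by linarith
  have "1 \<le> (4::real) powr (1 / (p j - 1))" using pj[of j] by (intro ge_one_powr_ge_zero) auto
  then have "1 * 1 \<le> (4 * real CARD('n)) * 4 powr (1 / (p j - 1))" using n4 by (intro mult_mono) auto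
  then show M1: "1 \<le> sparse_M" using le[of j] by linarith
  have "4 * (real CARD('n) / sparse_M) \<le> 1 / 4 powr (1 / (p j - 1))"
    using le[of j] M1 n by (simp add: field_simps)
  then have "(4 * (real CARD('n) / sparse_M)) powr (p j - 1) \<le> (1 / 4 powr (1 / (p j - 1))) powr (p j - 1)"
    using M1 pj[of j] by (intro powr_mono2) auto
  also have "\<dots> = 1 / 4" using pj[of j] by (simp add: powr_divide powr_powr)
  finally show "4 * (4 * (real CARD('n) / sparse_M)) powr (p j - 1) \<le> 1" by simp
qed

definition lp_const :: "real \<Rightarrow> real" where
  "lp_const A = 3 * A * (\<kappa> * sparse_M) ^ CARD('n) * (\<Sum>j\<in>UNIV. 4 powr p j)"

text \<open>On a cube the functions are replaced by their averages over the stopping partition.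
  These are bounded, so \<open>bnd\<close> applies to them, and what remains is the form on the
  stopped cubes, where the argument is repeated.\<close>

theorem lp_from_bounded:
  assumes A: "0 \<le> A" and bnd: "\<And>P f. P \<in> D \<Longrightarrow> (\<And>i x. x \<in> P \<Longrightarrow> \<bar>f i x\<bar> \<le> 1) \<Longrightarrow> \<bar>loc P f\<bar> \<le> A * vol P"
    and P: "P \<in> D"
  shows "\<bar>loc P f\<bar> \<le> lp_const A * (\<Prod>j\<in>UNIV. nrm j P (f j))"
proof -
  note M = sparse_M
  have kM: "1 \<le> \<kappa> * sparse_M" using mult_mono[of 1 \<kappa> 1 sparse_M] kappa_ge_1 M(1) by simp
  have n: "0 < real CARD('n)" by simp
  have pj: "0 < p j" for j using p_gt_1[of j] by simp
  \<comment> \<open>The factor 3 counts the step functions on \<open>P\<close>, the step functions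
    on the cubes of the partition, and the original functions on atoms that have not
    stopped.\<close>
  define K1 where "K1 = 3 * A * (\<kappa> * sparse_M) ^ CARD('n)"
  have K1: "0 \<le> K1" using A kM by (simp add: K1_def)
  have bndt: "\<bar>loc P f\<bar> \<le> A * vol P * (\<Prod>j\<in>UNIV. t j)"
    if "P \<in> D" "\<And>j. 0 < t j" "\<And>j x. x \<in> P \<Longrightarrow> \<bar>f j x\<bar> \<le> t j" for P f t
  proof -
    define k where "k j x = f j x / t j" for j x
    have t0: "t j \<noteq> 0" for j using that(2)[of j] by simp
    have "(\<lambda>s. restr P (f s)) = (\<lambda>s x. t s * restr P (k s) x)" using t0 by (auto simp: restr_def k_def fun_eq_iff)
    then have "loc P f = (\<Prod>j\<in>UNIV. t j) * loc P k" using form_scale[of t "\<lambda>s. restr P (k s)"] by simp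
    moreover have "\<bar>loc P k\<bar> \<le> A * vol P"
    proof (rule bnd[OF that(1)])
      fix i x assume "x \<in> P"
      then show "\<bar>k i x\<bar> \<le> 1" using that(3)[of x i] that(2)[of i] by (simp add: k_def)
    qed
    moreover have "0 \<le> (\<Prod>j\<in>UNIV. t j)" using that(2) by (intro prod_nonneg) (auto intro: less_imp_le)
    ultimately show ?thesis by (simp add: abs_mult mult_left_mono mult.commute)
  qed
  have zero: "loc P f = 0" if "P \<in> D" "I P (\<lambda>x. \<bar>f j x\<bar>) = 0" for P f j
  proof (rule form_zero[of _ j])
    fix x
    show "restr P (f j) x = 0" using I_eq_0D[OF that(1) _ that(2), of x] by (cases "x \<in> P") (auto simp: restr_def)
  qed
  \<comment> \<open>The subtracted averages are the reserve of the induction: by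
    \<open>carleson_step\<close> the averages on \<open>P\<close> are paid for by the reserve of the
    stopped cubes and by the powers outside of them.\<close>
  have claim: "\<bar>loc P f\<bar> \<le> K1 * (\<Sum>j\<in>UNIV. (4 powr p j * I P (\<lambda>x. \<bar>f j x\<bar> powr p j) - vol P * (av P (\<lambda>x. \<bar>f j x\<bar>)) powr p j) / p j)"
    if "P \<in> D" for P f
    using that
  proof (induction "card P" arbitrary: P rule: less_induct)
    case less
    note P = less.prems
    have v: "0 < vol P" by (rule vol_pos[OF P])
    define a where "a j = av P (\<lambda>x. \<bar>f j x\<bar>)" for j
    have a0: "0 \<le> a j" for j unfolding a_def using P v by (intro divide_nonneg_pos I_nonneg) auto
    have Ia: "I P (\<lambda>x. \<bar>f j x\<bar>) = a j * vol P" for j using v by (simp add: a_def)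
    define L where "L j = sparse_M * a j" for j
    have L0: "0 \<le> L j" for j using M(1) a0 by (simp add: L_def)
    have "a j * 1 \<le> a j * (\<kappa> * sparse_M)" for j using a0 kM by (intro mult_left_mono) auto
    then have "I P (\<lambda>x. \<bar>f j x\<bar>) \<le> \<kappa> * L j * vol P" for j
      unfolding Ia L_def using v by (intro mult_right_mono) (auto simp: mult_ac)
    from stopping_partition[of P L f, OF P L0 this] obtain \<R> where \<R>: "finite \<R>" "\<R> \<subseteq> D" "\<Union>\<R> = P" "disjoint \<R>"
      and stop: "\<And>R. R \<in> \<R> \<Longrightarrow> card R = 1 \<or> (\<exists>j. L j * vol R < I R (\<lambda>x. \<bar>f j x\<bar>))"
      and le: "\<And>R j. R \<in> \<R> \<Longrightarrow> I R (\<lambda>x. \<bar>f j x\<bar>) \<le> \<kappa> * L j * vol R" by blast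
    define \<S> where "\<S> = {R \<in> \<R>. \<exists>j. L j * vol R < I R (\<lambda>x. \<bar>f j x\<bar>)}"
    have \<S>: "finite \<S>" "\<S> \<subseteq> D" "disjoint \<S>" "\<Union>\<S> \<subseteq> P" "\<S> \<subseteq> \<R>"
      using \<R> by (auto simp: \<S>_def disjoint_def)
    define T where "T P = (\<Sum>j\<in>UNIV. (4 powr p j * I P (\<lambda>x. \<bar>f j x\<bar> powr p j) - vol P * (av P (\<lambda>x. \<bar>f j x\<bar>)) powr p j) / p j)" for P
    show ?case
    proof (cases "\<exists>j. a j = 0")
      case True
      then obtain j where "a j = 0" by blast
      then have 0: "loc P f = 0" using Ia[of j] by (intro zero[OF P, of f j]) simp
      \<comment> \<open>Jensen's inequality up to a constant, as the Carleson step with no stopped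
        cubes.\<close>
      have "0 \<le> 4 powr p j * I P (\<lambda>x. \<bar>f j x\<bar> powr p j) - vol P * a j powr p j" for j
      proof -
        have "2 * vol P * a j powr p j \<le> (\<Sum>R\<in>{}. vol R * (av R (\<lambda>x. \<bar>f j x\<bar>)) powr p j) + 4 powr p j * I (P - \<Union>{}) (\<lambda>x. \<bar>f j x\<bar> powr p j)"
          unfolding a_def by (rule carleson_step[OF P _ _ _ _ p_gt_1 _ _ M(2)]) (use n M(1) v in auto)
        moreover have "0 \<le> vol P * a j powr p j" using v by simp
        ultimately show ?thesis by simp
      qed
      then have "0 \<le> T P" unfolding T_def a_def[symmetric] using pj by (intro sum_nonneg divide_nonneg_pos)
      then show ?thesis using 0 K1 by (simp add: T_def)
    next
      case False
      then have a: "0 < a j" for j using a0[of j] by (metis less_eq_real_def)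
      have L: "0 < L j" for j using a[of j] M(1) by (simp add: L_def)
      have posR: "0 < vol R" if "R \<in> \<R>" for R using that \<R> vol_pos by blast
      define pa where "pa = (\<Prod>j\<in>UNIV. a j)"
      have pkL: "(\<Prod>j\<in>UNIV. \<kappa> * L j) = (\<kappa> * sparse_M) ^ CARD('n) * pa"
        by (simp add: L_def pa_def mult.assoc[symmetric] prod.distrib)
      have kL: "0 < \<kappa> * L j" "L j \<le> \<kappa> * L j" for j using L[of j] kappa_ge_1 by (auto simp: mult_le_cancel_right1)
      define g where "g j x = (\<Sum>R\<in>\<R>. av R (f j) * indicat_real R x)" for j x
      have gR: "g j x = av R (f j)" if "R \<in> \<R>" "x \<in> R" for j x R
      proof -
        have "g j x = (\<Sum>R'\<in>\<R>. if R' = R then av R (f j) else 0)"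
          unfolding g_def using that \<R>(4) by (intro sum.cong) (auto simp: indicator_def disjoint_def)
        then show ?thesis using that \<R>(1) by simp
      qed
      have avle: "\<bar>av R (f j)\<bar> \<le> \<kappa> * L j" if "R \<in> \<R>" for R j
      proof -
        have "\<bar>I R (f j)\<bar> \<le> \<kappa> * L j * vol R" using I_abs[of R "f j"] le[OF that, of j] that \<R>(2) by force
        then show ?thesis using posR[OF that] by (simp add: abs_divide pos_divide_le_eq)
      qed
      have gle: "\<bar>g j x\<bar> \<le> \<kappa> * L j" if "x \<in> P" for j x
        using that \<R>(3) gR avle by force
      have "loc P f - (\<Sum>R\<in>\<R>. loc R f) = loc P g - (\<Sum>R\<in>\<R>. loc R g)"
      proof (rule partition_defect[OF P \<R>(1,2,4,3)])
        fix R j assume R: "R \<in> \<R>"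
        have "I R (g j) = I R (\<lambda>_. av R (f j))" using gR[OF R] by (intro wint_cong) auto
        then show "I R (f j) = I R (g j)" using posR[OF R] by (simp add: wint_const)
      qed
      then have "\<bar>loc P f\<bar> \<le> \<bar>loc P g\<bar> + (\<Sum>R\<in>\<R>. \<bar>loc R g\<bar>) + (\<Sum>R\<in>\<R>. \<bar>loc R f\<bar>)"
        using sum_abs[of "\<lambda>R. loc R g" \<R>] sum_abs[of "\<lambda>R. loc R f" \<R>] by linarith
      also have "\<bar>loc P g\<bar> \<le> A * vol P * (\<Prod>j\<in>UNIV. \<kappa> * L j)"
        using gle kL by (intro bndt P) auto
      also have "(\<Sum>R\<in>\<R>. \<bar>loc R g\<bar>) \<le> (\<Sum>R\<in>\<R>. A * vol R * (\<Prod>j\<in>UNIV. \<kappa> * L j))"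
        using gle kL \<R> by (intro sum_mono bndt) auto
      also have "\<dots> = A * vol P * (\<Prod>j\<in>UNIV. \<kappa> * L j)"
        using vol_partition[OF \<R>(1,2,4)] \<R>(3) by (simp add: sum_distrib_left[symmetric] sum_distrib_right[symmetric])
      also have "(\<Sum>R\<in>\<R>. \<bar>loc R f\<bar>) = (\<Sum>R\<in>\<R> - \<S>. \<bar>loc R f\<bar>) + (\<Sum>R\<in>\<S>. \<bar>loc R f\<bar>)"
        by (rule sum.subset_diff[OF \<S>(5) \<R>(1)])
      also have "(\<Sum>R\<in>\<R> - \<S>. \<bar>loc R f\<bar>) \<le> (\<Sum>R\<in>\<R> - \<S>. A * vol R * (\<Prod>j\<in>UNIV. \<kappa> * L j))"
      proof (rule sum_mono)
        fix R assume R: "R \<in> \<R> - \<S>"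
        then have "card R = 1" using stop by (auto simp: \<S>_def)
        then obtain x where x: "R = {x}" by (auto simp: card_1_singleton_iff)
        have mx: "0 < m x" using posR[of R] R x by simp
        have "\<bar>f j y\<bar> \<le> \<kappa> * L j" if "y \<in> R" for j y
        proof -
          have "I R (\<lambda>x. \<bar>f j x\<bar>) \<le> L j * vol R" using R by (auto simp: \<S>_def not_less)
          then show ?thesis using that kL(2)[of j] mx by (simp add: x wint_def mult.commute)
        qed
        then show "\<bar>loc R f\<bar> \<le> A * vol R * (\<Prod>j\<in>UNIV. \<kappa> * L j)"
          using R \<R> kL by (intro bndt) auto
      qed
      also have "\<dots> \<le> (\<Sum>R\<in>\<R>. A * vol R * (\<Prod>j\<in>UNIV. \<kappa> * L j))"
      proof (rule sum_mono2[OF \<R>(1)])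
        fix R assume "R \<in> \<R> - (\<R> - \<S>)"
        then have "0 \<le> vol R" using posR[of R] by auto
        moreover have "0 \<le> (\<Prod>j\<in>UNIV. \<kappa> * L j)" using kL(1) by (intro prod_nonneg) (blast intro: less_imp_le)
        ultimately show "0 \<le> A * vol R * (\<Prod>j\<in>UNIV. \<kappa> * L j)" using A by simp
      qed auto
      also have "\<dots> = A * vol P * (\<Prod>j\<in>UNIV. \<kappa> * L j)"
        using vol_partition[OF \<R>(1,2,4)] \<R>(3) by (simp add: sum_distrib_left[symmetric] sum_distrib_right[symmetric])
      also have "(\<Sum>R\<in>\<S>. \<bar>loc R f\<bar>) \<le> (\<Sum>R\<in>\<S>. K1 * T R)"
      proof (rule sum_mono)
        fix R assume R: "R \<in> \<S>"
        then obtain j where j: "L j * vol R < I R (\<lambda>x. \<bar>f j x\<bar>)" by (auto simp: \<S>_def)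
        \<comment> \<open>\<open>P\<close> itself has not stopped, since \<open>sparse_M\<close> is
          at least 1. So the recursion reaches strictly smaller cubes only.\<close>
        have "R \<noteq> P"
        proof
          assume "R = P"
          moreover have "a j * vol P \<le> L j * vol P"
            unfolding L_def using M(1) a[of j] v by (intro mult_right_mono) (auto simp: mult_le_cancel_right1)
          ultimately show False using j Ia[of j] by simp
        qed
        then have "R \<subset> P" using R \<S>(4) by auto
        then show "\<bar>loc R f\<bar> \<le> K1 * T R"
          unfolding T_def using R \<S>(2) cube_finite[OF P] by (intro less.hyps) (auto intro: psubset_card_mono)
      qed
      finally have "\<bar>loc P f\<bar> \<le> K1 * (vol P * pa) + K1 * (\<Sum>R\<in>\<S>. T R)"
        unfolding pkL K1_def sum_distrib_left[symmetric] by (simp add: algebra_simps)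
      also have "\<dots> = K1 * (vol P * pa + (\<Sum>R\<in>\<S>. T R))" by (simp add: algebra_simps)
      also have "\<dots> \<le> K1 * T P"
      proof (rule mult_left_mono[OF _ K1])
        \<comment> \<open>The product of averages becomes a sum of powers, which can be treated for
          each position separately.\<close>
        have "vol P * pa \<le> vol P * (\<Sum>j\<in>UNIV. a j powr p j / p j)"
          unfolding pa_def using v a0 by (intro mult_left_mono prod_le_weighted_sum p_gt_1 p_sum) auto
        also have "\<dots> = (\<Sum>j\<in>UNIV. (vol P * a j powr p j) / p j)" by (simp add: sum_distrib_left)
        finally have 1: "vol P * pa + (\<Sum>R\<in>\<S>. T R) \<le> (\<Sum>j\<in>UNIV. (vol P * a j powr p j) / p j) + (\<Sum>R\<in>\<S>. T R)" by simp
        have eqT: "(\<Sum>R\<in>\<S>. T R) = (\<Sum>j\<in>UNIV. (\<Sum>R\<in>\<S>. 4 powr p j * I R (\<lambda>x. \<bar>f j x\<bar> powr p j) - vol R * (av R (\<lambda>x. \<bar>f j x\<bar>)) powr p j) / p j)"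
          unfolding T_def by (subst sum.swap) (simp only: sum_divide_distrib)
        have "(\<Sum>j\<in>UNIV. (vol P * a j powr p j) / p j) + (\<Sum>R\<in>\<S>. T R)
           = (\<Sum>j\<in>UNIV. (vol P * a j powr p j + (\<Sum>R\<in>\<S>. 4 powr p j * I R (\<lambda>x. \<bar>f j x\<bar> powr p j) - vol R * (av R (\<lambda>x. \<bar>f j x\<bar>)) powr p j)) / p j)"
          by (simp only: eqT sum.distrib add_divide_distrib)
        also have "\<dots> \<le> T P"
          unfolding T_def
        proof (intro sum_mono divide_right_mono)
          fix j
          have small: "(\<Sum>R\<in>\<S>. vol R) \<le> real CARD('n) / sparse_M * vol P"
          proof -
            have "(\<Sum>R\<in>\<S>. vol R) \<le> (\<Sum>R\<in>\<S>. \<Sum>j\<in>UNIV. I R (\<lambda>x. \<bar>f j x\<bar>) / L j)"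
            proof (rule sum_mono)
              fix R assume R: "R \<in> \<S>"
              then obtain j where j: "L j * vol R < I R (\<lambda>x. \<bar>f j x\<bar>)" by (auto simp: \<S>_def)
              have "vol R \<le> I R (\<lambda>x. \<bar>f j x\<bar>) / L j" using j L[of j] by (simp add: field_simps)
              also have "\<dots> \<le> (\<Sum>j\<in>UNIV. I R (\<lambda>x. \<bar>f j x\<bar>) / L j)"
                using R \<S>(2) L by (intro member_le_sum[of j UNIV "\<lambda>j. I R (\<lambda>x. \<bar>f j x\<bar>) / L j"] divide_nonneg_pos I_nonneg) auto
              finally show "vol R \<le> (\<Sum>j\<in>UNIV. I R (\<lambda>x. \<bar>f j x\<bar>) / L j)" .
            qed
            also have "\<dots> = (\<Sum>j\<in>UNIV. (\<Sum>R\<in>\<S>. I R (\<lambda>x. \<bar>f j x\<bar>)) / L j)"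
              by (subst sum.swap) (simp only: sum_divide_distrib)
            also have "\<dots> \<le> (\<Sum>j\<in>(UNIV::'n set). vol P / sparse_M)"
            proof (rule sum_mono)
              fix j
              have "(\<Sum>R\<in>\<S>. I R (\<lambda>x. \<bar>f j x\<bar>)) = I (\<Union>\<S>) (\<lambda>x. \<bar>f j x\<bar>)" by (rule I_partition[OF \<S>(1-3)])
              also have "\<dots> \<le> a j * vol P" unfolding Ia[symmetric] by (rule I_mono_set[OF P \<S>(4)]) simp
              finally have "(\<Sum>R\<in>\<S>. I R (\<lambda>x. \<bar>f j x\<bar>)) / L j \<le> (a j * vol P) / L j" using L[of j] by (intro divide_right_mono) auto
              also have "\<dots> = vol P / sparse_M" using a[of j] by (simp add: L_def)
              finally show "(\<Sum>R\<in>\<S>. I R (\<lambda>x. \<bar>f j x\<bar>)) / L j \<le> vol P / sparse_M" .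
            qed
            finally show ?thesis by simp
          qed
          have "2 * vol P * a j powr p j \<le> (\<Sum>R\<in>\<S>. vol R * (av R (\<lambda>x. \<bar>f j x\<bar>)) powr p j) + 4 powr p j * I (P - \<Union>\<S>) (\<lambda>x. \<bar>f j x\<bar> powr p j)"
            unfolding a_def
            by (rule carleson_step[OF P \<S>(1-4) p_gt_1 _ small M(2)]) (use n M(1) in auto)
          moreover have "I P (\<lambda>x. \<bar>f j x\<bar> powr p j) = I (P - \<Union>\<S>) (\<lambda>x. \<bar>f j x\<bar> powr p j) + (\<Sum>R\<in>\<S>. I R (\<lambda>x. \<bar>f j x\<bar> powr p j))"
            unfolding I_partition[OF \<S>(1-3)] unfolding wint_def by (rule sum.subset_diff[OF \<S>(4) cube_finite[OF P]])
          ultimately show "vol P * a j powr p j + (\<Sum>R\<in>\<S>. 4 powr p j * I R (\<lambda>x. \<bar>f j x\<bar> powr p j) - vol R * (av R (\<lambda>x. \<bar>f j x\<bar>)) powr p j)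
             \<le> 4 powr p j * I P (\<lambda>x. \<bar>f j x\<bar> powr p j) - vol P * (av P (\<lambda>x. \<bar>f j x\<bar>)) powr p j"
            by (simp add: sum_subtractf sum_distrib_left[symmetric] a_def[symmetric] algebra_simps)
        qed (use pj in \<open>auto intro: less_imp_le\<close>)
        finally show "vol P * pa + (\<Sum>R\<in>\<S>. T R) \<le> T P" using 1 by linarith
      qed
      finally show ?thesis by (simp add: T_def)
    qed
  qed
  show ?thesis
  proof (cases "\<exists>j. nrm j P (f j) = 0")
    case True
    then obtain j where "nrm j P (f j) = 0" by blast
    then have "I P (\<lambda>x. \<bar>f j x\<bar> powr p j) = 0" by (simp add: nrm_def)
    then have "f j x = 0" if "x \<in> P" for x using I_eq_0D[OF P _ _ that, of "\<lambda>x. \<bar>f j x\<bar> powr p j"] by simp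
    then have "loc P f = 0" by (intro form_zero[of _ j]) (auto simp: restr_def)
    moreover have 0: "(\<Prod>j\<in>UNIV. nrm j P (f j)) = 0" using True by (auto intro!: prod_zero)
    ultimately show ?thesis unfolding 0 by simp
  next
    case False
    \<comment> \<open>With all norms scaled to one, the additive bound turns into a constant;
      homogeneity then restores the product of the norms.\<close>
    define t where "t j = nrm j P (f j)" for j
    have t: "0 < t j" for j using False nrm_nonneg[of j P "f j"] by (metis t_def less_eq_real_def)
    define k where "k j x = f j x / t j" for j x
    have t0: "t j \<noteq> 0" for j using t[of j] by simp
    have "(\<lambda>s. restr P (f s)) = (\<lambda>s x. t s * restr P (k s) x)" using t0 by (auto simp: restr_def k_def fun_eq_iff)
    then have eq: "loc P f = (\<Prod>j\<in>UNIV. t j) * loc P k" using form_scale[of t "\<lambda>s. restr P (k s)"] by simp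
    have k1: "I P (\<lambda>x. \<bar>k j x\<bar> powr p j) = 1" for j
    proof -
      define S where "S = I P (\<lambda>x. \<bar>f j x\<bar> powr p j)"
      have S: "0 \<le> S" unfolding S_def using P by (intro I_nonneg) auto
      have tp: "t j powr p j = S" using pj[of j] S by (simp add: t_def nrm_def S_def[symmetric] powr_powr)
      have "I P (\<lambda>x. \<bar>k j x\<bar> powr p j) = I P (\<lambda>x. \<bar>f j x\<bar> powr p j / S)"
        using t[of j] tp by (intro wint_cong) (simp add: k_def powr_divide)
      also have "\<dots> = 1" using tp t[of j] by (auto simp: wint_divide S_def[symmetric])
      finally show ?thesis .
    qed
    have "\<bar>loc P k\<bar> \<le> K1 * (\<Sum>j\<in>UNIV. (4 powr p j * I P (\<lambda>x. \<bar>k j x\<bar> powr p j) - vol P * (av P (\<lambda>x. \<bar>k j x\<bar>)) powr p j) / p j)"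
      by (rule claim[OF P])
    also have "\<dots> \<le> K1 * (\<Sum>j\<in>UNIV. 4 powr p j)"
    proof (intro mult_left_mono[OF _ K1] sum_mono)
      fix j
      have "(4 powr p j * I P (\<lambda>x. \<bar>k j x\<bar> powr p j) - vol P * (av P (\<lambda>x. \<bar>k j x\<bar>)) powr p j) / p j \<le> 4 powr p j / p j"
        using pj[of j] vol_pos[OF P] by (intro divide_right_mono) (auto simp: k1)
      also have "\<dots> \<le> 4 powr p j / 1" using p_gt_1[of j] by (intro divide_left_mono) auto
      finally show "(4 powr p j * I P (\<lambda>x. \<bar>k j x\<bar> powr p j) - vol P * (av P (\<lambda>x. \<bar>k j x\<bar>)) powr p j) / p j \<le> 4 powr p j" by simp
    qed
    finally have "\<bar>loc P k\<bar> \<le> lp_const A" by (simp add: lp_const_def K1_def)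
    moreover have "0 \<le> (\<Prod>j\<in>UNIV. t j)" using t by (intro prod_nonneg) (auto intro: less_imp_le)
    ultimately show ?thesis unfolding eq by (simp add: abs_mult mult_left_mono mult.commute t_def[symmetric])
  qed
qed

end

section \<open>Dyadic cubes\<close>

text \<open>Cubes are described by a point and a scale, without reference to a corner, so that
  nesting becomes arithmetic of floors.\<close>

definition cube_of :: "int \<Rightarrow> 'a::euclidean_space \<Rightarrow> 'a set" where
  "cube_of m x = {y. \<forall>b\<in>Basis. \<lfloor>(y \<bullet> b) / 2 powi m\<rfloor> = \<lfloor>(x \<bullet> b) / 2 powi m\<rfloor>}"

lemma mem_dyadic_interval:
  fixes y :: real
  shows "y \<in> {2 powi m * real_of_int l ..< 2 powi m * (real_of_int l + 1)} \<longleftrightarrow> \<lfloor>y / 2 powi m\<rfloor> = l"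
proof -
  have "(0::real) < 2 powi m" by simp
  then show ?thesis by (auto simp: floor_eq_iff field_simps)
qed

lemma dyadic_cubes_of_scale_eq: "dyadic_cubes_of_scale m = range (cube_of m)"
proof (intro equalityI subsetI)
  fix Q :: "'a set" assume "Q \<in> dyadic_cubes_of_scale m"
  then obtain l :: "'a \<Rightarrow> int" where l: "Q = {x. \<forall>b\<in>Basis. \<lfloor>(x \<bullet> b) / 2 powi m\<rfloor> = l b}"
    unfolding dyadic_cubes_of_scale_def mem_dyadic_interval by blast
  define x :: 'a where "x = (\<Sum>b\<in>Basis. (2 powi m * real_of_int (l b)) *\<^sub>R b)"
  have "x \<bullet> b = 2 powi m * real_of_int (l b)" if "b \<in> Basis" for b using that by (simp add: x_def)
  then have "Q = cube_of m x" unfolding l cube_of_def by auto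
  then show "Q \<in> range (cube_of m)" by blast
next
  fix Q :: "'a set" assume "Q \<in> range (cube_of m)"
  then obtain x :: 'a where "Q = cube_of m x" by blast
  then show "Q \<in> dyadic_cubes_of_scale m"
    unfolding dyadic_cubes_of_scale_def mem_dyadic_interval cube_of_def by auto
qed

lemma cube_of_self [simp]: "x \<in> cube_of m x"
  by (simp add: cube_of_def)

lemma cube_of_eq: "y \<in> cube_of m x \<Longrightarrow> cube_of m y = cube_of m x"
  by (auto simp: cube_of_def)

lemma dyadic_floor_coarser:
  fixes t :: real assumes "m \<le> m'"
  shows "\<lfloor>t / 2 powi m'\<rfloor> = \<lfloor>t / 2 powi m\<rfloor> div 2 ^ nat (m' - m)"
proof -
  have "(2::real) powi m' = 2 powi m * 2 powi (m' - m)" by (simp add: power_int_add[symmetric])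
  also have "(2::real) powi (m' - m) = real_of_int (2 ^ nat (m' - m))" using assms by (simp add: power_int_def)
  finally have "t / 2 powi m' = (t / 2 powi m) / real_of_int (2 ^ nat (m' - m))" by simp
  then show ?thesis by (simp only: floor_divide_real_eq_div zero_le_power zero_le_numeral)
qed

lemma cube_of_coarser: "m \<le> m' \<Longrightarrow> cube_of m x \<subseteq> cube_of m' x"
  by (auto simp: cube_of_def dyadic_floor_coarser[of m m'])

lemma scale_cube_of: "Q \<in> dyadic_cubes_of_scale m \<Longrightarrow> x \<in> Q \<Longrightarrow> Q = cube_of m x"
  unfolding dyadic_cubes_of_scale_eq using cube_of_eq by blast

lemma cube_of_scale: "cube_of m x \<in> dyadic_cubes_of_scale m"
  by (simp add: dyadic_cubes_of_scale_eq)

lemma scale_subset: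
  assumes "Q \<in> dyadic_cubes_of_scale m" "R \<in> dyadic_cubes_of_scale m'" "m \<le> m'" "Q \<inter> R \<noteq> {}"
  shows "Q \<subseteq> R"
proof -
  obtain x where "x \<in> Q" "x \<in> R" using assms by blast
  then show ?thesis using assms scale_cube_of cube_of_coarser by metis
qed

lemma scale_disjoint:
  assumes "Q \<in> dyadic_cubes_of_scale m" "R \<in> dyadic_cubes_of_scale m" "Q \<noteq> R" shows "Q \<inter> R = {}"
  using assms scale_cube_of by blast

lemma scale_nonempty: "Q \<in> dyadic_cubes_of_scale m \<Longrightarrow> Q \<noteq> {}"
  unfolding dyadic_cubes_of_scale_eq using cube_of_self by blast

lemma cube_of_borel: "cube_of m (x::'a::euclidean_space) \<in> sets borel"
proof -
  have "cube_of m x = (\<Inter>b\<in>Basis. {y. y \<bullet> b \<in> {2 powi m * real_of_int \<lfloor>(x \<bullet> b) / 2 powi m\<rfloor> ..< 2 powi m * (real_of_int \<lfloor>(x \<bullet> b) / 2 powi m\<rfloor> + 1)}})"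
    unfolding mem_dyadic_interval by (auto simp: cube_of_def)
  also have "\<dots> \<in> sets borel"
    by (intro sets.finite_INT) (auto simp: nonempty_Basis)
  finally show ?thesis .
qed

text \<open>A half-open cube lies between an open and a closed box of equal measure.\<close>

lemma cube_of_lmeasurable: "cube_of m (x::'a::euclidean_space) \<in> lmeasurable"
  and measure_cube_of: "measure lebesgue (cube_of m x) = (2 powi m) ^ DIM('a)"
proof -
  define l where "l b = \<lfloor>(x \<bullet> b) / 2 powi m\<rfloor>" for b
  define a :: 'a where "a = (\<Sum>b\<in>Basis. (2 powi m * real_of_int (l b)) *\<^sub>R b)"
  define c :: 'a where "c = (\<Sum>b\<in>Basis. (2 powi m * (real_of_int (l b) + 1)) *\<^sub>R b)"
  have ab: "a \<bullet> b = 2 powi m * real_of_int (l b)" "c \<bullet> b = 2 powi m * (real_of_int (l b) + 1)" if "b \<in> Basis" for b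
    using that by (simp_all add: a_def c_def)
  have mem: "y \<in> cube_of m x \<longleftrightarrow> (\<forall>b\<in>Basis. a \<bullet> b \<le> y \<bullet> b \<and> y \<bullet> b < c \<bullet> b)" for y
    unfolding cube_of_def using mem_dyadic_interval[of _ m "l _"] ab by (auto simp: l_def)
  have sub: "box a c \<subseteq> cube_of m x" "cube_of m x \<subseteq> cbox a c"
    using mem by (auto simp: mem_box less_imp_le)
  have ms: "cube_of m x \<in> sets lebesgue" using cube_of_borel by (metis sets_completionI_sets sets_lborel)
  show lm: "cube_of m x \<in> lmeasurable"
    by (rule fmeasurableI2[OF lmeasurable_cbox sub(2) ms])
  have le: "a \<bullet> b \<le> c \<bullet> b" "(c - a) \<bullet> b = 2 powi m" if "b \<in> Basis" for b
    using ab[OF that] by (simp_all add: inner_diff_left algebra_simps)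
  have pr: "(\<Prod>b\<in>Basis. (c - a) \<bullet> b) = (2 powi m) ^ DIM('a)" using le by simp
  have "measure lebesgue (box a c) = (2 powi m) ^ DIM('a)" "measure lebesgue (cbox a c) = (2 powi m) ^ DIM('a)"
    using le pr by (simp_all add: measure_lborel_box_eq measure_lborel_cbox_eq)
  moreover have "measure lebesgue (box a c) \<le> measure lebesgue (cube_of m x)"
    by (rule measure_mono_fmeasurable[OF sub(1) _ lm]) simp
  moreover have "measure lebesgue (cube_of m x) \<le> measure lebesgue (cbox a c)"
    by (rule measure_mono_fmeasurable[OF sub(2) ms]) simp
  ultimately show "measure lebesgue (cube_of m x) = (2 powi m) ^ DIM('a)" by linarith
qed

lemma scale_lmeasurable: "Q \<in> dyadic_cubes_of_scale m \<Longrightarrow> Q \<in> lmeasurable"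
  and measure_scale: "(Q::'a::euclidean_space set) \<in> dyadic_cubes_of_scale m \<Longrightarrow> measure lebesgue Q = (2 powi m) ^ DIM('a)"
  unfolding dyadic_cubes_of_scale_eq using cube_of_lmeasurable measure_cube_of by blast+

lemma measure_scale_pos: "Q \<in> dyadic_cubes_of_scale m \<Longrightarrow> 0 < measure lebesgue Q"
  by (simp add: measure_scale)

lemma scale_unique:
  assumes "Q \<in> dyadic_cubes_of_scale m" "Q \<in> dyadic_cubes_of_scale m'" shows "m = m'"
proof -
  have "((2::real) powi m) ^ DIM('a) = (2 powi m') ^ DIM('a)" using measure_scale assms by metis
  then have "(2::real) powi m = 2 powi m'" by (rule power_eq_imp_eq_base) (auto simp: less_imp_le)
  then show ?thesis by (metis linorder_neqE_linordered_idom order_less_irrefl power_int_strict_increasing one_less_numeral_iff semiring_norm(76))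
qed

text \<open>A count by volume: arbitrarily many disjoint cubes of equal volume do not fit into
  \<open>P\<close>.\<close>

lemma finite_subcubes:
  assumes P: "P \<in> dyadic_cubes_of_scale M"
  shows "finite {I \<in> dyadic_cubes_of_scale N. I \<subseteq> (P::'a::euclidean_space set)}" (is "finite ?X")
proof (rule ccontr)
  assume inf: "infinite ?X"
  define v where "v = ((2::real) powi N) ^ DIM('a)"
  have v: "0 < v" by (simp add: v_def)
  obtain k :: nat where k: "measure lebesgue P < real k * v" using reals_Archimedean3[OF v] by blast
  obtain Y where Y: "Y \<subseteq> ?X" "finite Y" "card Y = k" using infinite_arbitrarily_large[OF inf] by metis
  have disj: "a \<inter> b = {}" if "a \<in> Y" "b \<in> Y" "a \<noteq> b" for a b
    using scale_disjoint[of a N b] that Y(1) by blast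
  have "real k * v = (\<Sum>I\<in>Y. measure lebesgue I)"
    using Y measure_scale[of _ N] by (subst sum.cong[OF refl, of Y _ "\<lambda>_. v"]) (auto simp: v_def)
  also have "\<dots> = measure lebesgue (\<Union>Y)"
    using Y scale_lmeasurable[of _ N] disj
    by (intro measure_Union'[symmetric]) (auto simp: pairwise_def disjnt_def)
  also have "\<dots> \<le> measure lebesgue P"
    using Y scale_lmeasurable[of _ N] scale_lmeasurable[OF P]
    by (intro measure_mono_fmeasurable) (auto intro!: sets.finite_Union dest: fmeasurableD)
  finally show False using k by simp
qed

section \<open>Integrals of products\<close>

lemma prod_Basis_vec:
  fixes f :: "('a::euclidean_space)^'n \<Rightarrow> 'b::comm_monoid_mult"
  shows "(\<Prod>b\<in>Basis. f b) = (\<Prod>j\<in>UNIV. \<Prod>b\<in>Basis. f (axis j b))"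
proof -
  have "(\<Prod>b\<in>Basis. f b) = (\<Prod>b\<in>(\<Union>j\<in>UNIV. axis j ` Basis). f b)"
    by (rule arg_cong[where f="prod f"]) (auto simp: Basis_vec_def)
  also have "\<dots> = (\<Prod>j\<in>UNIV. \<Prod>b\<in>axis j ` Basis. f b)"
    by (rule prod.UNION_disjoint) (auto simp: axis_eq_axis)
  also have "\<dots> = (\<Prod>j\<in>UNIV. \<Prod>b\<in>Basis. f (axis j b))"
    by (intro prod.cong refl prod.reindex_cong[where l="axis _"]) (auto simp: inj_on_def axis_eq_axis)
  finally show ?thesis .
qed

section \<open>Lebesgue measure on tuples as a product measure\<close>

interpretation lborel_product: product_sigma_finite "\<lambda>_. lborel :: 'a::euclidean_space measure"
  by standard

text \<open>Lebesgue measure is complete: a preimage that differs from a measurable set by a null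
  set is measurable.\<close>

lemma lebesgue_measurable_cong_AE:
  fixes g h :: "'a::euclidean_space \<Rightarrow> real"
  assumes "AE x in lebesgue. g x = h x" "h \<in> borel_measurable lebesgue"
  shows "g \<in> borel_measurable lebesgue"
proof (rule measurableI)
  fix A :: "real set" assume A: "A \<in> sets borel"
  have "AE x in lebesgue. x \<in> h -` A \<inter> space lebesgue \<longleftrightarrow> x \<in> g -` A \<inter> space lebesgue"
    using assms(1) by (rule AE_mp) auto
  then show "g -` A \<inter> space lebesgue \<in> sets lebesgue"
    by (rule completion.in_sets_AE[OF _ measurable_sets[OF assms(2) A]]) auto
qed simp

lemma measurable_chi:
  "(\<lambda>w. \<chi> j. w j) \<in> Pi\<^sub>M UNIV (\<lambda>_. lborel :: 'a::euclidean_space measure) \<rightarrow>\<^sub>M (borel :: ('a^'n) measure)"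
proof (rule borel_measurable_euclidean_space[THEN iffD2], intro ballI)
  fix b :: "'a^'n" assume "b \<in> Basis"
  then obtain i u where b: "b = axis i u" by (auto simp: Basis_vec_def)
  have "(\<lambda>w. w i \<bullet> u) \<in> borel_measurable (Pi\<^sub>M UNIV (\<lambda>_. lborel :: 'a measure))" by measurable
  then show "(\<lambda>w. (\<chi> j. w j) \<bullet> b) \<in> borel_measurable (Pi\<^sub>M UNIV (\<lambda>_. lborel :: 'a measure))"
    by (simp add: b inner_axis)
qed

text \<open>Lebesgue measure is determined by its values on boxes, and the side lengths of a box in
  the space of tuples multiply position by position.\<close>

lemma lborel_vec_eq_distr:
  "(lborel :: (('a::euclidean_space)^'n) measure) = distr (Pi\<^sub>M UNIV (\<lambda>_. lborel)) borel (\<lambda>w. \<chi> j. w j)"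
proof (rule lborel_eqI)
  note meas = measurable_chi
  fix l u :: "'a^'n" assume le: "\<And>b. b \<in> Basis \<Longrightarrow> l \<bullet> b \<le> u \<bullet> b"
  have le': "l $ j \<bullet> b \<le> u $ j \<bullet> b" if "b \<in> Basis" for j b
    using le[of "axis j b"] that by (auto simp: inner_axis Basis_vec_def)
  have "(\<lambda>w. \<chi> j. w j) -` box l u \<inter> space (Pi\<^sub>M UNIV (\<lambda>_. lborel)) = Pi\<^sub>E UNIV (\<lambda>j. box (l $ j) (u $ j))"
    by (auto simp: space_PiM mem_box Basis_vec_def inner_axis PiE_def Pi_def)
  then have "emeasure (distr (Pi\<^sub>M UNIV (\<lambda>_. lborel)) borel (\<lambda>w. \<chi> j. w j)) (box l u)
      = emeasure (Pi\<^sub>M UNIV (\<lambda>_. lborel)) (Pi\<^sub>E UNIV (\<lambda>j. box (l $ j) (u $ j)))"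
    by (subst emeasure_distr[OF meas]) auto
  also have "\<dots> = (\<Prod>j\<in>UNIV. emeasure lborel (box (l $ j) (u $ j)))"
    by (rule lborel_product.emeasure_PiM) auto
  also have "\<dots> = (\<Prod>j\<in>UNIV. ennreal (\<Prod>b\<in>Basis. (u $ j - l $ j) \<bullet> b))"
    using le' by (simp add: emeasure_lborel_box_eq)
  also have "\<dots> = ennreal (\<Prod>j\<in>UNIV. \<Prod>b\<in>Basis. (u $ j - l $ j) \<bullet> b)"
    using le' by (subst prod_ennreal) (auto intro!: prod_nonneg simp: inner_diff_left)
  also have "(\<Prod>j\<in>UNIV. \<Prod>b\<in>Basis. (u $ j - l $ j) \<bullet> b) = (\<Prod>b\<in>Basis. (u - l) \<bullet> b)"
    unfolding prod_Basis_vec by (simp add: inner_axis)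
  finally show "emeasure (distr (Pi\<^sub>M UNIV (\<lambda>_. lborel)) borel (\<lambda>w. \<chi> j. w j)) (box l u) = ennreal (\<Prod>b\<in>Basis. (u - l) \<bullet> b)" .
qed simp

text \<open>Fubini's theorem for Borel representatives of the factors. Changing a factor on a null
  set changes the product only on a null cylinder.\<close>

lemma integral_prod_vec:
  fixes g :: "'n::finite \<Rightarrow> 'a::euclidean_space \<Rightarrow> real"
  assumes g: "\<And>j. integrable lebesgue (g j)"
  shows "integrable lebesgue (\<lambda>x::'a^'n. \<Prod>j\<in>UNIV. g j (x $ j))"
    and "(LINT x|lebesgue. (\<Prod>j\<in>UNIV. g j ((x::'a^'n) $ j))) = (\<Prod>j\<in>UNIV. (LINT x|lebesgue. g j x))"
proof -
  have "\<exists>h\<in>borel_measurable lborel. AE x in lborel. g j x = h x" for j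
    using g[of j] by (intro completion_ex_borel_measurable_real) (auto dest: borel_measurable_integrable)
  then obtain h where hm: "\<And>j. h j \<in> borel_measurable lborel" and h: "\<And>j. AE x in lborel. g j x = h j x" by metis
  have hl: "h j \<in> borel_measurable lebesgue" for j using hm measurable_completion by blast
  have ae: "AE x in lebesgue. g j x = h j x" for j using h by (rule AE_completion)
  have hi: "integrable lborel (h j)" for j
  proof -
    have "integrable lebesgue (h j)" using g[of j] ae[of j] hl by (subst integrable_cong_AE[symmetric]) (auto dest: borel_measurable_integrable)
    then show ?thesis using hm integrable_completion by blast
  qed
  let ?\<chi> = "(\<lambda>w. \<chi> j. w j) :: ('n \<Rightarrow> 'a) \<Rightarrow> 'a^'n"
  note meas = measurable_chi
  have vm: "(\<lambda>x::'a^'n. x $ j) \<in> borel_measurable borel" for j by (simp add: borel_measurable_continuous_onI continuous_on_component)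
  have Hm: "(\<lambda>x::'a^'n. \<Prod>j\<in>UNIV. h j (x $ j)) \<in> borel_measurable borel"
    using hm vm by (intro borel_measurable_prod measurable_compose[OF vm]) auto
  have null: "AE x in (lborel :: ('a^'n) measure). g j (x $ j) = h j (x $ j)" for j
  proof -
    obtain N where N: "{x. g j x \<noteq> h j x} \<subseteq> N" "emeasure lborel N = 0" "N \<in> sets lborel"
      using h[of j] by (auto elim: AE_E)
    have "emeasure lborel {x::'a^'n. x $ j \<in> N} = emeasure (Pi\<^sub>M UNIV (\<lambda>_. lborel)) (Pi\<^sub>E UNIV (\<lambda>i. if i = j then N else UNIV))"
    proof -
      have "{x::'a^'n. x $ j \<in> N} = (\<lambda>x. x $ j) -` N \<inter> space borel" by auto
      then have s: "{x::'a^'n. x $ j \<in> N} \<in> sets borel" using measurable_sets[OF vm] N(3) by (metis sets_lborel)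
      have "?\<chi> -` {x. x $ j \<in> N} \<inter> space (Pi\<^sub>M UNIV (\<lambda>_. lborel)) = Pi\<^sub>E UNIV (\<lambda>i. if i = j then N else UNIV)"
        by (auto simp: space_PiM PiE_def Pi_def split: if_splits)
      then show ?thesis by (subst lborel_vec_eq_distr, subst emeasure_distr[OF meas s]) simp
    qed
    also have "\<dots> = (\<Prod>i\<in>UNIV. emeasure lborel (if i = j then N else UNIV))"
      using N(3) by (intro lborel_product.emeasure_PiM) auto
    \<comment> \<open>One factor is zero and the others, if any, are infinite; the product of
      extended nonnegative reals is zero.\<close>
    also have "\<dots> = 0" using N(2) by (intro prod_zero) auto
    finally have e0: "emeasure lborel {x::'a^'n. x $ j \<in> N} = 0" .
    have "{x::'a^'n. x $ j \<in> N} \<in> sets lborel"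
    proof -
      have "{x::'a^'n. x $ j \<in> N} = (\<lambda>x. x $ j) -` N \<inter> space borel" by auto
      then show ?thesis using measurable_sets[OF vm] N(3) by (metis sets_lborel)
    qed
    then show ?thesis using e0 N(1) by (intro AE_I[of _ _ "{x. x $ j \<in> N}"]) auto
  qed
  have AE: "AE x in lebesgue. (\<Prod>j\<in>UNIV. g j ((x::'a^'n) $ j)) = (\<Prod>j\<in>UNIV. h j (x $ j))"
  proof -
    have "AE x in (lborel :: ('a^'n) measure). \<forall>j\<in>UNIV. g j (x $ j) = h j (x $ j)"
      using null by (intro AE_finite_allI) auto
    then have "AE x in (lborel :: ('a^'n) measure). (\<Prod>j\<in>UNIV. g j (x $ j)) = (\<Prod>j\<in>UNIV. h j (x $ j))"
      by (rule AE_mp) (auto intro!: prod.cong)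
    then show ?thesis by (rule AE_completion)
  qed
  have Hl: "(\<lambda>x::'a^'n. \<Prod>j\<in>UNIV. h j (x $ j)) \<in> borel_measurable lebesgue"
    by (rule measurable_completion) (use Hm in simp)
  have Gl: "(\<lambda>x::'a^'n. \<Prod>j\<in>UNIV. g j (x $ j)) \<in> borel_measurable lebesgue"
    by (rule lebesgue_measurable_cong_AE[OF AE Hl])
  have Hint: "integrable lborel (\<lambda>x::'a^'n. \<Prod>j\<in>UNIV. h j (x $ j))"
    and Heq: "(LINT x|lborel. (\<Prod>j\<in>UNIV. h j ((x::'a^'n) $ j))) = (\<Prod>j\<in>UNIV. (LINT x|lborel. h j x))"
  proof -
    have "integrable (Pi\<^sub>M UNIV (\<lambda>_. lborel)) (\<lambda>w. \<Prod>j\<in>UNIV. h j (w j))"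
      using hi by (intro lborel_product.product_integrable_prod) auto
    then show "integrable lborel (\<lambda>x::'a^'n. \<Prod>j\<in>UNIV. h j (x $ j))"
      by (subst lborel_vec_eq_distr, subst integrable_distr_eq[OF meas Hm]) simp
    have "(LINT x|lborel. (\<Prod>j\<in>UNIV. h j ((x::'a^'n) $ j))) = (LINT w|Pi\<^sub>M UNIV (\<lambda>_. lborel). (\<Prod>j\<in>UNIV. h j (w j)))"
      by (subst lborel_vec_eq_distr, subst integral_distr[OF meas Hm]) simp
    also have "\<dots> = (\<Prod>j\<in>UNIV. (LINT x|lborel. h j x))"
      using hi by (intro lborel_product.product_integral_prod) auto
    finally show "(LINT x|lborel. (\<Prod>j\<in>UNIV. h j ((x::'a^'n) $ j))) = (\<Prod>j\<in>UNIV. (LINT x|lborel. h j x))" .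
  qed
  have Hm': "(\<lambda>x::'a^'n. \<Prod>j\<in>UNIV. h j (x $ j)) \<in> borel_measurable lborel" using Hm by simp
  have "integrable lebesgue (\<lambda>x::'a^'n. \<Prod>j\<in>UNIV. h j (x $ j))" using Hint integrable_completion[OF Hm'] by simp
  then show "integrable lebesgue (\<lambda>x::'a^'n. \<Prod>j\<in>UNIV. g j (x $ j))"
    using AE Gl Hl by (subst integrable_cong_AE) auto
  have "(LINT x|lebesgue. (\<Prod>j\<in>UNIV. g j ((x::'a^'n) $ j))) = (LINT x|lebesgue. (\<Prod>j\<in>UNIV. h j ((x::'a^'n) $ j)))"
    using AE Gl Hl by (intro integral_cong_AE) auto
  also have "\<dots> = (\<Prod>j\<in>UNIV. (LINT x|lborel. h j x))" using integral_completion[OF Hm'] Heq by simp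
  also have "\<dots> = (\<Prod>j\<in>UNIV. (LINT x|lebesgue. g j x))"
  proof (rule prod.cong[OF refl])
    fix j
    have "(LINT x|lborel. h j x) = (LINT x|lebesgue. h j x)" using integral_completion[OF hm] by simp
    also have "\<dots> = (LINT x|lebesgue. g j x)"
      using ae hl g by (intro integral_cong_AE[symmetric]) (auto dest: borel_measurable_integrable)
    finally show "(LINT x|lborel. h j x) = (LINT x|lebesgue. g j x)" .
  qed
  finally show "(LINT x|lebesgue. (\<Prod>j\<in>UNIV. g j ((x::'a^'n) $ j))) = (\<Prod>j\<in>UNIV. (LINT x|lebesgue. g j x))" .
qed

lemma scale_cube_vec:
  fixes Q :: "(('a::euclidean_space)^'n) set"
  assumes "Q \<in> dyadic_cubes_of_scale m"
  shows "\<exists>R. (\<forall>j. R j \<in> dyadic_cubes_of_scale m) \<and> (\<forall>x. x \<in> Q \<longleftrightarrow> (\<forall>j. x $ j \<in> R j))"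
proof -
  obtain z where z: "Q = cube_of m z" using assms by (auto simp: dyadic_cubes_of_scale_eq)
  have "x \<in> Q \<longleftrightarrow> (\<forall>j. x $ j \<in> cube_of m (z $ j))" for x
    unfolding z cube_of_def by (auto simp: Basis_vec_def inner_axis)
  then show ?thesis by (intro exI[of _ "\<lambda>j. cube_of m (z $ j)"]) (simp add: cube_of_scale)
qed

section \<open>The finite model attached to a dyadic cube\<close>

text \<open>\<open>N\<close> is the scale of the atoms. It will be so small that neither the kernel
  nor the given test functions distinguish points of one atom.\<close>

locale dyadic_model =
  fixes N top_scale :: int and P :: "(real^'d::finite) set"
  assumes P_scale: "P \<in> dyadic_cubes_of_scale top_scale"
begin

definition atoms :: "(real^'d) set set" where
  "atoms = {I \<in> dyadic_cubes_of_scale N. I \<subseteq> P}"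

definition atm :: "(real^'d) set \<Rightarrow> (real^'d) set set" where
  "atm Q = {I \<in> atoms. I \<subseteq> Q}"

definition coarse :: "(real^'d) set \<Rightarrow> bool" where
  "coarse Q \<longleftrightarrow> Q \<subseteq> P \<and> (\<exists>m\<ge>N. Q \<in> dyadic_cubes_of_scale m)"

definition DD :: "(real^'d) set set set" where
  "DD = atm ` {Q. coarse Q}"

text \<open>A cube of the tree is known only as a set of atoms, so its dyadic children are taken
  from the union. For a single atom they contain no atoms, a case that the tree axioms
  exclude.\<close>

definition chd :: "(real^'d) set set \<Rightarrow> (real^'d) set set set" where
  "chd A = atm ` {R. dyadic_child R (\<Union>A)}"

abbreviation (input) meas :: "(real^'d) set \<Rightarrow> real" where "meas \<equiv> measure lebesgue"

lemma finite_atoms: "finite atoms"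
  unfolding atoms_def by (rule finite_subcubes[OF P_scale])

lemma finite_at: "finite (atm Q)"
  using finite_atoms by (simp add: atm_def)

lemma atom_scale: "I \<in> atoms \<Longrightarrow> I \<in> dyadic_cubes_of_scale N"
  by (simp add: atoms_def)

lemma atoms_disjoint: "I \<in> atoms \<Longrightarrow> J \<in> atoms \<Longrightarrow> I \<noteq> J \<Longrightarrow> I \<inter> J = {}"
  using scale_disjoint atom_scale by blast

lemma meas_atom: "I \<in> atoms \<Longrightarrow> 0 < meas I"
  using measure_scale_pos atom_scale by blast

lemma cube_of_in_at: "coarse Q \<Longrightarrow> x \<in> Q \<Longrightarrow> cube_of N x \<in> atm Q"
proof -
  assume Q: "coarse Q" and x: "x \<in> Q"
  then obtain m where m: "N \<le> m" "Q \<in> dyadic_cubes_of_scale m" "Q \<subseteq> P" by (auto simp: coarse_def)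
  then have "cube_of N x \<subseteq> Q" using x cube_of_coarser scale_cube_of by metis
  then show ?thesis using m by (auto simp: atm_def atoms_def cube_of_scale)
qed

lemma at_finest:
  assumes "Q \<in> dyadic_cubes_of_scale N" "Q \<subseteq> P" shows "atm Q = {Q}"
proof -
  have "I = Q" if "I \<in> atoms" "I \<subseteq> Q" for I
  proof (rule ccontr)
    assume "I \<noteq> Q"
    then have "I \<inter> Q = {}" using scale_disjoint atom_scale[OF that(1)] assms(1) by blast
    then show False using that(2) scale_nonempty[OF atom_scale[OF that(1)]] by auto
  qed
  then show ?thesis using assms by (auto simp: atm_def atoms_def)
qed

lemma Union_at: "coarse Q \<Longrightarrow> \<Union>(atm Q) = Q"
  using cube_of_in_at cube_of_self by (fastforce simp: atm_def)

lemma at_mono: "Q \<subseteq> R \<Longrightarrow> atm Q \<subseteq> atm R"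
  by (auto simp: atm_def)

lemma DD_iff: "A \<in> DD \<longleftrightarrow> coarse (\<Union>A) \<and> A = atm (\<Union>A)"
  unfolding DD_def using Union_at by (auto simp: image_iff)

lemma at_in_DD: "coarse Q \<Longrightarrow> atm Q \<in> DD"
  by (auto simp: DD_def)

lemma at_nonempty: "coarse Q \<Longrightarrow> atm Q \<noteq> {}"
  using cube_of_in_at scale_nonempty by (metis coarse_def equals0D ex_in_conv)

lemma indicator_at:
  assumes "coarse Q" shows "indicat_real Q x = (\<Sum>I\<in>atm Q. indicat_real I x)"
proof (cases "x \<in> Q")
  case True
  then have c: "cube_of N x \<in> atm Q" by (rule cube_of_in_at[OF assms])
  have "(\<Sum>I\<in>atm Q. indicat_real I x) = (\<Sum>I\<in>atm Q. if I = cube_of N x then 1 else 0)"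
    using scale_cube_of by (intro sum.cong) (auto simp: atm_def atoms_def indicator_def)
  then show ?thesis using c finite_at True by simp
next
  case False
  then have "indicat_real I x = 0" if "I \<in> atm Q" for I using that by (auto simp: atm_def indicator_def)
  then show ?thesis using False by simp
qed

lemma integral_at:
  assumes Q: "coarse Q" and h: "integrable lebesgue h"
  shows "(LINT x|lebesgue. indicat_real Q x * h x) = (\<Sum>I\<in>atm Q. LINT x|lebesgue. indicat_real I x * h x)"
proof -
  have "(LINT x|lebesgue. indicat_real Q x * h x) = (LINT x|lebesgue. (\<Sum>I\<in>atm Q. indicat_real I x * h x))"
    by (simp add: indicator_at[OF Q] sum_distrib_right)
  also have "\<dots> = (\<Sum>I\<in>atm Q. LINT x|lebesgue. indicat_real I x * h x)"
    using h scale_lmeasurable[OF atom_scale]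
    by (intro Bochner_Integration.integral_sum integrable_real_mult_indicator[of _ lebesgue h, unfolded mult.commute[of "h _"]])
       (auto simp: atm_def dest: fmeasurableD)
  finally show ?thesis .
qed

lemma sum_at:
  assumes Q: "coarse Q" shows "sum meas (atm Q) = meas Q"
proof -
  have "meas (\<Union>(atm Q)) = sum meas (atm Q)"
    using finite_at scale_lmeasurable[OF atom_scale] atoms_disjoint
    by (intro measure_Union') (auto simp: atm_def pairwise_def disjnt_def)
  then show ?thesis by (simp add: Union_at[OF Q])
qed

lemma child_coarse:
  assumes "coarse Q" "card (atm Q) \<noteq> 1" "dyadic_child R Q"
  obtains m where "N < m" "Q \<in> dyadic_cubes_of_scale m" "R \<in> dyadic_cubes_of_scale (m - 1)" "coarse R" "R \<subseteq> Q"
proof -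
  obtain m where m: "Q \<in> dyadic_cubes_of_scale m" "R \<in> dyadic_cubes_of_scale (m - 1)" "R \<subseteq> Q"
    using assms(3) by (auto simp: dyadic_child_def)
  have "N \<le> m" using assms(1) m(1) scale_unique by (auto simp: coarse_def)
  moreover have "m \<noteq> N"
  proof
    assume "m = N"
    then have "atm Q = {Q}" using m(1) assms(1) by (intro at_finest) (auto simp: coarse_def)
    then show False using assms(2) by simp
  qed
  ultimately have "N < m" by simp
  moreover from this have "coarse R" using m assms(1) unfolding coarse_def by (intro conjI exI[of _ "m - 1"]) auto
  ultimately show ?thesis using that m by blast
qed

text \<open>A cube with more than one atom has a scale above \<open>N\<close>, so its children still
  consist of atoms. Halving the sides divides the volume by \<open>2 ^ CARD('d)\<close>.\<close>

lemma weighted_tree_model: "weighted_tree meas DD chd (2 ^ CARD('d))"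
proof
  show "(1::real) \<le> 2 ^ CARD('d)" by simp
  fix A assume A: "A \<in> DD"
  then obtain Q where Q: "coarse Q" "A = atm Q" "\<Union>A = Q" using DD_iff by metis
  show "finite A" "A \<noteq> {}" using Q finite_at at_nonempty by auto
  show "0 < meas I" if "I \<in> A" for I using that Q meas_atom by (auto simp: atm_def)
  assume nA: "card A \<noteq> 1"
  have ch: "\<exists>R m. c = atm R \<and> N < m \<and> Q \<in> dyadic_cubes_of_scale m \<and> R \<in> dyadic_cubes_of_scale (m - 1) \<and> coarse R \<and> R \<subseteq> Q"
    if "c \<in> chd A" for c
    using that child_coarse[OF Q(1) nA[unfolded Q(2)]] unfolding chd_def Q(3) by (metis image_iff mem_Collect_eq)
  show "\<Union>(chd A) = A"
  proof
    show "\<Union>(chd A) \<subseteq> A" using ch at_mono Q by blast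
    show "A \<subseteq> \<Union>(chd A)"
    proof
      fix I assume I: "I \<in> A"
      obtain m where m: "N \<le> m" "Q \<in> dyadic_cubes_of_scale m" using Q(1) by (auto simp: coarse_def)
      have "m \<noteq> N"
      proof
        assume "m = N"
        then have "atm Q = {Q}" using m Q(1) by (intro at_finest) (auto simp: coarse_def)
        then show False using nA Q(2) by simp
      qed
      then have "N \<le> m - 1" using m by simp
      obtain x where x: "x \<in> I" using I Q(2) scale_nonempty[OF atom_scale, of I] by (auto simp: atm_def)
      have IQ: "I \<subseteq> Q" "I \<in> atoms" using I Q(2) by (auto simp: atm_def)
      have "I = cube_of N x" using scale_cube_of[OF atom_scale[OF IQ(2)] x] .
      then have IR: "I \<subseteq> cube_of (m - 1) x" using cube_of_coarser[OF \<open>N \<le> m - 1\<close>] by blast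
      have "Q = cube_of m x" using scale_cube_of[OF m(2)] x IQ by blast
      then have "cube_of (m - 1) x \<subseteq> Q" using cube_of_coarser[of "m - 1" m x] by simp
      then have "dyadic_child (cube_of (m - 1) x) Q"
        unfolding dyadic_child_def using m(2) cube_of_scale by blast
      moreover have "I \<in> atm (cube_of (m - 1) x)" using IR IQ by (simp add: atm_def)
      ultimately show "I \<in> \<Union>(chd A)" unfolding chd_def Q(3) by blast
    qed
  qed
  fix c assume c: "c \<in> chd A"
  then obtain R m where R: "c = atm R" "N < m" "Q \<in> dyadic_cubes_of_scale m" "R \<in> dyadic_cubes_of_scale (m - 1)" "coarse R" "R \<subseteq> Q"
    using ch by blast
  show "c \<in> DD" using R at_in_DD by blast
  have mQ: "meas Q = 2 ^ CARD('d) * meas R"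
  proof -
    have "(2::real) powi m = 2 * 2 powi (m - 1)" using power_int_add_1[of "2::real" "m - 1"] by simp
    then show ?thesis using measure_scale[OF R(3)] measure_scale[OF R(4)] by (simp add: power_mult_distrib)
  qed
  show "c \<subset> A"
  proof -
    have "1 < (2::real) ^ CARD('d)" by (rule one_less_power) auto
    then have "1 * meas R < 2 ^ CARD('d) * meas R" by (rule mult_strict_right_mono[OF _ measure_scale_pos[OF R(4)]])
    then have "R \<noteq> Q" using mQ by auto
    then have "atm R \<noteq> atm Q" using Union_at R(5) Q(1) by metis
    then show ?thesis using R Q at_mono by blast
  qed
  show "sum meas A \<le> 2 ^ CARD('d) * sum meas c"
    using mQ sum_at[OF Q(1)] sum_at[OF R(5)] by (simp add: Q(2) R(1))
  fix c' assume c': "c' \<in> chd A" "c \<noteq> c'"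
  then obtain R' m' where R': "c' = atm R'" "Q \<in> dyadic_cubes_of_scale m'" "R' \<in> dyadic_cubes_of_scale (m' - 1)"
    using ch by blast
  have "m' = m" using scale_unique R(3) R'(2) by blast
  then have "R \<inter> R' = {}" using scale_disjoint[OF R(4)] R' c' R(1) by blast
  then show "c \<inter> c' = {}" using scale_nonempty[OF atom_scale] by (fastforce simp: R R' atm_def)
qed

section \<open>Step functions on the atoms\<close>

definition ext :: "((real^'d) set \<Rightarrow> real) \<Rightarrow> real^'d \<Rightarrow> real" where
  "ext g x = (\<Sum>I\<in>atoms. g I * indicat_real I x)"

lemma ext_atom: assumes "I \<in> atoms" "x \<in> I" shows "ext g x = g I"
proof -
  have "ext g x = (\<Sum>J\<in>atoms. if J = I then g I else 0)"
    unfolding ext_def using assms atoms_disjoint by (intro sum.cong) (auto simp: indicator_def)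
  then show ?thesis using assms finite_atoms by simp
qed

lemma ext_outside: assumes "\<And>I. I \<in> atoms \<Longrightarrow> x \<notin> I" shows "ext g x = 0"
  unfolding ext_def using assms by (simp add: indicator_def)

lemma ext_support: assumes "\<And>I. I \<notin> atm Q \<Longrightarrow> g I = 0" "x \<notin> Q" shows "ext g x = 0"
proof (cases "\<exists>I\<in>atoms. x \<in> I")
  case True
  then obtain I where I: "I \<in> atoms" "x \<in> I" by blast
  then have "I \<notin> atm Q" using assms(2) by (auto simp: atm_def)
  then show ?thesis using assms(1) ext_atom[OF I] by simp
qed (auto intro: ext_outside)

lemma ext_vanish: assumes "coarse Q" "\<And>I. I \<in> atm Q \<Longrightarrow> g I = 0" "x \<in> Q" shows "ext g x = 0"
  using assms cube_of_in_at[OF assms(1,3)] ext_atom[of "cube_of N x" x g] by (auto simp: atm_def)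

lemma ext_test: "dyadic_test_function (ext g)"
  unfolding dyadic_test_function_def ext_def[abs_def] using finite_atoms atom_scale
  by (intro exI[of _ atoms] exI[of _ g]) (auto simp: dyadic_cube_def)

lemma ext_lin: "ext (\<lambda>I. \<alpha> * g I + \<beta> * h I) = (\<lambda>x. \<alpha> * ext g x + \<beta> * ext h x)"
  by (auto simp: ext_def fun_eq_iff sum_distrib_left sum.distrib algebra_simps)

lemma integrable_atom: "I \<in> atoms \<Longrightarrow> integrable lebesgue (indicat_real I)"
  using scale_lmeasurable[OF atom_scale] lmeasurable_iff_integrable by blast

lemma ext_integrable: "integrable lebesgue (ext g)"
  unfolding ext_def[abs_def] by (intro Bochner_Integration.integrable_sum integrable_mult_right integrable_atom)

lemma ext_integral: "(LINT x|lebesgue. ext g x) = (\<Sum>I\<in>atoms. g I * meas I)"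
proof -
  have "(LINT x|lebesgue. ext g x) = (\<Sum>I\<in>atoms. LINT x|lebesgue. g I * indicat_real I x)"
    unfolding ext_def by (intro Bochner_Integration.integral_sum integrable_mult_right integrable_atom)
  also have "\<dots> = (\<Sum>I\<in>atoms. g I * meas I)" by simp
  finally show ?thesis .
qed

lemma sum_atoms_at: assumes "\<And>I. I \<notin> atm Q \<Longrightarrow> g I = 0" shows "(\<Sum>I\<in>atoms. g I * meas I) = wint meas (atm Q) g"
proof -
  have "(\<Sum>I\<in>atoms. g I * meas I) = (\<Sum>I\<in>atm Q. g I * meas I)"
    using assms by (intro sum.mono_neutral_right finite_atoms) (auto simp: atm_def)
  then show ?thesis by (simp add: wint_def mult.commute)
qed

lemma ext_powr: assumes "q \<noteq> 0" shows "\<bar>ext g x\<bar> powr q = ext (\<lambda>I. \<bar>g I\<bar> powr q) x"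
proof (cases "\<exists>I\<in>atoms. x \<in> I")
  case True
  then show ?thesis using ext_atom by metis
next
  case False
  then show ?thesis using ext_outside by simp
qed

lemma Lp_norm_ext:
  assumes "1 < q" "\<And>I. I \<notin> atm Q \<Longrightarrow> g I = 0"
  shows "Lp_norm q (ext g) = (wint meas (atm Q) (\<lambda>I. \<bar>g I\<bar> powr q)) powr (1 / q)"
  unfolding Lp_norm_def using assms by (simp add: ext_powr ext_integral sum_atoms_at[of Q])

text \<open>Integrals, supports and norms of a step function are those of its values on the atoms,
  so the axioms carry over with the same constants.\<close>

lemma perfect_form_model:
  fixes \<Lambda> :: "('n::finite \<Rightarrow> real^'d \<Rightarrow> real) \<Rightarrow> real"
  assumes \<Lambda>: "multilinear_on_test_functions \<Lambda>" "dyadic_decay \<Lambda>" "perfect_smoothness \<Lambda>" and p: "hoelder_tuple p"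
  shows "perfect_form meas DD chd (2 ^ CARD('d)) (\<lambda>g. \<Lambda> (\<lambda>j. ext (g j))) p"
proof -
  interpret weighted_tree meas DD chd "2 ^ CARD('d)" by (rule weighted_tree_model)
  show ?thesis
  proof
    show "1 < p j" for j using p by (auto simp: hoelder_tuple_def)
    show "(\<Sum>j\<in>UNIV. 1 / p j) = 1" using p by (auto simp: hoelder_tuple_def)
    fix f :: "'n \<Rightarrow> (real^'d) set \<Rightarrow> real" and i
    show "\<Lambda> (\<lambda>j. ext ((f(i := \<lambda>x. \<alpha> * g x + \<beta> * h x)) j)) = \<alpha> * \<Lambda> (\<lambda>j. ext ((f(i := g)) j)) + \<beta> * \<Lambda> (\<lambda>j. ext ((f(i := h)) j))" for \<alpha> \<beta> g h
    proof -
      have upd: "(\<lambda>j. ext ((f(i := k)) j)) = (\<lambda>j. ext (f j))(i := ext k)" for k by auto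
      show ?thesis unfolding upd ext_lin
        using \<Lambda>(1)[unfolded multilinear_on_test_functions_def, rule_format, of "\<lambda>j. ext (f j)" "ext g" "ext h" i \<alpha> \<beta>] ext_test by blast
    qed
    fix A assume "A \<in> DD"
    then obtain Q where Q: "coarse Q" "A = atm Q" "\<Union>A = Q" using DD_iff by metis
    have dQ: "dyadic_cube Q" using Q(1) by (auto simp: coarse_def dyadic_cube_def)
    show "\<Lambda> (\<lambda>j. ext (f j)) = 0"
      if "i \<noteq> j" "\<And>I. I \<notin> A \<Longrightarrow> f j I = 0" "wint meas A (f j) = 0" "\<And>I. I \<in> A \<Longrightarrow> f i I = 0" for j
    proof -
      have "supported_on (ext (f j)) Q" unfolding supported_on_def using that(2) Q(2) ext_support by blast
      moreover have "(LINT x|lebesgue. ext (f j) x) = 0"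
        unfolding ext_integral using sum_atoms_at[of Q "f j"] that Q(2) by simp
      moreover have "\<forall>x\<in>Q. ext (f i) x = 0" using ext_vanish[OF Q(1)] that(4) Q(2) by blast
      ultimately show ?thesis
        using \<Lambda>(3)[unfolded perfect_smoothness_def, rule_format, of "\<lambda>j. ext (f j)" Q i j] ext_test dQ that(1) by blast
    qed
    show "\<bar>\<Lambda> (\<lambda>j. ext (f j))\<bar> \<le> (\<Prod>j\<in>UNIV. (wint meas A (\<lambda>x. \<bar>f j x\<bar> powr p j)) powr (1 / p j))"
      if "card A \<noteq> 1" and f: "\<And>j I. I \<notin> A \<Longrightarrow> f j I = 0" and ij: "i \<noteq> j" and c: "c \<in> chd A" "c' \<in> chd A" "c \<noteq> c'"
        and fi: "\<And>I. I \<notin> c \<Longrightarrow> f i I = 0" and fj: "\<And>I. I \<notin> c' \<Longrightarrow> f j I = 0" for j c c'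
    proof -
      obtain R R' where R: "c = atm R" "dyadic_child R Q" "c' = atm R'" "dyadic_child R' Q"
        using c unfolding chd_def Q(3) by blast
      have "R \<noteq> R'" using R c(3) by auto
      moreover have "supported_on (ext (f i)) R" "supported_on (ext (f j)) R'" "supported_on (ext (f k)) Q" for k
        unfolding supported_on_def using fi fj f R Q(2) ext_support by blast+
      ultimately have "\<bar>\<Lambda> (\<lambda>j. ext (f j))\<bar> \<le> (\<Prod>j\<in>UNIV. Lp_norm (p j) (ext (f j)))"
        using \<Lambda>(2)[unfolded dyadic_decay_def, rule_format, of "\<lambda>j. ext (f j)" Q p] ext_test dQ p R ij by blast
      then show ?thesis using Lp_norm_ext[of "p _" Q "f _"] p f Q(2) by (simp add: hoelder_tuple_def)
    qed
  qed
qed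

section \<open>Averaging over the atoms\<close>

definition atom_avg :: "(real^'d \<Rightarrow> real) \<Rightarrow> (real^'d) set \<Rightarrow> real" where
  "atom_avg b I = (if I \<in> atoms then (LINT x|lebesgue. indicat_real I x * b x) / meas I else 0)"

text \<open>The majorant of the averaged testing function. Averaging can lower norms, while the
  testing condition is stated with the norms before averaging. The power mean keeps them exactly on
  cubes made of atoms.\<close>

definition atom_power_avg :: "real \<Rightarrow> (real^'d \<Rightarrow> real) \<Rightarrow> (real^'d) set \<Rightarrow> real" where
  "atom_power_avg q b I = (if I \<in> atoms then ((LINT x|lebesgue. indicat_real I x * \<bar>b x\<bar> powr q) / meas I) powr (1 / q) else 0)"

lemma integrable_indicat: "S \<in> sets lebesgue \<Longrightarrow> integrable lebesgue h \<Longrightarrow> integrable lebesgue (\<lambda>x. indicat_real S x * h x)"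
  using integrable_mult_indicator[of S lebesgue h] by simp

text \<open>Hoelder's inequality on one atom, from Young's inequality with a parameter
  \<open>t\<close> whose optimal value is \<open>A powr (1 / q)\<close>.\<close>

lemma atom_avg_le_atom_power_avg:
  assumes q: "1 < q" and b: "integrable lebesgue b" "integrable lebesgue (\<lambda>x. \<bar>b x\<bar> powr q)"
  shows "\<bar>atom_avg b I\<bar> \<le> atom_power_avg q b I"
proof (cases "I \<in> atoms")
  case True
  have mI: "0 < meas I" by (rule meas_atom[OF True])
  have sI: "I \<in> sets lebesgue" using scale_lmeasurable[OF atom_scale[OF True]] by auto
  define A where "A = (LINT x|lebesgue. indicat_real I x * \<bar>b x\<bar> powr q) / meas I"
  define B where "B = (LINT x|lebesgue. indicat_real I x * \<bar>b x\<bar>) / meas I"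
  note iA = integrable_indicat[OF sI b(2)] and iB = integrable_indicat[OF sI integrable_abs[OF b(1)]]
  have A0: "0 \<le> A" unfolding A_def using mI by (intro divide_nonneg_pos integral_nonneg_AE) auto
  have AB: "B \<le> A * t powr (1 - q) / q + t * (1 - 1 / q)" if t: "0 < t" for t
  proof -
    have pt: "y \<le> y powr q * t powr (1 - q) / q + t * (1 - 1 / q)" if "0 \<le> y" for y
    proof -
      have q': "1 < q / (q - 1)" "1 / q + 1 / (q / (q - 1)) = 1" using q by (auto simp: field_simps)
      have "y * t powr (q - 1) \<le> y powr q / q + (t powr (q - 1)) powr (q / (q - 1)) / (q / (q - 1))"
        using q q' that by (intro Youngs_inequality) auto
      also have "(t powr (q - 1)) powr (q / (q - 1)) = t powr q" using q by (simp add: powr_powr)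
      finally have "y * t powr (q - 1) * t powr (1 - q) \<le> (y powr q / q + t powr q / (q / (q - 1))) * t powr (1 - q)"
        by (intro mult_right_mono) auto
      moreover have "t powr (q - 1) * t powr (1 - q) = 1" "t powr q * t powr (1 - q) = t"
        using t by (simp_all add: powr_add[symmetric])
      moreover have "(y powr q / q + t powr q / (q / (q - 1))) * t powr (1 - q)
         = y powr q * t powr (1 - q) / q + (t powr q * t powr (1 - q)) * (1 - 1 / q)"
        using q by (simp add: field_simps)
      ultimately show ?thesis by (simp add: mult.assoc)
    qed
    have "(LINT x|lebesgue. indicat_real I x * \<bar>b x\<bar>)
       \<le> (LINT x|lebesgue. (indicat_real I x * \<bar>b x\<bar> powr q) * (t powr (1 - q) / q) + indicat_real I x * (t * (1 - 1 / q)))"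
    proof (rule integral_mono[OF iB])
      show "integrable lebesgue (\<lambda>x. (indicat_real I x * \<bar>b x\<bar> powr q) * (t powr (1 - q) / q) + indicat_real I x * (t * (1 - 1 / q)))"
        using iA integrable_atom[OF True] by (intro Bochner_Integration.integrable_add integrable_mult_left)
      fix x
      show "indicat_real I x * \<bar>b x\<bar> \<le> (indicat_real I x * \<bar>b x\<bar> powr q) * (t powr (1 - q) / q) + indicat_real I x * (t * (1 - 1 / q))"
        using pt[of "\<bar>b x\<bar>"] by (cases "x \<in> I") auto
    qed
    also have "\<dots> = (A * meas I) * (t powr (1 - q) / q) + meas I * (t * (1 - 1 / q))"
      using iA integrable_atom[OF True] mI
      by (subst Bochner_Integration.integral_add) (auto intro!: integrable_mult_left simp: A_def)
    also have "\<dots> = (A * t powr (1 - q) / q + t * (1 - 1 / q)) * meas I" by (simp add: algebra_simps)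
    finally show ?thesis unfolding B_def using mI by (simp add: divide_le_eq)
  qed
  have "B \<le> A powr (1 / q)"
  proof (cases "A = 0")
    case True
    \<comment> \<open>The optimal parameter would be zero in this case, so it is approached by
      positive ones.\<close>
    have "B \<le> e" if "0 < e" for e
    proof -
      have "B \<le> e * (1 - 1 / q)" using AB[OF that] True by simp
      also have "\<dots> \<le> e * 1" using that q by (intro mult_left_mono) auto
      finally show ?thesis by simp
    qed
    then have "B \<le> 0" by (rule field_le_epsilon[of B 0, simplified])
    then show ?thesis using True by simp
  next
    case False
    then have A: "0 < A" using A0 by simp
    define t where "t = A powr (1 / q)"
    have t: "0 < t" using A by (simp add: t_def)
    have tq: "t powr q = A" using A q by (simp add: t_def powr_powr)
    have "A * t powr (1 - q) = t powr q * t powr (1 - q)" by (simp add: tq)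
    also have "\<dots> = t" using t by (simp add: powr_add[symmetric])
    finally have "B \<le> t / q + t * (1 - 1 / q)" using AB[OF t] by simp
    also have "\<dots> = t" by (simp add: algebra_simps)
    finally show ?thesis by (simp add: t_def)
  qed
  moreover have "\<bar>atom_avg b I\<bar> \<le> B"
  proof -
    have "\<bar>LINT x|lebesgue. indicat_real I x * b x\<bar> \<le> (LINT x|lebesgue. \<bar>indicat_real I x * b x\<bar>)" by (rule integral_abs_bound)
    then show ?thesis unfolding atom_avg_def B_def using True mI by (simp add: abs_mult divide_right_mono)
  qed
  ultimately show ?thesis using True by (simp add: atom_power_avg_def A_def)
qed (simp add: atom_avg_def atom_power_avg_def)

lemma wint_atom_avg:
  assumes Q: "coarse Q" and b: "integrable lebesgue b"
  shows "wint meas (atm Q) (atom_avg b) = (LINT x|lebesgue. indicat_real Q x * b x)"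
  unfolding wint_def integral_at[OF Q b] using meas_atom
  by (intro sum.cong) (force simp: atom_avg_def atm_def)+

lemma wint_atom_power_avg:
  assumes Q: "coarse Q" and q: "1 < q" and b: "integrable lebesgue (\<lambda>x. \<bar>b x\<bar> powr q)"
  shows "wint meas (atm Q) (\<lambda>I. atom_power_avg q b I powr q) = (LINT x|lebesgue. indicat_real Q x * \<bar>b x\<bar> powr q)"
  unfolding wint_def integral_at[OF Q b]
proof (rule sum.cong[OF refl])
  fix I assume I: "I \<in> atm Q"
  have mI: "0 < meas I" using I meas_atom by (auto simp: atm_def)
  have "0 \<le> (LINT x|lebesgue. indicat_real I x * \<bar>b x\<bar> powr q) / meas I"
    using mI by (intro divide_nonneg_pos integral_nonneg_AE) auto
  then show "meas I * atom_power_avg q b I powr q = (LINT x|lebesgue. indicat_real I x * \<bar>b x\<bar> powr q)"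
    using I mI q by (simp add: atom_power_avg_def atm_def powr_powr)
qed

text \<open>An atom is either contained in \<open>R\<close> or disjoint from it, so an integral over
  \<open>R\<close> does not see the averaging.\<close>

lemma integral_ext_atom_avg:
  assumes Q: "coarse Q" and b: "integrable lebesgue b" and R: "R \<in> dyadic_cubes_of_scale m" "N \<le> m"
  shows "(LINT x|lebesgue. indicat_real R x * (indicat_real Q x * b x)) = (LINT x|lebesgue. indicat_real R x * ext (restr (atm Q) (atom_avg b)) x)"
proof -
  have IR: "indicat_real R x * indicat_real I x = (if I \<subseteq> R then indicat_real I x else 0)" if "I \<in> atoms" for I x
    using scale_subset[OF atom_scale[OF that] R] by (auto simp: indicator_def)
  have RQ: "integrable lebesgue (\<lambda>x. indicat_real R x * b x)"
    using scale_lmeasurable[OF R(1)] by (intro integrable_indicat b) auto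
  have "(LINT x|lebesgue. indicat_real R x * (indicat_real Q x * b x)) = (LINT x|lebesgue. indicat_real Q x * (indicat_real R x * b x))"
    by (simp add: mult_ac)
  also have "\<dots> = (\<Sum>I\<in>atm Q. LINT x|lebesgue. indicat_real I x * (indicat_real R x * b x))" by (rule integral_at[OF Q RQ])
  also have "\<dots> = (\<Sum>I\<in>atm Q. if I \<subseteq> R then atom_avg b I * meas I else 0)"
  proof (rule sum.cong[OF refl])
    fix I assume "I \<in> atm Q"
    then have I: "I \<in> atoms" by (simp add: atm_def)
    have "(LINT x|lebesgue. indicat_real I x * (indicat_real R x * b x)) = (LINT x|lebesgue. (if I \<subseteq> R then indicat_real I x else 0) * b x)"
      by (rule arg_cong[where f="integral\<^sup>L lebesgue"], rule HOL.ext)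
        (simp only: IR[OF I, symmetric] mult_ac)
    also have "\<dots> = (if I \<subseteq> R then (LINT x|lebesgue. indicat_real I x * b x) else 0)" by simp
    also have "\<dots> = (if I \<subseteq> R then atom_avg b I * meas I else 0)" using I meas_atom[OF I] by (simp add: atom_avg_def)
    finally show "(LINT x|lebesgue. indicat_real I x * (indicat_real R x * b x)) = (if I \<subseteq> R then atom_avg b I * meas I else 0)" .
  qed
  also have "\<dots> = (\<Sum>I\<in>atoms. if I \<subseteq> R then restr (atm Q) (atom_avg b) I * meas I else 0)"
    by (rule sum.mono_neutral_cong_left[OF finite_atoms]) (auto simp: atm_def restr_def)
  also have "\<dots> = (\<Sum>I\<in>atoms. LINT x|lebesgue. restr (atm Q) (atom_avg b) I * (if I \<subseteq> R then indicat_real I x else 0))"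
    by (intro sum.cong refl) simp
  also have "\<dots> = (LINT x|lebesgue. (\<Sum>I\<in>atoms. restr (atm Q) (atom_avg b) I * (if I \<subseteq> R then indicat_real I x else 0)))"
  proof (intro Bochner_Integration.integral_sum[symmetric] integrable_mult_right)
    fix I assume "I \<in> atoms"
    then show "integrable lebesgue (\<lambda>x. if I \<subseteq> R then indicat_real I x else 0)"
      using integrable_atom by (cases "I \<subseteq> R") simp_all
  qed
  also have "\<dots> = (LINT x|lebesgue. indicat_real R x * ext (restr (atm Q) (atom_avg b)) x)"
    unfolding ext_def sum_distrib_left
    by (intro Bochner_Integration.integral_cong refl sum.cong) (simp only: IR[symmetric] mult_ac)
  finally show ?thesis .
qed

lemma ext_restr_one: assumes Q: "coarse Q" shows "ext (restr (atm Q) (\<lambda>_. 1)) = indicat_real Q"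
proof
  fix x
  have "ext (restr (atm Q) (\<lambda>_. 1)) x = (\<Sum>I\<in>atm Q. indicat_real I x)"
    unfolding ext_def by (rule sum.mono_neutral_cong_right[OF finite_atoms]) (auto simp: atm_def restr_def)
  then show "ext (restr (atm Q) (\<lambda>_. 1)) x = indicat_real Q x" by (simp add: indicator_at[OF Q])
qed

end

text \<open>Provides one scale for finitely many cubes or functions. With \<open>- N'\<close> in the
  predicate it also serves for sufficiently large scales.\<close>

lemma scale_family_lower_bound:
  assumes "finite S" "\<And>s. s \<in> S \<Longrightarrow> \<exists>N::int. \<forall>N'\<le>N. Q s N'"
  shows "\<exists>N. \<forall>N'\<le>N. \<forall>s\<in>S. Q s N'"
  using assms
proof (induction S rule: finite_induct)
  case (insert s S)
  obtain N1 where N1: "\<forall>N'\<le>N1. \<forall>s\<in>S. Q s N'" using insert by auto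
  have "\<exists>N::int. \<forall>N'\<le>N. Q s N'" by (rule insert.prems) simp
  then obtain N2 where N2: "\<forall>N'\<le>N2. Q s N'" by blast
  show ?case using N1 N2 by (intro exI[of _ "min N1 N2"]) auto
qed auto

text \<open>A dyadic cube in the space of tuples is a product of cubes, so by Fubini's theorem the
  form is a finite combination of products of integrals over cubes. In this shape it can be
  evaluated on testing functions, which need not be test functions, and averaging on a fine scale
  does not change it.\<close>

lemma kernel_formula:
  fixes \<Lambda> :: "('n::finite \<Rightarrow> real^'d::finite \<Rightarrow> real) \<Rightarrow> real"
  assumes K: "dyadic_test_function K" and \<Lambda>: "has_integral_kernel \<Lambda> K"
  shows "\<exists>(S::(real^'d^'n) set set) c R N. finite S \<and> (\<forall>N'\<le>N. \<forall>s\<in>S. \<forall>j. \<exists>m\<ge>N'. R s j \<in> dyadic_cubes_of_scale m) \<and>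
    (\<forall>f. (\<forall>j. integrable lebesgue (f j)) \<longrightarrow> \<Lambda> f = (\<Sum>s\<in>S. c s * (\<Prod>j\<in>UNIV. (LINT x|lebesgue. indicat_real (R s j) x * f j x))))"
proof -
  obtain S c where S: "finite S" "\<And>Q. Q \<in> S \<Longrightarrow> dyadic_cube Q" and K_eq: "K = (\<lambda>x. \<Sum>Q\<in>S. c Q * indicat_real Q x)"
    using K unfolding dyadic_test_function_def by blast
  have "\<exists>R m. (\<forall>j. R j \<in> dyadic_cubes_of_scale m) \<and> (\<forall>x. x \<in> Q \<longleftrightarrow> (\<forall>j. x $ j \<in> R j))" if Q: "Q \<in> S" for Q
  proof -
    obtain m where "Q \<in> dyadic_cubes_of_scale m" using S(2)[OF Q] unfolding dyadic_cube_def by blast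
    from scale_cube_vec[OF this] show ?thesis by blast
  qed
  then obtain R ms where R: "\<And>Q j. Q \<in> S \<Longrightarrow> R Q j \<in> dyadic_cubes_of_scale (ms Q)"
    and mem: "\<And>Q x. Q \<in> S \<Longrightarrow> x \<in> Q \<longleftrightarrow> (\<forall>j. x $ j \<in> R Q j)" by metis
  have "\<exists>N. \<forall>N'\<le>N. \<forall>s\<in>S. \<forall>j. \<exists>m\<ge>N'. R s j \<in> dyadic_cubes_of_scale m"
    using R by (intro scale_family_lower_bound[OF S(1)]) blast
  then obtain N where N: "\<forall>N'\<le>N. \<forall>s\<in>S. \<forall>j. \<exists>m\<ge>N'. R s j \<in> dyadic_cubes_of_scale m" by blast
  have "\<Lambda> f = (\<Sum>s\<in>S. c s * (\<Prod>j\<in>UNIV. (LINT x|lebesgue. indicat_real (R s j) x * f j x)))"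
    if f: "\<And>j. integrable lebesgue (f j)" for f
  proof -
    have "set_integrable lebesgue T (f j)" if "compact T" for T j
      unfolding set_integrable_def using lmeasurable_compact[OF that] f
      by (intro integrable_mult_indicator) auto
    then have "locally_integrable (f j)" for j
      by (simp add: locally_integrable_def)
    then have "\<Lambda> f = (LINT x|lebesgue. K x * (\<Prod>j\<in>UNIV. f j (x $ j)))"
      using \<Lambda> unfolding has_integral_kernel_def by blast
    also have "\<dots> = (LINT x|lebesgue. (\<Sum>s\<in>S. c s * (\<Prod>j\<in>UNIV. indicat_real (R s j) (x $ j) * f j (x $ j))))"
    proof -
      have "K x * (\<Prod>j\<in>UNIV. f j (x $ j)) = (\<Sum>s\<in>S. c s * (\<Prod>j\<in>UNIV. indicat_real (R s j) (x $ j) * f j (x $ j)))" for x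
      proof -
        have "indicat_real s x = (\<Prod>j\<in>UNIV. indicat_real (R s j) (x $ j))" if "s \<in> S" for s
          using mem[OF that, of x] by (cases "x \<in> s") (auto simp: indicator_def intro!: prod_zero)
        then show ?thesis unfolding K_eq sum_distrib_right prod.distrib by (intro sum.cong refl) (simp add: mult.assoc)
      qed
      then show ?thesis by simp
    qed
    also have "\<dots> = (\<Sum>s\<in>S. LINT x|lebesgue. c s * (\<Prod>j\<in>UNIV. indicat_real (R s j) (x $ j) * f j (x $ j)))"
    proof (rule Bochner_Integration.integral_sum)
      fix s assume s: "s \<in> S"
      have "integrable lebesgue (\<lambda>x. indicat_real (R s j) x * f j x)" for j
        using integrable_mult_indicator[OF _ f[of j], of "R s j"] scale_lmeasurable[OF R[OF s, of j]] by auto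
      then show "integrable lebesgue (\<lambda>x. c s * (\<Prod>j\<in>UNIV. indicat_real (R s j) (x $ j) * f j (x $ j)))"
        by (intro integrable_mult_right integral_prod_vec(1)[where g="\<lambda>j x. indicat_real (R s j) x * f j x"])
    qed
    also have "\<dots> = (\<Sum>s\<in>S. c s * (\<Prod>j\<in>UNIV. (LINT x|lebesgue. indicat_real (R s j) x * f j x)))"
    proof (rule sum.cong[OF refl])
      fix s assume s: "s \<in> S"
      have "integrable lebesgue (\<lambda>x. indicat_real (R s j) x * f j x)" for j
        using integrable_mult_indicator[OF _ f[of j], of "R s j"] scale_lmeasurable[OF R[OF s, of j]] by auto
      from integral_prod_vec(2)[where g="\<lambda>j x. indicat_real (R s j) x * f j x", OF this]
      show "(LINT x|lebesgue. c s * (\<Prod>j\<in>UNIV. indicat_real (R s j) (x $ j) * f j (x $ j)))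
         = c s * (\<Prod>j\<in>UNIV. (LINT x|lebesgue. indicat_real (R s j) x * f j x))" by simp
    qed
    finally show ?thesis .
  qed
  then show ?thesis using S(1) N by blast
qed

text \<open>A sum over all lengths, because the final constant may not depend on
  \<open>k\<close>.\<close>

definition full_const :: "('n::finite \<Rightarrow> real) \<Rightarrow> real \<Rightarrow> real \<Rightarrow> real" where
  "full_const p \<kappa> B = (\<Sum>k\<le>CARD('n). \<bar>perfect_form.lp_const \<kappa> p (perfect_form.bounded_const \<kappa> p k B)\<bar>)"

section \<open>Transfer of the hypotheses to the model\<close>

context dyadic_model
begin

text \<open>The testing functions are averaged over the atoms. Their means are kept, the majorants
  carry their norms, and the form keeps its values because the cubes of its kernel are not finer
  than the atoms.\<close>

lemma model_estimate:
  fixes \<Lambda> :: "('n::finite \<Rightarrow> real^'d \<Rightarrow> real) \<Rightarrow> real" and p :: "'n \<Rightarrow> real" and b :: "('n, 'd) testing_family"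
  assumes NP: "N \<le> top_scale" and n: "2 \<le> CARD('n)" and p: "hoelder_tuple p" and B: "1 \<le> B" and k: "1 \<le> k" "k \<le> CARD('n)"
    and \<Lambda>: "multilinear_on_test_functions \<Lambda>" "dyadic_decay \<Lambda>" "perfect_smoothness \<Lambda>"
    and S: "\<And>s j. s \<in> S \<Longrightarrow> \<exists>m\<ge>N. R s j \<in> dyadic_cubes_of_scale m"
    and ker: "\<And>f. (\<And>j. integrable lebesgue (f j)) \<Longrightarrow> \<Lambda> f = (\<Sum>s\<in>S. c s * (\<Prod>j\<in>UNIV. (LINT x|lebesgue. indicat_real (R s j) x * f j x)))"
    and adm: "admissible \<Sigma>"
    and H1: "\<forall>\<sigma>\<in>\<Sigma>. \<forall>Q. \<forall>j \<in> path_at \<sigma> ` {1..k-1}. length \<sigma> = k \<longrightarrow> nested \<sigma> Q \<longrightarrow>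
        b \<sigma> Q j \<in> borel_measurable lebesgue \<and>
        supported_on (b \<sigma> Q j) (Q j) \<and>
        (LINT x|lebesgue. b \<sigma> Q j x) = measure lebesgue (Q j) \<and>
        integrable lebesgue (\<lambda>x. \<bar>b \<sigma> Q j x\<bar> powr p j) \<and>
        (LINT x|lebesgue. \<bar>b \<sigma> Q j x\<bar> powr p j) \<le> B * measure lebesgue (Q j)"
    and H2: "\<forall>\<sigma>\<in>\<Sigma>. \<forall>\<sigma>'\<in>\<Sigma>. \<forall>Q Q' j.
        length \<sigma> = k \<longrightarrow> length \<sigma>' = k \<longrightarrow> nested \<sigma> Q \<longrightarrow> nested \<sigma>' Q' \<longrightarrow> 1 \<le> j \<longrightarrow> j < k \<longrightarrow>
        (\<forall>l\<in>{1..j}. path_at \<sigma> l = path_at \<sigma>' l \<and> Q (path_at \<sigma> l) = Q' (path_at \<sigma>' l)) \<longrightarrow>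
        b \<sigma> Q (path_at \<sigma> j) = b \<sigma>' Q' (path_at \<sigma>' j)"
    and H3: "\<forall>\<sigma>\<in>\<Sigma>. \<forall>Q g. length \<sigma> = k \<longrightarrow> nested \<sigma> Q \<longrightarrow>
        dyadic_test_function g \<longrightarrow> supported_on g (Q (path_at \<sigma> k)) \<longrightarrow>
        \<bar>\<Lambda> (testing_tuple b \<sigma> Q g)\<bar> \<le> B * (\<Prod>j\<in>UNIV. Lp_norm (p j) (testing_tuple b \<sigma> Q g j))"
  shows "\<bar>\<Lambda> (\<lambda>j. ext (restr (atm P) (g j)))\<bar>
    \<le> full_const p (2 ^ CARD('d)) B * (\<Prod>j\<in>UNIV. Lp_norm (p j) (ext (restr (atm P) (g j))))"
proof -
  interpret pf: perfect_form meas DD chd "2 ^ CARD('d)" "\<lambda>g. \<Lambda> (\<lambda>j. ext (g j))" p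
    by (rule perfect_form_model[OF \<Lambda> p])
  have p1: "1 < p j" for j by (rule pf.p_gt_1)
  define rq where "rq Q j = \<Union>(Q j)" for Q :: "'n \<Rightarrow> (real^'d) set set" and j
  define b' where "b' \<sigma> Q j = atom_avg (b \<sigma> (rq Q) j)" for \<sigma> Q j
  define w' where "w' \<sigma> Q j = atom_power_avg (p j) (b \<sigma> (rq Q) j)" for \<sigma> Q j
  have rq: "coarse (rq Q j)" "Q j = atm (rq Q j)" if "pf.tnested \<sigma> Q" for \<sigma> Q j
    using that DD_iff[of "Q j"] by (auto simp: pf.tnested_def rq_def)
  have ne: "\<sigma> \<noteq> []" if "\<sigma> \<in> \<Sigma>" for \<sigma> using adm that by (auto simp: admissible_def is_path_def)
  have last: "path_at \<sigma> (length \<sigma>) = last \<sigma>" if "\<sigma> \<in> \<Sigma>" for \<sigma> :: "'n list"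
    using ne[OF that] by (simp add: path_at_def last_conv_nth)
  have nest: "nested \<sigma> (rq Q)" if \<sigma>: "\<sigma> \<in> \<Sigma>" "pf.tnested \<sigma> Q" for \<sigma> Q
    unfolding nested_def
  proof (intro conjI allI impI)
    show "dyadic_cube (rq Q j)" for j using rq(1)[OF \<sigma>(2), of j] by (auto simp: coarse_def dyadic_cube_def)
    show "rq Q (path_at \<sigma> j) \<subseteq> rq Q (path_at \<sigma> i)" if "1 \<le> i \<and> i < j \<and> j \<le> length \<sigma>" for i j
    proof -
      have "Q (\<sigma> ! (j - 1)) \<subseteq> Q (\<sigma> ! (i - 1))" using that by (intro pf.tnestedD[OF \<sigma>(2)]) auto
      then show ?thesis by (auto simp: rq_def path_at_def)
    qed
    show "rq Q s = rq Q (path_at \<sigma> (length \<sigma>))" if "s \<notin> set \<sigma>" for s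
      unfolding last[OF \<sigma>(1)] using \<sigma>(2) that by (simp add: pf.tnested_def rq_def)
    show "rq Q (path_at \<sigma> (CARD('n) - 1)) = rq Q (path_at \<sigma> CARD('n))" if "length \<sigma> = CARD('n)"
    proof -
      have "path_at \<sigma> CARD('n) = last \<sigma>" using last[OF \<sigma>(1)] that by simp
      moreover have "path_at \<sigma> (CARD('n) - 1) = \<sigma> ! (CARD('n) - 2)" by (simp add: path_at_def numeral_2_eq_2)
      ultimately show ?thesis using \<sigma>(2) that by (simp add: pf.tnested_def rq_def)
    qed
  qed
  have path: "j \<in> path_at \<sigma> ` {1..k-1}" if j: "j \<in> set (butlast \<sigma>)" and len: "length \<sigma> = k" for j and \<sigma> :: "'n list"
  proof -
    obtain i where i: "i < length (butlast \<sigma>)" "butlast \<sigma> ! i = j" using j by (metis in_set_conv_nth)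
    then have "path_at \<sigma> (Suc i) = j" by (simp add: path_at_def nth_butlast)
    moreover have "Suc i \<in> {1..k-1}" using i len by simp
    ultimately show ?thesis by blast
  qed
  have bD: "integrable lebesgue (b \<sigma> (rq Q) j)" "integrable lebesgue (\<lambda>x. \<bar>b \<sigma> (rq Q) j x\<bar> powr p j)"
     "supported_on (b \<sigma> (rq Q) j) (rq Q j)" "(LINT x|lebesgue. b \<sigma> (rq Q) j x) = meas (rq Q j)"
     "(LINT x|lebesgue. \<bar>b \<sigma> (rq Q) j x\<bar> powr p j) \<le> B * meas (rq Q j)"
    if \<sigma>: "\<sigma> \<in> \<Sigma>" "length \<sigma> = k" "pf.tnested \<sigma> Q" "j \<in> set (butlast \<sigma>)" for \<sigma> Q j
  proof -
    have h: "b \<sigma> (rq Q) j \<in> borel_measurable lebesgue \<and> supported_on (b \<sigma> (rq Q) j) (rq Q j) \<and>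
        (LINT x|lebesgue. b \<sigma> (rq Q) j x) = meas (rq Q j) \<and> integrable lebesgue (\<lambda>x. \<bar>b \<sigma> (rq Q) j x\<bar> powr p j) \<and>
        (LINT x|lebesgue. \<bar>b \<sigma> (rq Q) j x\<bar> powr p j) \<le> B * meas (rq Q j)"
      by (rule H1[rule_format, OF \<sigma>(1) path[OF \<sigma>(4,2)] \<sigma>(2) nest[OF \<sigma>(1,3)]])
    then show "integrable lebesgue (\<lambda>x. \<bar>b \<sigma> (rq Q) j x\<bar> powr p j)" "supported_on (b \<sigma> (rq Q) j) (rq Q j)"
      "(LINT x|lebesgue. b \<sigma> (rq Q) j x) = meas (rq Q j)" "(LINT x|lebesgue. \<bar>b \<sigma> (rq Q) j x\<bar> powr p j) \<le> B * meas (rq Q j)"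
      by blast+
    obtain m where m: "rq Q j \<in> dyadic_cubes_of_scale m" using rq(1)[OF \<sigma>(3), of j] by (auto simp: coarse_def)
    have ii: "integrable lebesgue (indicat_real (rq Q j))" using scale_lmeasurable[OF m] lmeasurable_iff_integrable by blast
    \<comment> \<open>From the bound on the power and the support in a cube, since a number is at
      most 1 plus its power.\<close>
    show "integrable lebesgue (b \<sigma> (rq Q) j)"
    proof (rule Bochner_Integration.integrable_bound)
      show "integrable lebesgue (\<lambda>x. indicat_real (rq Q j) x + \<bar>b \<sigma> (rq Q) j x\<bar> powr p j)"
        using h ii by (intro Bochner_Integration.integrable_add) auto
      show "AE x in lebesgue. norm (b \<sigma> (rq Q) j x) \<le> norm (indicat_real (rq Q j) x + \<bar>b \<sigma> (rq Q) j x\<bar> powr p j)"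
      proof (rule AE_I2)
        fix x
        have "\<bar>b \<sigma> (rq Q) j x\<bar> \<le> indicat_real (rq Q j) x + \<bar>b \<sigma> (rq Q) j x\<bar> powr p j"
          using h le_one_plus_powr[of "p j" "\<bar>b \<sigma> (rq Q) j x\<bar>"] p1[of j] by (cases "x \<in> rq Q j") (auto simp: supported_on_def)
        then show "norm (b \<sigma> (rq Q) j x) \<le> norm (indicat_real (rq Q j) x + \<bar>b \<sigma> (rq Q) j x\<bar> powr p j)" by simp
      qed
    qed (use h in blast)
  qed
  have Lp_atm: "Lp_norm (p s) (ext (restr (atm Q) h)) = pf.nrm s (atm Q) h" for s Q h
  proof -
    have "Lp_norm (p s) (ext (restr (atm Q) h)) = (wint meas (atm Q) (\<lambda>I. \<bar>restr (atm Q) h I\<bar> powr p s)) powr (1 / p s)"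
      by (rule Lp_norm_ext[OF p1]) (simp add: restr_def)
    also have "wint meas (atm Q) (\<lambda>I. \<bar>restr (atm Q) h I\<bar> powr p s) = wint meas (atm Q) (\<lambda>I. \<bar>h I\<bar> powr p s)"
      by (rule wint_cong) (simp add: restr_def)
    finally show ?thesis by (simp add: pf.nrm_def)
  qed
  have data: "pf.testing_data \<Sigma> k B b' w'"
    unfolding pf.testing_data_def
  proof (intro conjI ballI allI impI)
    fix \<sigma> Q j assume \<sigma>: "\<sigma> \<in> \<Sigma>" and j: "j \<in> set (butlast \<sigma>)" and len: "length \<sigma> = k" and tn: "pf.tnested \<sigma> Q"
    note D = bD[OF \<sigma> len tn j] and r = rq[OF tn, of j]
    have supp: "(\<lambda>x. indicat_real (rq Q j) x * b \<sigma> (rq Q) j x) = b \<sigma> (rq Q) j"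
      "(\<lambda>x. indicat_real (rq Q j) x * \<bar>b \<sigma> (rq Q) j x\<bar> powr p j) = (\<lambda>x. \<bar>b \<sigma> (rq Q) j x\<bar> powr p j)"
      using D(3) p1[of j] by (auto simp: supported_on_def indicator_def fun_eq_iff)
    show "\<bar>b' \<sigma> Q j x\<bar> \<le> w' \<sigma> Q j x" for x unfolding b'_def w'_def by (rule atom_avg_le_atom_power_avg[OF p1 D(1,2)])
    have "wint meas (atm (rq Q j)) (b' \<sigma> Q j) = meas (rq Q j)"
      unfolding b'_def wint_atom_avg[OF r(1) D(1)] supp(1) by (rule D(4))
    then show "wint meas (Q j) (b' \<sigma> Q j) = sum meas (Q j)" using r sum_at by metis
    have "wint meas (atm (rq Q j)) (\<lambda>I. w' \<sigma> Q j I powr p j) \<le> B * meas (rq Q j)"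
      unfolding w'_def wint_atom_power_avg[OF r(1) p1 D(2)] supp(2) by (rule D(5))
    then show "wint meas (Q j) (\<lambda>I. w' \<sigma> Q j I powr p j) \<le> B * sum meas (Q j)" using r sum_at by metis
  next
    fix \<sigma> \<sigma>' Q Q' j
    assume \<sigma>: "\<sigma> \<in> \<Sigma>" "\<sigma>' \<in> \<Sigma>" "length \<sigma> = k" "length \<sigma>' = k" "pf.tnested \<sigma> Q" "pf.tnested \<sigma>' Q'" "Suc j < k"
      and eq: "\<forall>l\<le>j. \<sigma> ! l = \<sigma>' ! l \<and> Q (\<sigma> ! l) = Q' (\<sigma>' ! l)"
    have "b \<sigma> (rq Q) (path_at \<sigma> (Suc j)) = b \<sigma>' (rq Q') (path_at \<sigma>' (Suc j))"
    proof (rule H2[rule_format, OF \<sigma>(1,2,3,4) nest[OF \<sigma>(1,5)] nest[OF \<sigma>(2,6)] _ \<sigma>(7)])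
      show "path_at \<sigma> l = path_at \<sigma>' l \<and> rq Q (path_at \<sigma> l) = rq Q' (path_at \<sigma>' l)" if "l \<in> {1..Suc j}" for l
      proof -
        have "l - 1 \<le> j" using that by auto
        then have "\<sigma> ! (l - 1) = \<sigma>' ! (l - 1) \<and> Q (\<sigma> ! (l - 1)) = Q' (\<sigma>' ! (l - 1))" using eq by blast
        then show ?thesis unfolding path_at_def rq_def by (metis)
      qed
    qed simp
    then have "b \<sigma> (rq Q) (\<sigma> ! j) = b \<sigma>' (rq Q') (\<sigma>' ! j)" by (simp add: path_at_def)
    moreover have "\<sigma> ! j = \<sigma>' ! j" using eq by blast
    ultimately show "b' \<sigma> Q (\<sigma> ! j) = b' \<sigma>' Q' (\<sigma>' ! j)" "w' \<sigma> Q (\<sigma> ! j) = w' \<sigma>' Q' (\<sigma>' ! j)"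
      by (simp_all add: b'_def w'_def)
  next
    fix \<sigma> Q g assume \<sigma>: "\<sigma> \<in> \<Sigma>" "length \<sigma> = k" "pf.tnested \<sigma> Q"
    define U where "U = rq Q (last \<sigma>)"
    have U: "coarse U" "Q (last \<sigma>) = atm U" using rq[OF \<sigma>(3)] by (auto simp: U_def)
    define h where "h = ext (restr (atm U) g)"
    have pk: "path_at \<sigma> k = last \<sigma>" using last[OF \<sigma>(1)] \<sigma>(2) by simp
    define F where "F = testing_tuple b \<sigma> (rq Q) h"
    have F: "F s = (if s = last \<sigma> then h else if s \<in> set \<sigma> then (\<lambda>x. indicat_real U x * b \<sigma> (rq Q) s x) else indicat_real U)" for s
      using last[OF \<sigma>(1)] by (simp add: F_def testing_tuple_def U_def Let_def)
    \<comment> \<open>The tuple after averaging. Its entries have the same integrals over the cubes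
      of the kernel as those of \<open>F\<close>, hence the form has the same value.\<close>
    define F' where "F' s = ext (restr (atm U) (pf.ttuple b' \<sigma> Q g s))" for s
    have sU: "U \<in> sets lebesgue" using U(1) scale_lmeasurable by (auto simp: coarse_def)
    have but: "s \<in> set (butlast \<sigma>)" if "s \<in> set \<sigma>" "s \<noteq> last \<sigma>" for s
      using that ne[OF \<sigma>(1)] by (metis append_butlast_last_id in_set_butlast_appendI Un_iff set_append set_ConsD empty_iff empty_set)
    have iF: "integrable lebesgue (F s)" for s
    proof -
      have "integrable lebesgue (indicat_real U)" using ext_integrable ext_restr_one[OF U(1)] by metis
      then show ?thesis
        unfolding F using integrable_indicat[OF sU bD(1)[OF \<sigma> but]] by (auto simp: h_def ext_integrable)
    qed
    have int: "(LINT x|lebesgue. indicat_real T x * F s x) = (LINT x|lebesgue. indicat_real T x * F' s x)"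
      if T: "T \<in> dyadic_cubes_of_scale m" "N \<le> m" for T m s
    proof -
      consider "s = last \<sigma>" | "s \<noteq> last \<sigma>" "s \<in> set \<sigma>" | "s \<noteq> last \<sigma>" "s \<notin> set \<sigma>" by blast
      then show ?thesis
      proof cases
        case 1 then show ?thesis by (simp add: F F'_def h_def pf.ttuple_def)
      next
        case 2
        then show ?thesis
          using integral_ext_atom_avg[OF U(1) bD(1)[OF \<sigma> but[OF 2(2,1)]] T] by (simp add: F F'_def pf.ttuple_def b'_def)
      next
        case 3 then show ?thesis by (simp add: F F'_def pf.ttuple_def ext_restr_one[OF U(1)])
      qed
    qed
    have "\<Lambda> F = (\<Sum>s\<in>S. c s * (\<Prod>j\<in>UNIV. (LINT x|lebesgue. indicat_real (R s j) x * F j x)))" by (rule ker[OF iF])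
    also have "\<dots> = (\<Sum>s\<in>S. c s * (\<Prod>j\<in>UNIV. (LINT x|lebesgue. indicat_real (R s j) x * F' j x)))"
    proof (intro sum.cong refl arg_cong2[where f="(*)"] prod.cong)
      fix s j assume "s \<in> S"
      then obtain m where "R s j \<in> dyadic_cubes_of_scale m" "N \<le> m" using S by blast
      then show "(LINT x|lebesgue. indicat_real (R s j) x * F j x) = (LINT x|lebesgue. indicat_real (R s j) x * F' j x)"
        by (rule int)
    qed
    also have "\<dots> = \<Lambda> F'" by (rule ker[symmetric]) (simp add: F'_def ext_integrable)
    finally have FF: "\<Lambda> F = \<Lambda> F'" .
    have nrm: "Lp_norm (p s) (F s) = pf.nrm s (atm U) (pf.ttuple w' \<sigma> Q g s)" for s
    proof -
      consider "s = last \<sigma>" | "s \<noteq> last \<sigma>" "s \<in> set \<sigma>" | "s \<noteq> last \<sigma>" "s \<notin> set \<sigma>" by blast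
      then show ?thesis
      proof cases
        case 1 then show ?thesis by (simp add: F h_def pf.ttuple_def Lp_atm)
      next
        case 2
        note D = bD[OF \<sigma> but[OF 2(2,1)]]
        have "\<bar>indicat_real U x * b \<sigma> (rq Q) s x\<bar> powr p s = indicat_real U x * \<bar>b \<sigma> (rq Q) s x\<bar> powr p s" for x
          using p1[of s] by (simp add: indicator_def)
        then have "Lp_norm (p s) (F s) = (wint meas (atm U) (\<lambda>I. atom_power_avg (p s) (b \<sigma> (rq Q) s) I powr p s)) powr (1 / p s)"
          using 2 by (simp add: F Lp_norm_def wint_atom_power_avg[OF U(1) p1 D(2)])
        moreover have "\<bar>atom_power_avg e f I\<bar> = atom_power_avg e f I" for e f I by (simp add: atom_power_avg_def)
        ultimately show ?thesis using 2 by (simp add: pf.nrm_def pf.ttuple_def w'_def)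
      next
        case 3
        then show ?thesis using Lp_atm[of s U "\<lambda>_. 1"] by (simp add: F pf.ttuple_def ext_restr_one[OF U(1)])
      qed
    qed
    have "\<bar>\<Lambda> F\<bar> \<le> B * (\<Prod>j\<in>UNIV. Lp_norm (p j) (F j))"
      unfolding F_def
    proof (rule H3[rule_format, OF \<sigma>(1,2) nest[OF \<sigma>(1,3)]])
      show "dyadic_test_function h" by (simp add: h_def ext_test)
      show "supported_on h (rq Q (path_at \<sigma> k))"
        unfolding pk U_def[symmetric] supported_on_def h_def by (auto intro: ext_support[of U] simp: restr_def)
    qed
    then show "\<bar>\<Lambda> (\<lambda>j. ext (restr (Q (last \<sigma>)) (pf.ttuple b' \<sigma> Q g j)))\<bar>
       \<le> B * (\<Prod>j\<in>UNIV. pf.nrm j (Q (last \<sigma>)) (pf.ttuple w' \<sigma> Q g j))"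
      unfolding FF nrm U(2) by (simp add: F'_def[abs_def])
  qed
  have cP: "coarse P" using P_scale NP by (auto simp: coarse_def)
  have PD: "atm P \<in> DD" by (rule at_in_DD[OF cP])
  define A where "A = pf.bounded_const k B"
  have A: "0 \<le> A"
    unfolding A_def pf.bounded_const_def
    using pf.step_const_iter_ge_1[OF pf.level_const_ge_1[OF B]] by (meson order_trans zero_le_one)
  have "\<bar>\<Lambda> (\<lambda>j. ext (restr (atm P) (g j)))\<bar> \<le> pf.lp_const A * (\<Prod>j\<in>UNIV. pf.nrm j (atm P) (g j))"
  proof (rule pf.lp_from_bounded[OF A _ PD])
    fix C and f :: "'n \<Rightarrow> (real^'d) set \<Rightarrow> real" assume "C \<in> DD" "\<And>i x. x \<in> C \<Longrightarrow> \<bar>f i x\<bar> \<le> 1"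
    then show "\<bar>\<Lambda> (\<lambda>j. ext (restr C (f j)))\<bar> \<le> A * sum meas C"
      unfolding A_def by (rule pf.testing_data_bounded[OF adm data B k n])
  qed
  also have "\<dots> \<le> full_const p (2 ^ CARD('d)) B * (\<Prod>j\<in>UNIV. pf.nrm j (atm P) (g j))"
  proof (rule mult_right_mono)
    have "\<bar>pf.lp_const A\<bar> \<le> full_const p (2 ^ CARD('d)) B"
      unfolding full_const_def A_def
      by (rule member_le_sum[of k "{..CARD('n)}" "\<lambda>k. \<bar>pf.lp_const (pf.bounded_const k B)\<bar>"]) (use k in auto)
    then show "pf.lp_const A \<le> full_const p (2 ^ CARD('d)) B" by linarith
  qed (simp add: prod_nonneg pf.nrm_nonneg)
  finally show ?thesis by (simp add: Lp_atm)
qed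

end

section \<open>Quadrants\<close>

text \<open>\<theta> collects the negative coordinates. Zero is never an interior point of a dyadic
  interval, so no dyadic cube meets two quadrants.\<close>

definition quadrant :: "'a::euclidean_space set \<Rightarrow> 'a set" where
  "quadrant \<theta> = {x. \<forall>b\<in>Basis. x \<bullet> b < 0 \<longleftrightarrow> b \<in> \<theta>}"

text \<open>The cube of scale \<open>m\<close> in the quadrant \<theta> with a corner at the origin.
  As \<open>m\<close> grows these cubes exhaust the quadrant.\<close>

definition corner_cube :: "'a::euclidean_space set \<Rightarrow> int \<Rightarrow> 'a set" where
  "corner_cube \<theta> m = {x. \<forall>b\<in>Basis. \<lfloor>(x \<bullet> b) / 2 powi m\<rfloor> = (if b \<in> \<theta> then - 1 else 0)}"

lemma corner_cube_scale: "corner_cube \<theta> m \<in> dyadic_cubes_of_scale m"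
  unfolding dyadic_cubes_of_scale_def mem_dyadic_interval corner_cube_def
  by (intro CollectI exI[of _ "\<lambda>b. if b \<in> \<theta> then - 1 else 0"]) (rule refl)

lemma sign_floor: "(t::real) < 0 \<longleftrightarrow> \<lfloor>t / 2 powi m\<rfloor> < 0"
proof -
  have "(0::real) < 2 powi m" by simp
  then show ?thesis by (simp add: field_simps)
qed

lemma corner_cube_subset: "corner_cube \<theta> m \<subseteq> quadrant \<theta>"
proof
  fix x assume x: "x \<in> corner_cube \<theta> m"
  have "x \<bullet> b < 0 \<longleftrightarrow> b \<in> \<theta>" if "b \<in> Basis" for b
    unfolding sign_floor[of _ m] using x that by (auto simp: corner_cube_def)
  then show "x \<in> quadrant \<theta>" by (simp add: quadrant_def)
qed

lemma in_corner_cube: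
  assumes "x \<in> quadrant \<theta>" "\<And>b. b \<in> Basis \<Longrightarrow> \<bar>x \<bullet> b\<bar> < 2 powi m"
  shows "x \<in> corner_cube \<theta> m"
proof -
  have "\<lfloor>(x \<bullet> b) / 2 powi m\<rfloor> = (if b \<in> \<theta> then - 1 else 0)" if b: "b \<in> Basis" for b
  proof -
    have pos: "(0::real) < 2 powi m" by simp
    have s: "x \<bullet> b < 0 \<longleftrightarrow> b \<in> \<theta>" using assms(1) b by (auto simp: quadrant_def)
    show ?thesis using s assms(2)[OF b] pos by (auto simp: floor_eq_iff field_simps)
  qed
  then show ?thesis by (simp add: corner_cube_def)
qed

lemma cube_quadrant: "dyadic_cube Q \<Longrightarrow> Q \<subseteq> quadrant \<theta> \<or> Q \<inter> quadrant \<theta> = {}"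
proof -
  assume "dyadic_cube Q"
  then obtain m z where Q: "Q = cube_of m z" by (auto simp: dyadic_cube_def dyadic_cubes_of_scale_eq)
  have "x \<in> quadrant \<theta> \<longleftrightarrow> z \<in> quadrant \<theta>" if "x \<in> Q" for x
  proof -
    have "\<lfloor>(x \<bullet> b) / 2 powi m\<rfloor> = \<lfloor>(z \<bullet> b) / 2 powi m\<rfloor>" if "b \<in> Basis" for b
      using \<open>x \<in> Q\<close> that by (simp add: Q cube_of_def)
    then show ?thesis unfolding quadrant_def by (simp only: sign_floor[of _ m] mem_Collect_eq cong: ball_cong)
  qed
  then show ?thesis by blast
qed

section \<open>Dyadic test functions: restriction to quadrants, fineness and support\<close>

lemma test_function_lincomb:
  assumes "dyadic_test_function u" "dyadic_test_function v"
  shows "dyadic_test_function (\<lambda>x. \<alpha> * u x + \<beta> * v x)"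
proof -
  obtain S1 c1 where S1: "finite S1" "\<And>Q. Q \<in> S1 \<Longrightarrow> dyadic_cube Q" "u = (\<lambda>x. \<Sum>Q\<in>S1. c1 Q * indicat_real Q x)"
    using assms(1) unfolding dyadic_test_function_def by blast
  obtain S2 c2 where S2: "finite S2" "\<And>Q. Q \<in> S2 \<Longrightarrow> dyadic_cube Q" "v = (\<lambda>x. \<Sum>Q\<in>S2. c2 Q * indicat_real Q x)"
    using assms(2) unfolding dyadic_test_function_def by blast
  define c where "c Q = \<alpha> * (if Q \<in> S1 then c1 Q else 0) + \<beta> * (if Q \<in> S2 then c2 Q else 0)" for Q
  have "\<alpha> * u x + \<beta> * v x = (\<Sum>Q\<in>S1 \<union> S2. c Q * indicat_real Q x)" for x
  proof -
    have "u x = (\<Sum>Q\<in>S1 \<union> S2. (if Q \<in> S1 then c1 Q else 0) * indicat_real Q x)"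
      unfolding S1(3) using S1(1) S2(1) by (intro sum.mono_neutral_cong_left) auto
    moreover have "v x = (\<Sum>Q\<in>S1 \<union> S2. (if Q \<in> S2 then c2 Q else 0) * indicat_real Q x)"
      unfolding S2(3) using S1(1) S2(1) by (intro sum.mono_neutral_cong_left) auto
    ultimately show ?thesis
      unfolding c_def distrib_right sum.distrib by (simp only: sum_distrib_left mult.assoc)
  qed
  then show ?thesis unfolding dyadic_test_function_def
    using S1 S2 by (intro exI[of _ "S1 \<union> S2"] exI[of _ c]) auto
qed

lemma test_function_quadrant:
  assumes "dyadic_test_function f" shows "dyadic_test_function (\<lambda>x. indicat_real (quadrant \<theta>) x * f x)"
proof -
  obtain S c where S: "finite S" "\<And>Q. Q \<in> S \<Longrightarrow> dyadic_cube Q" "f = (\<lambda>x. \<Sum>Q\<in>S. c Q * indicat_real Q x)"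
    using assms unfolding dyadic_test_function_def by blast
  have "indicat_real (quadrant \<theta>) x * f x = (\<Sum>Q\<in>{Q \<in> S. Q \<subseteq> quadrant \<theta>}. c Q * indicat_real Q x)" for x
  proof -
    have "indicat_real (quadrant \<theta>) x * f x = (\<Sum>Q\<in>S. if Q \<subseteq> quadrant \<theta> then c Q * indicat_real Q x else 0)"
      unfolding S(3) sum_distrib_left using cube_quadrant[OF S(2), of _ \<theta>]
      by (intro sum.cong) (auto simp: indicator_def)
    then show ?thesis by (simp only: sum.inter_filter[OF S(1)])
  qed
  then show ?thesis unfolding dyadic_test_function_def
    using S by (intro exI[of _ "{Q \<in> S. Q \<subseteq> quadrant \<theta>}"] exI[of _ c]) auto
qed

lemma sum_quadrants:
  fixes x :: "'a::euclidean_space"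
  shows "(\<Sum>\<theta>\<in>Pow Basis. indicat_real (quadrant \<theta>) x * f x) = f x"
proof -
  define \<theta>0 where "\<theta>0 = {b \<in> Basis. x \<bullet> b < 0}"
  have "(\<Sum>\<theta>\<in>Pow Basis. indicat_real (quadrant \<theta>) x * f x) = (\<Sum>\<theta>\<in>Pow Basis. if \<theta> = \<theta>0 then f x else 0)"
    by (intro sum.cong) (auto simp: quadrant_def \<theta>0_def indicator_def)
  also have "\<dots> = f x" by (subst sum.delta) (auto simp: \<theta>0_def)
  finally show ?thesis .
qed

lemma test_function_fine:
  assumes "dyadic_test_function f" shows "\<exists>N. \<forall>N'\<le>N. \<forall>x y. y \<in> cube_of N' x \<longrightarrow> f y = f x"
proof -
  obtain S c where S: "finite S" "\<And>Q. Q \<in> S \<Longrightarrow> dyadic_cube Q" "f = (\<lambda>x. \<Sum>Q\<in>S. c Q * indicat_real Q x)"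
    using assms unfolding dyadic_test_function_def by blast
  have "\<exists>N. \<forall>N'\<le>N. \<forall>Q\<in>S. \<forall>x y. y \<in> cube_of N' x \<longrightarrow> (y \<in> Q \<longleftrightarrow> x \<in> Q)"
  proof (rule scale_family_lower_bound[OF S(1)])
    fix Q assume "Q \<in> S"
    then obtain m where m: "Q \<in> dyadic_cubes_of_scale m" using S(2) by (auto simp: dyadic_cube_def)
    have "y \<in> Q \<longleftrightarrow> x \<in> Q" if "N' \<le> m" "y \<in> cube_of N' x" for N' x y
    proof -
      have "y \<in> cube_of m x" using cube_of_coarser[OF that(1)] that(2) by blast
      then have "cube_of m y = cube_of m x" by (rule cube_of_eq)
      then show ?thesis using scale_cube_of[OF m] cube_of_self by metis
    qed
    then show "\<exists>N. \<forall>N'\<le>N. \<forall>x y. y \<in> cube_of N' x \<longrightarrow> (y \<in> Q \<longleftrightarrow> x \<in> Q)" by blast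
  qed
  then obtain N where "\<forall>N'\<le>N. \<forall>Q\<in>S. \<forall>x y. y \<in> cube_of N' x \<longrightarrow> (y \<in> Q \<longleftrightarrow> x \<in> Q)" by blast
  then have "\<forall>N'\<le>N. \<forall>x y. y \<in> cube_of N' x \<longrightarrow> f y = f x"
    unfolding S(3) by (intro allI impI sum.cong) (auto simp: indicator_def)
  then show ?thesis by blast
qed

lemma test_function_integrable: "dyadic_test_function f \<Longrightarrow> integrable lebesgue f"
  unfolding dyadic_test_function_def dyadic_cube_def
  using scale_lmeasurable lmeasurable_iff_integrable by (fastforce intro!: Bochner_Integration.integrable_sum integrable_mult_right)

lemma test_function_bounded_support:
  assumes "dyadic_test_function f" shows "\<exists>M. \<forall>m\<ge>M. \<forall>x. f x \<noteq> 0 \<longrightarrow> (\<forall>b\<in>Basis. \<bar>x \<bullet> b\<bar> < 2 powi m)"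
proof -
  obtain S c where S: "finite S" "\<And>Q. Q \<in> S \<Longrightarrow> dyadic_cube Q" "f = (\<lambda>x. \<Sum>Q\<in>S. c Q * indicat_real Q x)"
    using assms unfolding dyadic_test_function_def by blast
  have "\<exists>N. \<forall>N'\<le>N. \<forall>Q\<in>S. \<forall>x\<in>Q. \<forall>b\<in>Basis. \<bar>x \<bullet> b\<bar> < 2 powi (- N')"
  proof (rule scale_family_lower_bound[OF S(1)])
    fix Q assume "Q \<in> S"
    then have "dyadic_cube Q" by (rule S(2))
    then obtain m z where Q: "Q = cube_of m z" by (auto simp: dyadic_cube_def dyadic_cubes_of_scale_eq)
    define u where "u = (\<Sum>b\<in>Basis. 2 powi m * (\<bar>real_of_int \<lfloor>(z \<bullet> b) / 2 powi m\<rfloor>\<bar> + 1))"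
    have xu: "\<bar>x \<bullet> b\<bar> \<le> u" if "x \<in> Q" "b \<in> Basis" for x b
    proof -
      have pos: "(0::real) < 2 powi m" by simp
      have "x \<bullet> b \<in> {2 powi m * real_of_int \<lfloor>(z \<bullet> b) / 2 powi m\<rfloor> ..< 2 powi m * (real_of_int \<lfloor>(z \<bullet> b) / 2 powi m\<rfloor> + 1)}"
        unfolding mem_dyadic_interval using that by (auto simp: Q cube_of_def)
      then have "\<bar>x \<bullet> b\<bar> \<le> \<bar>2 powi m * real_of_int \<lfloor>(z \<bullet> b) / 2 powi m\<rfloor>\<bar> + 2 powi m"
        using pos by (simp add: distrib_left abs_le_iff) linarith
      also have "\<dots> = 2 powi m * (\<bar>real_of_int \<lfloor>(z \<bullet> b) / 2 powi m\<rfloor>\<bar> + 1)"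
        using pos by (simp add: abs_mult distrib_left)
      also have "\<dots> \<le> u" unfolding u_def using that(2)
        by (intro member_le_sum[of b Basis "\<lambda>b. 2 powi m * (\<bar>real_of_int \<lfloor>(z \<bullet> b) / 2 powi m\<rfloor>\<bar> + 1)"]) auto
      finally show ?thesis .
    qed
    obtain k :: nat where k: "u < 2 ^ k" using real_arch_pow[of 2 u] by auto
    have "\<bar>x \<bullet> b\<bar> < 2 powi (- N')" if "N' \<le> - int k" "x \<in> Q" "b \<in> Basis" for N' x b
    proof -
      have "(2::real) powi int k \<le> 2 powi (- N')" using that(1) by (intro power_int_increasing) auto
      then show ?thesis using xu[OF that(2,3)] k by simp
    qed
    then show "\<exists>N. \<forall>N'\<le>N. \<forall>x\<in>Q. \<forall>b\<in>Basis. \<bar>x \<bullet> b\<bar> < 2 powi (- N')" by blast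
  qed
  then obtain N where N: "\<forall>N'\<le>N. \<forall>Q\<in>S. \<forall>x\<in>Q. \<forall>b\<in>Basis. \<bar>x \<bullet> b\<bar> < 2 powi (- N')" by blast
  have "\<forall>b\<in>Basis. \<bar>x \<bullet> b\<bar> < 2 powi m" if m: "- N \<le> m" and x: "f x \<noteq> 0" for m x
  proof -
    have "\<exists>Q\<in>S. x \<in> Q"
    proof (rule ccontr)
      assume "\<not> (\<exists>Q\<in>S. x \<in> Q)"
      then have "f x = 0" unfolding S(3) by (intro sum.neutral) auto
      then show False using x by simp
    qed
    then obtain Q where "Q \<in> S" "x \<in> Q" by blast
    then show ?thesis using N[rule_format, of "- m" Q x] m by auto
  qed
  then show ?thesis by blast
qed

text \<open>Mass in one quadrant can be spread over larger and larger cubes of it. The form does not see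
  this if another function vanishes on the quadrant, but the kernel has compact support.\<close>

lemma mixed_quadrants_vanish:
  fixes \<Lambda> :: "('n::finite \<Rightarrow> real^'d::finite \<Rightarrow> real) \<Rightarrow> real"
  assumes \<Lambda>: "multilinear_on_test_functions \<Lambda>" "perfect_smoothness \<Lambda>"
    and S: "finite S" and Rm: "\<And>s j. s \<in> S \<Longrightarrow> \<exists>m. R s j \<in> dyadic_cubes_of_scale m"
    and ker: "\<And>f. (\<And>j. integrable lebesgue (f j)) \<Longrightarrow> \<Lambda> f = (\<Sum>s\<in>S. c s * (\<Prod>j\<in>UNIV. (LINT x|lebesgue. indicat_real (R s j) x * f j x)))"
    and F: "\<And>j. dyadic_test_function (F j)" and ij: "i \<noteq> j"
    and Fj: "\<And>x. x \<notin> quadrant \<theta> \<Longrightarrow> F j x = 0" and Fi: "\<And>x. x \<in> quadrant \<theta> \<Longrightarrow> F i x = 0"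
  shows "\<Lambda> F = 0"
proof (rule ccontr)
  assume nz: "\<Lambda> F \<noteq> 0"
  define a where "a = (LINT x|lebesgue. F j x)"
  define T where "T m = corner_cube \<theta> m" for m :: int
  have T: "T m \<in> dyadic_cubes_of_scale m" for m by (simp add: T_def corner_cube_scale)
  have Tt: "dyadic_test_function (indicat_real (T m))" for m
    unfolding dyadic_test_function_def using T[of m]
    by (intro exI[of _ "{T m}"] exI[of _ "\<lambda>_. 1"]) (auto simp: dyadic_cube_def)
  have mT: "measure lebesgue (T m) = (2 powi m) ^ CARD('d)" for m using measure_scale[OF T] by simp
  obtain M where M: "\<And>m x. M \<le> m \<Longrightarrow> F j x \<noteq> 0 \<Longrightarrow> (\<forall>b\<in>Basis. \<bar>x \<bullet> b\<bar> < 2 powi m)"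
    using test_function_bounded_support[OF F[of j]] by blast
  \<comment> \<open>A bound that does not involve \<open>m\<close>: however large the corner cube, a
    cube of the kernel meets it in at most its own measure.\<close>
  define D where "D = (\<Sum>s\<in>S. \<bar>c s\<bar> * (measure lebesgue (R s j) * (\<Prod>k\<in>UNIV - {j}. \<bar>LINT x|lebesgue. indicat_real (R s k) x * F k x\<bar>)))"
  have D: "0 \<le> D" unfolding D_def by (intro sum_nonneg mult_nonneg_nonneg prod_nonneg) auto
  have bound: "\<bar>\<Lambda> (F(j := indicat_real (T m)))\<bar> \<le> D" for m
  proof -
    have int: "integrable lebesgue ((F(j := indicat_real (T m))) k)" for k
      using F Tt by (auto intro: test_function_integrable)
    have "\<bar>\<Lambda> (F(j := indicat_real (T m)))\<bar> \<le> (\<Sum>s\<in>S. \<bar>c s * (\<Prod>k\<in>UNIV. (LINT x|lebesgue. indicat_real (R s k) x * (F(j := indicat_real (T m))) k x))\<bar>)"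
      unfolding ker[OF int] by (rule sum_abs)
    also have "\<dots> \<le> D" unfolding D_def
    proof (rule sum_mono)
      fix s assume s: "s \<in> S"
      obtain l where l: "R s j \<in> dyadic_cubes_of_scale l" using Rm[OF s] by blast
      have "\<bar>LINT x|lebesgue. indicat_real (R s j) x * indicat_real (T m) x\<bar> \<le> measure lebesgue (R s j)"
      proof -
        have "(LINT x|lebesgue. indicat_real (R s j) x * indicat_real (T m) x) = measure lebesgue (R s j \<inter> T m)"
          by (simp add: indicator_inter_arith[symmetric])
        also have "\<dots> \<le> measure lebesgue (R s j)"
          using scale_lmeasurable[OF l] scale_lmeasurable[OF T] by (intro measure_mono_fmeasurable) (auto dest: fmeasurableD)
        finally show ?thesis by (simp add: indicator_inter_arith[symmetric])
      qed
      then show "\<bar>c s * (\<Prod>k\<in>UNIV. (LINT x|lebesgue. indicat_real (R s k) x * (F(j := indicat_real (T m))) k x))\<bar>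
         \<le> \<bar>c s\<bar> * (measure lebesgue (R s j) * (\<Prod>k\<in>UNIV - {j}. \<bar>LINT x|lebesgue. indicat_real (R s k) x * F k x\<bar>))"
        by (simp add: prod.remove[of UNIV j] abs_mult abs_prod mult_left_mono mult_right_mono prod_nonneg)
    qed
    finally show ?thesis .
  qed
  have "\<bar>\<Lambda> F\<bar> * (2 powi m) ^ CARD('d) \<le> \<bar>a\<bar> * D" if m: "M \<le> m" for m
  proof -
    define t where "t = a / measure lebesgue (T m)"
    have tm: "0 < measure lebesgue (T m)" by (rule measure_scale_pos[OF T])
    \<comment> \<open>It has mean zero and lives on the corner cube, where \<open>F i\<close>
      vanishes. Smoothness thus replaces \<open>F j\<close> by the indicator of the corner cube with
      the coefficient \<open>t\<close>, which decays like the inverse of the volume.\<close>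
    define k where "k = (\<lambda>x. 1 * F j x + (- t) * indicat_real (T m) x)"
    have kt: "dyadic_test_function k"
      unfolding k_def by (rule test_function_lincomb[OF F Tt])
    have "\<Lambda> (F(j := k)) = 0"
    proof (rule \<Lambda>(2)[unfolded perfect_smoothness_def, rule_format, of "F(j := k)" "T m" i j])
      show "dyadic_test_function ((F(j := k)) l)" for l using F kt by simp
      show "dyadic_cube (T m)" using T dyadic_cube_def by blast
      show "i \<noteq> j" by fact
      show "supported_on ((F(j := k)) j) (T m)"
        unfolding supported_on_def T_def
      proof (intro allI impI)
        fix x assume x: "x \<notin> corner_cube \<theta> m"
        have "F j x = 0"
        proof (rule ccontr)
          assume "F j x \<noteq> 0"
          then have "x \<in> corner_cube \<theta> m" using M[OF m] Fj by (intro in_corner_cube) blast+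
          then show False using x by simp
        qed
        then show "(F(j := k)) j x = 0" using x by (simp add: k_def T_def)
      qed
      have "(LINT x|lebesgue. k x) = a + (- t) * measure lebesgue (T m)"
        unfolding k_def a_def using test_function_integrable[OF F[of j]] test_function_integrable[OF Tt[of m]]
        by (subst Bochner_Integration.integral_add) (auto intro: integrable_mult_right)
      then show "(LINT x|lebesgue. (F(j := k)) j x) = 0" using tm by (simp add: t_def)
      show "(F(j := k)) i x = 0" if "x \<in> T m" for x
        using that Fi corner_cube_subset ij by (auto simp: T_def)
    qed
    moreover have "\<Lambda> (F(j := k)) = 1 * \<Lambda> (F(j := F j)) + (- t) * \<Lambda> (F(j := indicat_real (T m)))"
      unfolding k_def by (rule \<Lambda>(1)[unfolded multilinear_on_test_functions_def, rule_format]) (use F Tt in auto)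
    ultimately have "\<Lambda> F = t * \<Lambda> (F(j := indicat_real (T m)))" by simp
    then have "\<bar>\<Lambda> F\<bar> \<le> \<bar>t\<bar> * D" using bound[of m] by (simp add: abs_mult mult_left_mono)
    then have "\<bar>\<Lambda> F\<bar> * measure lebesgue (T m) \<le> \<bar>t\<bar> * D * measure lebesgue (T m)" using tm by (intro mult_right_mono) auto
    also have "\<dots> = \<bar>a\<bar> * D" using tm by (simp add: t_def abs_divide)
    finally show ?thesis by (simp add: mT)
  qed note up = this
  obtain l :: nat where l: "\<bar>a\<bar> * D / \<bar>\<Lambda> F\<bar> < 2 ^ l" using real_arch_pow[of 2 "\<bar>a\<bar> * D / \<bar>\<Lambda> F\<bar>"] by auto
  define m where "m = max M (int l)"
  have "(2::real) ^ l = 2 powi int l" by simp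
  also have "\<dots> \<le> 2 powi m" unfolding m_def by (intro power_int_increasing) auto
  also have "\<dots> \<le> (2 powi m) ^ CARD('d)"
  proof (rule self_le_power)
    have "(2::real) powi 0 \<le> 2 powi m" unfolding m_def by (intro power_int_increasing) auto
    then show "(1::real) \<le> 2 powi m" by simp
  qed simp
  finally have "\<bar>a\<bar> * D / \<bar>\<Lambda> F\<bar> < (2 powi m) ^ CARD('d)" using l by linarith
  then have "\<bar>a\<bar> * D < \<bar>\<Lambda> F\<bar> * (2 powi m) ^ CARD('d)" using nz by (simp add: field_simps)
  then show False using up[of m] by (simp add: m_def)
qed

lemma Lp_norm_nonneg: "0 \<le> Lp_norm q f"
  by (simp add: Lp_norm_def)

lemma test_function_powr_integrable:
  assumes "dyadic_test_function f" "1 < q" shows "integrable lebesgue (\<lambda>x. \<bar>f x\<bar> powr q)"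
proof -
  obtain S c where S: "finite S" "\<And>Q. Q \<in> S \<Longrightarrow> dyadic_cube Q" "f = (\<lambda>x. \<Sum>Q\<in>S. c Q * indicat_real Q x)"
    using assms unfolding dyadic_test_function_def by blast
  define A where "A = (\<Sum>Q\<in>S. \<bar>c Q\<bar>)"
  have fA: "\<bar>f x\<bar> \<le> A" for x
    unfolding S(3) A_def by (rule order_trans[OF sum_abs]) (intro sum_mono, simp add: abs_mult indicator_def)
  have fi: "integrable lebesgue f" by (rule test_function_integrable[OF assms(1)])
  show ?thesis
  proof (rule Bochner_Integration.integrable_bound)
    show "integrable lebesgue (\<lambda>x. A powr (q - 1) * \<bar>f x\<bar>)" using fi by (intro integrable_mult_right integrable_abs)
    show "AE x in lebesgue. norm (\<bar>f x\<bar> powr q) \<le> norm (A powr (q - 1) * \<bar>f x\<bar>)"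
    proof (rule AE_I2)
      fix x
      have "\<bar>f x\<bar> powr q = \<bar>f x\<bar> powr (q - 1) * \<bar>f x\<bar>"
        using powr_add[of "\<bar>f x\<bar>" "q - 1" 1] by (cases "f x = 0") auto
      also have "\<dots> \<le> A powr (q - 1) * \<bar>f x\<bar>" using fA assms(2) by (intro mult_right_mono powr_mono2) auto
      finally show "norm (\<bar>f x\<bar> powr q) \<le> norm (A powr (q - 1) * \<bar>f x\<bar>)" by simp
    qed
    show "(\<lambda>x. \<bar>f x\<bar> powr q) \<in> borel_measurable lebesgue" using fi by (auto dest: borel_measurable_integrable)
  qed
qed

lemma Lp_norm_quadrant:
  assumes "dyadic_test_function f" "1 < q"
  shows "Lp_norm q (\<lambda>x. indicat_real (quadrant \<theta>) x * f x) \<le> Lp_norm q f"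
  unfolding Lp_norm_def
proof (rule powr_mono2[OF _ integral_nonneg_AE integral_mono])
  show "integrable lebesgue (\<lambda>x. \<bar>indicat_real (quadrant \<theta>) x * f x\<bar> powr q)"
    using test_function_powr_integrable[OF test_function_quadrant[OF assms(1)] assms(2)] .
  show "\<bar>indicat_real (quadrant \<theta>) x * f x\<bar> powr q \<le> \<bar>f x\<bar> powr q" for x
    using assms(2) by (intro powr_mono2) (auto simp: indicator_def)
qed (use assms test_function_powr_integrable in auto)

text \<open>Only one function is expanded over the quadrants; the others are then forced into the
  same quadrant, so the number of terms is the number of quadrants. Within a quadrant all functions
  live in one corner cube, to which the finite model applies.\<close>

theorem theorem1p4:
  fixes p :: "'n::finite \<Rightarrow> real" and B :: real
  assumes "2 \<le> CARD('n)" and "hoelder_tuple p" and "1 \<le> B"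
  shows "\<exists>C::real. \<forall>(k::nat) (\<Lambda> :: ('n \<Rightarrow> real^'d::finite \<Rightarrow> real) \<Rightarrow> real)
            (\<Sigma> :: 'n list set) (b :: ('n, 'd) testing_family).
     1 \<le> k \<longrightarrow> k \<le> CARD('n) \<longrightarrow> perfect_CZ_form \<Lambda> \<longrightarrow> admissible \<Sigma> \<longrightarrow>
     (\<forall>\<sigma>\<in>\<Sigma>. \<forall>Q. \<forall>j \<in> path_at \<sigma> ` {1..k-1}. length \<sigma> = k \<longrightarrow> nested \<sigma> Q \<longrightarrow>
        b \<sigma> Q j \<in> borel_measurable lebesgue \<and>
        supported_on (b \<sigma> Q j) (Q j) \<and>
        (LINT x|lebesgue. b \<sigma> Q j x) = measure lebesgue (Q j) \<and>
        integrable lebesgue (\<lambda>x. \<bar>b \<sigma> Q j x\<bar> powr p j) \<and>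
        (LINT x|lebesgue. \<bar>b \<sigma> Q j x\<bar> powr p j) \<le> B * measure lebesgue (Q j)) \<longrightarrow>
     (\<forall>\<sigma>\<in>\<Sigma>. \<forall>\<sigma>'\<in>\<Sigma>. \<forall>Q Q' j.
        length \<sigma> = k \<longrightarrow> length \<sigma>' = k \<longrightarrow> nested \<sigma> Q \<longrightarrow> nested \<sigma>' Q' \<longrightarrow> 1 \<le> j \<longrightarrow> j < k \<longrightarrow>
        (\<forall>l\<in>{1..j}. path_at \<sigma> l = path_at \<sigma>' l \<and> Q (path_at \<sigma> l) = Q' (path_at \<sigma>' l)) \<longrightarrow>
        b \<sigma> Q (path_at \<sigma> j) = b \<sigma>' Q' (path_at \<sigma>' j)) \<longrightarrow>
     (\<forall>\<sigma>\<in>\<Sigma>. \<forall>Q g. length \<sigma> = k \<longrightarrow> nested \<sigma> Q \<longrightarrow>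
        dyadic_test_function g \<longrightarrow> supported_on g (Q (path_at \<sigma> k)) \<longrightarrow>
        \<bar>\<Lambda> (testing_tuple b \<sigma> Q g)\<bar> \<le> B * (\<Prod>j\<in>UNIV. Lp_norm (p j) (testing_tuple b \<sigma> Q g j))) \<longrightarrow>
     (\<forall>f. (\<forall>j. dyadic_test_function (f j)) \<longrightarrow>
        \<bar>\<Lambda> f\<bar> \<le> C * (\<Prod>j\<in>UNIV. Lp_norm (p j) (f j)))"
proof -
  define C where "C = full_const p (2 ^ CARD('d)) B"
  have C: "0 \<le> C" by (simp add: C_def full_const_def sum_nonneg)
  define qs :: "(real^'d) set set" where "qs = Pow Basis"
  have qs: "finite qs" by (simp add: qs_def)
  have p1: "1 < p j" for j using assms(2) by (simp add: hoelder_tuple_def)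
  show ?thesis
  proof (rule exI[of _ "real (card qs) * C"], intro allI impI)
    fix k :: nat and \<Lambda> :: "('n \<Rightarrow> real^'d \<Rightarrow> real) \<Rightarrow> real" and \<Sigma> and b :: "('n, 'd) testing_family" and f
    assume k: "1 \<le> k" "k \<le> CARD('n)" and CZ: "perfect_CZ_form \<Lambda>" and adm: "admissible \<Sigma>"
      and H: "\<forall>\<sigma>\<in>\<Sigma>. \<forall>Q. \<forall>j \<in> path_at \<sigma> ` {1..k-1}. length \<sigma> = k \<longrightarrow> nested \<sigma> Q \<longrightarrow>
        b \<sigma> Q j \<in> borel_measurable lebesgue \<and>
        supported_on (b \<sigma> Q j) (Q j) \<and>
        (LINT x|lebesgue. b \<sigma> Q j x) = measure lebesgue (Q j) \<and>
        integrable lebesgue (\<lambda>x. \<bar>b \<sigma> Q j x\<bar> powr p j) \<and>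
        (LINT x|lebesgue. \<bar>b \<sigma> Q j x\<bar> powr p j) \<le> B * measure lebesgue (Q j)"
      "\<forall>\<sigma>\<in>\<Sigma>. \<forall>\<sigma>'\<in>\<Sigma>. \<forall>Q Q' j.
        length \<sigma> = k \<longrightarrow> length \<sigma>' = k \<longrightarrow> nested \<sigma> Q \<longrightarrow> nested \<sigma>' Q' \<longrightarrow> 1 \<le> j \<longrightarrow> j < k \<longrightarrow>
        (\<forall>l\<in>{1..j}. path_at \<sigma> l = path_at \<sigma>' l \<and> Q (path_at \<sigma> l) = Q' (path_at \<sigma>' l)) \<longrightarrow>
        b \<sigma> Q (path_at \<sigma> j) = b \<sigma>' Q' (path_at \<sigma>' j)"
      "\<forall>\<sigma>\<in>\<Sigma>. \<forall>Q g. length \<sigma> = k \<longrightarrow> nested \<sigma> Q \<longrightarrow>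
        dyadic_test_function g \<longrightarrow> supported_on g (Q (path_at \<sigma> k)) \<longrightarrow>
        \<bar>\<Lambda> (testing_tuple b \<sigma> Q g)\<bar> \<le> B * (\<Prod>j\<in>UNIV. Lp_norm (p j) (testing_tuple b \<sigma> Q g j))"
      and f0: "\<forall>j::'n. dyadic_test_function (f j :: real^'d \<Rightarrow> real)"
    have f: "dyadic_test_function (f j)" for j using f0 by blast
    obtain K where \<Lambda>: "multilinear_on_test_functions \<Lambda>" "dyadic_decay \<Lambda>" "perfect_smoothness \<Lambda>"
      and K: "dyadic_test_function K" "has_integral_kernel \<Lambda> K" using CZ unfolding perfect_CZ_form_def by blast
    obtain S :: "(real^'d^'n) set set" and c R N0 where S: "finite S"
      and R0: "\<forall>N'\<le>N0. \<forall>s\<in>S. \<forall>j. \<exists>m\<ge>N'. R s j \<in> dyadic_cubes_of_scale m"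
      and ker0: "\<forall>f. (\<forall>j. integrable lebesgue (f j)) \<longrightarrow> \<Lambda> f = (\<Sum>s\<in>S. c s * (\<Prod>j\<in>UNIV. (LINT x|lebesgue. indicat_real (R s j) x * f j x)))"
      using kernel_formula[OF K] by (elim exE conjE)
    have R: "\<exists>m\<ge>N. R s j \<in> dyadic_cubes_of_scale m" if "N \<le> N0" "s \<in> S" for N s j using R0 that by blast
    have ker: "\<Lambda> h = (\<Sum>s\<in>S. c s * (\<Prod>j\<in>UNIV. (LINT x|lebesgue. indicat_real (R s j) x * h j x)))"
      if "\<And>j. integrable lebesgue (h j)" for h using ker0 that by blast
    have Rm: "\<exists>m. R s j \<in> dyadic_cubes_of_scale m" if "s \<in> S" for s j using R[OF order_refl that] by blast
    define fq where "fq \<theta> j = (\<lambda>x. indicat_real (quadrant \<theta>) x * f j x)" for \<theta> j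
    have fq: "dyadic_test_function (fq \<theta> j)" for \<theta> j unfolding fq_def by (rule test_function_quadrant[OF f])
    have one: "\<bar>\<Lambda> (fq \<theta>)\<bar> \<le> C * (\<Prod>j\<in>UNIV. Lp_norm (p j) (fq \<theta> j))" for \<theta>
    proof -
      have "\<exists>N. \<forall>N'\<le>N. \<forall>j\<in>UNIV. \<forall>x. fq \<theta> j x \<noteq> 0 \<longrightarrow> (\<forall>b\<in>Basis. \<bar>x \<bullet> b\<bar> < 2 powi (- N'))"
      proof (rule scale_family_lower_bound)
        fix j :: 'n
        obtain M where "\<forall>m\<ge>M. \<forall>x. fq \<theta> j x \<noteq> 0 \<longrightarrow> (\<forall>b\<in>Basis. \<bar>x \<bullet> b\<bar> < 2 powi m)"
          using test_function_bounded_support[OF fq] by blast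
        then show "\<exists>N. \<forall>N'\<le>N. \<forall>x. fq \<theta> j x \<noteq> 0 \<longrightarrow> (\<forall>b\<in>Basis. \<bar>x \<bullet> b\<bar> < 2 powi (- N'))"
          by (intro exI[of _ "- M"]) simp
      qed simp
      then obtain M where M: "\<And>j x. fq \<theta> j x \<noteq> 0 \<Longrightarrow> (\<forall>b\<in>Basis. \<bar>x \<bullet> b\<bar> < 2 powi M)" by blast
      have "\<exists>N. \<forall>N'\<le>N. \<forall>j\<in>UNIV. \<forall>x y. y \<in> cube_of N' x \<longrightarrow> fq \<theta> j y = fq \<theta> j x"
        using test_function_fine[OF fq] by (intro scale_family_lower_bound) auto
      then obtain N1 where N1: "\<And>N' j x y. N' \<le> N1 \<Longrightarrow> y \<in> cube_of N' x \<Longrightarrow> fq \<theta> j y = fq \<theta> j x" by blast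
      \<comment> \<open>The atoms must be fine enough for the kernel and for the functions, and not
        larger than the corner cube.\<close>
      define N where "N = min N0 (min N1 M)"
      have N: "N \<le> N0" "N \<le> N1" "N \<le> M" by (auto simp: N_def)
      interpret dm: dyadic_model N M "corner_cube \<theta> M" by unfold_locales (rule corner_cube_scale)
      have cP: "dm.coarse (corner_cube \<theta> M)" using corner_cube_scale[of \<theta> M] N(3) by (auto simp: dm.coarse_def)
      \<comment> \<open>The functions are constant on atoms, so any point of an atom gives the
        value.\<close>
      define g where "g j I = fq \<theta> j (SOME x. x \<in> I)" for j I
      have eq: "fq \<theta> j = dm.ext (restr (dm.atm (corner_cube \<theta> M)) (g j))" for j
      proof
        fix x
        show "fq \<theta> j x = dm.ext (restr (dm.atm (corner_cube \<theta> M)) (g j)) x"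
        proof (cases "x \<in> corner_cube \<theta> M")
          case True
          then have c: "cube_of N x \<in> dm.atm (corner_cube \<theta> M)" by (rule dm.cube_of_in_at[OF cP])
          have "(SOME y. y \<in> cube_of N x) \<in> cube_of N x" by (rule someI[of _ x]) simp
          then have "g j (cube_of N x) = fq \<theta> j x" unfolding g_def by (rule N1[OF N(2)])
          then show ?thesis using dm.ext_atom[of "cube_of N x" x] c by (simp add: restr_def dm.atm_def)
        next
          case False
          have "fq \<theta> j x = 0"
          proof (rule ccontr)
            assume nz: "fq \<theta> j x \<noteq> 0"
            then have "x \<in> quadrant \<theta>" by (auto simp: fq_def indicator_def split: if_splits)
            then have "x \<in> corner_cube \<theta> M" using M[OF nz] by (intro in_corner_cube) auto
            then show False using False by simp
          qed
          moreover have "dm.ext (restr (dm.atm (corner_cube \<theta> M)) (g j)) x = 0"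
            by (rule dm.ext_support[OF _ False]) (simp add: restr_def)
          ultimately show ?thesis by simp
        qed
      qed
      have "\<bar>\<Lambda> (\<lambda>j. dm.ext (restr (dm.atm (corner_cube \<theta> M)) (g j)))\<bar>
        \<le> full_const p (2 ^ CARD('d)) B * (\<Prod>j\<in>UNIV. Lp_norm (p j) (dm.ext (restr (dm.atm (corner_cube \<theta> M)) (g j))))"
        by (rule dm.model_estimate[OF N(3) assms k \<Lambda> R[OF N(1)] ker adm H])
      then show ?thesis unfolding eq[symmetric] C_def by simp
    qed
    obtain u :: 'n where True by blast
    have fsum: "f j = (\<lambda>x. \<Sum>\<theta>\<in>qs. fq \<theta> j x)" for j
      unfolding fq_def qs_def using sum_quadrants[where f="f j"] by auto
    have test0: "dyadic_test_function (\<lambda>x. 0 :: real)"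
      unfolding dyadic_test_function_def by (intro exI[of _ "{}"]) auto
    have expand: "\<Lambda> (h(u := (\<lambda>x. \<Sum>\<theta>\<in>A. G \<theta> x))) = (\<Sum>\<theta>\<in>A. \<Lambda> (h(u := G \<theta>))) \<and> dyadic_test_function (\<lambda>x. \<Sum>\<theta>\<in>A. G \<theta> x)"
      if "finite A" "\<And>j. dyadic_test_function (h j)" "\<And>\<theta>. dyadic_test_function (G \<theta>)" for h u A and G :: "(real^'d) set \<Rightarrow> real^'d \<Rightarrow> real"
      using that(1)
    proof (induction A rule: finite_induct)
      case empty
      have "\<Lambda> (h(u := (\<lambda>x. 0 * 0 + 0 * 0))) = 0 * \<Lambda> (h(u := (\<lambda>x. 0))) + 0 * \<Lambda> (h(u := (\<lambda>x. 0)))"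
        by (rule \<Lambda>(1)[unfolded multilinear_on_test_functions_def, rule_format]) (use that test0 in auto)
      then show ?case using test0 by (simp del: fun_upd_apply)
    next
      case (insert \<theta> A)
      have "\<Lambda> (h(u := (\<lambda>x. 1 * G \<theta> x + 1 * (\<Sum>\<theta>\<in>A. G \<theta> x)))) = 1 * \<Lambda> (h(u := G \<theta>)) + 1 * \<Lambda> (h(u := (\<lambda>x. \<Sum>\<theta>\<in>A. G \<theta> x)))"
        by (rule \<Lambda>(1)[unfolded multilinear_on_test_functions_def, rule_format]) (use that insert in auto)
      moreover have "dyadic_test_function (\<lambda>x. \<Sum>\<theta>\<in>insert \<theta> A. G \<theta> x)"
        using test_function_lincomb[of "G \<theta>" "\<lambda>x. \<Sum>\<theta>\<in>A. G \<theta> x" 1 1] that(3) insert by simp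
      ultimately show ?case using insert by (simp del: fun_upd_apply)
    qed
    have "\<Lambda> f = \<Lambda> (f(u := (\<lambda>x. \<Sum>\<theta>\<in>qs. fq \<theta> u x)))" using fsum[of u] by (metis fun_upd_triv)
    also have "\<dots> = (\<Sum>\<theta>\<in>qs. \<Lambda> (f(u := fq \<theta> u)))" using expand[OF qs, of f "\<lambda>\<theta>. fq \<theta> u" u] f fq by blast
    also have "\<dots> = (\<Sum>\<theta>\<in>qs. \<Lambda> (fq \<theta>))"
    proof (rule sum.cong[OF refl])
      fix \<theta> assume \<theta>: "\<theta> \<in> qs"
      \<comment> \<open>The function at \<open>u\<close> already lives in the quadrant \<theta>. The
        others are cut down to it one at a time, and their pieces in other quadrants contribute
        nothing.\<close>
      have "\<Lambda> (f(u := fq \<theta> u)) = \<Lambda> (\<lambda>s. if s \<in> insert u A then fq \<theta> s else f s)" if "finite A" for A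
        using that
      proof (induction A rule: finite_induct)
        case empty
        have "f(u := fq \<theta> u) = (\<lambda>s. if s \<in> insert u {} then fq \<theta> s else f s)" by auto
        then show ?case by simp
      next
        case (insert i A)
        define f1 where "f1 = (\<lambda>s. if s \<in> insert u A then fq \<theta> s else f s)"
        have f1: "dyadic_test_function (f1 s)" for s using f fq by (simp add: f1_def)
        show ?case
        proof (cases "i = u")
          case True
          then show ?thesis using insert by (simp add: insert_absorb)
        next
          case False
          then have f1i: "f1 i = f i" using insert by (simp add: f1_def)
          have "\<Lambda> f1 = \<Lambda> (f1(i := (\<lambda>x. \<Sum>\<theta>\<in>qs. fq \<theta> i x)))" using fsum[of i] f1i by (metis fun_upd_triv)
          also have "\<dots> = (\<Sum>\<theta>'\<in>qs. \<Lambda> (f1(i := fq \<theta>' i)))" using expand[OF qs, of f1 "\<lambda>\<theta>. fq \<theta> i" i] f1 fq by blast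
          also have "\<dots> = (\<Sum>\<theta>'\<in>qs. if \<theta>' = \<theta> then \<Lambda> (f1(i := fq \<theta> i)) else 0)"
          proof (rule sum.cong[OF refl])
            fix \<theta>' assume \<theta>': "\<theta>' \<in> qs"
            have "\<Lambda> (f1(i := fq \<theta>' i)) = 0" if "\<theta>' \<noteq> \<theta>"
            proof (rule mixed_quadrants_vanish[OF \<Lambda>(1,3) S Rm ker _ False, where \<theta>=\<theta>])
              show "dyadic_test_function ((f1(i := fq \<theta>' i)) s)" for s using f1 fq by simp
              show "(f1(i := fq \<theta>' i)) u x = 0" if "x \<notin> quadrant \<theta>" for x using that False by (simp add: f1_def fq_def)
              show "(f1(i := fq \<theta>' i)) i x = 0" if "x \<in> quadrant \<theta>" for x
              proof -
                have "x \<notin> quadrant \<theta>'" using that \<open>\<theta>' \<noteq> \<theta>\<close> \<theta> \<theta>' by (auto simp: quadrant_def qs_def)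
                then show ?thesis by (simp add: fq_def)
              qed
            qed
            then show "\<Lambda> (f1(i := fq \<theta>' i)) = (if \<theta>' = \<theta> then \<Lambda> (f1(i := fq \<theta> i)) else 0)" by auto
          qed
          also have "\<dots> = \<Lambda> (f1(i := fq \<theta> i))" using qs \<theta> by simp
          also have "f1(i := fq \<theta> i) = (\<lambda>s. if s \<in> insert u (insert i A) then fq \<theta> s else f s)" by (auto simp: f1_def)
          finally show ?thesis using insert.IH by (simp add: f1_def)
        qed
      qed
      from this[of UNIV] show "\<Lambda> (f(u := fq \<theta> u)) = \<Lambda> (fq \<theta>)" by simp
    qed
    finally have "\<bar>\<Lambda> f\<bar> \<le> (\<Sum>\<theta>\<in>qs. \<bar>\<Lambda> (fq \<theta>)\<bar>)" using sum_abs[of "\<lambda>\<theta>. \<Lambda> (fq \<theta>)" qs] by simp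
    also have "\<dots> \<le> (\<Sum>\<theta>\<in>qs. C * (\<Prod>j\<in>UNIV. Lp_norm (p j) (f j)))"
    proof (rule sum_mono)
      fix \<theta>
      have "(\<Prod>j\<in>UNIV. Lp_norm (p j) (fq \<theta> j)) \<le> (\<Prod>j\<in>UNIV. Lp_norm (p j) (f j))"
        unfolding fq_def using f p1 by (intro prod_mono conjI Lp_norm_nonneg Lp_norm_quadrant)
      then show "\<bar>\<Lambda> (fq \<theta>)\<bar> \<le> C * (\<Prod>j\<in>UNIV. Lp_norm (p j) (f j))"
        using one[of \<theta>] C by (meson mult_left_mono order_trans)
    qed
    finally show "\<bar>\<Lambda> f\<bar> \<le> real (card qs) * C * (\<Prod>j\<in>UNIV. Lp_norm (p j) (f j))" by simp
  qed
qed

end
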